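(* Let $\lambda^\Box$ be the multi-level Fitch-style modal calculus described in the context, extended with product and unit types at every level. For all derivable judgments $\Delta \vdash^l M : A$ and $\Delta \vdash^l N : A$ (same context stack, level and type), we have $\Delta \vdash^l M = N : A$ in the equational theory if and only if $[\![ M ]\!] = [\![ N ]\!]$ for every cartesian infinitely enriched category $\mathfrak{C}$ and every interpretation of the base types in it.
   Context: Calculus $\lambda^\Box$. Levels are natural numbers. Types of level $l$: base types $\iota^l$, $A^l \to B^l$, $A^l \times B^l$, $1^l$, and (for $l \ge 1$) $\Box A^{l-1}$. A context of level $l$ is a list $x_1:A_1^l,\dots,x_n:A_n^l$; a context stack of level $l$ is a sequence $\Gamma^{l+n-1};\dots;\Gamma^{l}$ ($n\ge 0$) whose levels decrease by one from left to right; $\#\Delta$ is its length; $\cdot$ is the empty context. Typing rules: (Var) if $x:A\in\Gamma^l$ then $\Delta^{l+1};\Gamma^l \vdash^l x:A$; (Abs) from $\Delta^{l+1};\Gamma^l,x:A \vdash^l M:B$ infer $\Delta^{l+1};\Gamma^l \vdash^l \lambda x.M : A\to B$; (App) from $\Delta^l\vdash^l M:A\to B$ and $\Delta^l \vdash^l N:A$ infer $\Delta^l\vdash^l MN:B$; (Quo) from $\Delta^{l+1};\cdot \vdash^l M:A$ infer $\Delta^{l+1}\vdash^{l+1} \grave{}M : \Box A$ (quotation); (Unq) from $\Delta^{l+1}\vdash^{l+1} M:\Box A$ infer $\Delta^{l+1};\Gamma^l \vdash^l {,}M : A$ for any context $\Gamma^l$ (unquotation); plus the standard rules for pairs $\langle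 M,N\rangle$, projections $\pi_1,\pi_2$ and unit $*$ acting within a fixed context stack. Substitution $[N/x]M := [N/x]_0M$ where $[N/x]_n y = N$ if $n=0$ and $y=x$, and $y$ otherwise; $[N/x]_n \grave{}M = \grave{}[N/x]_{n+1}M$; $[N/x]_n {,}M = {,}[N/x]_{n-1}M$ if $n>0$ and ${,}M$ if $n=0$; other constructs are handled homomorphically (capture-avoiding). The equational theory $\Delta\vdash^l M=N:A$ is the congruence on well-typed terms generated by the $\beta\eta$ rules for $\to$ (with this substitution), for products and unit, and $ {,}\grave{}M = M$, $M = \grave{}{,}M$ for $M:\Box A$. Models. A (lax) monoidal functor $F$ between cartesian categories is normal if for every $X$ the map $\mathrm{Hom}(1,X)\to\mathrm{Hom}(1,FX)$, $f\mapsto Ff\circ\iota$ (with $\iota:1\to F1$ the unit) is a bijection. A cartesian infinitely enriched category $\mathfrak{C}$ is a sequence of cartesian closed categories $\mathfrak{C}_0,\mathfrak{C}_1,\dots$ with finite-product-preserving normal functors $\Box_n:\mathfrak{C}_n\to\mathfrak{C}_{n+1}$. Interpretation. Base types $\iota^l$ go to arbitrary objects of $\mathfrak{C}_l$; $\to,\times,1$ go to exponentials $[-,-]$, products and terminal object of $\mathfrak{C}_l$; $[\![\Box A^{l}]\!] = \Box_l[\![A]\!]$; $[\![\Gamma]\!]$ is the product of its types. For a context stack $\Delta$ of level $l$ define a finite-product-preserving functor $\Delta(-):\mathfrak{C}_l\to\mathfrak{C}_{l+\#\Delta}$ by $\epsilon(X)=X$ for the empty stack, $\Gamma(X)=\Box[[\![\Gamma]\!],X]$,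 $(\Gamma;\Delta)(X)=\Box[[\![\Gamma]\!],\Delta(X)]$. A judgment with stack $\Gamma;\Delta$ ($\Gamma$ leftmost; the empty stack is identified with $\cdot$) is interpreted as a morphism $[\![\Gamma]\!]\to\Delta([\![A]\!])$, inductively: $[\![\Gamma\vdash^l x:A]\!]$ is the projection; for $\Gamma;\Gamma_1;\Delta_1\vdash^l x:A$, take $[\![\Gamma_1;\Delta_1\vdash x:A]\!]:[\![\Gamma_1]\!]\to\Delta_1([\![A]\!])$, transpose it to $1\to[[\![\Gamma_1]\!],\Delta_1([\![A]\!])]$, apply $\Box$ and precompose with $1\cong\Box1$ and with $!:[\![\Gamma]\!]\to 1$; $[\![\Gamma\vdash^l\lambda x.M]\!]$ is the exponential transpose of $[\![M]\!]$; $[\![\Gamma;\Delta;\Gamma'\vdash\lambda x.M]\!]$ is $[\![M]\!]:[\![\Gamma]\!]\to\Delta(\Box[[\![\Gamma']\!]\times[\![A]\!],[\![B]\!]])$ followed by the iso to $\Delta(\Box[[\![\Gamma']\!],[[\![A]\!],[\![B]\!]]])$; $[\![MN]\!] = \Delta(\mathrm{ev})\circ(\text{iso }\Delta(X)\times\Delta(Y)\cong\Delta(X\times Y))\circ\langle[\![M]\!],[\![N]\!]\rangle$; pairs, projections and unit are interpreted similarly using that $\Delta(-)$ preserves finite products; $[\![\Gamma;\Delta\vdash \grave{}M:\Box A]\!]$ is $[\![M]\!]:[\![\Gamma]\!]\to\Delta(\Box[1,[\![A]\!]])$ followed by the iso to $\Delta(\Box[\![A]\!])$; $[\![\Gamma;\Delta;\Gamma'\vdash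 {,}M:A]\!] = \Delta(\Box k)\circ[\![M]\!]$ with $k:[\![A]\!]\to[[\![\Gamma']\!],[\![A]\!]]$ the transpose of the projection. *)

theory Defs
  imports Main "HOL-Library.Infinite_Typeclass"
begin

section \<open>The calculus\<close>

text \<open>
  The level superscripts of types are not part of the syntax: every type is used at an explicitly
  given level, and \<open>wf_ty l A\<close> says that \<open>A\<close> is a type of level \<open>l\<close>.  At every level there is one
  base type for each element of \<open>'b\<close>.
\<close>

datatype 'b ty =
    Base 'b
  | Fun "'b ty" "'b ty"  (infixr "\<rightarrow>" 65)
  | Prod "'b ty" "'b ty"
  | One
  | Box "'b ty"

fun wf_ty :: "nat \<Rightarrow> 'b ty \<Rightarrow> bool" where
  "wf_ty l (Base b) \<longleftrightarrow> True"
| "wf_ty l (A \<rightarrow> B) \<longleftrightarrow> wf_ty l A \<and> wf_ty l B"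
| "wf_ty l (Prod A B) \<longleftrightarrow> wf_ty l A \<and> wf_ty l B"
| "wf_ty l One \<longleftrightarrow> True"
| "wf_ty 0 (Box A) \<longleftrightarrow> False"
| "wf_ty (Suc l) (Box A) \<longleftrightarrow> wf_ty l A"

text \<open>
  Variables are de Bruijn indices into the rightmost context of the stack.  A context lists its
  most recent variable first, so \<open>\<Gamma>, x : A\<close> is \<open>A # \<Gamma>\<close>.  A context stack lists its contexts from
  left to right, so \<open>\<Gamma> # \<Delta>\<close> has leftmost context \<open>\<Gamma>\<close>, and \<open>\<Delta> @ [\<Gamma>]\<close> has current context \<open>\<Gamma>\<close>.
\<close>

type_synonym 'b ctx = "'b ty list"
type_synonym 'b stack = "'b ctx list"

definition wf_ctx :: "nat \<Rightarrow> 'b ctx \<Rightarrow> bool" where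
  "wf_ctx l \<Gamma> \<longleftrightarrow> (\<forall>A\<in>set \<Gamma>. wf_ty l A)"

fun wf_stack :: "nat \<Rightarrow> 'b stack \<Rightarrow> bool" where
  "wf_stack l [] \<longleftrightarrow> True"
| "wf_stack l (\<Gamma> # \<Delta>) \<longleftrightarrow> wf_ctx (l + length \<Delta>) \<Gamma> \<and> wf_stack l \<Delta>"

text \<open>
  A bound variable carries its type, so that the type of a term is determined by the stack and the
  interpretation, given by induction on typing derivations, is determined by the judgment.
\<close>

datatype 'b tm =
    Var nat
  | Lam "'b ty" "'b tm"
  | App "'b tm" "'b tm"
  | Pair "'b tm" "'b tm"
  | Fst "'b tm"
  | Snd "'b tm"
  | Star
  | Quo "'b tm"
  | Unq "'b tm"

text \<open>
  The empty stack is identified with the stack consisting of one empty context; this is what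
  \<open>Emp\<close> and \<open>Emp'\<close> say, here and in the other judgments below.
\<close>

inductive typing :: "'b stack \<Rightarrow> nat \<Rightarrow> 'b tm \<Rightarrow> 'b ty \<Rightarrow> bool"
    ("_ \<turnstile>\<^bsub>_\<^esub> _ : _" [51, 0, 51, 51] 50) where
  Var: "wf_stack l (\<Delta> @ [\<Gamma>]) \<Longrightarrow> i < length \<Gamma> \<Longrightarrow> \<Delta> @ [\<Gamma>] \<turnstile>\<^bsub>l\<^esub> Var i : \<Gamma> ! i"
| Abs: "\<Delta> @ [A # \<Gamma>] \<turnstile>\<^bsub>l\<^esub> M : B \<Longrightarrow> \<Delta> @ [\<Gamma>] \<turnstile>\<^bsub>l\<^esub> Lam A M : A \<rightarrow> B"
| App: "\<Delta> \<turnstile>\<^bsub>l\<^esub> M : A \<rightarrow> B \<Longrightarrow> \<Delta> \<turnstile>\<^bsub>l\<^esub> N : A \<Longrightarrow> \<Delta> \<turnstile>\<^bsub>l\<^esub> App M N : B"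
| Pair: "\<Delta> \<turnstile>\<^bsub>l\<^esub> M : A \<Longrightarrow> \<Delta> \<turnstile>\<^bsub>l\<^esub> N : B \<Longrightarrow> \<Delta> \<turnstile>\<^bsub>l\<^esub> Pair M N : Prod A B"
| Fst: "\<Delta> \<turnstile>\<^bsub>l\<^esub> M : Prod A B \<Longrightarrow> \<Delta> \<turnstile>\<^bsub>l\<^esub> Fst M : A"
| Snd: "\<Delta> \<turnstile>\<^bsub>l\<^esub> M : Prod A B \<Longrightarrow> \<Delta> \<turnstile>\<^bsub>l\<^esub> Snd M : B"
| Star: "wf_stack l \<Delta> \<Longrightarrow> \<Delta> \<turnstile>\<^bsub>l\<^esub> Star : One"
| Quo: "\<Delta> @ [[]] \<turnstile>\<^bsub>l\<^esub> M : A \<Longrightarrow> \<Delta> \<turnstile>\<^bsub>Suc l\<^esub> Quo M : Box A"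
| Unq: "\<Delta> \<turnstile>\<^bsub>Suc l\<^esub> M : Box A \<Longrightarrow> wf_ctx l \<Gamma> \<Longrightarrow> \<Delta> @ [\<Gamma>] \<turnstile>\<^bsub>l\<^esub> Unq M : A"
| Emp: "[[]] \<turnstile>\<^bsub>l\<^esub> M : A \<Longrightarrow> [] \<turnstile>\<^bsub>l\<^esub> M : A"
| Emp': "[] \<turnstile>\<^bsub>l\<^esub> M : A \<Longrightarrow> [[]] \<turnstile>\<^bsub>l\<^esub> M : A"

text \<open>
  \<open>lift n k M\<close> makes room for a new variable at index \<open>k\<close>, and \<open>subst n k N M\<close> substitutes \<open>N\<close> for
  (and removes) the variable at index \<open>k\<close>, of the context \<open>n\<close> places to the left of the current
  one.  An abstraction binds in the current context, so it affects \<open>k\<close> and \<open>N\<close> only if \<open>n = 0\<close>.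
\<close>

primrec lift :: "nat \<Rightarrow> nat \<Rightarrow> 'b tm \<Rightarrow> 'b tm" where
  "lift n k (Var i) = (if n = 0 \<and> k \<le> i then Var (Suc i) else Var i)"
| "lift n k (Lam A M) = Lam A (lift n (if n = 0 then Suc k else k) M)"
| "lift n k (App M N) = App (lift n k M) (lift n k N)"
| "lift n k (Pair M N) = Pair (lift n k M) (lift n k N)"
| "lift n k (Fst M) = Fst (lift n k M)"
| "lift n k (Snd M) = Snd (lift n k M)"
| "lift n k Star = Star"
| "lift n k (Quo M) = Quo (lift (Suc n) k M)"
| "lift n k (Unq M) = (if n = 0 then Unq M else Unq (lift (n - 1) k M))"

primrec subst :: "nat \<Rightarrow> nat \<Rightarrow> 'b tm \<Rightarrow> 'b tm \<Rightarrow> 'b tm" where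
  "subst n k N (Var i) =
     (if n = 0 then (if i = k then N else if k < i then Var (i - 1) else Var i) else Var i)"
| "subst n k N (Lam A M) =
     Lam A (if n = 0 then subst n (Suc k) (lift 0 0 N) M else subst n k N M)"
| "subst n k N (App P Q) = App (subst n k N P) (subst n k N Q)"
| "subst n k N (Pair P Q) = Pair (subst n k N P) (subst n k N Q)"
| "subst n k N (Fst M) = Fst (subst n k N M)"
| "subst n k N (Snd M) = Snd (subst n k N M)"
| "subst n k N Star = Star"
| "subst n k N (Quo M) = Quo (subst (Suc n) k N M)"
| "subst n k N (Unq M) = (if n = 0 then Unq M else Unq (subst (n - 1) k N M))"

inductive eqth :: "'b stack \<Rightarrow> nat \<Rightarrow> 'b tm \<Rightarrow> 'b tm \<Rightarrow> 'b ty \<Rightarrow> bool"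
    ("_ \<turnstile>\<^bsub>_\<^esub> _ \<approx> _ : _" [51, 0, 51, 51, 51] 50) where
  Refl: "\<Delta> \<turnstile>\<^bsub>l\<^esub> M : A \<Longrightarrow> \<Delta> \<turnstile>\<^bsub>l\<^esub> M \<approx> M : A"
| Sym: "\<Delta> \<turnstile>\<^bsub>l\<^esub> M \<approx> N : A \<Longrightarrow> \<Delta> \<turnstile>\<^bsub>l\<^esub> N \<approx> M : A"
| Trans: "\<Delta> \<turnstile>\<^bsub>l\<^esub> M \<approx> N : A \<Longrightarrow> \<Delta> \<turnstile>\<^bsub>l\<^esub> N \<approx> P : A \<Longrightarrow> \<Delta> \<turnstile>\<^bsub>l\<^esub> M \<approx> P : A"
| CAbs: "\<Delta> @ [A # \<Gamma>] \<turnstile>\<^bsub>l\<^esub> M \<approx> M' : B \<Longrightarrow> \<Delta> @ [\<Gamma>] \<turnstile>\<^bsub>l\<^esub> Lam A M \<approx> Lam A M' : A \<rightarrow> B"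
| CApp: "\<Delta> \<turnstile>\<^bsub>l\<^esub> M \<approx> M' : A \<rightarrow> B \<Longrightarrow> \<Delta> \<turnstile>\<^bsub>l\<^esub> N \<approx> N' : A
    \<Longrightarrow> \<Delta> \<turnstile>\<^bsub>l\<^esub> App M N \<approx> App M' N' : B"
| CPair: "\<Delta> \<turnstile>\<^bsub>l\<^esub> M \<approx> M' : A \<Longrightarrow> \<Delta> \<turnstile>\<^bsub>l\<^esub> N \<approx> N' : B
    \<Longrightarrow> \<Delta> \<turnstile>\<^bsub>l\<^esub> Pair M N \<approx> Pair M' N' : Prod A B"
| CFst: "\<Delta> \<turnstile>\<^bsub>l\<^esub> M \<approx> M' : Prod A B \<Longrightarrow> \<Delta> \<turnstile>\<^bsub>l\<^esub> Fst M \<approx> Fst M' : A"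
| CSnd: "\<Delta> \<turnstile>\<^bsub>l\<^esub> M \<approx> M' : Prod A B \<Longrightarrow> \<Delta> \<turnstile>\<^bsub>l\<^esub> Snd M \<approx> Snd M' : B"
| CQuo: "\<Delta> @ [[]] \<turnstile>\<^bsub>l\<^esub> M \<approx> M' : A \<Longrightarrow> \<Delta> \<turnstile>\<^bsub>Suc l\<^esub> Quo M \<approx> Quo M' : Box A"
| CUnq: "\<Delta> \<turnstile>\<^bsub>Suc l\<^esub> M \<approx> M' : Box A \<Longrightarrow> wf_ctx l \<Gamma> \<Longrightarrow> \<Delta> @ [\<Gamma>] \<turnstile>\<^bsub>l\<^esub> Unq M \<approx> Unq M' : A"
| CEmp: "[[]] \<turnstile>\<^bsub>l\<^esub> M \<approx> N : A \<Longrightarrow> [] \<turnstile>\<^bsub>l\<^esub> M \<approx> N : A"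
| CEmp': "[] \<turnstile>\<^bsub>l\<^esub> M \<approx> N : A \<Longrightarrow> [[]] \<turnstile>\<^bsub>l\<^esub> M \<approx> N : A"
| Fun_beta: "\<Delta> @ [A # \<Gamma>] \<turnstile>\<^bsub>l\<^esub> M : B \<Longrightarrow> \<Delta> @ [\<Gamma>] \<turnstile>\<^bsub>l\<^esub> N : A
    \<Longrightarrow> \<Delta> @ [\<Gamma>] \<turnstile>\<^bsub>l\<^esub> App (Lam A M) N \<approx> subst 0 0 N M : B"
| Fun_eta: "\<Delta> \<turnstile>\<^bsub>l\<^esub> M : A \<rightarrow> B \<Longrightarrow> \<Delta> \<turnstile>\<^bsub>l\<^esub> M \<approx> Lam A (App (lift 0 0 M) (Var 0)) : A \<rightarrow> B"
| Fst_beta: "\<Delta> \<turnstile>\<^bsub>l\<^esub> M : A \<Longrightarrow> \<Delta> \<turnstile>\<^bsub>l\<^esub> N : B \<Longrightarrow> \<Delta> \<turnstile>\<^bsub>l\<^esub> Fst (Pair M N) \<approx> M : A"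
| Snd_beta: "\<Delta> \<turnstile>\<^bsub>l\<^esub> M : A \<Longrightarrow> \<Delta> \<turnstile>\<^bsub>l\<^esub> N : B \<Longrightarrow> \<Delta> \<turnstile>\<^bsub>l\<^esub> Snd (Pair M N) \<approx> N : B"
| Prod_eta: "\<Delta> \<turnstile>\<^bsub>l\<^esub> M : Prod A B \<Longrightarrow> \<Delta> \<turnstile>\<^bsub>l\<^esub> M \<approx> Pair (Fst M) (Snd M) : Prod A B"
| One_eta: "\<Delta> \<turnstile>\<^bsub>l\<^esub> M : One \<Longrightarrow> \<Delta> \<turnstile>\<^bsub>l\<^esub> M \<approx> Star : One"
| Box_beta: "\<Delta> @ [[]] \<turnstile>\<^bsub>l\<^esub> M : A \<Longrightarrow> wf_ctx l \<Gamma> \<Longrightarrow> \<Delta> @ [\<Gamma>] \<turnstile>\<^bsub>l\<^esub> Unq (Quo M) \<approx> M : A"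
| Box_eta: "\<Delta> \<turnstile>\<^bsub>Suc l\<^esub> M : Box A \<Longrightarrow> \<Delta> \<turnstile>\<^bsub>Suc l\<^esub> M \<approx> Quo (Unq M) : Box A"


section \<open>Cartesian infinitely enriched categories\<close>

record ('o, 'm) category =
  Ob :: "'o set"
  Ar :: "'m set"
  Dom :: "'m \<Rightarrow> 'o"
  Cod :: "'m \<Rightarrow> 'o"
  Id :: "'o \<Rightarrow> 'm"
  Comp :: "'m \<Rightarrow> 'm \<Rightarrow> 'm"  (infixr "\<cdot>\<index>" 70)

definition hom :: "('o, 'm, 'z) category_scheme \<Rightarrow> 'o \<Rightarrow> 'o \<Rightarrow> 'm set" where
  "hom C X Y = {f \<in> Ar C. Dom C f = X \<and> Cod C f = Y}"

definition is_category :: "('o, 'm, 'z) category_scheme \<Rightarrow> bool" where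
  "is_category C \<longleftrightarrow>
     (\<forall>f\<in>Ar C. Dom C f \<in> Ob C \<and> Cod C f \<in> Ob C) \<and>
     (\<forall>X\<in>Ob C. Id C X \<in> hom C X X) \<and>
     (\<forall>X\<in>Ob C. \<forall>Y\<in>Ob C. \<forall>Z\<in>Ob C. \<forall>f\<in>hom C X Y. \<forall>g\<in>hom C Y Z. g \<cdot>\<^bsub>C\<^esub> f \<in> hom C X Z) \<and>
     (\<forall>X\<in>Ob C. \<forall>Y\<in>Ob C. \<forall>f\<in>hom C X Y. f \<cdot>\<^bsub>C\<^esub> Id C X = f \<and> Id C Y \<cdot>\<^bsub>C\<^esub> f = f) \<and>
     (\<forall>W\<in>Ob C. \<forall>X\<in>Ob C. \<forall>Y\<in>Ob C. \<forall>Z\<in>Ob C. \<forall>f\<in>hom C W X. \<forall>g\<in>hom C X Y. \<forall>h\<in>hom C Y Z.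
        (h \<cdot>\<^bsub>C\<^esub> g) \<cdot>\<^bsub>C\<^esub> f = h \<cdot>\<^bsub>C\<^esub> (g \<cdot>\<^bsub>C\<^esub> f))"

definition inverse_arrows :: "('o, 'm, 'z) category_scheme \<Rightarrow> 'm \<Rightarrow> 'm \<Rightarrow> bool" where
  "inverse_arrows C f g \<longleftrightarrow> f \<in> Ar C \<and> g \<in> hom C (Cod C f) (Dom C f) \<and>
     g \<cdot>\<^bsub>C\<^esub> f = Id C (Dom C f) \<and> f \<cdot>\<^bsub>C\<^esub> g = Id C (Cod C f)"

definition is_iso :: "('o, 'm, 'z) category_scheme \<Rightarrow> 'm \<Rightarrow> bool" where
  "is_iso C f \<longleftrightarrow> (\<exists>g. inverse_arrows C f g)"

definition inverse_of :: "('o, 'm, 'z) category_scheme \<Rightarrow> 'm \<Rightarrow> 'm" where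
  "inverse_of C f = (THE g. inverse_arrows C f g)"

record ('o, 'm) ccc = "('o, 'm) category" +
  Unit :: 'o
  Times :: "'o \<Rightarrow> 'o \<Rightarrow> 'o"
  Proj1 :: "'o \<Rightarrow> 'o \<Rightarrow> 'm"
  Proj2 :: "'o \<Rightarrow> 'o \<Rightarrow> 'm"
  Expo :: "'o \<Rightarrow> 'o \<Rightarrow> 'o"
  Eval :: "'o \<Rightarrow> 'o \<Rightarrow> 'm"

text \<open>\<open>Expo C X Y\<close> is the exponential \<open>[X, Y]\<close>, with evaluation \<open>[X, Y] \<times> X \<rightarrow> Y\<close>.\<close>

definition bang :: "('o, 'm, 'z) ccc_scheme \<Rightarrow> 'o \<Rightarrow> 'm" where
  "bang C X = (THE f. f \<in> hom C X (Unit C))"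

definition tuple :: "('o, 'm, 'z) ccc_scheme \<Rightarrow> 'm \<Rightarrow> 'm \<Rightarrow> 'm" where
  "tuple C f g = (THE h. h \<in> hom C (Dom C f) (Times C (Cod C f) (Cod C g)) \<and>
     Proj1 C (Cod C f) (Cod C g) \<cdot>\<^bsub>C\<^esub> h = f \<and> Proj2 C (Cod C f) (Cod C g) \<cdot>\<^bsub>C\<^esub> h = g)"

definition times_map :: "('o, 'm, 'z) ccc_scheme \<Rightarrow> 'm \<Rightarrow> 'm \<Rightarrow> 'm" where
  "times_map C f g = tuple C (f \<cdot>\<^bsub>C\<^esub> Proj1 C (Dom C f) (Dom C g)) (g \<cdot>\<^bsub>C\<^esub> Proj2 C (Dom C f) (Dom C g))"

text \<open>\<open>is_transpose C Z X f h\<close>: \<open>h : Z \<rightarrow> [X, Y]\<close> is the exponential transpose of \<open>f : Z \<times> X \<rightarrow> Y\<close>.\<close>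

definition is_transpose :: "('o, 'm, 'z) ccc_scheme \<Rightarrow> 'o \<Rightarrow> 'o \<Rightarrow> 'm \<Rightarrow> 'm \<Rightarrow> bool" where
  "is_transpose C Z X f h \<longleftrightarrow> h \<in> hom C Z (Expo C X (Cod C f)) \<and>
     Eval C X (Cod C f) \<cdot>\<^bsub>C\<^esub> times_map C h (Id C X) = f"

definition transpose :: "('o, 'm, 'z) ccc_scheme \<Rightarrow> 'o \<Rightarrow> 'o \<Rightarrow> 'm \<Rightarrow> 'm" where
  "transpose C Z X f = (THE h. is_transpose C Z X f h)"

definition is_ccc :: "('o, 'm, 'z) ccc_scheme \<Rightarrow> bool" where
  "is_ccc C \<longleftrightarrow> is_category C \<and>
     Unit C \<in> Ob C \<and> (\<forall>X\<in>Ob C. \<exists>!f. f \<in> hom C X (Unit C)) \<and>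
     (\<forall>X\<in>Ob C. \<forall>Y\<in>Ob C. Times C X Y \<in> Ob C \<and>
        Proj1 C X Y \<in> hom C (Times C X Y) X \<and> Proj2 C X Y \<in> hom C (Times C X Y) Y \<and>
        (\<forall>Z\<in>Ob C. \<forall>f\<in>hom C Z X. \<forall>g\<in>hom C Z Y. \<exists>!h. h \<in> hom C Z (Times C X Y) \<and>
           Proj1 C X Y \<cdot>\<^bsub>C\<^esub> h = f \<and> Proj2 C X Y \<cdot>\<^bsub>C\<^esub> h = g)) \<and>
     (\<forall>X\<in>Ob C. \<forall>Y\<in>Ob C. Expo C X Y \<in> Ob C \<and>
        Eval C X Y \<in> hom C (Times C (Expo C X Y) X) Y \<and>
        (\<forall>Z\<in>Ob C. \<forall>f\<in>hom C (Times C Z X) Y. \<exists>!h. is_transpose C Z X f h))"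

definition expo_map :: "('o, 'm, 'z) ccc_scheme \<Rightarrow> 'o \<Rightarrow> 'm \<Rightarrow> 'm" where
  "expo_map C X f =
     transpose C (Expo C X (Dom C f)) X (f \<cdot>\<^bsub>C\<^esub> Eval C X (Dom C f))"

text \<open>The isomorphism \<open>[X \<times> Y, Z] \<rightarrow> [X, [Y, Z]]\<close>.\<close>

definition curry_iso :: "('o, 'm, 'z) ccc_scheme \<Rightarrow> 'o \<Rightarrow> 'o \<Rightarrow> 'o \<Rightarrow> 'm" where
  "curry_iso C X Y Z =
     (let E = Expo C (Times C X Y) Z; P = Times C E X; Q = Times C P Y in
      transpose C E X (transpose C P Y (Eval C (Times C X Y) Z \<cdot>\<^bsub>C\<^esub>
        tuple C (Proj1 C E X \<cdot>\<^bsub>C\<^esub> Proj1 C P Y)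
          (tuple C (Proj2 C E X \<cdot>\<^bsub>C\<^esub> Proj1 C P Y) (Proj2 C P Y)))))"

text \<open>The isomorphism \<open>[1, X] \<rightarrow> X\<close>.\<close>

definition unit_expo_iso :: "('o, 'm, 'z) ccc_scheme \<Rightarrow> 'o \<Rightarrow> 'm" where
  "unit_expo_iso C X = Eval C (Unit C) X \<cdot>\<^bsub>C\<^esub>
     tuple C (Id C (Expo C (Unit C) X)) (bang C (Expo C (Unit C) X))"

text \<open>The transpose \<open>1 \<rightarrow> [X, Y]\<close> of \<open>f : X \<rightarrow> Y\<close>.\<close>

definition name_of :: "('o, 'm, 'z) ccc_scheme \<Rightarrow> 'm \<Rightarrow> 'm" where
  "name_of C f = transpose C (Unit C) (Dom C f) (f \<cdot>\<^bsub>C\<^esub> Proj2 C (Unit C) (Dom C f))"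

record ('o, 'm) ftor =
  FO :: "'o \<Rightarrow> 'o"
  FM :: "'m \<Rightarrow> 'm"

definition is_functor ::
    "('o, 'm, 'y) ccc_scheme \<Rightarrow> ('o, 'm, 'z) ccc_scheme \<Rightarrow> ('o, 'm) ftor \<Rightarrow> bool" where
  "is_functor C D F \<longleftrightarrow>
     (\<forall>X\<in>Ob C. FO F X \<in> Ob D \<and> FM F (Id C X) = Id D (FO F X)) \<and>
     (\<forall>X\<in>Ob C. \<forall>Y\<in>Ob C. \<forall>f\<in>hom C X Y. FM F f \<in> hom D (FO F X) (FO F Y)) \<and>
     (\<forall>X\<in>Ob C. \<forall>Y\<in>Ob C. \<forall>Z\<in>Ob C. \<forall>f\<in>hom C X Y. \<forall>g\<in>hom C Y Z.
        FM F (g \<cdot>\<^bsub>C\<^esub> f) = FM F g \<cdot>\<^bsub>D\<^esub> FM F f)"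

definition preserves_finite_products ::
    "('o, 'm, 'y) ccc_scheme \<Rightarrow> ('o, 'm, 'z) ccc_scheme \<Rightarrow> ('o, 'm) ftor \<Rightarrow> bool" where
  "preserves_finite_products C D F \<longleftrightarrow>
     is_iso D (bang D (FO F (Unit C))) \<and>
     (\<forall>X\<in>Ob C. \<forall>Y\<in>Ob C. is_iso D (tuple D (FM F (Proj1 C X Y)) (FM F (Proj2 C X Y))))"

text \<open>
  The unit \<open>1 \<rightarrow> F 1\<close> of the monoidal structure on a finite-product-preserving functor.
\<close>

definition unit_map ::
    "('o, 'm, 'y) ccc_scheme \<Rightarrow> ('o, 'm, 'z) ccc_scheme \<Rightarrow> ('o, 'm) ftor \<Rightarrow> 'm" where
  "unit_map C D F = inverse_of D (bang D (FO F (Unit C)))"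

definition normal_map ::
    "('o, 'm, 'y) ccc_scheme \<Rightarrow> ('o, 'm, 'z) ccc_scheme \<Rightarrow> ('o, 'm) ftor \<Rightarrow> 'm \<Rightarrow> 'm" where
  "normal_map C D F f = FM F f \<cdot>\<^bsub>D\<^esub> unit_map C D F"

definition is_normal ::
    "('o, 'm, 'y) ccc_scheme \<Rightarrow> ('o, 'm, 'z) ccc_scheme \<Rightarrow> ('o, 'm) ftor \<Rightarrow> bool" where
  "is_normal C D F \<longleftrightarrow>
     (\<forall>X\<in>Ob C. bij_betw (normal_map C D F) (hom C (Unit C) X) (hom D (Unit D) (FO F X)))"

text \<open>
  Objects and arrows form subsets of the types \<open>'o\<close> and \<open>'m\<close>.  In a statement about all
  cartesian infinitely enriched categories these types should be infinite, as the term model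
  does not fit into a finite type.
\<close>

record ('o, 'm) enriched =
  Cat :: "nat \<Rightarrow> ('o, 'm) ccc"
  BOX :: "nat \<Rightarrow> ('o, 'm) ftor"

definition cartesian_infinitely_enriched :: "('o, 'm) enriched \<Rightarrow> bool" where
  "cartesian_infinitely_enriched \<CC> \<longleftrightarrow>
     (\<forall>n. is_ccc (Cat \<CC> n) \<and>
          is_functor (Cat \<CC> n) (Cat \<CC> (Suc n)) (BOX \<CC> n) \<and>
          preserves_finite_products (Cat \<CC> n) (Cat \<CC> (Suc n)) (BOX \<CC> n) \<and>
          is_normal (Cat \<CC> n) (Cat \<CC> (Suc n)) (BOX \<CC> n))"


section \<open>Interpretation\<close>

definition base_interpretation :: "('o, 'm) enriched \<Rightarrow> (nat \<Rightarrow> 'b \<Rightarrow> 'o) \<Rightarrow> bool" where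
  "base_interpretation \<CC> \<beta> \<longleftrightarrow> (\<forall>l b. \<beta> l b \<in> Ob (Cat \<CC> l))"

text \<open>There is no equation for \<open>Box A\<close> at level \<open>0\<close>, which is not a type.\<close>

fun ty_obj :: "('o, 'm) enriched \<Rightarrow> (nat \<Rightarrow> 'b \<Rightarrow> 'o) \<Rightarrow> nat \<Rightarrow> 'b ty \<Rightarrow> 'o" where
  "ty_obj \<CC> \<beta> l (Base b) = \<beta> l b"
| "ty_obj \<CC> \<beta> l (A \<rightarrow> B) = Expo (Cat \<CC> l) (ty_obj \<CC> \<beta> l A) (ty_obj \<CC> \<beta> l B)"
| "ty_obj \<CC> \<beta> l (Prod A B) = Times (Cat \<CC> l) (ty_obj \<CC> \<beta> l A) (ty_obj \<CC> \<beta> l B)"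
| "ty_obj \<CC> \<beta> l One = Unit (Cat \<CC> l)"
| "ty_obj \<CC> \<beta> (Suc l) (Box A) = FO (BOX \<CC> l) (ty_obj \<CC> \<beta> l A)"

primrec ctx_obj :: "('o, 'm) enriched \<Rightarrow> (nat \<Rightarrow> 'b \<Rightarrow> 'o) \<Rightarrow> nat \<Rightarrow> 'b ctx \<Rightarrow> 'o" where
  "ctx_obj \<CC> \<beta> l [] = Unit (Cat \<CC> l)"
| "ctx_obj \<CC> \<beta> l (A # \<Gamma>) = Times (Cat \<CC> l) (ctx_obj \<CC> \<beta> l \<Gamma>) (ty_obj \<CC> \<beta> l A)"

fun ctx_proj :: "('o, 'm) enriched \<Rightarrow> (nat \<Rightarrow> 'b \<Rightarrow> 'o) \<Rightarrow> nat \<Rightarrow> 'b ctx \<Rightarrow> nat \<Rightarrow> 'm" where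
  "ctx_proj \<CC> \<beta> l (A # \<Gamma>) 0 = Proj2 (Cat \<CC> l) (ctx_obj \<CC> \<beta> l \<Gamma>) (ty_obj \<CC> \<beta> l A)"
| "ctx_proj \<CC> \<beta> l (A # \<Gamma>) (Suc i) =
     ctx_proj \<CC> \<beta> l \<Gamma> i \<cdot>\<^bsub>Cat \<CC> l\<^esub> Proj1 (Cat \<CC> l) (ctx_obj \<CC> \<beta> l \<Gamma>) (ty_obj \<CC> \<beta> l A)"

text \<open>
  The functor \<open>\<Delta>(-)\<close> from \<open>\<CC>\<^sub>l\<close> to \<open>\<CC>\<^sub>n\<close> given by a context stack \<open>\<Delta>\<close> of level \<open>l\<close>, where
  \<open>n = l + length \<Delta>\<close>.
\<close>

primrec stack_obj ::
    "('o, 'm) enriched \<Rightarrow> (nat \<Rightarrow> 'b \<Rightarrow> 'o) \<Rightarrow> nat \<Rightarrow> 'b stack \<Rightarrow> 'o \<Rightarrow> 'o" where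
  "stack_obj \<CC> \<beta> l [] X = X"
| "stack_obj \<CC> \<beta> l (\<Gamma> # \<Delta>) X =
     (let n = l + length \<Delta> in
      FO (BOX \<CC> n) (Expo (Cat \<CC> n) (ctx_obj \<CC> \<beta> n \<Gamma>) (stack_obj \<CC> \<beta> l \<Delta> X)))"

primrec stack_map ::
    "('o, 'm) enriched \<Rightarrow> (nat \<Rightarrow> 'b \<Rightarrow> 'o) \<Rightarrow> nat \<Rightarrow> 'b stack \<Rightarrow> 'm \<Rightarrow> 'm" where
  "stack_map \<CC> \<beta> l [] f = f"
| "stack_map \<CC> \<beta> l (\<Gamma> # \<Delta>) f =
     (let n = l + length \<Delta> in
      FM (BOX \<CC> n) (expo_map (Cat \<CC> n) (ctx_obj \<CC> \<beta> n \<Gamma>) (stack_map \<CC> \<beta> l \<Delta> f)))"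

text \<open>The isomorphisms \<open>\<Delta>(X) \<times> \<Delta>(Y) \<rightarrow> \<Delta>(X \<times> Y)\<close> and \<open>1 \<rightarrow> \<Delta>(1)\<close>.\<close>

definition stack_prod_iso ::
    "('o, 'm) enriched \<Rightarrow> (nat \<Rightarrow> 'b \<Rightarrow> 'o) \<Rightarrow> nat \<Rightarrow> 'b stack \<Rightarrow> 'o \<Rightarrow> 'o \<Rightarrow> 'm" where
  "stack_prod_iso \<CC> \<beta> l \<Delta> X Y =
     (let D = Cat \<CC> (l + length \<Delta>) in
      inverse_of D (tuple D (stack_map \<CC> \<beta> l \<Delta> (Proj1 (Cat \<CC> l) X Y))
                            (stack_map \<CC> \<beta> l \<Delta> (Proj2 (Cat \<CC> l) X Y))))"

definition stack_unit_iso ::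
    "('o, 'm) enriched \<Rightarrow> (nat \<Rightarrow> 'b \<Rightarrow> 'o) \<Rightarrow> nat \<Rightarrow> 'b stack \<Rightarrow> 'm" where
  "stack_unit_iso \<CC> \<beta> l \<Delta> =
     (let D = Cat \<CC> (l + length \<Delta>) in
      inverse_of D (bang D (stack_obj \<CC> \<beta> l \<Delta> (Unit (Cat \<CC> l)))))"

text \<open>
  \<open>interp \<CC> \<beta> (\<Gamma> # \<Delta>) l M A f\<close>: the judgment with stack \<open>\<Gamma> # \<Delta>\<close> is interpreted as the arrow
  \<open>f : \<lbrakk>\<Gamma>\<rbrakk> \<rightarrow> \<Delta>(\<lbrakk>A\<rbrakk>)\<close> of \<open>\<CC>\<^sub>n\<close>, where \<open>n = l + length \<Delta>\<close>.  A judgment with the empty stack is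
  interpreted like the one with stack \<open>[[]]\<close>, as an arrow \<open>1 \<rightarrow> \<lbrakk>A\<rbrakk>\<close> of \<open>\<CC>\<^sub>l\<close>.  Accordingly, a
  quotation in the empty stack sends \<open>f : 1 \<rightarrow> \<lbrakk>A\<rbrakk>\<close> to its image \<open>1 \<rightarrow> \<box>\<lbrakk>A\<rbrakk>\<close> under the bijection
  that makes \<open>\<box>\<close> normal, and an unquotation that leaves the empty stack uses the inverse of that
  bijection.
\<close>

inductive interp ::
    "('o, 'm) enriched \<Rightarrow> (nat \<Rightarrow> 'b \<Rightarrow> 'o) \<Rightarrow> 'b stack \<Rightarrow> nat \<Rightarrow> 'b tm \<Rightarrow> 'b ty \<Rightarrow> 'm \<Rightarrow> bool"
  for \<CC> \<beta> where
  Var: "i < length \<Gamma> \<Longrightarrow> interp \<CC> \<beta> [\<Gamma>] l (Var i) (\<Gamma> ! i) (ctx_proj \<CC> \<beta> l \<Gamma> i)"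
| Var_stack: "interp \<CC> \<beta> (\<Gamma>1 # \<Delta>1) l (Var i) A f \<Longrightarrow> n = l + length \<Delta>1
    \<Longrightarrow> interp \<CC> \<beta> (\<Gamma> # \<Gamma>1 # \<Delta>1) l (Var i) A
          (FM (BOX \<CC> n) (name_of (Cat \<CC> n) f)
             \<cdot>\<^bsub>Cat \<CC> (Suc n)\<^esub> unit_map (Cat \<CC> n) (Cat \<CC> (Suc n)) (BOX \<CC> n)
             \<cdot>\<^bsub>Cat \<CC> (Suc n)\<^esub> bang (Cat \<CC> (Suc n)) (ctx_obj \<CC> \<beta> (Suc n) \<Gamma>))"
| Abs: "interp \<CC> \<beta> [A # \<Gamma>] l M B f
    \<Longrightarrow> interp \<CC> \<beta> [\<Gamma>] l (Lam A M) (A \<rightarrow> B)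
          (transpose (Cat \<CC> l) (ctx_obj \<CC> \<beta> l \<Gamma>) (ty_obj \<CC> \<beta> l A) f)"
| Abs_stack: "interp \<CC> \<beta> (\<Gamma> # \<Delta> @ [A # \<Gamma>']) l M B f \<Longrightarrow> n = Suc l + length \<Delta>
    \<Longrightarrow> interp \<CC> \<beta> (\<Gamma> # \<Delta> @ [\<Gamma>']) l (Lam A M) (A \<rightarrow> B)
          (stack_map \<CC> \<beta> (Suc l) \<Delta> (FM (BOX \<CC> l)
             (curry_iso (Cat \<CC> l) (ctx_obj \<CC> \<beta> l \<Gamma>') (ty_obj \<CC> \<beta> l A) (ty_obj \<CC> \<beta> l B)))
             \<cdot>\<^bsub>Cat \<CC> n\<^esub> f)"
| App: "interp \<CC> \<beta> (\<Gamma> # \<Delta>) l M (A \<rightarrow> B) f \<Longrightarrow> interp \<CC> \<beta> (\<Gamma> # \<Delta>) l N A g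
    \<Longrightarrow> X = ty_obj \<CC> \<beta> l A \<Longrightarrow> Y = ty_obj \<CC> \<beta> l B \<Longrightarrow> n = l + length \<Delta>
    \<Longrightarrow> interp \<CC> \<beta> (\<Gamma> # \<Delta>) l (App M N) B
          (stack_map \<CC> \<beta> l \<Delta> (Eval (Cat \<CC> l) X Y)
             \<cdot>\<^bsub>Cat \<CC> n\<^esub> stack_prod_iso \<CC> \<beta> l \<Delta> (Expo (Cat \<CC> l) X Y) X
             \<cdot>\<^bsub>Cat \<CC> n\<^esub> tuple (Cat \<CC> n) f g)"
| Pair: "interp \<CC> \<beta> (\<Gamma> # \<Delta>) l M A f \<Longrightarrow> interp \<CC> \<beta> (\<Gamma> # \<Delta>) l N B g \<Longrightarrow> n = l + length \<Delta>
    \<Longrightarrow> interp \<CC> \<beta> (\<Gamma> # \<Delta>) l (Pair M N) (Prod A B)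
          (stack_prod_iso \<CC> \<beta> l \<Delta> (ty_obj \<CC> \<beta> l A) (ty_obj \<CC> \<beta> l B)
             \<cdot>\<^bsub>Cat \<CC> n\<^esub> tuple (Cat \<CC> n) f g)"
| Fst: "interp \<CC> \<beta> (\<Gamma> # \<Delta>) l M (Prod A B) f \<Longrightarrow> n = l + length \<Delta>
    \<Longrightarrow> interp \<CC> \<beta> (\<Gamma> # \<Delta>) l (Fst M) A
          (stack_map \<CC> \<beta> l \<Delta> (Proj1 (Cat \<CC> l) (ty_obj \<CC> \<beta> l A) (ty_obj \<CC> \<beta> l B))
             \<cdot>\<^bsub>Cat \<CC> n\<^esub> f)"
| Snd: "interp \<CC> \<beta> (\<Gamma> # \<Delta>) l M (Prod A B) f \<Longrightarrow> n = l + length \<Delta>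
    \<Longrightarrow> interp \<CC> \<beta> (\<Gamma> # \<Delta>) l (Snd M) B
          (stack_map \<CC> \<beta> l \<Delta> (Proj2 (Cat \<CC> l) (ty_obj \<CC> \<beta> l A) (ty_obj \<CC> \<beta> l B))
             \<cdot>\<^bsub>Cat \<CC> n\<^esub> f)"
| Star: "n = l + length \<Delta>
    \<Longrightarrow> interp \<CC> \<beta> (\<Gamma> # \<Delta>) l Star One
          (stack_unit_iso \<CC> \<beta> l \<Delta> \<cdot>\<^bsub>Cat \<CC> n\<^esub> bang (Cat \<CC> n) (ctx_obj \<CC> \<beta> n \<Gamma>))"
| Quo: "interp \<CC> \<beta> (\<Gamma> # \<Delta> @ [[]]) l M A f \<Longrightarrow> n = Suc l + length \<Delta>
    \<Longrightarrow> interp \<CC> \<beta> (\<Gamma> # \<Delta>) (Suc l) (Quo M) (Box A)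
          (stack_map \<CC> \<beta> (Suc l) \<Delta> (FM (BOX \<CC> l) (unit_expo_iso (Cat \<CC> l) (ty_obj \<CC> \<beta> l A)))
             \<cdot>\<^bsub>Cat \<CC> n\<^esub> f)"
| Quo_empty: "interp \<CC> \<beta> [[]] l M A f
    \<Longrightarrow> interp \<CC> \<beta> [] (Suc l) (Quo M) (Box A)
          (normal_map (Cat \<CC> l) (Cat \<CC> (Suc l)) (BOX \<CC> l) f)"
| Unq: "interp \<CC> \<beta> (\<Gamma> # \<Delta>) (Suc l) M (Box A) f \<Longrightarrow> n = Suc l + length \<Delta>
    \<Longrightarrow> X = ty_obj \<CC> \<beta> l A \<Longrightarrow> Y = ctx_obj \<CC> \<beta> l \<Gamma>'
    \<Longrightarrow> interp \<CC> \<beta> (\<Gamma> # \<Delta> @ [\<Gamma>']) l (Unq M) A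
          (stack_map \<CC> \<beta> (Suc l) \<Delta>
             (FM (BOX \<CC> l) (transpose (Cat \<CC> l) X Y (Proj1 (Cat \<CC> l) X Y)))
             \<cdot>\<^bsub>Cat \<CC> n\<^esub> f)"
| Unq_empty: "interp \<CC> \<beta> [] (Suc l) M (Box A) f
    \<Longrightarrow> interp \<CC> \<beta> [\<Gamma>'] l (Unq M) A
          (inv_into (hom (Cat \<CC> l) (Unit (Cat \<CC> l)) (ty_obj \<CC> \<beta> l A))
             (normal_map (Cat \<CC> l) (Cat \<CC> (Suc l)) (BOX \<CC> l)) f
             \<cdot>\<^bsub>Cat \<CC> l\<^esub> bang (Cat \<CC> l) (ctx_obj \<CC> \<beta> l \<Gamma>'))"
| Emp: "interp \<CC> \<beta> [[]] l M A f \<Longrightarrow> interp \<CC> \<beta> [] l M A f"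
| Emp': "interp \<CC> \<beta> [] l M A f \<Longrightarrow> interp \<CC> \<beta> [[]] l M A f"

definition denotation ::
    "('o, 'm) enriched \<Rightarrow> (nat \<Rightarrow> 'b \<Rightarrow> 'o) \<Rightarrow> 'b stack \<Rightarrow> nat \<Rightarrow> 'b tm \<Rightarrow> 'b ty \<Rightarrow> 'm" where
  "denotation \<CC> \<beta> \<Delta> l M A = (THE f. interp \<CC> \<beta> \<Delta> l M A f)"

end

theory Submission
  imports Defs "HOL-Library.Countable"
begin

text \<open>
  By normality, an arrow \<open>\<lbrakk>\<Gamma>\<rbrakk> \<rightarrow> \<Delta>(\<lbrakk>A\<rbrakk>)\<close> is the same as an element \<open>1 \<rightarrow> \<box>[\<lbrakk>\<Gamma>\<rbrakk>, \<Delta>(\<lbrakk>A\<rbrakk>)]\<close>, so the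
  interpretation of a judgment with stack \<open>S\<close> and type \<open>A\<close> amounts to an element of \<open>S(\<lbrakk>A\<rbrakk>)\<close>, and the
  elements of \<open>S(-)\<close> form a finite-product-preserving functor to sets. In this form the clauses of the
  interpretation are uniform in the stack, and they are natural in the part of the stack that a
  construct leaves alone. A substitution is precomposition in the category with hom sets
  \<open>S(\<box>[X, Y])\<close>, which is again natural; this gives the substitution lemma and hence soundness.

  For completeness, closed terms of type \<open>A \<rightarrow> B\<close> modulo derivable equality are the arrows \<open>A \<rightarrow> B\<close> of
  a cartesian infinitely enriched category. An element of \<open>S(A)\<close> in it is read back as a term in the
  stack \<open>S\<close> by repeatedly unquoting it and applying it to the tuple of the variables of the next
  context, and reading back the interpretation of a term yields the term up to derivable equality.
  Since only finitely many base types occur in an equation, they can be renamed to natural numbers;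
  there are then countably many terms, so the syntactic category embeds into any infinite types of
  objects and arrows.
\<close>

section \<open>Syntax\<close>

text \<open>The clauses of \<open>interp\<close> single out the leftmost context, so a construct
  takes different forms in a stack with one context and in a longer one: abstraction is a transpose
  in the first case and an action under \<open>\<box>\<close> in the second. Substitution would
  inherit this distinction, while its induction moves from context to context through quotation and
  unquotation. Elements treat the leftmost context like all others. The price is the identification
  of \<open>[]\<close> with \<open>[[]]\<close>: elements for the two live in the categories of
  levels \<open>l\<close> and \<open>Suc l\<close> and have to be matched by normality wherever an
  abstraction or unquotation meets the empty stack. Arrows of the syntactic category are closed
  terms because these can be used in every stack: \<open>lift\<close> and \<open>subst\<close> fix
  them, and weakening does not change them. Equations between arrows can therefore be checked by
  evaluation on a variable. Each class of equal terms is replaced by a chosen representative, so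
  that an arrow is still coded by a single term and counting terms bounds the arrows.\<close>

definition cur :: "'b stack \<Rightarrow> 'b ctx" where
  "cur S = (if S = [] then [] else last S)"

lemma cur_simps [simp]: "cur [] = []" "cur (S @ [\<Gamma>]) = \<Gamma>" "cur [\<Gamma>] = \<Gamma>"
  by (auto simp: cur_def)

text \<open>
  Syntax-directed typing: the rules \<open>Emp\<close> and \<open>Emp'\<close> are absorbed by letting the empty stack have
  an empty current context and an empty stack to its left.
\<close>

inductive ity :: "'b stack \<Rightarrow> nat \<Rightarrow> 'b tm \<Rightarrow> 'b ty \<Rightarrow> bool" where
  Var: "i < length (cur S) \<Longrightarrow> ity S l (Var i) (cur S ! i)"
| Lam: "wf_ty l A \<Longrightarrow> ity (butlast S @ [A # cur S]) l M B \<Longrightarrow> ity S l (Lam A M) (A \<rightarrow> B)"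
| App: "ity S l M (A \<rightarrow> B) \<Longrightarrow> ity S l N A \<Longrightarrow> ity S l (App M N) B"
| Pair: "ity S l M A \<Longrightarrow> ity S l N B \<Longrightarrow> ity S l (Pair M N) (Prod A B)"
| Fst: "ity S l M (Prod A B) \<Longrightarrow> ity S l (Fst M) A"
| Snd: "ity S l M (Prod A B) \<Longrightarrow> ity S l (Snd M) B"
| Star: "ity S l Star One"
| Quo: "ity (S @ [[]]) l M A \<Longrightarrow> ity S (Suc l) (Quo M) (Box A)"
| Unq: "ity (butlast S) (Suc l) M (Box A) \<Longrightarrow> ity S l (Unq M) A"

inductive_cases ity_VarE [elim!]: "ity S l (Var i) A"
inductive_cases ity_LamE [elim!]: "ity S l (Lam B M) A"
inductive_cases ity_AppE [elim!]: "ity S l (App M N) A"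
inductive_cases ity_PairE [elim!]: "ity S l (Pair M N) A"
inductive_cases ity_FstE [elim!]: "ity S l (Fst M) A"
inductive_cases ity_SndE [elim!]: "ity S l (Snd M) A"
inductive_cases ity_StarE [elim!]: "ity S l Star A"
inductive_cases ity_QuoE [elim!]: "ity S l (Quo M) A"
inductive_cases ity_UnqE [elim!]: "ity S l (Unq M) A"

text \<open>Counted from the right, like the depth in \<open>lift\<close> and \<open>subst\<close>,
  with empty contexts beyond the left end. Empty contexts added on the left are thus invisible; in
  particular \<open>nthc\<close> cannot tell \<open>[]\<close> from \<open>[[]]\<close>.\<close>

definition nthc :: "'b stack \<Rightarrow> nat \<Rightarrow> 'b ctx" where
  "nthc S n = (if n < length S then rev S ! n else [])"

lemma nthc_simps [simp]: "nthc [] n = []" "nthc (S @ [\<Gamma>]) 0 = \<Gamma>" "nthc (S @ [\<Gamma>]) (Suc n) = nthc S n"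
  by (auto simp: nthc_def)

lemma nthc_0: "nthc S 0 = cur S"
  by (cases S rule: rev_cases) auto

lemma nthc_butlast [simp]: "nthc (butlast S) n = nthc S (Suc n)"
  by (cases S rule: rev_cases) auto

text \<open>A context lists its most recent variable first, so appending older variables at the end
  of the list changes no index, and the term needs no renaming. The lengths of the stacks are not
  compared, so the lemma covers larger contexts, more contexts on the left, and the passage between
  \<open>[]\<close> and \<open>[[]]\<close>.\<close>

lemma ity_weaken:
  assumes "ity S l M A" and "\<And>n. \<exists>\<Gamma>. nthc S' n = nthc S n @ \<Gamma>"
  shows "ity S' l M A"
  using assms
proof (induction arbitrary: S' rule: ity.induct)
  case (Var i S l)
  obtain \<Gamma> where "cur S' = cur S @ \<Gamma>" using Var.prems[of 0] by (auto simp: nthc_0)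
  then show ?case using Var.hyps ity.Var[of i S' l] by (simp add: nth_append)
next
  case (Lam l A S M B)
  show ?case
  proof (rule ity.Lam[OF Lam.hyps(1)], rule Lam.IH)
    show "\<exists>\<Gamma>. nthc (butlast S' @ [A # cur S']) n = nthc (butlast S @ [A # cur S]) n @ \<Gamma>" for n
      using Lam.prems[of n] by (cases n) (auto simp: nthc_0)
  qed
next
  case (Quo S l M A)
  show ?case
  proof (rule ity.Quo, rule Quo.IH)
    show "\<exists>\<Gamma>. nthc (S' @ [[]]) n = nthc (S @ [[]]) n @ \<Gamma>" for n
      using Quo.prems[of "n - 1"] by (cases n) auto
  qed
next
  case (Unq S l M A)
  then show ?case by (auto intro!: ity.Unq)
qed (auto intro: ity.intros)

lemma ity_Nil: "ity [] l M A \<Longrightarrow> ity S l M A"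
  by (erule ity_weaken) auto

lemma nthc_Nil_singleton [simp]: "nthc [[]] n = []"
  by (cases n) (simp_all add: nthc_def)

lemma ity_Nil_iff: "ity [[]] l M A \<longleftrightarrow> ity [] l M A"
  by (auto intro: ity_Nil elim: ity_weaken)

lemma wf_stack_append: "wf_stack l (S @ T) \<longleftrightarrow> wf_stack (l + length T) S \<and> wf_stack l T"
  by (induction S) (auto simp: add_ac)

lemma wf_stack_snoc [simp]: "wf_stack l (S @ [\<Gamma>]) \<longleftrightarrow> wf_stack (Suc l) S \<and> wf_ctx l \<Gamma>"
  by (simp add: wf_stack_append)

lemma wf_ctx_simps [simp]: "wf_ctx l []" "wf_ctx l (A # \<Gamma>) \<longleftrightarrow> wf_ty l A \<and> wf_ctx l \<Gamma>"
  by (auto simp: wf_ctx_def)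

lemma wf_butlast_cur: "wf_stack l S \<Longrightarrow> wf_stack (Suc l) (butlast S) \<and> wf_ctx l (cur S)"
  by (cases S rule: rev_cases) auto

lemma typing_imp_ity: "S \<turnstile>\<^bsub>l\<^esub> M : A \<Longrightarrow> ity S l M A \<and> wf_stack l S"
proof (induction rule: typing.induct)
  case (Var l \<Delta> \<Gamma> i)
  then show ?case using ity.Var[of i "\<Delta> @ [\<Gamma>]" l] by simp
next
  case (Emp l M A)
  then show ?case by (simp add: ity_Nil_iff)
next
  case (Emp' l M A)
  then show ?case by (simp add: ity_Nil_iff)
qed (auto intro: ity.intros)

lemma typing_Nil_iff: "[[]] \<turnstile>\<^bsub>l\<^esub> M : A \<longleftrightarrow> [] \<turnstile>\<^bsub>l\<^esub> M : A"
  by (auto intro: typing.Emp typing.Emp')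

lemma ity_imp_typing: "ity S l M A \<Longrightarrow> wf_stack l S \<Longrightarrow> S \<turnstile>\<^bsub>l\<^esub> M : A"
proof (induction rule: ity.induct)
  case (Var i S l)
  then show ?case by (cases S rule: rev_cases) (auto intro: typing.Var)
next
  case (Lam l A S M B)
  then show ?case
    by (cases S rule: rev_cases) (auto intro: typing.Abs typing.Emp typing.Abs[of "[]", simplified])
next
  case (Unq S l M A)
  then show ?case
    using typing.Unq[of "[]" l M A "[]"] by (cases S rule: rev_cases) (auto intro: typing.Unq typing.Emp)
qed (auto intro: typing.intros)

lemma typing_iff: "S \<turnstile>\<^bsub>l\<^esub> M : A \<longleftrightarrow> ity S l M A \<and> wf_stack l S"
  using typing_imp_ity ity_imp_typing by blast

lemma wf_ty_nth: "wf_ctx l \<Gamma> \<Longrightarrow> i < length \<Gamma> \<Longrightarrow> wf_ty l (\<Gamma> ! i)"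
  by (simp add: wf_ctx_def)

lemma ity_wf_ty: "ity S l M A \<Longrightarrow> wf_stack l S \<Longrightarrow> wf_ty l A"
  by (induction rule: ity.induct) (auto simp: wf_butlast_cur wf_ty_nth)

text \<open>The interpretation of an application or a projection depends on types that the term does
  not display. Computing them from stack and term lets the semantics be a function on terms instead
  of a relation on derivations. For typable terms the default \<open>One\<close> is never
  reached.\<close>

primrec tyof :: "'b stack \<Rightarrow> 'b tm \<Rightarrow> 'b ty" where
  "tyof S (Var i) = cur S ! i"
| "tyof S (Lam A M) = A \<rightarrow> tyof (butlast S @ [A # cur S]) M"
| "tyof S (App M N) = (case tyof S M of A \<rightarrow> B \<Rightarrow> B | _ \<Rightarrow> One)"
| "tyof S (Pair M N) = Prod (tyof S M) (tyof S N)"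
| "tyof S (Fst M) = (case tyof S M of Prod A B \<Rightarrow> A | _ \<Rightarrow> One)"
| "tyof S (Snd M) = (case tyof S M of Prod A B \<Rightarrow> B | _ \<Rightarrow> One)"
| "tyof S Star = One"
| "tyof S (Quo M) = Box (tyof (S @ [[]]) M)"
| "tyof S (Unq M) = (case tyof (butlast S) M of Box A \<Rightarrow> A | _ \<Rightarrow> One)"

lemma tyof: "ity S l M A \<Longrightarrow> tyof S M = A"
  by (induction rule: ity.induct) auto

section \<open>Simultaneous substitution\<close>

definition up :: "(nat \<Rightarrow> 'b tm) \<Rightarrow> nat \<Rightarrow> 'b tm" where
  "up \<sigma> = case_nat (Var 0) (\<lambda>i. lift 0 0 (\<sigma> i))"

lemma up_simps [simp]: "up \<sigma> 0 = Var 0" "up \<sigma> (Suc i) = lift 0 0 (\<sigma> i)"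
  by (simp_all add: up_def)

text \<open>Both \<open>lift\<close> and \<open>subst\<close> are instances, so one induction gives
  the semantics of both. The terms \<open>\<sigma> i\<close> live in the context that is current at
  depth 0; hence only binders met at depth 0 shift them.\<close>

primrec sub :: "nat \<Rightarrow> (nat \<Rightarrow> 'b tm) \<Rightarrow> 'b tm \<Rightarrow> 'b tm" where
  "sub n \<sigma> (Var i) = (if n = 0 then \<sigma> i else Var i)"
| "sub n \<sigma> (Lam A M) = Lam A (sub n (if n = 0 then up \<sigma> else \<sigma>) M)"
| "sub n \<sigma> (App M N) = App (sub n \<sigma> M) (sub n \<sigma> N)"
| "sub n \<sigma> (Pair M N) = Pair (sub n \<sigma> M) (sub n \<sigma> N)"
| "sub n \<sigma> (Fst M) = Fst (sub n \<sigma> M)"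
| "sub n \<sigma> (Snd M) = Snd (sub n \<sigma> M)"
| "sub n \<sigma> Star = Star"
| "sub n \<sigma> (Quo M) = Quo (sub (Suc n) \<sigma> M)"
| "sub n \<sigma> (Unq M) = (if n = 0 then Unq M else Unq (sub (n - 1) \<sigma> M))"

definition ren :: "nat \<Rightarrow> nat \<Rightarrow> 'b tm" where
  "ren k i = (if k \<le> i then Var (Suc i) else Var i)"

definition single :: "nat \<Rightarrow> 'b tm \<Rightarrow> nat \<Rightarrow> 'b tm" where
  "single k N i = (if i = k then N else if k < i then Var (i - 1) else Var i)"

lemma up_ren: "up (ren k) = ren (Suc k)"
  by (auto simp: up_def ren_def fun_eq_iff split: nat.splits)

lemma up_single: "up (single k N) = single (Suc k) (lift 0 0 N)"
  by (auto simp: up_def single_def fun_eq_iff split: nat.splits)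

lemma up_Var: "up Var = Var"
  by (auto simp: up_def fun_eq_iff split: nat.splits)

lemma sub_Var: "sub n Var M = M"
  by (induction M arbitrary: n) (auto simp: up_Var)

lemma lift_sub: "lift n k M = sub n (ren k) M"
  by (induction M arbitrary: n k) (auto simp: up_ren, auto simp: ren_def)

lemma subst_sub: "subst n k N M = sub n (single k N) M"
  by (induction M arbitrary: n k N) (auto simp: up_single, auto simp: single_def)

text \<open>Of the context \<open>n\<close> places to the left, a typable term mentions only indices
  below the length of that context, so from \<open>k\<close> on there is nothing to shift or to
  replace. Closed terms are therefore fixed at every depth and index.\<close>

lemma closed_invariant:
  assumes "ity S l M A" "length (nthc S n) \<le> k"
  shows "lift n k M = M" "subst n k N M = M"
proof -
  have "lift n k M = M \<and> subst n k N M = M" using assms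
  proof (induction arbitrary: n k N rule: ity.induct)
    case (Var i S l)
    then show ?case by (cases n) (auto simp: nthc_0)
  next
    case (Lam l A S M B)
    show ?case using Lam.IH[of n "if n = 0 then Suc k else k"] Lam.prems by (cases n) (auto simp: nthc_0)
  next
    case (Quo S l M A)
    then show ?case using Quo.IH[of "Suc n" k] by auto
  next
    case (Unq S l M A)
    then show ?case using Unq.IH[of "n - 1" k] by (cases n) auto
  qed (auto simp: nthc_0)
  then show "lift n k M = M" "subst n k N M = M" by auto
qed

section \<open>Cartesian closed categories and functors to sets\<close>

locale ccc =
  fixes C :: "('o, 'm) ccc" (structure)
  assumes is_ccc: "is_ccc C"
begin

lemmas ccc_unit = is_ccc[unfolded is_ccc_def, THEN conjunct2, THEN conjunct2, THEN conjunct1, THEN bspec]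
lemmas ccc_prod = is_ccc[unfolded is_ccc_def, THEN conjunct2, THEN conjunct2, THEN conjunct2, THEN conjunct1, THEN bspec, THEN bspec]
lemmas ccc_expo = is_ccc[unfolded is_ccc_def, THEN conjunct2, THEN conjunct2, THEN conjunct2, THEN conjunct2, THEN bspec, THEN bspec]

lemma is_category: "is_category C"
  using is_ccc by (simp add: is_ccc_def)

lemmas cat_Ar = is_category[unfolded is_category_def, THEN conjunct1, THEN bspec]
lemmas cat_Id = is_category[unfolded is_category_def, THEN conjunct2, THEN conjunct1, THEN bspec]
lemmas cat_Comp = is_category[unfolded is_category_def, THEN conjunct2, THEN conjunct2, THEN conjunct1,
  THEN bspec, THEN bspec, THEN bspec, THEN bspec, THEN bspec]
lemmas cat_Comp_Id = is_category[unfolded is_category_def, THEN conjunct2, THEN conjunct2, THEN conjunct2,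
  THEN conjunct1, THEN bspec, THEN bspec, THEN bspec]
lemmas cat_assoc = is_category[unfolded is_category_def, THEN conjunct2, THEN conjunct2, THEN conjunct2,
  THEN conjunct2, THEN bspec, THEN bspec, THEN bspec, THEN bspec, THEN bspec, THEN bspec, THEN bspec]

text \<open>Hom sets are unfolded into conditions on \<open>Ar\<close>, \<open>Dom\<close> and
  \<open>Cod\<close>. In this form the category laws are conditional rewrite rules whose side
  conditions the simplifier can prove; composition is normalised to nest to the right.\<close>

lemma in_hom_iff: "f \<in> hom C X Y \<longleftrightarrow> f \<in> Ar C \<and> Dom C f = X \<and> Cod C f = Y"
  by (simp add: hom_def)

lemma Dom_Cod_Ob [simp]: "f \<in> Ar C \<Longrightarrow> Dom C f \<in> Ob C" "f \<in> Ar C \<Longrightarrow> Cod C f \<in> Ob C"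
  using cat_Ar by simp_all

lemma Id_simps [simp]:
  assumes "X \<in> Ob C"
  shows "Id C X \<in> Ar C" "Dom C (Id C X) = X" "Cod C (Id C X) = X"
  using cat_Id[OF assms] by (simp_all add: in_hom_iff)

lemma Comp_simps [simp]:
  assumes "f \<in> Ar C" "g \<in> Ar C" "Dom C g = Cod C f"
  shows "g \<cdot> f \<in> Ar C" "Dom C (g \<cdot> f) = Dom C f" "Cod C (g \<cdot> f) = Cod C g"
  using cat_Comp[of "Dom C f" "Cod C f" "Cod C g" f g] assms by (simp_all add: in_hom_iff)

lemma Comp_Id [simp]: "f \<in> Ar C \<Longrightarrow> Dom C f = X \<Longrightarrow> f \<cdot> Id C X = f"
  and Id_Comp [simp]: "f \<in> Ar C \<Longrightarrow> Cod C f = X \<Longrightarrow> Id C X \<cdot> f = f"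
  using cat_Comp_Id[of "Dom C f" "Cod C f" f] by (auto simp: in_hom_iff)

lemma Comp_assoc [simp]:
  assumes "f \<in> Ar C" "g \<in> Ar C" "h \<in> Ar C" "Dom C g = Cod C f" "Dom C h = Cod C g"
  shows "(h \<cdot> g) \<cdot> f = h \<cdot> (g \<cdot> f)"
  using assms by (intro cat_assoc[of "Dom C f" "Cod C f" "Cod C g" "Cod C h"]) (simp_all add: in_hom_iff)

lemma Unit_Ob [simp]: "Unit C \<in> Ob C"
  and Times_Ob [simp]: "X \<in> Ob C \<Longrightarrow> Y \<in> Ob C \<Longrightarrow> Times C X Y \<in> Ob C"
  and Expo_Ob [simp]: "X \<in> Ob C \<Longrightarrow> Y \<in> Ob C \<Longrightarrow> Expo C X Y \<in> Ob C"
  using is_ccc ccc_prod[of X Y] ccc_expo[of X Y] by (simp_all add: is_ccc_def)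

lemma Proj_simps [simp]:
  assumes "X \<in> Ob C" "Y \<in> Ob C"
  shows "Proj1 C X Y \<in> Ar C" "Dom C (Proj1 C X Y) = Times C X Y" "Cod C (Proj1 C X Y) = X"
    "Proj2 C X Y \<in> Ar C" "Dom C (Proj2 C X Y) = Times C X Y" "Cod C (Proj2 C X Y) = Y"
  using ccc_prod[OF assms] by (simp_all add: hom_def)

lemma Eval_simps [simp]:
  assumes "X \<in> Ob C" "Y \<in> Ob C"
  shows "Eval C X Y \<in> Ar C" "Dom C (Eval C X Y) = Times C (Expo C X Y) X" "Cod C (Eval C X Y) = Y"
  using ccc_expo[OF assms] by (simp_all add: hom_def)

lemma bang_hom: "X \<in> Ob C \<Longrightarrow> bang C X \<in> hom C X (Unit C)"
  unfolding bang_def by (rule theI'[OF ccc_unit])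

lemma bang_simps [simp]:
  assumes "X \<in> Ob C"
  shows "bang C X \<in> Ar C" "Dom C (bang C X) = X" "Cod C (bang C X) = Unit C"
  using bang_hom[OF assms] by (auto simp: hom_def)

lemma bang_unique: "f \<in> Ar C \<Longrightarrow> Cod C f = Unit C \<Longrightarrow> f = bang C (Dom C f)"
proof -
  assume f: "f \<in> Ar C" "Cod C f = Unit C"
  then have "f \<in> hom C (Dom C f) (Unit C)" by (simp add: hom_def)
  moreover have "\<exists>!g. g \<in> hom C (Dom C f) (Unit C)"
    using f by (intro ccc_unit) simp
  ultimately show ?thesis using bang_hom[of "Dom C f"] f(1) by auto
qed

lemma bang_Comp [simp]: "f \<in> Ar C \<Longrightarrow> Cod C f = X \<Longrightarrow> bang C X \<cdot> f = bang C (Dom C f)"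
  using bang_unique[of "bang C X \<cdot> f"] by auto

lemma bang_Unit [simp]: "bang C (Unit C) = Id C (Unit C)"
  using bang_unique[of "Id C (Unit C)"] by auto

lemma tuple_ex1:
  assumes "f \<in> Ar C" "g \<in> Ar C" "Dom C f = Dom C g"
  shows "\<exists>!h. h \<in> hom C (Dom C f) (Times C (Cod C f) (Cod C g)) \<and>
     Proj1 C (Cod C f) (Cod C g) \<cdot> h = f \<and> Proj2 C (Cod C f) (Cod C g) \<cdot> h = g"
proof -
  have "f \<in> hom C (Dom C f) (Cod C f)" "g \<in> hom C (Dom C f) (Cod C g)"
    using assms by (auto simp: hom_def)
  moreover have "Dom C f \<in> Ob C" "Cod C f \<in> Ob C" "Cod C g \<in> Ob C" using assms by auto
  ultimately show ?thesis
    using ccc_prod[of "Cod C f" "Cod C g", THEN conjunct2, THEN conjunct2, THEN conjunct2] by simp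
qed

lemma tuple_props:
  assumes "f \<in> Ar C" "g \<in> Ar C" "Dom C f = Dom C g"
  shows "tuple C f g \<in> hom C (Dom C f) (Times C (Cod C f) (Cod C g)) \<and>
     Proj1 C (Cod C f) (Cod C g) \<cdot> tuple C f g = f \<and> Proj2 C (Cod C f) (Cod C g) \<cdot> tuple C f g = g"
  unfolding tuple_def by (rule theI'[OF tuple_ex1[OF assms]])

lemma tuple_simps [simp]:
  assumes "f \<in> Ar C" "g \<in> Ar C" "Dom C f = Dom C g"
  shows "tuple C f g \<in> Ar C" "Dom C (tuple C f g) = Dom C f" "Cod C (tuple C f g) = Times C (Cod C f) (Cod C g)"
  using tuple_props[OF assms] by (auto simp: hom_def)

lemma Proj_tuple [simp]:
  assumes "f \<in> Ar C" "g \<in> Ar C" "Dom C f = Dom C g" "Cod C f = X" "Cod C g = Y"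
  shows "Proj1 C X Y \<cdot> tuple C f g = f" "Proj2 C X Y \<cdot> tuple C f g = g"
  using tuple_props[OF assms(1-3)] unfolding assms(4,5) by simp_all

lemma tuple_unique:
  assumes "h \<in> Ar C" "Cod C h = Times C X Y" "X \<in> Ob C" "Y \<in> Ob C"
    "Proj1 C X Y \<cdot> h = f" "Proj2 C X Y \<cdot> h = g"
  shows "h = tuple C f g"
proof -
  have fg: "f \<in> Ar C" "g \<in> Ar C" "Dom C f = Dom C g" "Cod C f = X" "Cod C g = Y" "Dom C h = Dom C f"
    using assms(1-4) by (auto simp flip: assms(5,6))
  have "h \<in> hom C (Dom C f) (Times C (Cod C f) (Cod C g))"
    using fg assms by (auto simp: hom_def)
  then show ?thesis
    unfolding tuple_def using assms(5,6) fg(4,5)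
    by (intro the1_equality[OF tuple_ex1[OF fg(1-3)], symmetric]) simp
qed

text \<open>Nesting to the right hides the redex \<open>Proj1 C X Y \<cdot> tuple C f g\<close> when
  a further arrow \<open>h\<close> precedes it; this form keeps it reducible.\<close>

lemma Proj_tuple_Comp [simp]:
  assumes "f \<in> Ar C" "g \<in> Ar C" "Dom C f = Dom C g" "Cod C f = X" "Cod C g = Y"
    "h \<in> Ar C" "Cod C h = Dom C f"
  shows "Proj1 C X Y \<cdot> tuple C f g \<cdot> h = f \<cdot> h" "Proj2 C X Y \<cdot> tuple C f g \<cdot> h = g \<cdot> h"
proof -
  have *: "X \<in> Ob C" "Y \<in> Ob C" using assms by auto
  have "Proj1 C X Y \<cdot> tuple C f g \<cdot> h = (Proj1 C X Y \<cdot> tuple C f g) \<cdot> h"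
    using assms * by (subst Comp_assoc) auto
  also have "\<dots> = f \<cdot> h" using assms by (subst Proj_tuple) auto
  finally show "Proj1 C X Y \<cdot> tuple C f g \<cdot> h = f \<cdot> h" .
  have "Proj2 C X Y \<cdot> tuple C f g \<cdot> h = (Proj2 C X Y \<cdot> tuple C f g) \<cdot> h"
    using assms * by (subst Comp_assoc) auto
  also have "\<dots> = g \<cdot> h" using assms by (subst Proj_tuple) auto
  finally show "Proj2 C X Y \<cdot> tuple C f g \<cdot> h = g \<cdot> h" .
qed

lemma tuple_Comp [simp]:
  assumes "f \<in> Ar C" "g \<in> Ar C" "Dom C f = Dom C g" "h \<in> Ar C" "Cod C h = Dom C f"
  shows "tuple C f g \<cdot> h = tuple C (f \<cdot> h) (g \<cdot> h)"
  by (rule tuple_unique[where X = "Cod C f" and Y = "Cod C g"]) (use assms in \<open>simp_all\<close>)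

lemma tuple_Proj [simp]: "X \<in> Ob C \<Longrightarrow> Y \<in> Ob C \<Longrightarrow> tuple C (Proj1 C X Y) (Proj2 C X Y) = Id C (Times C X Y)"
  by (rule tuple_unique[symmetric, where X = X and Y = Y]) auto

lemma tuple_Proj_Comp [simp]:
  assumes "h \<in> Ar C" "Cod C h = Times C X Y" "X \<in> Ob C" "Y \<in> Ob C"
  shows "tuple C (Proj1 C X Y \<cdot> h) (Proj2 C X Y \<cdot> h) = h"
  by (rule tuple_unique[OF assms refl refl, symmetric])

section \<open>Exponentials through application of generalised elements\<close>

definition ap :: "'o \<Rightarrow> 'o \<Rightarrow> 'm \<Rightarrow> 'm \<Rightarrow> 'm" where
  "ap X Y u x = Eval C X Y \<cdot> tuple C u x"

lemma ap_simps [simp]: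
  assumes "u \<in> Ar C" "x \<in> Ar C" "Dom C u = Dom C x" "Cod C u = Expo C X Y" "Cod C x = X" "Y \<in> Ob C"
  shows "ap X Y u x \<in> Ar C" "Dom C (ap X Y u x) = Dom C x" "Cod C (ap X Y u x) = Y"
proof -
  have "X \<in> Ob C" using assms by auto
  then show "ap X Y u x \<in> Ar C" "Dom C (ap X Y u x) = Dom C x" "Cod C (ap X Y u x) = Y"
    using assms by (simp_all add: ap_def)
qed

lemma ap_Comp [simp]:
  assumes "u \<in> Ar C" "x \<in> Ar C" "Dom C u = Dom C x" "Cod C u = Expo C X Y" "Cod C x = X" "Y \<in> Ob C"
    "h \<in> Ar C" "Cod C h = Dom C x"
  shows "ap X Y u x \<cdot> h = ap X Y (u \<cdot> h) (x \<cdot> h)"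
proof -
  have "X \<in> Ob C" using assms by auto
  then show ?thesis using assms by (simp add: ap_def)
qed

lemma is_transpose_iff:
  assumes "X \<in> Ob C" "Z \<in> Ob C" "Y \<in> Ob C" "Cod C f = Y"
  shows "is_transpose C Z X f h \<longleftrightarrow> h \<in> Ar C \<and> Dom C h = Z \<and> Cod C h = Expo C X Y \<and>
    ap X Y (h \<cdot> Proj1 C Z X) (Proj2 C Z X) = f"
  using assms by (auto simp: is_transpose_def hom_def times_map_def ap_def)

lemma transpose_ex1:
  assumes "X \<in> Ob C" "Z \<in> Ob C" "f \<in> Ar C" "Dom C f = Times C Z X"
  shows "\<exists>!h. is_transpose C Z X f h"
proof -
  have "f \<in> hom C (Times C Z X) (Cod C f)" "Cod C f \<in> Ob C" using assms by (auto simp: hom_def)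
  then show ?thesis
    using ccc_expo[of X "Cod C f", THEN conjunct2, THEN conjunct2] assms(1,2) by simp
qed

lemma transpose_props:
  assumes "X \<in> Ob C" "Z \<in> Ob C" "f \<in> Ar C" "Dom C f = Times C Z X"
  shows "is_transpose C Z X f (transpose C Z X f)"
  unfolding transpose_def by (rule theI'[OF transpose_ex1[OF assms]])

lemma transpose_simps [simp]:
  assumes "X \<in> Ob C" "Z \<in> Ob C" "f \<in> Ar C" "Dom C f = Times C Z X"
  shows "transpose C Z X f \<in> Ar C" "Dom C (transpose C Z X f) = Z"
    "Cod C (transpose C Z X f) = Expo C X (Cod C f)"
  using transpose_props[OF assms] assms by (auto simp: is_transpose_def hom_def)

lemma ap_transpose_Proj:
  assumes "X \<in> Ob C" "Z \<in> Ob C" "f \<in> Ar C" "Dom C f = Times C Z X" "Cod C f = Y"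
  shows "ap X Y (transpose C Z X f \<cdot> Proj1 C Z X) (Proj2 C Z X) = f"
  using transpose_props[OF assms(1-4)] is_transpose_iff[of X Z Y f] assms by auto

text \<open>The beta law. It is stated for the composite of the transpose with \<open>h\<close>
  because this is the form that \<open>ap_Comp\<close> leaves behind when an arrow is pushed
  inside.\<close>

lemma ap_transpose [simp]:
  assumes "Z \<in> Ob C" "f \<in> Ar C" "Dom C f = Times C Z X" "Cod C f = Y"
    "h \<in> Ar C" "x \<in> Ar C" "Dom C h = Dom C x" "Cod C h = Z" "Cod C x = X"
  shows "ap X Y (transpose C Z X f \<cdot> h) x = f \<cdot> tuple C h x"
proof -
  have X: "X \<in> Ob C" "Y \<in> Ob C" using assms by auto
  have "f \<cdot> tuple C h x = ap X Y (transpose C Z X f \<cdot> Proj1 C Z X) (Proj2 C Z X) \<cdot> tuple C h x"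
    using ap_transpose_Proj[OF X(1) assms(1-4)] by simp
  also have "\<dots> = ap X Y (transpose C Z X f \<cdot> h) x"
    using assms X by simp
  finally show ?thesis ..
qed

text \<open>Extensionality, from uniqueness of transposes: arrows into an exponential agree if they
  agree on a fresh variable, here \<open>Proj2 C W X\<close>. Most equations below are proved by
  this rule followed by computation with \<open>ap\<close>, as in the simply typed lambda
  calculus.\<close>

lemma expo_ext:
  assumes "u \<in> Ar C" "v \<in> Ar C" "Dom C u = W" "Dom C v = W" "Cod C u = Expo C X Y" "Cod C v = Expo C X Y"
    "X \<in> Ob C" "Y \<in> Ob C"
    "ap X Y (u \<cdot> Proj1 C W X) (Proj2 C W X) = ap X Y (v \<cdot> Proj1 C W X) (Proj2 C W X)"
  shows "u = v"
proof -
  have W: "W \<in> Ob C" using assms by auto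
  let ?f = "ap X Y (u \<cdot> Proj1 C W X) (Proj2 C W X)"
  have f: "?f \<in> Ar C" "Dom C ?f = Times C W X" "Cod C ?f = Y" using assms W by simp_all
  have "is_transpose C W X ?f u" "is_transpose C W X ?f v"
    using assms W f by (auto simp: is_transpose_iff[of X W Y])
  then show ?thesis using transpose_ex1[OF assms(7) W f(1,2)] by blast
qed

lemma expo_map_simps [simp]:
  assumes "X \<in> Ob C" "f \<in> Ar C"
  shows "expo_map C X f \<in> Ar C" "Dom C (expo_map C X f) = Expo C X (Dom C f)"
    "Cod C (expo_map C X f) = Expo C X (Cod C f)"
  using assms by (simp_all add: expo_map_def)

lemma ap_expo_map [simp]:
  assumes "f \<in> Ar C" "u \<in> Ar C" "x \<in> Ar C" "Dom C u = Dom C x" "Cod C u = Expo C X (Dom C f)" "Cod C x = X"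
    "Y = Cod C f"
  shows "ap X Y (expo_map C X f \<cdot> u) x = f \<cdot> ap X (Dom C f) u x"
proof -
  have "X \<in> Ob C" using assms by auto
  then show ?thesis using assms by (simp add: expo_map_def ap_def[of X "Dom C f" u])
qed

lemma name_of_simps [simp]:
  assumes "f \<in> Ar C"
  shows "name_of C f \<in> Ar C" "Dom C (name_of C f) = Unit C" "Cod C (name_of C f) = Expo C (Dom C f) (Cod C f)"
  using assms by (simp_all add: name_of_def)

lemma ap_name_of [simp]:
  assumes "f \<in> Ar C" "u \<in> Ar C" "x \<in> Ar C" "Dom C u = Dom C x" "Cod C u = Unit C" "Cod C x = Dom C f"
    "X = Dom C f" "Y = Cod C f"
  shows "ap X Y (name_of C f \<cdot> u) x = f \<cdot> x"
  using assms by (simp add: name_of_def)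

text \<open>The arrow \<open>X \<rightarrow> [Y, X]\<close> that interprets unquotation.\<close>

abbreviation (in -) konst :: "('o, 'm) ccc \<Rightarrow> 'o \<Rightarrow> 'o \<Rightarrow> 'm" where
  "konst C X Y \<equiv> transpose C X Y (Proj1 C X Y)"

lemma curry_iso_simps [simp]:
  assumes "X \<in> Ob C" "Y \<in> Ob C" "Z \<in> Ob C"
  shows "curry_iso C X Y Z \<in> Ar C" "Dom C (curry_iso C X Y Z) = Expo C (Times C X Y) Z"
    "Cod C (curry_iso C X Y Z) = Expo C X (Expo C Y Z)"
  using assms by (simp_all add: curry_iso_def Let_def)

lemma ap_curry_iso [simp]:
  assumes "u \<in> Ar C" "x \<in> Ar C" "y \<in> Ar C" "Dom C u = Dom C x" "Dom C x = Dom C y"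
    "Cod C u = Expo C (Times C X Y) Z" "Cod C x = X" "Cod C y = Y" "Z \<in> Ob C"
  shows "ap Y Z (ap X (Expo C Y Z) (curry_iso C X Y Z \<cdot> u) x) y = ap (Times C X Y) Z u (tuple C x y)"
proof -
  have "X \<in> Ob C" "Y \<in> Ob C" using assms by auto
  then show ?thesis using assms by (simp add: curry_iso_def Let_def ap_def[of "Times C X Y"])
qed

text \<open>Internal composition \<open>[Y, Z] \<times> [X, Y] \<rightarrow> [X, Z]\<close>. It
  induces the composition on the sets \<open>E [X, Y]\<close> by which substitution is
  interpreted.\<close>

definition cmp :: "'o \<Rightarrow> 'o \<Rightarrow> 'o \<Rightarrow> 'm" where
  "cmp X Y Z = (let P = Times C (Expo C Y Z) (Expo C X Y) in
     transpose C P X (ap Y Z (Proj1 C (Expo C Y Z) (Expo C X Y) \<cdot> Proj1 C P X)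
       (ap X Y (Proj2 C (Expo C Y Z) (Expo C X Y) \<cdot> Proj1 C P X) (Proj2 C P X))))"

lemma cmp_simps [simp]:
  assumes "X \<in> Ob C" "Y \<in> Ob C" "Z \<in> Ob C"
  shows "cmp X Y Z \<in> Ar C" "Dom C (cmp X Y Z) = Times C (Expo C Y Z) (Expo C X Y)"
    "Cod C (cmp X Y Z) = Expo C X Z"
  using assms by (simp_all add: cmp_def Let_def)

lemma ap_cmp [simp]:
  assumes "w \<in> Ar C" "x \<in> Ar C" "Dom C w = Dom C x" "Cod C w = Times C (Expo C Y Z) (Expo C X Y)" "Cod C x = X"
    "Y \<in> Ob C" "Z \<in> Ob C"
  shows "ap X Z (cmp X Y Z \<cdot> w) x =
    ap Y Z (Proj1 C (Expo C Y Z) (Expo C X Y) \<cdot> w) (ap X Y (Proj2 C (Expo C Y Z) (Expo C X Y) \<cdot> w) x)"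
proof -
  have "X \<in> Ob C" using assms by auto
  then show ?thesis using assms by (simp add: cmp_def Let_def)
qed

lemma unit_expo_iso_ap: "X \<in> Ob C \<Longrightarrow> unit_expo_iso C X = ap (Unit C) X (Id C (Expo C (Unit C) X)) (bang C (Expo C (Unit C) X))"
  by (simp add: unit_expo_iso_def ap_def)

lemma unit_expo_iso_simps [simp]:
  assumes "X \<in> Ob C"
  shows "unit_expo_iso C X \<in> Ar C" "Dom C (unit_expo_iso C X) = Expo C (Unit C) X" "Cod C (unit_expo_iso C X) = X"
  using assms by (simp_all add: unit_expo_iso_ap)

lemma inverse_arrows_unique: "inverse_arrows C f g \<Longrightarrow> inverse_arrows C f h \<Longrightarrow> g = h"
proof -
  assume "inverse_arrows C f g" "inverse_arrows C f h"
  then have *: "f \<in> Ar C" "g \<in> Ar C" "h \<in> Ar C" "Dom C g = Cod C f" "Cod C g = Dom C f" "Dom C h = Cod C f" "Cod C h = Dom C f"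
    "g \<cdot> f = Id C (Dom C f)" "f \<cdot> h = Id C (Cod C f)"
    by (auto simp: inverse_arrows_def hom_def)
  have "g = g \<cdot> (f \<cdot> h)" using * by simp
  also have "\<dots> = (g \<cdot> f) \<cdot> h" using * by (intro Comp_assoc[symmetric]) auto
  also have "\<dots> = h" using * by simp
  finally show ?thesis .
qed

lemma inverse_of_props:
  assumes "is_iso C f"
  shows "inverse_of C f \<in> Ar C" "Dom C (inverse_of C f) = Cod C f" "Cod C (inverse_of C f) = Dom C f"
    "inverse_of C f \<cdot> f = Id C (Dom C f)" "f \<cdot> inverse_of C f = Id C (Cod C f)"
proof -
  have "inverse_arrows C f (inverse_of C f)"
    unfolding inverse_of_def using assms inverse_arrows_unique by (metis is_iso_def theI)
  then show "inverse_of C f \<in> Ar C" "Dom C (inverse_of C f) = Cod C f" "Cod C (inverse_of C f) = Dom C f"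
    "inverse_of C f \<cdot> f = Id C (Dom C f)" "f \<cdot> inverse_of C f = Id C (Cod C f)"
    by (auto simp: inverse_arrows_def hom_def)
qed

end

text \<open>A finite-product-preserving functor from \<open>C\<close> to sets.\<close>

locale fpp = ccc C for C :: "('o, 'm) ccc" (structure) +
  fixes E :: "'o \<Rightarrow> 'e set" and act :: "'m \<Rightarrow> 'e \<Rightarrow> 'e"
  assumes act_in [simp]: "f \<in> Ar C \<Longrightarrow> a \<in> E (Dom C f) \<Longrightarrow> Cod C f = Y \<Longrightarrow> act f a \<in> E Y"
    and act_Id [simp]: "X \<in> Ob C \<Longrightarrow> a \<in> E X \<Longrightarrow> act (Id C X) a = a"
    and act_Comp: "f \<in> Ar C \<Longrightarrow> g \<in> Ar C \<Longrightarrow> Dom C g = Cod C f \<Longrightarrow> a \<in> E (Dom C f) \<Longrightarrow>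
      act (g \<cdot> f) a = act g (act f a)"
    and pair_ex1: "X \<in> Ob C \<Longrightarrow> Y \<in> Ob C \<Longrightarrow> a \<in> E X \<Longrightarrow> b \<in> E Y \<Longrightarrow>
      \<exists>!c. c \<in> E (Times C X Y) \<and> act (Proj1 C X Y) c = a \<and> act (Proj2 C X Y) c = b"
    and unit_ex1: "\<exists>!c. c \<in> E (Unit C)"
begin

text \<open>Used in this direction, several actions on one element collapse into a single arrow, and
  an identity of elements follows from an identity of arrows in \<open>C\<close>.\<close>

lemma act_act:
  "f \<in> Ar C \<Longrightarrow> g \<in> Ar C \<Longrightarrow> Dom C g = Cod C f \<Longrightarrow> a \<in> E (Dom C f) \<Longrightarrow> act g (act f a) = act (g \<cdot> f) a"
  by (simp add: act_Comp)

definition pr :: "'o \<Rightarrow> 'o \<Rightarrow> 'e \<Rightarrow> 'e \<Rightarrow> 'e" where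
  "pr X Y a b = (THE c. c \<in> E (Times C X Y) \<and> act (Proj1 C X Y) c = a \<and> act (Proj2 C X Y) c = b)"

definition un :: 'e where
  "un = (THE c. c \<in> E (Unit C))"

lemma un_in [simp]: "un \<in> E (Unit C)"
  unfolding un_def by (rule theI'[OF unit_ex1])

lemma un_eqI: "a \<in> E (Unit C) \<Longrightarrow> a = un"
  using unit_ex1 un_in by auto

lemma pr_props:
  assumes "X \<in> Ob C" "Y \<in> Ob C" "a \<in> E X" "b \<in> E Y"
  shows "pr X Y a b \<in> E (Times C X Y)" "act (Proj1 C X Y) (pr X Y a b) = a" "act (Proj2 C X Y) (pr X Y a b) = b"
  unfolding pr_def using theI'[OF pair_ex1[OF assms]] by blast+

lemma pr_unique:
  assumes "X \<in> Ob C" "Y \<in> Ob C" "c \<in> E (Times C X Y)" "act (Proj1 C X Y) c = a" "act (Proj2 C X Y) c = b"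
  shows "c = pr X Y a b"
proof -
  have ab: "a \<in> E X" "b \<in> E Y" using assms by auto
  show ?thesis
    unfolding pr_def using assms by (intro the1_equality[OF pair_ex1[OF assms(1,2) ab], symmetric]) simp
qed

lemma pr_act [simp]:
  assumes "f \<in> Ar C" "g \<in> Ar C" "Dom C f = Dom C g" "Cod C f = X" "Cod C g = Y" "p \<in> E (Dom C f)"
  shows "pr X Y (act f p) (act g p) = act (tuple C f g) p"
proof -
  have "X \<in> Ob C" "Y \<in> Ob C" using assms by auto
  then show ?thesis
    using assms by (intro pr_unique[symmetric]) (auto simp: act_act)
qed

lemma un_act: "X \<in> Ob C \<Longrightarrow> p \<in> E X \<Longrightarrow> un = act (bang C X) p"
  by (rule un_eqI[symmetric]) simp

text \<open>Two elements are images of one element \<open>p\<close> of the product. An identity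
  between elements built from both is then an identity of arrows applied to \<open>p\<close>, which
  computation with \<open>ap\<close> settles; most of the following lemmas are proved in this
  way.\<close>

lemma pairE:
  assumes "X \<in> Ob C" "Y \<in> Ob C" "a \<in> E X" "b \<in> E Y"
  obtains p where "p \<in> E (Times C X Y)" "a = act (Proj1 C X Y) p" "b = act (Proj2 C X Y) p"
  using pr_props[OF assms] by metis

text \<open>
  The sets \<open>E [X, Y]\<close> are the hom sets of a category with the objects of \<open>C\<close>: \<open>nm\<close> is the functor
  from \<open>C\<close>, and \<open>star X' X Y s\<close> is precomposition with \<open>s\<close>. The arrow \<open>lft X' X A s\<close> below is \<open>s \<times> A\<close>,
  and \<open>sgl X A b\<close> is the pairing of the identity of \<open>X\<close> with \<open>b\<close>.
\<close>

definition nm :: "'m \<Rightarrow> 'e" where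
  "nm f = act (name_of C f) un"

definition star :: "'o \<Rightarrow> 'o \<Rightarrow> 'o \<Rightarrow> 'e \<Rightarrow> 'e \<Rightarrow> 'e" where
  "star X' X Y s a = act (cmp X' X Y) (pr (Expo C X Y) (Expo C X' X) a s)"

lemma nm_in [simp]: "f \<in> Ar C \<Longrightarrow> Dom C f = X \<Longrightarrow> Cod C f = Y \<Longrightarrow> nm f \<in> E (Expo C X Y)"
  by (simp add: nm_def)

lemma star_in [simp]:
  assumes "X \<in> Ob C" "X' \<in> Ob C" "Y \<in> Ob C" "s \<in> E (Expo C X' X)" "a \<in> E (Expo C X Y)"
  shows "star X' X Y s a \<in> E (Expo C X' Y)"
  using assms by (simp add: star_def pr_props)

lemma star_act [simp]:
  assumes "u \<in> Ar C" "v \<in> Ar C" "Dom C u = Dom C v" "Cod C u = Expo C X Y" "Cod C v = Expo C X' X"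
    "p \<in> E (Dom C u)" "X \<in> Ob C" "X' \<in> Ob C" "Y \<in> Ob C"
  shows "star X' X Y (act v p) (act u p) = act (cmp X' X Y \<cdot> tuple C u v) p"
  using assms by (simp add: star_def act_act)

text \<open>The unit element is the image of any element under \<open>bang\<close>, so an element
  named by an arrow can also be expressed over a given \<open>p\<close>.\<close>

lemma nm_act:
  "f \<in> Ar C \<Longrightarrow> X \<in> Ob C \<Longrightarrow> p \<in> E X \<Longrightarrow> nm f = act (name_of C f \<cdot> bang C X) p"
  by (simp add: nm_def un_act act_act)

text \<open>Associativity of composition with an arrow of \<open>C\<close> as outer factor, or
  naturality of precomposition in the codomain. This is what lets substitution in one context
  commute with whatever acts in the contexts to the right of it.\<close>

lemma star_expo_map:
  assumes "f \<in> Ar C" "X \<in> Ob C" "X' \<in> Ob C" "a \<in> E (Expo C X (Dom C f))" "s \<in> E (Expo C X' X)"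
    "Cod C f = Z" "Dom C f = Y"
  shows "star X' X Z s (act (expo_map C X f) a) = act (expo_map C X' f) (star X' X Y s a)"
proof -
  let ?P1 = "Proj1 C (Expo C X Y) (Expo C X' X)" and ?P2 = "Proj2 C (Expo C X Y) (Expo C X' X)"
  have Y: "Y \<in> Ob C" "Z \<in> Ob C" using assms by auto
  obtain p where p: "p \<in> E (Times C (Expo C X Y) (Expo C X' X))" "a = act ?P1 p" "s = act ?P2 p"
    using pairE[of "Expo C X Y" "Expo C X' X" a s] assms Y by auto
  have "cmp X' X Z \<cdot> tuple C (expo_map C X f \<cdot> ?P1) ?P2 = expo_map C X' f \<cdot> cmp X' X Y"
    by (rule expo_ext[of _ _ "Times C (Expo C X Y) (Expo C X' X)" X' Z]) (use assms(1-3,6,7) Y in simp_all)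
  then show ?thesis using assms(1-3,6,7) Y p by (simp add: act_act)
qed

text \<open>A constant function absorbs precomposition. This matches \<open>subst\<close> stopping
  at an unquotation that discards the very context being substituted.\<close>

lemma star_konst:
  assumes "X \<in> Ob C" "X' \<in> Ob C" "Y \<in> Ob C" "a \<in> E Y" "s \<in> E (Expo C X' X)"
  shows "star X' X Y s (act (konst C Y X) a) = act (konst C Y X') a"
proof -
  let ?P1 = "Proj1 C Y (Expo C X' X)" and ?P2 = "Proj2 C Y (Expo C X' X)"
  obtain p where p: "p \<in> E (Times C Y (Expo C X' X))" "a = act ?P1 p" "s = act ?P2 p"
    using pairE[of Y "Expo C X' X" a s] assms by auto
  have "cmp X' X Y \<cdot> tuple C (konst C Y X \<cdot> ?P1) ?P2 = konst C Y X' \<cdot> ?P1"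
    by (rule expo_ext[of _ _ "Times C Y (Expo C X' X)" X' Y]) (use assms(1-3) in simp_all)
  then show ?thesis using assms(1-3) p by (simp add: act_act)
qed

lemma expo_map_nm:
  assumes "f \<in> Ar C" "g \<in> Ar C" "Dom C g = Cod C f" "Dom C f = X"
  shows "act (expo_map C X g) (nm f) = nm (g \<cdot> f)"
proof -
  have X: "X \<in> Ob C" using assms by auto
  have "expo_map C X g \<cdot> name_of C f = name_of C (g \<cdot> f)"
    by (rule expo_ext[of _ _ "Unit C" X "Cod C g"]) (use assms X in simp_all)
  then show ?thesis using assms X by (simp add: nm_def act_act)
qed

lemma star_nm:
  assumes "f \<in> Ar C" "Dom C f = X" "Cod C f = Y" "X' \<in> Ob C" "s \<in> E (Expo C X' X)"
  shows "star X' X Y s (nm f) = act (expo_map C X' f) s"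
proof -
  have X: "X \<in> Ob C" "Y \<in> Ob C" using assms by auto
  have "cmp X' X Y \<cdot> tuple C (name_of C f \<cdot> bang C (Expo C X' X)) (Id C (Expo C X' X)) = expo_map C X' f"
    by (rule expo_ext[of _ _ "Expo C X' X" X' Y]) (use assms X in simp_all)
  moreover have "s = act (Id C (Expo C X' X)) s" using assms X by simp
  ultimately show ?thesis
    using assms X star_act[of "name_of C f \<cdot> bang C (Expo C X' X)" "Id C (Expo C X' X)" X Y X' s]
    by (simp add: nm_act[of f "Expo C X' X" s])
qed

definition lft :: "'o \<Rightarrow> 'o \<Rightarrow> 'o \<Rightarrow> 'e \<Rightarrow> 'e" where
  "lft X' X A s = act (let W = Expo C X' X; Z = Times C X' A in transpose C W Z (tuple C
     (ap X' X (Proj1 C W Z) (Proj1 C X' A \<cdot> Proj2 C W Z)) (Proj2 C X' A \<cdot> Proj2 C W Z))) s"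

lemma lft_in [simp]:
  assumes "X \<in> Ob C" "X' \<in> Ob C" "A \<in> Ob C" "s \<in> E (Expo C X' X)"
  shows "lft X' X A s \<in> E (Expo C (Times C X' A) (Times C X A))"
  using assms by (simp add: lft_def Let_def)

text \<open>By uniqueness of pairs in \<open>[X' \<times> A, -]\<close>, this equation and the next
  one determine the element \<open>s \<times> A\<close>.\<close>

lemma lft_Proj1:
  assumes "X \<in> Ob C" "X' \<in> Ob C" "A \<in> Ob C" "s \<in> E (Expo C X' X)"
  shows "act (expo_map C (Times C X' A) (Proj1 C X A)) (lft X' X A s) =
    star (Times C X' A) X' X (nm (Proj1 C X' A)) s"
proof -
  let ?W = "Expo C X' X" let ?Z = "Times C X' A"
  let ?L = "transpose C ?W ?Z (tuple C
     (ap X' X (Proj1 C ?W ?Z) (Proj1 C X' A \<cdot> Proj2 C ?W ?Z)) (Proj2 C X' A \<cdot> Proj2 C ?W ?Z))"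
  have "expo_map C ?Z (Proj1 C X A) \<cdot> ?L = cmp ?Z X' X \<cdot> tuple C (Id C ?W) (name_of C (Proj1 C X' A) \<cdot> bang C ?W)"
    by (rule expo_ext[of _ _ ?W ?Z X]) (use assms in \<open>simp_all\<close>)
  then show ?thesis
    using assms star_act[of "Id C ?W" "name_of C (Proj1 C X' A) \<cdot> bang C ?W" X' X "Times C X' A" s]
    by (simp add: nm_act[of "Proj1 C X' A" ?W s] lft_def act_act Let_def)
qed

lemma lft_Proj2:
  assumes "X \<in> Ob C" "X' \<in> Ob C" "A \<in> Ob C" "s \<in> E (Expo C X' X)"
  shows "act (expo_map C (Times C X' A) (Proj2 C X A)) (lft X' X A s) = nm (Proj2 C X' A)"
proof -
  let ?W = "Expo C X' X" let ?Z = "Times C X' A"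
  let ?L = "transpose C ?W ?Z (tuple C
     (ap X' X (Proj1 C ?W ?Z) (Proj1 C X' A \<cdot> Proj2 C ?W ?Z)) (Proj2 C X' A \<cdot> Proj2 C ?W ?Z))"
  have "expo_map C ?Z (Proj2 C X A) \<cdot> ?L = name_of C (Proj2 C X' A) \<cdot> bang C ?W"
    by (rule expo_ext[of _ _ ?W ?Z A]) (use assms in \<open>simp_all\<close>)
  then show ?thesis
    using assms by (simp add: nm_act[of "Proj2 C X' A" ?W s] lft_def act_act Let_def)
qed

text \<open>Currying is natural in the context \<open>X\<close>: precomposing a curried element with
  \<open>s\<close> amounts to precomposing the uncurried one with \<open>s \<times> A\<close>. This
  is substitution under a binder of the substituted context.\<close>

lemma star_curry:
  assumes "X \<in> Ob C" "X' \<in> Ob C" "A \<in> Ob C" "B \<in> Ob C" "s \<in> E (Expo C X' X)"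
    "a \<in> E (Expo C (Times C X A) B)"
  shows "star X' X (Expo C A B) s (act (curry_iso C X A B) a) =
    act (curry_iso C X' A B) (star (Times C X' A) (Times C X A) B (lft X' X A s) a)"
proof -
  let ?W = "Expo C X' X" let ?Z = "Times C X' A" let ?U = "Expo C (Times C X A) B"
  let ?L = "transpose C ?W ?Z (tuple C
     (ap X' X (Proj1 C ?W ?Z) (Proj1 C X' A \<cdot> Proj2 C ?W ?Z)) (Proj2 C X' A \<cdot> Proj2 C ?W ?Z))"
  let ?P1 = "Proj1 C ?U ?W" and ?P2 = "Proj2 C ?U ?W"
  obtain p where p: "p \<in> E (Times C ?U ?W)" "a = act ?P1 p" "s = act ?P2 p"
    using pairE[of ?U ?W a s] assms by auto
  \<comment> \<open>Both sides land in \<open>[X', [A, B]]\<close>, so extensionality is needed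
    twice: on a variable of \<open>X'\<close>, then on one of \<open>A\<close>.\<close>
  have "cmp X' X (Expo C A B) \<cdot> tuple C (curry_iso C X A B \<cdot> ?P1) ?P2 =
      curry_iso C X' A B \<cdot> cmp ?Z (Times C X A) B \<cdot> tuple C ?P1 (?L \<cdot> ?P2)"
    by (rule expo_ext[of _ _ "Times C ?U ?W" X' "Expo C A B"], use assms in simp_all)
      (rule expo_ext[of _ _ "Times C (Times C ?U ?W) X'" A B], use assms in simp_all)
  then show ?thesis using assms(1-4) p by (simp add: act_act lft_def Let_def)
qed

definition sgl :: "'o \<Rightarrow> 'o \<Rightarrow> 'e \<Rightarrow> 'e" where
  "sgl X A b = act (transpose C (Expo C X A) X (tuple C (Proj2 C (Expo C X A) X) (Eval C X A))) b"

lemma sgl_in [simp]: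
  assumes "X \<in> Ob C" "A \<in> Ob C" "b \<in> E (Expo C X A)"
  shows "sgl X A b \<in> E (Expo C X (Times C X A))"
  using assms by (simp add: sgl_def)

lemma Eval_tuple: "Eval C X Y \<cdot> tuple C u x = ap X Y u x"
  by (simp add: ap_def)

lemma ap_Proj [simp]: "X \<in> Ob C \<Longrightarrow> Y \<in> Ob C \<Longrightarrow> ap X Y (Proj1 C (Expo C X Y) X) (Proj2 C (Expo C X Y) X) = Eval C X Y"
  by (simp add: ap_def)

lemma Eval_Comp:
  "h \<in> Ar C \<Longrightarrow> X \<in> Ob C \<Longrightarrow> Y \<in> Ob C \<Longrightarrow> Cod C h = Times C (Expo C X Y) X \<Longrightarrow>
    Eval C X Y \<cdot> h = ap X Y (Proj1 C (Expo C X Y) X \<cdot> h) (Proj2 C (Expo C X Y) X \<cdot> h)"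
  by (simp add: ap_def)

lemma sgl_Proj1:
  assumes "X \<in> Ob C" "A \<in> Ob C" "b \<in> E (Expo C X A)"
  shows "act (expo_map C X (Proj1 C X A)) (sgl X A b) = nm (Id C X)"
proof -
  let ?W = "Expo C X A"
  have "expo_map C X (Proj1 C X A) \<cdot> transpose C ?W X (tuple C (Proj2 C ?W X) (Eval C X A)) =
      name_of C (Id C X) \<cdot> bang C ?W"
    by (rule expo_ext[of _ _ ?W X X]) (use assms in \<open>simp_all add: Eval_tuple\<close>)
  then show ?thesis
    using assms by (simp add: nm_act[of "Id C X" ?W b] sgl_def act_act)
qed

lemma sgl_Proj2:
  assumes "X \<in> Ob C" "A \<in> Ob C" "b \<in> E (Expo C X A)"
  shows "act (expo_map C X (Proj2 C X A)) (sgl X A b) = b"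
proof -
  let ?W = "Expo C X A"
  have "expo_map C X (Proj2 C X A) \<cdot> transpose C ?W X (tuple C (Proj2 C ?W X) (Eval C X A)) = Id C ?W"
    by (rule expo_ext[of _ _ ?W X A]) (use assms in \<open>simp_all add: Eval_tuple\<close>)
  then show ?thesis using assms by (simp add: sgl_def act_act)
qed

lemma expo_pair_ex1:
  assumes "X \<in> Ob C" "Y \<in> Ob C" "Z \<in> Ob C" "a \<in> E (Expo C X Y)" "b \<in> E (Expo C X Z)"
  shows "\<exists>!c. c \<in> E (Expo C X (Times C Y Z)) \<and> act (expo_map C X (Proj1 C Y Z)) c = a \<and>
    act (expo_map C X (Proj2 C Y Z)) c = b"
proof -
  let ?U = "Expo C X Y" and ?V = "Expo C X Z"
  let ?P = "Times C ?U ?V"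
  \<comment> \<open>The canonical arrow
    \<open>[X, Y] \<times> [X, Z] \<rightarrow> [X, Y \<times> Z]\<close>. Facts 1, 2 and 3 make it
    inverse to the tuple of the two images of the projections.\<close>
  let ?t = "transpose C ?P X (tuple C (ap X Y (Proj1 C ?U ?V \<cdot> Proj1 C ?P X) (Proj2 C ?P X))
    (ap X Z (Proj2 C ?U ?V \<cdot> Proj1 C ?P X) (Proj2 C ?P X)))"
  let ?p1 = "expo_map C X (Proj1 C Y Z)" and ?p2 = "expo_map C X (Proj2 C Y Z)"
  have 1: "?p1 \<cdot> ?t = Proj1 C ?U ?V"
    by (rule expo_ext[of _ _ ?P X Y]) (use assms in simp_all)
  have 2: "?p2 \<cdot> ?t = Proj2 C ?U ?V"
    by (rule expo_ext[of _ _ ?P X Z]) (use assms in simp_all)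
  have 3: "?t \<cdot> tuple C ?p1 ?p2 = Id C (Expo C X (Times C Y Z))"
    by (rule expo_ext[of _ _ "Expo C X (Times C Y Z)" X "Times C Y Z"]) (use assms in simp_all)
  obtain p where p: "p \<in> E ?P" "a = act (Proj1 C ?U ?V) p" "b = act (Proj2 C ?U ?V) p"
    using pairE[of ?U ?V a b] assms by auto
  show ?thesis
  proof (rule ex1I[of _ "act ?t p"], intro conjI)
    show "act ?t p \<in> E (Expo C X (Times C Y Z))" using assms(1-3) p by simp
    show "act ?p1 (act ?t p) = a" "act ?p2 (act ?t p) = b" using assms(1-3) p by (simp_all add: act_act 1 2)
  next
    fix c assume c: "c \<in> E (Expo C X (Times C Y Z)) \<and> act ?p1 c = a \<and> act ?p2 c = b"
    have "p = pr ?U ?V a b"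
      using assms(1-3) p by (intro pr_unique) auto
    also have "\<dots> = act (tuple C ?p1 ?p2) c"
      using c assms(1-3) by (metis expo_map_simps Proj_simps Expo_Ob pr_act)
    finally have "act ?t p = act (?t \<cdot> tuple C ?p1 ?p2) c"
      using assms(1-3) c by (subst act_Comp) auto
    then show "c = act ?t p" unfolding 3 using c assms(1-3) by simp
  qed
qed

lemma expo_unit_ex1:
  assumes "X \<in> Ob C"
  shows "\<exists>!c. c \<in> E (Expo C X (Unit C))"
proof (rule ex1I[of _ "nm (bang C X)"])
  show "nm (bang C X) \<in> E (Expo C X (Unit C))" using assms by simp
  fix c assume c: "c \<in> E (Expo C X (Unit C))"
  let ?W = "Expo C X (Unit C)"
  have e: "Eval C X (Unit C) = bang C (Times C ?W X)"
    by (rule trans[OF bang_unique]) (use assms in simp_all)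
  have "name_of C (bang C X) \<cdot> bang C ?W = Id C ?W"
    by (rule expo_ext[of _ _ ?W X "Unit C"]) (use assms in \<open>simp_all add: e\<close>)
  then show "c = nm (bang C X)" using c assms by (simp add: nm_act[of "bang C X" ?W c])
qed

lemma expo_map_Comp:
  assumes "X \<in> Ob C" "f \<in> Ar C" "g \<in> Ar C" "Dom C g = Cod C f"
  shows "expo_map C X (g \<cdot> f) = expo_map C X g \<cdot> expo_map C X f"
  by (rule expo_ext[of _ _ "Expo C X (Dom C f)" X "Cod C g"]) (use assms in simp_all)

lemma expo_map_Id:
  assumes "X \<in> Ob C" "Y \<in> Ob C"
  shows "expo_map C X (Id C Y) = Id C (Expo C X Y)"
  by (rule expo_ext[of _ _ "Expo C X Y" X Y]) (use assms in simp_all)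

text \<open>\<open>[X, -]\<close> preserves finite products, so composing with it stays within this
  class of functors. Together with \<open>fpp_functor\<close>, used for \<open>\<box>\<close>, this
  is the step that adds one context to a stack.\<close>

lemma fpp_expo:
  assumes "X \<in> Ob C"
  shows "fpp C (\<lambda>Y. E (Expo C X Y)) (\<lambda>f. act (expo_map C X f))"
  by unfold_locales (use assms in \<open>simp_all add: expo_map_Comp expo_map_Id act_Comp expo_pair_ex1 expo_unit_ex1\<close>)

text \<open>Beta for elements. The pair \<open>d\<close> of function and argument is given by its
  projections instead of as \<open>pr\<close>, because in the application it is the pairing of the
  functor \<open>E [X, -]\<close>, a different instance of the locale.\<close>

lemma star_beta:
  assumes "X \<in> Ob C" "A \<in> Ob C" "B \<in> Ob C" "a \<in> E (Expo C (Times C X A) B)" "b \<in> E (Expo C X A)"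
    "d \<in> E (Expo C X (Times C (Expo C A B) A))"
    "act (expo_map C X (Proj1 C (Expo C A B) A)) d = act (curry_iso C X A B) a"
    "act (expo_map C X (Proj2 C (Expo C A B) A)) d = b"
  shows "act (expo_map C X (Eval C A B)) d = star X (Times C X A) B (sgl X A b) a"
proof -
  let ?U = "Expo C (Times C X A) B" and ?W = "Expo C X A"
  let ?P1 = "Proj1 C ?U ?W" and ?P2 = "Proj2 C ?U ?W" and ?P = "Times C ?U ?W" and ?F = "Expo C A B"
  let ?s = "transpose C ?W X (tuple C (Proj2 C ?W X) (Eval C X A))"
  \<comment> \<open>The same pair, manufactured from the common element \<open>p\<close>; uniqueness
    of pairs for \<open>[X, -]\<close> identifies it with the given \<open>d\<close>.\<close>
  let ?d = "transpose C ?P X (tuple C (ap X ?F (curry_iso C X A B \<cdot> ?P1 \<cdot> Proj1 C ?P X) (Proj2 C ?P X))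
    (ap X A (?P2 \<cdot> Proj1 C ?P X) (Proj2 C ?P X)))"
  obtain p where p: "p \<in> E ?P" "a = act ?P1 p" "b = act ?P2 p"
    using pairE[of ?U ?W a b] assms by auto
  have "expo_map C X (Proj1 C ?F A) \<cdot> ?d = curry_iso C X A B \<cdot> ?P1"
    by (rule expo_ext[of _ _ ?P X ?F]) (use assms(1-3) in simp_all)
  moreover have "expo_map C X (Proj2 C ?F A) \<cdot> ?d = ?P2"
    by (rule expo_ext[of _ _ ?P X A]) (use assms(1-3) in simp_all)
  ultimately have "act ?d p \<in> E (Expo C X (Times C ?F A)) \<and>
      act (expo_map C X (Proj1 C ?F A)) (act ?d p) = act (curry_iso C X A B) a \<and>
      act (expo_map C X (Proj2 C ?F A)) (act ?d p) = b"
    using assms(1-3) p by (simp add: act_act)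
  moreover have "act (curry_iso C X A B) a \<in> E (Expo C X ?F)" using assms by simp
  ultimately have d: "d = act ?d p"
    using expo_pair_ex1[of X ?F A "act (curry_iso C X A B) a" b] assms by (metis (no_types, lifting) Expo_Ob)
  have "expo_map C X (Eval C A B) \<cdot> ?d = cmp X (Times C X A) B \<cdot> tuple C ?P1 (?s \<cdot> ?P2)"
    by (rule expo_ext[of _ _ ?P X B]) (use assms(1-3) in \<open>simp_all add: Eval_tuple\<close>)
  then show ?thesis using d p assms(1-3) by (simp add: act_act sgl_def)
qed

text \<open>Eta for elements: \<open>d\<close> pairs the weakened function with the newest variable,
  again characterised by its projections, and evaluating and then currying it returns the
  function.\<close>

lemma star_eta:
  assumes "X \<in> Ob C" "A \<in> Ob C" "B \<in> Ob C" "m \<in> E (Expo C X (Expo C A B))"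
    "d \<in> E (Expo C (Times C X A) (Times C (Expo C A B) A))"
    "act (expo_map C (Times C X A) (Proj1 C (Expo C A B) A)) d =
      star (Times C X A) X (Expo C A B) (nm (Proj1 C X A)) m"
    "act (expo_map C (Times C X A) (Proj2 C (Expo C A B) A)) d = nm (Proj2 C X A)"
  shows "act (curry_iso C X A B) (act (expo_map C (Times C X A) (Eval C A B)) d) = m"
proof -
  let ?Z = "Times C X A" and ?F = "Expo C A B"
  let ?P = "Expo C X ?F"
  let ?d = "transpose C ?P ?Z (tuple C (ap X ?F (Proj1 C ?P ?Z) (Proj1 C X A \<cdot> Proj2 C ?P ?Z)) (Proj2 C X A \<cdot> Proj2 C ?P ?Z))"
  have 1: "expo_map C ?Z (Proj1 C ?F A) \<cdot> ?d = cmp ?Z X ?F \<cdot> tuple C (Id C ?P) (name_of C (Proj1 C X A) \<cdot> bang C ?P)"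
    by (rule expo_ext[of _ _ ?P ?Z ?F]) (use assms(1-3) in simp_all)
  have 2: "expo_map C ?Z (Proj2 C ?F A) \<cdot> ?d = name_of C (Proj2 C X A) \<cdot> bang C ?P"
    by (rule expo_ext[of _ _ ?P ?Z A]) (use assms(1-3) in simp_all)
  have 3: "star ?Z X ?F (nm (Proj1 C X A)) m = act (expo_map C ?Z (Proj1 C ?F A)) (act ?d m)"
    using assms(1-4) star_act[of "Id C ?P" "name_of C (Proj1 C X A) \<cdot> bang C ?P" X ?F ?Z m]
    by (simp add: nm_act[of "Proj1 C X A" ?P m] act_act 1)
  have "nm (Proj2 C X A) = act (expo_map C ?Z (Proj2 C ?F A)) (act ?d m)"
    using assms(1-4) by (simp add: nm_act[of "Proj2 C X A" ?P m] act_act 2)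
  moreover have "act ?d m \<in> E (Expo C ?Z (Times C ?F A))" using assms(1-4) by simp
  ultimately have d: "d = act ?d m"
    using expo_pair_ex1[of ?Z ?F A "star ?Z X ?F (nm (Proj1 C X A)) m" "nm (Proj2 C X A)"] assms 3
    by (metis (no_types, lifting) Expo_Ob Times_Ob Proj_simps nm_in star_in)
  have "curry_iso C X A B \<cdot> expo_map C ?Z (Eval C A B) \<cdot> ?d = Id C ?P"
    by (rule expo_ext[of _ _ ?P X ?F], use assms(1-3) in simp_all)
     (rule expo_ext[of _ _ "Times C ?P X" A B], use assms(1-3) in \<open>simp_all add: Eval_Comp\<close>)
  then show ?thesis using d assms(1-4) by (simp add: act_act)
qed

text \<open>The left side weakens an element from the empty context to \<open>X\<close>; the right
  side first applies what interprets quotation and then what interprets unquotation. This is the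
  content of \<open>Box_beta\<close>.\<close>

lemma star_bang:
  assumes "X \<in> Ob C" "Y \<in> Ob C" "a \<in> E (Expo C (Unit C) Y)"
  shows "star X (Unit C) Y (nm (bang C X)) a = act (konst C Y X) (act (unit_expo_iso C Y) a)"
proof -
  let ?P = "Expo C (Unit C) Y"
  have "cmp X (Unit C) Y \<cdot> tuple C (Id C ?P) (name_of C (bang C X) \<cdot> bang C ?P) = konst C Y X \<cdot> unit_expo_iso C Y"
    by (rule expo_ext[of _ _ ?P X Y]) (use assms(1-3) in \<open>simp_all add: unit_expo_iso_ap\<close>)
  then show ?thesis
    using assms star_act[of "Id C ?P" "name_of C (bang C X) \<cdot> bang C ?P" "Unit C" Y X a]
    by (simp add: nm_act[of "bang C X" ?P a] act_act)
qed

lemma ap_transpose_Id: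
  assumes "Z \<in> Ob C" "X \<in> Ob C" "f \<in> Ar C" "Dom C f = Times C Z X" "Cod C f = Y"
    "x \<in> Ar C" "Dom C x = Z" "Cod C x = X"
  shows "ap X Y (transpose C Z X f) x = f \<cdot> tuple C (Id C Z) x"
  using assms ap_transpose[of Z f X Y "Id C Z" x] by simp

text \<open>The two isomorphism steps in the opposite order, unquotation before quotation: the
  content of \<open>Box_eta\<close>.\<close>

lemma unit_expo_konst:
  assumes "X \<in> Ob C" "a \<in> E X"
  shows "act (unit_expo_iso C X) (act (konst C X (Unit C)) a) = a"
proof -
  have "unit_expo_iso C X \<cdot> konst C X (Unit C) = Id C X"
    using assms by (simp add: unit_expo_iso_ap ap_transpose_Id)
  then show ?thesis using assms by (simp add: act_act)
qed

end

section \<open>Natural transformations between product-preserving functors to sets\<close>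

locale fpp_trans = F: fpp C E act + G: fpp C E' act'
  for C :: "('o, 'm) ccc" (structure) and E :: "'o \<Rightarrow> 'e set" and act and E' :: "'o \<Rightarrow> 'f set" and act' +
  fixes t :: "'o \<Rightarrow> 'e \<Rightarrow> 'f"
  assumes trans_in: "X \<in> Ob C \<Longrightarrow> a \<in> E X \<Longrightarrow> t X a \<in> E' X"
    and trans_act: "f \<in> Ar C \<Longrightarrow> a \<in> E (Dom C f) \<Longrightarrow> t (Cod C f) (act f a) = act' f (t (Dom C f) a)"
begin

lemma trans_act': "f \<in> Ar C \<Longrightarrow> a \<in> E X \<Longrightarrow> Dom C f = X \<Longrightarrow> Cod C f = Y \<Longrightarrow> t Y (act f a) = act' f (t X a)"
  using trans_act[of f a] by simp

lemma trans_un: "t (Unit C) F.un = G.un"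
  by (rule G.un_eqI) (simp add: trans_in)

text \<open>Naturality alone forces compatibility with pairs, by uniqueness of pairs in the target.
  Passing from an arrow to its element, precomposing with an arrow, and substituting are all
  natural, so each of them commutes with application, pairs, projections and unit without a separate
  proof.\<close>

lemma trans_pr:
  assumes "X \<in> Ob C" "Y \<in> Ob C" "a \<in> E X" "b \<in> E Y"
  shows "t (Times C X Y) (F.pr X Y a b) = G.pr X Y (t X a) (t Y b)"
  using F.pr_props[OF assms] assms
  by (intro G.pr_unique) (auto simp: trans_in simp flip: trans_act')

end

lemma (in ccc) fpp_hom:
  assumes "W \<in> Ob C"
  shows "fpp C (hom C W) (Comp C)"
proof
  fix X Y a b
  assume XY: "X \<in> Ob C" "Y \<in> Ob C" and "a \<in> hom C W X" "b \<in> hom C W Y"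
  then have ab: "a \<in> Ar C" "Dom C a = W" "Cod C a = X" "b \<in> Ar C" "Dom C b = W" "Cod C b = Y"
    by (auto simp: in_hom_iff)
  show "\<exists>!c. c \<in> hom C W (Times C X Y) \<and> Proj1 C X Y \<cdot> c = a \<and> Proj2 C X Y \<cdot> c = b"
    using tuple_ex1[of a b] ab by simp
next
  show "\<exists>!c. c \<in> hom C W (Unit C)" by (rule ccc_unit[OF assms])
qed (auto simp: in_hom_iff)

lemma (in fpp) fpp_functor:
  assumes "is_ccc D" and F: "is_functor D C F" and "preserves_finite_products D C F"
  shows "fpp D (\<lambda>X. E (FO F X)) (\<lambda>f. act (FM F f))"
proof -
  interpret D: ccc D by unfold_locales fact
  have FO [simp]: "FO F X \<in> Ob C" "FM F (Id D X) = Id C (FO F X)" if "X \<in> Ob D" for X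
    using F that by (auto simp: is_functor_def)
  have FM [simp]: "FM F f \<in> Ar C" "Dom C (FM F f) = FO F (Dom D f)" "Cod C (FM F f) = FO F (Cod D f)"
    if "f \<in> Ar D" for f
  proof -
    have "FM F f \<in> hom C (FO F (Dom D f)) (FO F (Cod D f))"
      using F that by (simp add: is_functor_def D.in_hom_iff)
    then show "FM F f \<in> Ar C" "Dom C (FM F f) = FO F (Dom D f)" "Cod C (FM F f) = FO F (Cod D f)"
      by (auto simp: in_hom_iff)
  qed
  have FM_Comp: "FM F (Comp D g f) = FM F g \<cdot> FM F f" if "f \<in> Ar D" "g \<in> Ar D" "Dom D g = Cod D f" for f g
    using F that unfolding is_functor_def
    by (metis D.Dom_Cod_Ob D.in_hom_iff)
  have u: "is_iso C (bang C (FO F (Unit D)))"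
    and t: "X \<in> Ob D \<Longrightarrow> Y \<in> Ob D \<Longrightarrow> is_iso C (tuple C (FM F (Proj1 D X Y)) (FM F (Proj2 D X Y)))" for X Y
    using assms(3) by (auto simp: preserves_finite_products_def)
  show ?thesis
  proof
    fix X Y a b assume XY: "X \<in> Ob D" "Y \<in> Ob D" and ab: "a \<in> E (FO F X)" "b \<in> E (FO F Y)"
    let ?p1 = "FM F (Proj1 D X Y)" and ?p2 = "FM F (Proj2 D X Y)"
    let ?t = "tuple C ?p1 ?p2"
    note inv = inverse_of_props[OF t[OF XY]]
    obtain p where p: "p \<in> E (Times C (FO F X) (FO F Y))" "a = act (Proj1 C (FO F X) (FO F Y)) p"
        "b = act (Proj2 C (FO F X) (FO F Y)) p"
      using pairE[of "FO F X" "FO F Y" a b] ab XY by auto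
    \<comment> \<open>Cancelling the comparison arrow \<open>?t\<close> against its inverse turns
      the images of the projections into the projections of the product in \<open>C\<close>.\<close>
    have 1: "?p1 \<cdot> inverse_of C ?t = Proj1 C (FO F X) (FO F Y)"
    proof -
      have "Proj1 C (FO F X) (FO F Y) \<cdot> ?t \<cdot> inverse_of C ?t = ?p1 \<cdot> inverse_of C ?t"
        using XY inv(1-3) by (intro Proj_tuple_Comp) auto
      then show ?thesis using XY inv by simp
    qed
    have 2: "?p2 \<cdot> inverse_of C ?t = Proj2 C (FO F X) (FO F Y)"
    proof -
      have "Proj2 C (FO F X) (FO F Y) \<cdot> ?t \<cdot> inverse_of C ?t = ?p2 \<cdot> inverse_of C ?t"
        using XY inv(1-3) by (intro Proj_tuple_Comp) auto
      then show ?thesis using XY inv by simp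
    qed
    show "\<exists>!c. c \<in> E (FO F (Times D X Y)) \<and> act ?p1 c = a \<and> act ?p2 c = b"
    proof (rule ex1I[of _ "act (inverse_of C ?t) p"], intro conjI)
      show "act (inverse_of C ?t) p \<in> E (FO F (Times D X Y))" using inv XY p by simp
      show "act ?p1 (act (inverse_of C ?t) p) = a" "act ?p2 (act (inverse_of C ?t) p) = b"
        using inv(1-3) XY p by (simp_all add: act_act 1 2)
    next
      fix c assume c: "c \<in> E (FO F (Times D X Y)) \<and> act ?p1 c = a \<and> act ?p2 c = b"
      have "p = pr (FO F X) (FO F Y) a b" using p XY by (intro pr_unique) auto
      also have "\<dots> = act ?t c" using c XY pr_act[of ?p1 ?p2 "FO F X" "FO F Y" c] by simp
      finally have "act (inverse_of C ?t) p = act (inverse_of C ?t \<cdot> ?t) c"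
        using c XY inv by (subst act_Comp) auto
      then show "c = act (inverse_of C ?t) p" unfolding inv(4) using c XY by simp
    qed
  next
    let ?g = "inverse_of C (bang C (FO F (Unit D)))"
    note inv = inverse_of_props[OF u]
    show "\<exists>!c. c \<in> E (FO F (Unit D))"
    proof (rule ex1I[of _ "act ?g un"])
      show "act ?g un \<in> E (FO F (Unit D))" using inv by simp
      fix c assume c: "c \<in> E (FO F (Unit D))"
      have "act (?g \<cdot> bang C (FO F (Unit D))) c = act ?g un"
        using c inv(1-3) by (simp add: act_Comp un_act[of "FO F (Unit D)" c] del: bang_Comp)
      then show "c = act ?g un" unfolding inv(4) using c by simp
    qed
  qed (auto simp: FM_Comp act_Comp)
qed

text \<open>A Yoneda argument: the inverse is the arrow that the universal property yields at
  \<open>W = X \<times> Y\<close>, and uniqueness at \<open>W = P\<close> gives the remaining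
  identity. It converts preservation of products by the set-valued functors of all stages
  \<open>W\<close> into the isomorphism that \<open>stack_prod_iso\<close> inverts.\<close>

lemma (in ccc) iso_tupleI:
  assumes "p \<in> Ar C" "q \<in> Ar C" "Dom C p = P" "Dom C q = P" "Cod C p = X" "Cod C q = Y"
    and ex1: "\<And>W f g. W \<in> Ob C \<Longrightarrow> f \<in> hom C W X \<Longrightarrow> g \<in> hom C W Y \<Longrightarrow>
      \<exists>!h. h \<in> hom C W P \<and> p \<cdot> h = f \<and> q \<cdot> h = g"
  shows "is_iso C (tuple C p q)"
proof -
  have Ob: "X \<in> Ob C" "Y \<in> Ob C" "P \<in> Ob C" using assms by auto
  obtain h where h: "h \<in> Ar C" "Dom C h = Times C X Y" "Cod C h = P" "p \<cdot> h = Proj1 C X Y" "q \<cdot> h = Proj2 C X Y"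
    using ex1[of "Times C X Y" "Proj1 C X Y" "Proj2 C X Y"] Ob by (auto simp: in_hom_iff)
  have th: "tuple C p q \<cdot> h = Id C (Times C X Y)" using assms(1-6) h Ob by simp
  have "p \<cdot> h \<cdot> tuple C p q = p"
  proof -
    have "p \<cdot> h \<cdot> tuple C p q = (p \<cdot> h) \<cdot> tuple C p q" using assms(1-6) h(1-3) Ob by (intro Comp_assoc[symmetric]) auto
    then show ?thesis using assms(1-6) h(4) by simp
  qed
  moreover have "q \<cdot> h \<cdot> tuple C p q = q"
  proof -
    have "q \<cdot> h \<cdot> tuple C p q = (q \<cdot> h) \<cdot> tuple C p q" using assms(1-6) h(1-3) Ob by (intro Comp_assoc[symmetric]) auto
    then show ?thesis using assms(1-6) h(5) by simp
  qed
  moreover have "p \<in> hom C P X" "q \<in> hom C P Y" "h \<cdot> tuple C p q \<in> hom C P P" "Id C P \<in> hom C P P"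
    "p \<cdot> Id C P = p" "q \<cdot> Id C P = q"
    using assms(1-6) h Ob by (auto simp: in_hom_iff)
  ultimately have "h \<cdot> tuple C p q = Id C P" using ex1[OF Ob(3), of p q] by blast
  then have "inverse_arrows C (tuple C p q) h"
    using th assms(1-6) h Ob by (simp add: inverse_arrows_def in_hom_iff)
  then show ?thesis by (auto simp: is_iso_def)
qed

lemma (in ccc) iso_bangI:
  assumes "P \<in> Ob C" and ex1: "\<And>W. W \<in> Ob C \<Longrightarrow> \<exists>!h. h \<in> hom C W P"
  shows "is_iso C (bang C P)"
proof -
  obtain h where h: "h \<in> Ar C" "Dom C h = Unit C" "Cod C h = P"
    using ex1[of "Unit C"] by (auto simp: in_hom_iff)
  have "h \<cdot> bang C P \<in> hom C P P" "Id C P \<in> hom C P P" using assms h by (auto simp: in_hom_iff)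
  then have "h \<cdot> bang C P = Id C P" using ex1[OF assms(1)] by blast
  then have "inverse_arrows C (bang C P) h"
    using assms(1) h by (simp add: inverse_arrows_def in_hom_iff)
  then show ?thesis by (auto simp: is_iso_def)
qed

text \<open>Applying the name of \<open>f\<close> to the generic element \<open>Id C X\<close>
  returns \<open>f\<close>.\<close>

lemma (in ccc) name_of_inj: "f \<in> hom C X Y \<Longrightarrow> g \<in> hom C X Y \<Longrightarrow> name_of C f = name_of C g \<Longrightarrow> f = g"
proof -
  assume fg: "f \<in> hom C X Y" "g \<in> hom C X Y" and e: "name_of C f = name_of C g"
  then have X: "X \<in> Ob C" by (auto simp: in_hom_iff)
  have "f = ap X Y (name_of C f \<cdot> bang C X) (Id C X)" using fg X by (simp add: in_hom_iff)
  also have "\<dots> = ap X Y (name_of C g \<cdot> bang C X) (Id C X)" by (simp only: e)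
  also have "\<dots> = g" using fg X by (simp add: in_hom_iff)
  finally show "f = g" .
qed

lemma (in ccc) name_of_surj: "k \<in> hom C (Unit C) (Expo C X Y) \<Longrightarrow> X \<in> Ob C \<Longrightarrow> Y \<in> Ob C \<Longrightarrow> \<exists>f \<in> hom C X Y. name_of C f = k"
proof -
  assume "k \<in> hom C (Unit C) (Expo C X Y)" and X: "X \<in> Ob C" "Y \<in> Ob C"
  then have k: "k \<in> Ar C" "Dom C k = Unit C" "Cod C k = Expo C X Y" by (auto simp: in_hom_iff)
  have b: "Proj1 C (Unit C) X = bang C (Times C (Unit C) X)"
    by (rule trans[OF bang_unique]) (use X in simp_all)
  let ?f = "ap X Y (k \<cdot> bang C X) (Id C X)"
  have "name_of C ?f = k"
    by (rule expo_ext[of _ _ "Unit C" X Y]) (use k X in \<open>simp_all add: b\<close>)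
  moreover have "?f \<in> hom C X Y" using k X by (simp add: in_hom_iff)
  ultimately show ?thesis by blast
qed

lemma (in fpp_trans) trans_nm:
  "f \<in> Ar C \<Longrightarrow> Dom C f = X \<Longrightarrow> Cod C f = Y \<Longrightarrow> t (Expo C X Y) (F.nm f) = G.nm f"
  using trans_act'[of "name_of C f" F.un "Unit C" "Expo C X Y"] by (simp add: F.nm_def G.nm_def trans_un)

lemma (in fpp_trans) fpp_trans_functor:
  assumes "is_ccc D" and F: "is_functor D C H" and "preserves_finite_products D C H"
  shows "fpp_trans D (\<lambda>X. E (FO H X)) (\<lambda>f. act (FM H f)) (\<lambda>X. E' (FO H X)) (\<lambda>f. act' (FM H f)) (\<lambda>X. t (FO H X))"
proof -
  interpret F': fpp D "\<lambda>X. E (FO H X)" "\<lambda>f. act (FM H f)" by (rule F.fpp_functor[OF assms])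
  interpret G': fpp D "\<lambda>X. E' (FO H X)" "\<lambda>f. act' (FM H f)" by (rule G.fpp_functor[OF assms])
  show ?thesis
  proof
    show "t (FO H X) a \<in> E' (FO H X)" if "X \<in> Ob D" "a \<in> E (FO H X)" for X a
      using F that by (intro trans_in) (auto simp: is_functor_def)
    show "t (FO H (Cod D f)) (act (FM H f) a) = act' (FM H f) (t (FO H (Dom D f)) a)"
      if f: "f \<in> Ar D" "a \<in> E (FO H (Dom D f))" for f a
    proof -
      have "FM H f \<in> hom C (FO H (Dom D f)) (FO H (Cod D f))"
        using F f by (simp add: is_functor_def F'.in_hom_iff)
      then show ?thesis using f by (intro trans_act') (auto simp: F.in_hom_iff)
    qed
  qed
qed

section \<open>Interpretation by elements\<close>

locale model =
  fixes \<CC> :: "('o, 'm) enriched" and \<beta> :: "nat \<Rightarrow> 'b \<Rightarrow> 'o"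
  assumes cie: "cartesian_infinitely_enriched \<CC>" and base: "base_interpretation \<CC> \<beta>"
begin

abbreviation "CAT l \<equiv> Cat \<CC> l"
abbreviation "Fo l \<equiv> FO (BOX \<CC> l)"
abbreviation "Fm l \<equiv> FM (BOX \<CC> l)"
abbreviation "ty \<equiv> ty_obj \<CC> \<beta>"
abbreviation "cx \<equiv> ctx_obj \<CC> \<beta>"
abbreviation "so \<equiv> stack_obj \<CC> \<beta>"
abbreviation "sm \<equiv> stack_map \<CC> \<beta>"

lemma is_ccc_CAT: "is_ccc (CAT l)" and BOX_functor: "is_functor (CAT l) (CAT (Suc l)) (BOX \<CC> l)"
  and BOX_products: "preserves_finite_products (CAT l) (CAT (Suc l)) (BOX \<CC> l)"
  and BOX_normal: "is_normal (CAT l) (CAT (Suc l)) (BOX \<CC> l)"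
  using cie by (auto simp: cartesian_infinitely_enriched_def)

sublocale C: ccc "CAT n" for n
  by unfold_locales (rule is_ccc_CAT)

lemma Fo_Ob [simp]: "X \<in> Ob (CAT l) \<Longrightarrow> Fo l X \<in> Ob (CAT (Suc l))"
  using BOX_functor[of l] by (simp add: is_functor_def)

lemma Fm_simps [simp]:
  assumes "f \<in> Ar (CAT l)"
  shows "Fm l f \<in> Ar (CAT (Suc l))" "Dom (CAT (Suc l)) (Fm l f) = Fo l (Dom (CAT l) f)"
    "Cod (CAT (Suc l)) (Fm l f) = Fo l (Cod (CAT l) f)"
proof -
  have "f \<in> hom (CAT l) (Dom (CAT l) f) (Cod (CAT l) f)" using assms by (simp add: C.in_hom_iff)
  moreover have "Dom (CAT l) f \<in> Ob (CAT l)" "Cod (CAT l) f \<in> Ob (CAT l)" using assms by auto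
  ultimately have "Fm l f \<in> hom (CAT (Suc l)) (Fo l (Dom (CAT l) f)) (Fo l (Cod (CAT l) f))"
    using BOX_functor[of l] unfolding is_functor_def by blast
  then show "Fm l f \<in> Ar (CAT (Suc l))" "Dom (CAT (Suc l)) (Fm l f) = Fo l (Dom (CAT l) f)"
    "Cod (CAT (Suc l)) (Fm l f) = Fo l (Cod (CAT l) f)"
    by (auto simp: C.in_hom_iff)
qed

lemma Fm_Comp:
  assumes "f \<in> Ar (CAT l)" "g \<in> Ar (CAT l)" "Dom (CAT l) g = Cod (CAT l) f"
  shows "Fm l (g \<cdot>\<^bsub>CAT l\<^esub> f) = Fm l g \<cdot>\<^bsub>CAT (Suc l)\<^esub> Fm l f"
proof -
  have "f \<in> hom (CAT l) (Dom (CAT l) f) (Cod (CAT l) f)" "g \<in> hom (CAT l) (Cod (CAT l) f) (Cod (CAT l) g)"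
    using assms by (auto simp: C.in_hom_iff)
  moreover have "Dom (CAT l) f \<in> Ob (CAT l)" "Cod (CAT l) f \<in> Ob (CAT l)" "Cod (CAT l) g \<in> Ob (CAT l)"
    using assms by auto
  ultimately show ?thesis using BOX_functor[of l] unfolding is_functor_def by blast
qed

lemma ty_Ob [simp]: "wf_ty l A \<Longrightarrow> ty l A \<in> Ob (CAT l)"
  using base by (induction l A rule: wf_ty.induct) (auto simp: base_interpretation_def)

lemma cx_Ob [simp]: "wf_ctx l \<Gamma> \<Longrightarrow> cx l \<Gamma> \<in> Ob (CAT l)"
  by (induction \<Gamma>) auto

lemma so_Ob [simp]: "wf_stack l S \<Longrightarrow> X \<in> Ob (CAT l) \<Longrightarrow> so l S X \<in> Ob (CAT (l + length S))"
  by (induction S) (auto simp: Let_def)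

lemma sm_simps [simp]:
  assumes "wf_stack l S" "f \<in> Ar (CAT l)"
  shows "sm l S f \<in> Ar (CAT (l + length S))" "Dom (CAT (l + length S)) (sm l S f) = so l S (Dom (CAT l) f)"
    "Cod (CAT (l + length S)) (sm l S f) = so l S (Cod (CAT l) f)"
  using assms by (induction S) (auto simp: Let_def)

section \<open>Stacks extended on the right, and their elements\<close>

lemma so_append: "so l (S @ T) X = so (l + length T) S (so l T X)"
  by (induction S) (simp_all add: Let_def add_ac)

lemma sm_append: "sm l (S @ T) f = sm (l + length T) S (sm l T f)"
  by (induction S) (simp_all add: Let_def add_ac)

lemma ctx_proj_simps [simp]:
  assumes "wf_ctx l \<Gamma>" "i < length \<Gamma>"
  shows "ctx_proj \<CC> \<beta> l \<Gamma> i \<in> Ar (CAT l)" "Dom (CAT l) (ctx_proj \<CC> \<beta> l \<Gamma> i) = cx l \<Gamma>"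
    "Cod (CAT l) (ctx_proj \<CC> \<beta> l \<Gamma> i) = ty l (\<Gamma> ! i)"
proof -
  have "ctx_proj \<CC> \<beta> l \<Gamma> i \<in> Ar (CAT l) \<and> Dom (CAT l) (ctx_proj \<CC> \<beta> l \<Gamma> i) = cx l \<Gamma> \<and>
    Cod (CAT l) (ctx_proj \<CC> \<beta> l \<Gamma> i) = ty l (\<Gamma> ! i)"
    using assms
  proof (induction \<Gamma> arbitrary: i)
    case (Cons A \<Gamma>)
    then show ?case by (cases i) auto
  qed simp
  then show "ctx_proj \<CC> \<beta> l \<Gamma> i \<in> Ar (CAT l)" "Dom (CAT l) (ctx_proj \<CC> \<beta> l \<Gamma> i) = cx l \<Gamma>"
    "Cod (CAT l) (ctx_proj \<CC> \<beta> l \<Gamma> i) = ty l (\<Gamma> ! i)" by auto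
qed

text \<open>Generalised elements of \<open>S(X)\<close> at stage \<open>W\<close>. Two stages
  matter: the terminal object, which gives \<open>El\<close>, and the object of a leftmost context,
  where the arrows of \<open>interp\<close> start.\<close>

definition EW :: "'o \<Rightarrow> 'b stack \<Rightarrow> nat \<Rightarrow> 'o \<Rightarrow> 'm set" where
  "EW W S l X = hom (CAT (l + length S)) W (so l S X)"

definition act :: "'b stack \<Rightarrow> nat \<Rightarrow> 'm \<Rightarrow> 'm \<Rightarrow> 'm" where
  "act S l f a = sm l S f \<cdot>\<^bsub>CAT (l + length S)\<^esub> a"

definition El :: "'b stack \<Rightarrow> nat \<Rightarrow> 'o \<Rightarrow> 'm set" where
  "El S l = EW (Unit (CAT (l + length S))) S l"

text \<open>The functor \<open>S(\<box> -)\<close> on level \<open>l\<close>, for a stack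
  \<open>S\<close> of level \<open>Suc l\<close>. By \<open>El_snoc\<close>, the elements for
  \<open>S @ [\<Gamma>]\<close> are its values at \<open>[\<Gamma>, -]\<close>, which is exactly
  where \<open>star\<close>, \<open>nm\<close>, \<open>lft\<close> and \<open>sgl\<close> are
  defined; the context \<open>\<Gamma>\<close> then plays the part of \<open>X\<close>
  there.\<close>

abbreviation "EB S l \<equiv> \<lambda>X. El S (Suc l) (Fo l X)"
abbreviation "actB S l \<equiv> \<lambda>f. act S (Suc l) (Fm l f)"

lemma EW_Nil: "EW W [] l = hom (CAT l) W" and act_Nil: "act [] l = Comp (CAT l)"
  by (simp_all add: EW_def act_def fun_eq_iff)

lemma EW_snoc: "EW W (S @ [\<Gamma>]) l = (\<lambda>X. EW W S (Suc l) (Fo l (Expo (CAT l) (cx l \<Gamma>) X)))"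
  by (simp add: EW_def fun_eq_iff so_append Let_def)

lemma El_snoc: "El (S @ [\<Gamma>]) l = (\<lambda>X. EB S l (Expo (CAT l) (cx l \<Gamma>) X))"
  by (simp add: El_def EW_snoc)

lemma act_snoc: "act (S @ [\<Gamma>]) l = (\<lambda>f. actB S l (expo_map (CAT l) (cx l \<Gamma>) f))"
  by (simp add: act_def fun_eq_iff sm_append Let_def)

text \<open>Adding a context on the right composes with \<open>\<box>\<close> and then with an
  exponential functor; the empty stack gives a representable functor.\<close>

lemma fpp_EW: "wf_stack l S \<Longrightarrow> W \<in> Ob (CAT (l + length S)) \<Longrightarrow> fpp (CAT l) (EW W S l) (act S l)"
proof (induction S arbitrary: l rule: rev_induct)
  case Nil
  then show ?case by (simp add: EW_Nil act_Nil C.fpp_hom)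
next
  case (snoc \<Gamma> S)
  then interpret F: fpp "CAT (Suc l)" "EW W S (Suc l)" "act S (Suc l)" by simp
  interpret G: fpp "CAT l" "\<lambda>X. EW W S (Suc l) (Fo l X)" "\<lambda>f. act S (Suc l) (Fm l f)"
    by (rule F.fpp_functor[OF is_ccc_CAT BOX_functor BOX_products])
  show ?case unfolding EW_snoc act_snoc by (rule G.fpp_expo) (use snoc.prems in simp)
qed

lemma fpp_El: "wf_stack l S \<Longrightarrow> fpp (CAT l) (El S l) (act S l)"
  by (simp add: El_def fpp_EW)

lemma fpp_EB: "wf_stack (Suc l) S \<Longrightarrow> fpp (CAT l) (EB S l) (actB S l)"
  by (rule fpp.fpp_functor[OF fpp_El is_ccc_CAT BOX_functor BOX_products])

text \<open>The bijection from arrows \<open>X \<rightarrow> Y\<close> to elements of \<open>\<box>[X, Y]\<close> given by normality.\<close>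

definition nu :: "nat \<Rightarrow> 'm \<Rightarrow> 'm" where
  "nu n f = normal_map (CAT n) (CAT (Suc n)) (BOX \<CC> n) (name_of (CAT n) f)"

lemma is_iso_bang_Fo: "is_iso (CAT (Suc n)) (bang (CAT (Suc n)) (Fo n (Unit (CAT n))))"
  using BOX_products[of n] by (simp add: preserves_finite_products_def)

lemma unit_map_simps [simp]:
  "unit_map (CAT n) (CAT (Suc n)) (BOX \<CC> n) \<in> Ar (CAT (Suc n))"
  "Dom (CAT (Suc n)) (unit_map (CAT n) (CAT (Suc n)) (BOX \<CC> n)) = Unit (CAT (Suc n))"
  "Cod (CAT (Suc n)) (unit_map (CAT n) (CAT (Suc n)) (BOX \<CC> n)) = Fo n (Unit (CAT n))"
  using C.inverse_of_props[OF is_iso_bang_Fo] by (simp_all add: unit_map_def)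

lemma normal_map_Comp:
  assumes "f \<in> Ar (CAT n)" "g \<in> Ar (CAT n)" "Dom (CAT n) f = Unit (CAT n)" "Dom (CAT n) g = Cod (CAT n) f"
  shows "normal_map (CAT n) (CAT (Suc n)) (BOX \<CC> n) (g \<cdot>\<^bsub>CAT n\<^esub> f) =
    Fm n g \<cdot>\<^bsub>CAT (Suc n)\<^esub> normal_map (CAT n) (CAT (Suc n)) (BOX \<CC> n) f"
  using assms by (simp add: normal_map_def Fm_Comp)

lemma nu_Comp:
  assumes "f \<in> Ar (CAT n)" "g \<in> Ar (CAT n)" "Dom (CAT n) g = Cod (CAT n) f" "Dom (CAT n) f = X"
  shows "nu n (g \<cdot>\<^bsub>CAT n\<^esub> f) = Fm n (expo_map (CAT n) X g) \<cdot>\<^bsub>CAT (Suc n)\<^esub> nu n f"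
proof -
  have X: "X \<in> Ob (CAT n)" using assms by auto
  have "name_of (CAT n) (g \<cdot>\<^bsub>CAT n\<^esub> f) = expo_map (CAT n) X g \<cdot>\<^bsub>CAT n\<^esub> name_of (CAT n) f"
    by (rule C.expo_ext[of _ n _ "Unit (CAT n)" X "Cod (CAT n) g"]) (use assms X in simp_all)
  then show ?thesis using assms X by (simp add: nu_def normal_map_Comp)
qed

lemma nu_bij:
  assumes "X \<in> Ob (CAT n)" "Y \<in> Ob (CAT n)"
  shows "bij_betw (nu n) (hom (CAT n) X Y) (hom (CAT (Suc n)) (Unit (CAT (Suc n))) (Fo n (Expo (CAT n) X Y)))"
proof -
  have "bij_betw (name_of (CAT n)) (hom (CAT n) X Y) (hom (CAT n) (Unit (CAT n)) (Expo (CAT n) X Y))"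
    unfolding bij_betw_def
  proof
    show "inj_on (name_of (CAT n)) (hom (CAT n) X Y)" by (auto intro: inj_onI C.name_of_inj)
    show "name_of (CAT n) ` hom (CAT n) X Y = hom (CAT n) (Unit (CAT n)) (Expo (CAT n) X Y)"
      using C.name_of_surj[of _ n X Y] assms by (force simp: C.in_hom_iff)
  qed
  moreover have "bij_betw (normal_map (CAT n) (CAT (Suc n)) (BOX \<CC> n)) (hom (CAT n) (Unit (CAT n)) (Expo (CAT n) X Y))
      (hom (CAT (Suc n)) (Unit (CAT (Suc n))) (Fo n (Expo (CAT n) X Y)))"
    using BOX_normal[of n] assms by (simp add: is_normal_def)
  ultimately have "bij_betw (normal_map (CAT n) (CAT (Suc n)) (BOX \<CC> n) \<circ> name_of (CAT n)) (hom (CAT n) X Y)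
      (hom (CAT (Suc n)) (Unit (CAT (Suc n))) (Fo n (Expo (CAT n) X Y)))"
    by (rule bij_betw_trans)
  then show ?thesis by (simp add: nu_def[abs_def] comp_def)
qed

lemma nu_in: "X \<in> Ob (CAT n) \<Longrightarrow> Y \<in> Ob (CAT n) \<Longrightarrow> f \<in> hom (CAT n) X Y \<Longrightarrow>
    nu n f \<in> hom (CAT (Suc n)) (Unit (CAT (Suc n))) (Fo n (Expo (CAT n) X Y))"
  using nu_bij bij_betwE by blast

lemma nu_inj: "X \<in> Ob (CAT n) \<Longrightarrow> Y \<in> Ob (CAT n) \<Longrightarrow> f \<in> hom (CAT n) X Y \<Longrightarrow> g \<in> hom (CAT n) X Y \<Longrightarrow>
    nu n f = nu n g \<longleftrightarrow> f = g"
  using nu_bij[of X n Y] by (auto simp: bij_betw_def dest: inj_onD)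

text \<open>The passage from an arrow out of the leftmost context to its element is natural, so
  clauses of \<open>interp\<close> that are actions or pairings carry over to elements
  unchanged.\<close>

lemma fpp_trans_nu:
  assumes "wf_stack l (\<Gamma> # S)"
  shows "fpp_trans (CAT l) (EW (cx (l + length S) \<Gamma>) S l) (act S l) (El (\<Gamma> # S) l) (act (\<Gamma> # S) l)
    (\<lambda>_. nu (l + length S))"
proof -
  interpret F: fpp "CAT l" "EW (cx (l + length S) \<Gamma>) S l" "act S l" by (rule fpp_EW) (use assms in simp_all)
  interpret G: fpp "CAT l" "El (\<Gamma> # S) l" "act (\<Gamma> # S) l" by (rule fpp_El) (use assms in simp_all)
  show ?thesis
  proof
    show "nu (l + length S) a \<in> El (\<Gamma> # S) l X"
      if "X \<in> Ob (CAT l)" "a \<in> EW (cx (l + length S) \<Gamma>) S l X" for X a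
      using that assms nu_in[of "cx (l + length S) \<Gamma>" "l + length S" "so l S X" a]
      by (simp add: EW_def El_def Let_def)
    show "nu (l + length S) (act S l f a) = act (\<Gamma> # S) l f (nu (l + length S) a)"
      if "f \<in> Ar (CAT l)" "a \<in> EW (cx (l + length S) \<Gamma>) S l (Dom (CAT l) f)" for f a
      using that assms nu_Comp[of a "l + length S" "sm l S f" "cx (l + length S) \<Gamma>"]
      by (simp add: EW_def act_def Let_def C.in_hom_iff)
  qed
qed

text \<open>The empty context denotes the terminal object, so the elements for \<open>S\<close> are
  themselves arrows out of a leftmost context, and their elements are those for
  \<open>[] # S\<close>.\<close>

lemma fpp_trans_pad:
  assumes "wf_stack l S"
  shows "fpp_trans (CAT l) (El S l) (act S l) (El ([] # S) l) (act ([] # S) l) (\<lambda>_. nu (l + length S))"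
  using fpp_trans_nu[of l "[]" S] assms by (simp add: El_def)

text \<open>\<open>butlast S @ [cur S]\<close> is \<open>S\<close> itself unless \<open>S\<close> is
  empty, in which case it is \<open>[[]]\<close>. Clauses that work in
  \<open>butlast S @ [cur S]\<close> thus need a correction in that one case.\<close>

definition dn :: "'b stack \<Rightarrow> nat \<Rightarrow> 'o \<Rightarrow> 'm \<Rightarrow> 'm" where
  "dn S l X a = (if S = [] then inv_into (hom (CAT l) (Unit (CAT l)) X) (nu l) a else a)"

lemma dn_snoc [simp]: "dn (S @ [\<Gamma>]) l X a = a" and dn_Cons [simp]: "dn (\<Gamma> # S) l X a = a"
  by (simp_all add: dn_def)

lemma El_Nil: "El [] l X = hom (CAT l) (Unit (CAT l)) X"
  by (simp add: El_def EW_Nil)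

lemma dn_Nil:
  assumes "X \<in> Ob (CAT l)" "a \<in> EB [] l (Expo (CAT l) (Unit (CAT l)) X)"
  shows "dn [] l X a \<in> El [] l X" "nu l (dn [] l X a) = a"
proof -
  have "a \<in> nu l ` hom (CAT l) (Unit (CAT l)) X"
    using nu_bij[of "Unit (CAT l)" l X] assms by (simp add: bij_betw_def El_Nil)
  then show "dn [] l X a \<in> El [] l X" "nu l (dn [] l X a) = a"
    by (simp_all add: dn_def El_Nil inv_into_into f_inv_into_f)
qed

lemma El_singleton: "El [[]] l X = EB [] l (Expo (CAT l) (Unit (CAT l)) X)"
  using El_snoc[of "[]" "[]" l] by simp

text \<open>
  An abstraction or unquotation in the empty stack is interpreted in the stack \<open>[[]]\<close> and taken back
  along \<open>nu\<close> by \<open>dn\<close>.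
\<close>

primrec sem :: "'b stack \<Rightarrow> nat \<Rightarrow> 'b tm \<Rightarrow> 'm" where
  "sem S l (Var i) = fpp.nm (CAT l) (EB (butlast S) l) (actB (butlast S) l) (ctx_proj \<CC> \<beta> l (cur S) i)"
| "sem S l (Lam A M) = (let T = butlast S @ [A # cur S]; B = tyof T M in
     dn S l (Expo (CAT l) (ty l A) (ty l B))
       (actB (butlast S) l (curry_iso (CAT l) (cx l (cur S)) (ty l A) (ty l B)) (sem T l M)))"
| "sem S l (App M N) = (let X = ty l (tyof S N); Y = ty l (tyof S (App M N)) in
     act S l (Eval (CAT l) X Y) (fpp.pr (CAT l) (El S l) (act S l) (Expo (CAT l) X Y) X (sem S l M) (sem S l N)))"
| "sem S l (Pair M N) =
     fpp.pr (CAT l) (El S l) (act S l) (ty l (tyof S M)) (ty l (tyof S N)) (sem S l M) (sem S l N)"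
| "sem S l (Fst M) = act S l (Proj1 (CAT l) (ty l (tyof S (Fst M))) (ty l (tyof S (Snd M)))) (sem S l M)"
| "sem S l (Snd M) = act S l (Proj2 (CAT l) (ty l (tyof S (Fst M))) (ty l (tyof S (Snd M)))) (sem S l M)"
| "sem S l Star = fpp.un (CAT l) (El S l)"
| "sem S l (Quo M) =
     actB S (l - 1) (unit_expo_iso (CAT (l - 1)) (ty (l - 1) (tyof (S @ [[]]) M))) (sem (S @ [[]]) (l - 1) M)"
| "sem S l (Unq M) = (let X = ty l (tyof S (Unq M)) in
     dn S l X (actB (butlast S) l (konst (CAT l) X (cx l (cur S))) (sem (butlast S) (Suc l) M)))"

lemma El_cur: "S \<noteq> [] \<Longrightarrow> El S l X = EB (butlast S) l (Expo (CAT l) (cx l (cur S)) X)"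
  by (cases S rule: rev_cases) (simp_all add: El_snoc)

lemma dn_in:
  assumes "wf_stack l S" "X \<in> Ob (CAT l)" "a \<in> EB (butlast S) l (Expo (CAT l) (cx l (cur S)) X)"
  shows "dn S l X a \<in> El S l X"
proof (cases "S = []")
  case True
  then show ?thesis using dn_Nil(1)[of X l a] assms by simp
next
  case False
  then show ?thesis using assms by (simp add: El_cur dn_def)
qed

lemma sem_in: "ity S l M A \<Longrightarrow> wf_stack l S \<Longrightarrow> sem S l M \<in> El S l (ty l A)"
proof (induction rule: ity.induct)
  case (Var i S l)
  note wf = wf_butlast_cur[OF Var.prems]
  interpret F: fpp "CAT l" "EB (butlast S) l" "actB (butlast S) l" by (rule fpp_EB) (use wf in simp)
  have "S \<noteq> []" using Var.hyps by auto
  then show ?case using Var.hyps wf by (simp add: El_cur)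
next
  case (Lam l A S M B)
  note wf = wf_butlast_cur[OF Lam.prems]
  interpret F: fpp "CAT l" "EB (butlast S) l" "actB (butlast S) l" by (rule fpp_EB) (use wf in simp)
  have B: "wf_ty l B" using ity_wf_ty[OF Lam.hyps(2)] Lam.hyps(1) wf by simp
  have "sem (butlast S @ [A # cur S]) l M \<in> EB (butlast S) l (Expo (CAT l) (Times (CAT l) (cx l (cur S)) (ty l A)) (ty l B))"
    using Lam.IH Lam.hyps(1) wf by (simp add: El_snoc)
  then have "actB (butlast S) l (curry_iso (CAT l) (cx l (cur S)) (ty l A) (ty l B)) (sem (butlast S @ [A # cur S]) l M)
      \<in> EB (butlast S) l (Expo (CAT l) (cx l (cur S)) (ty l (A \<rightarrow> B)))"
    using wf Lam.hyps(1) B by (intro F.act_in) simp_all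
  then have "dn S l (ty l (A \<rightarrow> B)) (actB (butlast S) l (curry_iso (CAT l) (cx l (cur S)) (ty l A) (ty l B))
      (sem (butlast S @ [A # cur S]) l M)) \<in> El S l (ty l (A \<rightarrow> B))"
    using Lam.hyps(1) B by (intro dn_in Lam.prems) auto
  then show ?case using tyof[OF Lam.hyps(2)] by (simp add: Let_def)
next
  case (App S l M A B N)
  interpret F: fpp "CAT l" "El S l" "act S l" by (rule fpp_El) fact
  have "wf_ty l (A \<rightarrow> B)" by (rule ity_wf_ty[OF App.hyps(1) App.prems])
  then show ?case using App tyof[OF App.hyps(1)] tyof[OF App.hyps(2)]
    by (simp add: F.pr_props Let_def)
next
  case (Pair S l M A N B)
  interpret F: fpp "CAT l" "El S l" "act S l" by (rule fpp_El) fact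
  have "wf_ty l A" "wf_ty l B" using Pair ity_wf_ty by blast+
  then show ?case using Pair tyof[OF Pair.hyps(1)] tyof[OF Pair.hyps(2)]
    by (simp add: F.pr_props)
next
  case (Fst S l M A B)
  interpret F: fpp "CAT l" "El S l" "act S l" by (rule fpp_El) fact
  have "wf_ty l (Prod A B)" by (rule ity_wf_ty[OF Fst.hyps(1) Fst.prems])
  then show ?case using Fst tyof[OF Fst.hyps(1)] by simp
next
  case (Snd S l M A B)
  interpret F: fpp "CAT l" "El S l" "act S l" by (rule fpp_El) fact
  have "wf_ty l (Prod A B)" by (rule ity_wf_ty[OF Snd.hyps(1) Snd.prems])
  then show ?case using Snd tyof[OF Snd.hyps(1)] by simp
next
  case (Star S l)
  interpret F: fpp "CAT l" "El S l" "act S l" by (rule fpp_El) fact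
  show ?case by simp
next
  case (Quo S l M A)
  interpret F: fpp "CAT l" "EB S l" "actB S l" by (rule fpp_EB) (use Quo.prems in simp)
  have "wf_ty l A" using ity_wf_ty[OF Quo.hyps(1)] Quo.prems by simp
  then show ?case using Quo tyof[OF Quo.hyps(1)] by (simp add: El_snoc)
next
  case (Unq S l M A)
  note wf = wf_butlast_cur[OF Unq.prems]
  interpret F: fpp "CAT l" "EB (butlast S) l" "actB (butlast S) l" by (rule fpp_EB) (use wf in simp)
  have A: "wf_ty l A" using ity_wf_ty[OF Unq.hyps(1)] wf by simp
  then have "dn S l (ty l A) (actB (butlast S) l (konst (CAT l) (ty l A) (cx l (cur S))) (sem (butlast S) (Suc l) M)) \<in> El S l (ty l A)"
    using wf Unq.IH by (intro dn_in Unq.prems F.act_in) simp_all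
  then show ?case using tyof[OF Unq.hyps(1)] by (simp add: Let_def)
qed

end

section \<open>Padding a stack with an empty context on the left\<close>

lemma nthc_Cons_Nil [simp]: "nthc ([] # S) n = nthc S n"
  by (auto simp: nthc_def nth_append)

lemma ity_pad: "ity ([] # S) l M A \<longleftrightarrow> ity S l M A"
  by (auto elim: ity_weaken)

lemma cur_Cons [simp]: "S \<noteq> [] \<Longrightarrow> cur (\<Gamma> # S) = cur S"
  by (simp add: cur_def)

context model
begin


text \<open>Only the comparison of \<open>[]\<close> with \<open>[[]]\<close> is wanted, but
  subterms live in longer stacks, so all stacks are treated. Naturality of \<open>nu\<close> handles
  every construct; the exceptions are abstraction and unquotation in the empty stack, which are
  settled by \<open>dn\<close>.\<close>

lemma sem_pad: "ity S l M A \<Longrightarrow> wf_stack l S \<Longrightarrow> sem ([] # S) l M = nu (l + length S) (sem S l M)"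
proof (induction rule: ity.induct)
  case (Var i S l)
  note wf = wf_butlast_cur[OF Var.prems]
  interpret T: fpp_trans "CAT (Suc l)" "El (butlast S) (Suc l)" "act (butlast S) (Suc l)"
    "El ([] # butlast S) (Suc l)" "act ([] # butlast S) (Suc l)" "\<lambda>_. nu (Suc l + length (butlast S))"
    by (rule fpp_trans_pad) (use wf in simp)
  interpret T': fpp_trans "CAT l" "EB (butlast S) l" "actB (butlast S) l"
    "EB ([] # butlast S) l" "actB ([] # butlast S) l" "\<lambda>_. nu (Suc l + length (butlast S))"
    by (rule T.fpp_trans_functor[OF is_ccc_CAT BOX_functor BOX_products])
  have S: "S \<noteq> []" using Var.hyps by auto
  then have [simp]: "Suc (l + (length S - Suc 0)) = l + length S" by (cases S) auto
  show ?case
    using S T'.trans_nm[of "ctx_proj \<CC> \<beta> l (cur S) i"] Var.hyps wf by simp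
next
  case (Lam l A S M B)
  note wf = wf_butlast_cur[OF Lam.prems]
  have L: "ity S l (Lam A M) (A \<rightarrow> B)" using Lam.hyps by (rule ity.Lam)
  have B: "wf_ty l B" using ity_wf_ty[OF Lam.hyps(2)] Lam.hyps(1) wf by simp
  show ?case
  proof (cases "S = []")
    case True
    \<comment> \<open>Both sides come from one element for \<open>[[]]\<close>: \<open>dn\<close>
      takes it back along \<open>nu\<close>, and padding applies \<open>nu\<close> again.\<close>
    have "sem [] l (Lam A M) = dn [] l (ty l (A \<rightarrow> B)) (sem [[]] l (Lam A M))"
      using Lam.hyps(2) True by (simp add: Let_def tyof)
    moreover have "sem [[]] l (Lam A M) \<in> EB [] l (Expo (CAT l) (Unit (CAT l)) (ty l (A \<rightarrow> B)))"
      using sem_in[of "[[]]" l "Lam A M" "A \<rightarrow> B"] L True by (simp add: El_singleton ity_pad)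
    ultimately show ?thesis using True dn_Nil(2)[of "ty l (A \<rightarrow> B)"] Lam.hyps(1) B by simp
  next
    case False
    then have [simp]: "Suc (l + (length S - Suc 0)) = l + length S" by (cases S) auto
    interpret T: fpp_trans "CAT (Suc l)" "El (butlast S) (Suc l)" "act (butlast S) (Suc l)"
      "El ([] # butlast S) (Suc l)" "act ([] # butlast S) (Suc l)" "\<lambda>_. nu (Suc l + length (butlast S))"
      by (rule fpp_trans_pad) (use wf in simp)
    have "sem (butlast S @ [A # cur S]) l M \<in> EB (butlast S) l (Expo (CAT l) (Times (CAT l) (cx l (cur S)) (ty l A)) (ty l B))"
      using sem_in[OF Lam.hyps(2)] Lam.hyps(1) wf by (simp add: El_snoc)
    moreover have "ity ([] # butlast S @ [A # cur S]) l M B" using Lam.hyps(2) by (simp add: ity_pad)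
    ultimately show ?thesis
      using False Lam.IH wf Lam.hyps B
        T.trans_act[of "Fm l (curry_iso (CAT l) (cx l (cur S)) (ty l A) (ty l B))" "sem (butlast S @ [A # cur S]) l M"]
      by (simp add: Let_def tyof dn_def)
  qed
next
  case (App S l M A B N)
  interpret T: fpp_trans "CAT l" "El S l" "act S l" "El ([] # S) l" "act ([] # S) l" "\<lambda>_. nu (l + length S)"
    by (rule fpp_trans_pad) fact
  have wf: "wf_ty l A" "wf_ty l B" using ity_wf_ty[OF App.hyps(1) App.prems] by auto
  have M: "sem S l M \<in> El S l (Expo (CAT l) (ty l A) (ty l B))" using sem_in[OF App.hyps(1) App.prems] by simp
  have N: "sem S l N \<in> El S l (ty l A)" using sem_in[OF App.hyps(2) App.prems] by simp
  have "ity ([] # S) l M (A \<rightarrow> B)" "ity ([] # S) l N A" using App.hyps by (simp_all add: ity_pad)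
  note * = this[THEN tyof] App.hyps[THEN tyof]
  show ?case
    using wf M N App.IH[OF App.prems]
      T.trans_pr[of "Expo (CAT l) (ty l A) (ty l B)" "ty l A" "sem S l M" "sem S l N"]
      T.trans_act[of "Eval (CAT l) (ty l A) (ty l B)" "T.F.pr (Expo (CAT l) (ty l A) (ty l B)) (ty l A) (sem S l M) (sem S l N)"]
    by (simp add: * Let_def T.F.pr_props)
next
  case (Pair S l M A N B)
  interpret T: fpp_trans "CAT l" "El S l" "act S l" "El ([] # S) l" "act ([] # S) l" "\<lambda>_. nu (l + length S)"
    by (rule fpp_trans_pad) fact
  have wf: "wf_ty l A" "wf_ty l B" using ity_wf_ty[OF _ Pair.prems] Pair.hyps by blast+
  have "ity ([] # S) l M A" "ity ([] # S) l N B" using Pair.hyps by (simp_all add: ity_pad)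
  note * = this[THEN tyof] Pair.hyps[THEN tyof]
  show ?case
    using wf Pair.IH[OF Pair.prems] Pair.hyps[THEN sem_in, OF Pair.prems]
      T.trans_pr[of "ty l A" "ty l B" "sem S l M" "sem S l N"]
    by (simp add: *)
next
  case (Fst S l M A B)
  interpret T: fpp_trans "CAT l" "El S l" "act S l" "El ([] # S) l" "act ([] # S) l" "\<lambda>_. nu (l + length S)"
    by (rule fpp_trans_pad) fact
  have wf: "wf_ty l A" "wf_ty l B" using ity_wf_ty[OF Fst.hyps Fst.prems] by auto
  have "ity ([] # S) l M (Prod A B)" using Fst.hyps by (simp_all add: ity_pad)
  note * = this[THEN tyof] Fst.hyps[THEN tyof]
  show ?case
    using wf Fst.IH[OF Fst.prems] Fst.hyps[THEN sem_in, OF Fst.prems]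
      T.trans_act[of "Proj1 (CAT l) (ty l A) (ty l B)" "sem S l M"]
    by (simp add: *)
next
  case (Snd S l M A B)
  interpret T: fpp_trans "CAT l" "El S l" "act S l" "El ([] # S) l" "act ([] # S) l" "\<lambda>_. nu (l + length S)"
    by (rule fpp_trans_pad) fact
  have wf: "wf_ty l A" "wf_ty l B" using ity_wf_ty[OF Snd.hyps Snd.prems] by auto
  have "ity ([] # S) l M (Prod A B)" using Snd.hyps by (simp_all add: ity_pad)
  note * = this[THEN tyof] Snd.hyps[THEN tyof]
  show ?case
    using wf Snd.IH[OF Snd.prems] Snd.hyps[THEN sem_in, OF Snd.prems]
      T.trans_act[of "Proj2 (CAT l) (ty l A) (ty l B)" "sem S l M"]
    by (simp add: *)
next
  case (Star S l)
  interpret T: fpp_trans "CAT l" "El S l" "act S l" "El ([] # S) l" "act ([] # S) l" "\<lambda>_. nu (l + length S)"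
    by (rule fpp_trans_pad) fact
  show ?case by (simp add: T.trans_un)
next
  case (Quo S l M A)
  interpret T: fpp_trans "CAT (Suc l)" "El S (Suc l)" "act S (Suc l)"
    "El ([] # S) (Suc l)" "act ([] # S) (Suc l)" "\<lambda>_. nu (Suc l + length S)"
    by (rule fpp_trans_pad) fact
  have A: "wf_ty l A" using ity_wf_ty[OF Quo.hyps] Quo.prems by simp
  have "ity ([] # S @ [[]]) l M A" using Quo.hyps by (simp add: ity_pad)
  note * = this[THEN tyof] Quo.hyps[THEN tyof]
  have "sem (S @ [[]]) l M \<in> EB S l (Expo (CAT l) (Unit (CAT l)) (ty l A))"
    using sem_in[OF Quo.hyps] Quo.prems by (simp add: El_snoc)
  then show ?case
    using A Quo.IH Quo.prems
      T.trans_act[of "Fm l (unit_expo_iso (CAT l) (ty l A))" "sem (S @ [[]]) l M"]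
    by (simp add: *)
next
  case (Unq S l M A)
  note wf = wf_butlast_cur[OF Unq.prems]
  have L: "ity S l (Unq M) A" using Unq.hyps by (rule ity.Unq)
  have A: "wf_ty l A" using ity_wf_ty[OF Unq.hyps] wf by simp
  show ?case
  proof (cases "S = []")
    case True
    have "sem [] l (Unq M) = dn [] l (ty l A) (sem [[]] l (Unq M))"
      using Unq.hyps True by (simp add: Let_def tyof)
    moreover have "sem [[]] l (Unq M) \<in> EB [] l (Expo (CAT l) (Unit (CAT l)) (ty l A))"
      using sem_in[of "[[]]" l "Unq M" A] L True by (simp add: El_singleton ity_pad)
    ultimately show ?thesis using True dn_Nil(2)[of "ty l A"] A by simp
  next
    case False
    then have [simp]: "Suc (l + (length S - Suc 0)) = l + length S" by (cases S) auto
    interpret T: fpp_trans "CAT (Suc l)" "El (butlast S) (Suc l)" "act (butlast S) (Suc l)"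
      "El ([] # butlast S) (Suc l)" "act ([] # butlast S) (Suc l)" "\<lambda>_. nu (Suc l + length (butlast S))"
      by (rule fpp_trans_pad) (use wf in simp)
    have "ity ([] # butlast S) (Suc l) M (Box A)" using Unq.hyps by (simp add: ity_pad)
    then show ?thesis
      using False Unq.IH wf A sem_in[OF Unq.hyps] Unq.hyps
        T.trans_act[of "Fm l (konst (CAT l) (ty l A) (cx l (cur S)))" "sem (butlast S) (Suc l) M"]
      by (simp add: Let_def tyof dn_def)
  qed
qed

section \<open>Agreement of the interpretation with its element form\<close>

lemma fpp_trans_pre:
  assumes "wf_stack l S" "h \<in> Ar (CAT (l + length S))"
  shows "fpp_trans (CAT l) (EW (Cod (CAT (l + length S)) h) S l) (act S l) (EW (Dom (CAT (l + length S)) h) S l) (act S l)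
    (\<lambda>_ a. a \<cdot>\<^bsub>CAT (l + length S)\<^esub> h)"
proof -
  interpret F: fpp "CAT l" "EW (Cod (CAT (l + length S)) h) S l" "act S l" by (rule fpp_EW) (use assms in simp_all)
  interpret G: fpp "CAT l" "EW (Dom (CAT (l + length S)) h) S l" "act S l" by (rule fpp_EW) (use assms in simp_all)
  show ?thesis
    by unfold_locales (use assms in \<open>auto simp: EW_def act_def C.in_hom_iff\<close>)
qed

lemma nm_EB_Nil:
  assumes "f \<in> Ar (CAT l)"
  shows "fpp.nm (CAT l) (EB [] l) (actB [] l) f = nu l f"
proof -
  interpret F: fpp "CAT l" "EB [] l" "actB [] l" by (rule fpp_EB) simp
  have "F.un = unit_map (CAT l) (CAT (Suc l)) (BOX \<CC> l)"
    by (rule F.un_eqI[symmetric]) (simp add: El_Nil C.in_hom_iff)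
  then show ?thesis unfolding F.nm_def by (simp add: act_Nil nu_def normal_map_def)
qed

text \<open>Since \<open>EW W S l\<close> preserves products at every stage, the comparison arrow is
  invertible. Its inverse after a tuple has the right projections and is therefore the abstract
  pair; from here on the isomorphism itself is no longer mentioned.\<close>

lemma stack_prod_iso_tuple:
  assumes "wf_stack l S" "X \<in> Ob (CAT l)" "Y \<in> Ob (CAT l)" "W \<in> Ob (CAT (l + length S))"
    "f \<in> EW W S l X" "g \<in> EW W S l Y"
  shows "stack_prod_iso \<CC> \<beta> l S X Y \<cdot>\<^bsub>CAT (l + length S)\<^esub> tuple (CAT (l + length S)) f g =
    fpp.pr (CAT l) (EW W S l) (act S l) X Y f g"
proof -
  let ?n = "l + length S"
  let ?p = "sm l S (Proj1 (CAT l) X Y)" and ?q = "sm l S (Proj2 (CAT l) X Y)"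
  let ?P = "Proj1 (CAT ?n) (so l S X) (so l S Y)" and ?Q = "Proj2 (CAT ?n) (so l S X) (so l S Y)"
  let ?t = "tuple (CAT ?n) ?p ?q"
  let ?i = "inverse_of (CAT ?n) ?t"
  interpret F: fpp "CAT l" "EW W S l" "act S l" by (rule fpp_EW) fact+
  have fg: "f \<in> Ar (CAT ?n)" "Dom (CAT ?n) f = W" "Cod (CAT ?n) f = so l S X"
    "g \<in> Ar (CAT ?n)" "Dom (CAT ?n) g = W" "Cod (CAT ?n) g = so l S Y"
    using assms(5,6) by (auto simp: EW_def C.in_hom_iff)
  have "is_iso (CAT ?n) ?t"
  proof (rule C.iso_tupleI)
    fix W f g
    assume W: "W \<in> Ob (CAT ?n)" "f \<in> hom (CAT ?n) W (so l S X)" "g \<in> hom (CAT ?n) W (so l S Y)"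
    then interpret G: fpp "CAT l" "EW W S l" "act S l" by (intro fpp_EW assms(1))
    show "\<exists>!h. h \<in> hom (CAT ?n) W (so l S (Times (CAT l) X Y)) \<and> ?p \<cdot>\<^bsub>CAT ?n\<^esub> h = f \<and> ?q \<cdot>\<^bsub>CAT ?n\<^esub> h = g"
      using G.pair_ex1[of X Y f g] assms(2,3) W by (simp add: EW_def act_def)
  qed (use assms in simp_all)
  note inv = C.inverse_of_props[OF this]
  have *: "so l S X \<in> Ob (CAT ?n)" "so l S Y \<in> Ob (CAT ?n)" using assms by auto
  have ti: "?t \<cdot>\<^bsub>CAT ?n\<^esub> ?i \<cdot>\<^bsub>CAT ?n\<^esub> tuple (CAT ?n) f g = tuple (CAT ?n) f g"
  proof -
    have "?t \<cdot>\<^bsub>CAT ?n\<^esub> ?i \<cdot>\<^bsub>CAT ?n\<^esub> tuple (CAT ?n) f g = (?t \<cdot>\<^bsub>CAT ?n\<^esub> ?i) \<cdot>\<^bsub>CAT ?n\<^esub> tuple (CAT ?n) f g"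
      by (rule C.Comp_assoc[symmetric]) (use assms inv(1-3) fg * in simp_all)
    then show ?thesis unfolding inv(5) using fg assms by simp
  qed
  have "?p \<cdot>\<^bsub>CAT ?n\<^esub> ?i \<cdot>\<^bsub>CAT ?n\<^esub> tuple (CAT ?n) f g = ?P \<cdot>\<^bsub>CAT ?n\<^esub> ?t \<cdot>\<^bsub>CAT ?n\<^esub> ?i \<cdot>\<^bsub>CAT ?n\<^esub> tuple (CAT ?n) f g"
    by (rule C.Proj_tuple_Comp(1)[symmetric]) (use assms inv(1-3) fg in simp_all)
  then have 1: "?p \<cdot>\<^bsub>CAT ?n\<^esub> ?i \<cdot>\<^bsub>CAT ?n\<^esub> tuple (CAT ?n) f g = f" unfolding ti using fg by simp
  have "?q \<cdot>\<^bsub>CAT ?n\<^esub> ?i \<cdot>\<^bsub>CAT ?n\<^esub> tuple (CAT ?n) f g = ?Q \<cdot>\<^bsub>CAT ?n\<^esub> ?t \<cdot>\<^bsub>CAT ?n\<^esub> ?i \<cdot>\<^bsub>CAT ?n\<^esub> tuple (CAT ?n) f g"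
    by (rule C.Proj_tuple_Comp(2)[symmetric]) (use assms inv(1-3) fg in simp_all)
  then have 2: "?q \<cdot>\<^bsub>CAT ?n\<^esub> ?i \<cdot>\<^bsub>CAT ?n\<^esub> tuple (CAT ?n) f g = g" unfolding ti using fg by simp
  have 3: "?i \<cdot>\<^bsub>CAT ?n\<^esub> tuple (CAT ?n) f g \<in> EW W S l (Times (CAT l) X Y)"
    unfolding EW_def C.in_hom_iff using inv(1-3) fg assms by simp
  show ?thesis
    using F.pr_unique[OF assms(2,3) 3] 1 2 by (simp add: stack_prod_iso_def Let_def act_def)
qed

lemma stack_unit_iso_bang:
  assumes "wf_stack l S" "W \<in> Ob (CAT (l + length S))"
  shows "stack_unit_iso \<CC> \<beta> l S \<cdot>\<^bsub>CAT (l + length S)\<^esub> bang (CAT (l + length S)) W = fpp.un (CAT l) (EW W S l)"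
proof -
  let ?n = "l + length S"
  interpret F: fpp "CAT l" "EW W S l" "act S l" by (rule fpp_EW) fact+
  have "is_iso (CAT ?n) (bang (CAT ?n) (so l S (Unit (CAT l))))"
  proof (rule C.iso_bangI)
    fix W assume W: "W \<in> Ob (CAT ?n)"
    then interpret G: fpp "CAT l" "EW W S l" "act S l" by (intro fpp_EW assms(1))
    show "\<exists>!h. h \<in> hom (CAT ?n) W (so l S (Unit (CAT l)))" using G.unit_ex1 by (simp add: EW_def)
  qed (use assms in simp)
  note inv = C.inverse_of_props[OF this]
  show ?thesis
    by (rule F.un_eqI) (use inv(1-3) assms in \<open>simp add: EW_def C.in_hom_iff stack_unit_iso_def Let_def\<close>)
qed

text \<open>\<open>den S l X f a\<close>: the arrow \<open>f\<close>, as in \<open>interp\<close>, and the element \<open>a\<close> of \<open>S(X)\<close> correspond.\<close>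

definition den :: "'b stack \<Rightarrow> nat \<Rightarrow> 'o \<Rightarrow> 'm \<Rightarrow> 'm \<Rightarrow> bool" where
  "den S l X f a \<longleftrightarrow> (case S of [] \<Rightarrow> f \<in> El [] l X \<and> a = f
     | \<Gamma> # \<Delta> \<Rightarrow> f \<in> EW (cx (l + length \<Delta>) \<Gamma>) \<Delta> l X \<and> nu (l + length \<Delta>) f = a)"

lemma den_Nil [simp]: "den [] l X f a \<longleftrightarrow> f \<in> El [] l X \<and> a = f"
  and den_Cons [simp]: "den (\<Gamma> # \<Delta>) l X f a \<longleftrightarrow>
    f \<in> EW (cx (l + length \<Delta>) \<Gamma>) \<Delta> l X \<and> nu (l + length \<Delta>) f = a"
  by (simp_all add: den_def)

lemma den_inj:
  assumes "wf_stack l S" "X \<in> Ob (CAT l)" "den S l X f a" "den S l X g b"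
  shows "f = g \<longleftrightarrow> a = b"
proof (cases S)
  case (Cons \<Gamma> \<Delta>)
  then show ?thesis
    using assms nu_inj[of "cx (l + length \<Delta>) \<Gamma>" "l + length \<Delta>" "so l \<Delta> X" f g] by (auto simp: EW_def)
qed (use assms in simp)

text \<open>Reconciles the clause of \<open>interp\<close> for abstraction in a single context, a
  transpose, with the clause for longer stacks, an action of \<open>curry_iso\<close>.\<close>

lemma nu_transpose:
  assumes "X \<in> Ob (CAT l)" "A \<in> Ob (CAT l)" "f \<in> Ar (CAT l)" "Dom (CAT l) f = Times (CAT l) X A" "Cod (CAT l) f = B"
  shows "nu l (transpose (CAT l) X A f) = Fm l (curry_iso (CAT l) X A B) \<cdot>\<^bsub>CAT (Suc l)\<^esub> nu l f"
proof -
  have B: "B \<in> Ob (CAT l)" using assms by auto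
  have "name_of (CAT l) (transpose (CAT l) X A f) = curry_iso (CAT l) X A B \<cdot>\<^bsub>CAT l\<^esub> name_of (CAT l) f"
    by (rule C.expo_ext[of _ l _ "Unit (CAT l)" X "Expo (CAT l) A B"], use assms B in simp_all)
       (rule C.expo_ext[of _ l _ "Times (CAT l) (Unit (CAT l)) X" A B], use assms B in simp_all)
  then show ?thesis using assms B by (simp add: nu_def normal_map_Comp)
qed

text \<open>Reconciles \<open>Quo_empty\<close> with the general clause for quotation, which acts by
  \<open>unit_expo_iso\<close>.\<close>

lemma nu_Unit:
  assumes "f \<in> Ar (CAT l)" "Dom (CAT l) f = Unit (CAT l)" "Cod (CAT l) f = A"
  shows "normal_map (CAT l) (CAT (Suc l)) (BOX \<CC> l) f = Fm l (unit_expo_iso (CAT l) A) \<cdot>\<^bsub>CAT (Suc l)\<^esub> nu l f"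
proof -
  have A: "A \<in> Ob (CAT l)" using assms by auto
  let ?U = "Unit (CAT l)"
  have "C.ap l ?U A (name_of (CAT l) f \<cdot>\<^bsub>CAT l\<^esub> Id (CAT l) ?U) (Id (CAT l) ?U) = f \<cdot>\<^bsub>CAT l\<^esub> Id (CAT l) ?U"
    by (rule C.ap_name_of) (use assms in simp_all)
  also have "\<dots> = f" using assms by simp
  also have "name_of (CAT l) f \<cdot>\<^bsub>CAT l\<^esub> Id (CAT l) ?U = name_of (CAT l) f" using assms by simp
  finally have "C.ap l (Unit (CAT l)) A (name_of (CAT l) f) (Id (CAT l) (Unit (CAT l))) = f" .
  then have "unit_expo_iso (CAT l) A \<cdot>\<^bsub>CAT l\<^esub> name_of (CAT l) f = f"
    using assms A by (simp add: C.unit_expo_iso_ap)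
  then have "normal_map (CAT l) (CAT (Suc l)) (BOX \<CC> l) f =
      normal_map (CAT l) (CAT (Suc l)) (BOX \<CC> l) (unit_expo_iso (CAT l) A \<cdot>\<^bsub>CAT l\<^esub> name_of (CAT l) f)"
    by (rule arg_cong[OF sym])
  also have "\<dots> = Fm l (unit_expo_iso (CAT l) A) \<cdot>\<^bsub>CAT (Suc l)\<^esub> nu l f"
    using assms A by (simp add: nu_def normal_map_Comp)
  finally show ?thesis .
qed

text \<open>Reconciles \<open>Unq_empty\<close>, where the unquoted arrow is preceded by
  \<open>bang\<close>, with the general clause for unquotation, which acts by
  \<open>konst\<close>.\<close>

lemma nu_const:
  assumes "g \<in> Ar (CAT l)" "Dom (CAT l) g = Unit (CAT l)" "Cod (CAT l) g = A" "X \<in> Ob (CAT l)"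
  shows "nu l (g \<cdot>\<^bsub>CAT l\<^esub> bang (CAT l) X) =
    Fm l (konst (CAT l) A X) \<cdot>\<^bsub>CAT (Suc l)\<^esub> normal_map (CAT l) (CAT (Suc l)) (BOX \<CC> l) g"
proof -
  have A: "A \<in> Ob (CAT l)" using assms by auto
  have b: "Proj1 (CAT l) (Unit (CAT l)) X = bang (CAT l) (Times (CAT l) (Unit (CAT l)) X)"
    by (rule trans[OF C.bang_unique[of _ l]]) (use assms in simp_all)
  have "name_of (CAT l) (g \<cdot>\<^bsub>CAT l\<^esub> bang (CAT l) X) = konst (CAT l) A X \<cdot>\<^bsub>CAT l\<^esub> g"
    by (rule C.expo_ext[of _ l _ "Unit (CAT l)" X A]) (use assms A in \<open>simp_all add: b\<close>)
  then show ?thesis using assms A by (simp add: nu_def normal_map_Comp)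
qed

text \<open>A function on terms describes \<open>interp\<close>, so \<open>interp\<close> is
  single-valued. The equation \<open>A' = A\<close> belongs to the induction because types such as
  that of an argument do not occur in the term: typing and interpretation have to be shown to agree
  on them.\<close>

lemma interp_sem:
  "interp \<CC> \<beta> S l M A f \<Longrightarrow> wf_stack l S \<Longrightarrow> ity S l M A' \<Longrightarrow> A' = A \<and> den S l (ty l A) f (sem S l M)"
proof (induction arbitrary: A' rule: interp.induct)
  case (Var i \<Gamma> l)
  then show ?case by (auto simp: EW_Nil C.in_hom_iff nm_EB_Nil)
next
  case (Var_stack \<Gamma>1 \<Delta>1 l i A f n \<Gamma>)
  \<comment> \<open>\<open>Var_stack\<close> adds a context on the left, while \<open>sem\<close> of
    a variable looks at the right end, so the stack is decomposed there as well.\<close>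
  obtain T \<Gamma>c where S: "\<Gamma>1 # \<Delta>1 = T @ [\<Gamma>c]" by (cases "\<Gamma>1 # \<Delta>1" rule: rev_cases) auto
  let ?S = "T @ [\<Gamma>c]"
  have n: "n = l + length T" using arg_cong[OF S, of length] Var_stack.hyps by simp
  have wf: "wf_stack l ?S" "wf_stack (Suc l) T" "wf_ctx l \<Gamma>c" "wf_ctx (Suc n) \<Gamma>"
    using Var_stack.prems(1) Var_stack.hyps unfolding S by (simp_all flip: n)
  have ity: "ity ?S l (Var i) A'" and i: "i < length \<Gamma>c"
    using Var_stack.prems(2) ity.Var[of i ?S l] unfolding S by auto
  have IH: "A' = A" "f \<in> EW (cx n \<Gamma>1) \<Delta>1 l (ty l A)" "nu n f = sem ?S l (Var i)"
    using Var_stack.IH[unfolded S, OF wf(1) ity] Var_stack.hyps unfolding S[symmetric] by (simp_all del: sem.simps)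
  have A: "wf_ty l A" using ity_wf_ty[OF ity wf(1)] IH by simp
  have SE: "sem ?S l (Var i) \<in> El ?S l (ty l A)" using sem_in[OF ity wf(1)] IH(1) by simp
  have f: "f \<in> Ar (CAT n)" "Dom (CAT n) f = cx n \<Gamma>1" "Cod (CAT n) f = so l \<Delta>1 (ty l A)"
    using IH(2) Var_stack.hyps by (auto simp: EW_def C.in_hom_iff)
  let ?b = "bang (CAT (Suc n)) (cx (Suc n) \<Gamma>)"
  have g: "Fm n (name_of (CAT n) f) \<cdot>\<^bsub>CAT (Suc n)\<^esub> unit_map (CAT n) (CAT (Suc n)) (BOX \<CC> n) \<cdot>\<^bsub>CAT (Suc n)\<^esub> ?b =
      sem ?S l (Var i) \<cdot>\<^bsub>CAT (Suc n)\<^esub> ?b"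
    using f wf by (simp add: IH(3)[symmetric] nu_def normal_map_def del: sem.simps)
  have n': "Suc n = Suc l + length T" using n by simp
  \<comment> \<open>The new arrow is the old element preceded by \<open>bang\<close>. Precomposition
    (\<open>P\<close>) and the passage to elements (\<open>Q\<close>) are both natural, hence
    preserve \<open>nm\<close>, and so take the variable in the shorter stack to the variable in the
    longer one.\<close>
  interpret P: fpp_trans "CAT (Suc l)" "EW (Cod (CAT (Suc n)) ?b) T (Suc l)" "act T (Suc l)"
      "EW (Dom (CAT (Suc n)) ?b) T (Suc l)" "act T (Suc l)" "\<lambda>_ a. a \<cdot>\<^bsub>CAT (Suc n)\<^esub> ?b"
    unfolding n' by (rule fpp_trans_pre) (use wf n in simp_all)
  interpret P': fpp_trans "CAT l" "\<lambda>X. EW (Cod (CAT (Suc n)) ?b) T (Suc l) (Fo l X)" "actB T l"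
      "\<lambda>X. EW (Dom (CAT (Suc n)) ?b) T (Suc l) (Fo l X)" "actB T l" "\<lambda>_ a. a \<cdot>\<^bsub>CAT (Suc n)\<^esub> ?b"
    by (rule P.fpp_trans_functor[OF is_ccc_CAT BOX_functor BOX_products])
  interpret Q: fpp_trans "CAT (Suc l)" "EW (cx (Suc l + length T) \<Gamma>) T (Suc l)" "act T (Suc l)"
      "El (\<Gamma> # T) (Suc l)" "act (\<Gamma> # T) (Suc l)" "\<lambda>_. nu (Suc l + length T)"
    by (rule fpp_trans_nu) (use wf n in simp)
  interpret Q': fpp_trans "CAT l" "\<lambda>X. EW (cx (Suc l + length T) \<Gamma>) T (Suc l) (Fo l X)" "actB T l"
      "EB (\<Gamma> # T) l" "actB (\<Gamma> # T) l" "\<lambda>_. nu (Suc l + length T)"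
    by (rule Q.fpp_trans_functor[OF is_ccc_CAT BOX_functor BOX_products])
  have b: "Cod (CAT (Suc n)) ?b = Unit (CAT (Suc l + length T))" "Dom (CAT (Suc n)) ?b = cx (Suc l + length T) \<Gamma>"
    using wf n by simp_all
  have sem_S: "sem ?S l (Var i) = P'.F.nm (ctx_proj \<CC> \<beta> l \<Gamma>c i)"
    unfolding b by (simp add: El_def)
  have "sem (\<Gamma> # ?S) l (Var i) = Q'.G.nm (ctx_proj \<CC> \<beta> l \<Gamma>c i)" by (simp add: butlast_append)
  also have "\<dots> = nu (Suc n) (Q'.F.nm (ctx_proj \<CC> \<beta> l \<Gamma>c i))"
    unfolding n' using i wf by (intro Q'.trans_nm[OF _ refl refl, symmetric]) simp
  also have "Q'.F.nm (ctx_proj \<CC> \<beta> l \<Gamma>c i) = sem ?S l (Var i) \<cdot>\<^bsub>CAT (Suc n)\<^esub> ?b"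
    unfolding sem_S using i wf P'.trans_nm[OF _ refl refl, of "ctx_proj \<CC> \<beta> l \<Gamma>c i"] by (simp add: b)
  finally have "sem (\<Gamma> # ?S) l (Var i) = nu (Suc n) (sem ?S l (Var i) \<cdot>\<^bsub>CAT (Suc n)\<^esub> ?b)" .
  moreover have "sem ?S l (Var i) \<cdot>\<^bsub>CAT (Suc n)\<^esub> ?b \<in> EW (cx (Suc n) \<Gamma>) ?S l (ty l A)"
    using SE wf n A by (simp add: El_def EW_def C.in_hom_iff del: sem.simps)
  moreover have len: "l + length ?S = Suc n" using n by simp
  ultimately show ?case unfolding S g den_Cons len using IH(1) by (simp del: sem.simps)
next
  case (Abs A \<Gamma> l M B f)
  from Abs.prems obtain B' where B': "A' = A \<rightarrow> B'" "wf_ty l A" "ity [A # \<Gamma>] l M B'" by auto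
  then have IH: "B' = B" "f \<in> EW (cx l (A # \<Gamma>)) [] l (ty l B)" "nu l f = sem [A # \<Gamma>] l M"
    using Abs.IH[of B'] Abs.prems by auto
  have B: "wf_ty l B" using ity_wf_ty[OF B'(3)] Abs.prems B' IH by simp
  show ?case
    using IH B B' Abs.prems nu_transpose[of "cx l \<Gamma>" l "ty l A" f "ty l B"]
    by (auto simp: EW_Nil C.in_hom_iff Let_def tyof act_Nil)
next
  case (Abs_stack \<Gamma> \<Delta> A \<Gamma>' l M B f n)
  from Abs_stack.prems obtain B' where B': "A' = A \<rightarrow> B'" "wf_ty l A" "ity (\<Gamma> # \<Delta> @ [A # \<Gamma>']) l M B'" by auto
  have wf: "wf_ctx n \<Gamma>" "wf_stack (Suc l) \<Delta>" "wf_ctx l \<Gamma>'" using Abs_stack.prems Abs_stack.hyps by (simp_all add: wf_stack_append)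
  have IH: "B' = B" "f \<in> EW (cx n \<Gamma>) \<Delta> (Suc l) (Fo l (Expo (CAT l) (cx l (A # \<Gamma>')) (ty l B)))" "nu n f = sem (\<Gamma> # \<Delta> @ [A # \<Gamma>']) l M"
    using Abs_stack.IH[of B'] Abs_stack.prems Abs_stack.hyps B' by (auto simp: EW_snoc wf_stack_append)
  have B: "wf_ty l B" using ity_wf_ty[OF B'(3)] wf B' IH Abs_stack.hyps by (simp add: wf_stack_append)
  interpret T: fpp_trans "CAT (Suc l)" "EW (cx (Suc l + length \<Delta>) \<Gamma>) \<Delta> (Suc l)" "act \<Delta> (Suc l)"
    "El (\<Gamma> # \<Delta>) (Suc l)" "act (\<Gamma> # \<Delta>) (Suc l)" "\<lambda>_. nu (Suc l + length \<Delta>)"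
    by (rule fpp_trans_nu) (use wf Abs_stack.hyps in simp)
  let ?c = "curry_iso (CAT l) (cx l \<Gamma>') (ty l A) (ty l B)"
  have "act \<Delta> (Suc l) (Fm l ?c) f \<in> EW (cx n \<Gamma>) \<Delta> (Suc l) (Fo l (Expo (CAT l) (cx l \<Gamma>') (ty l (A \<rightarrow> B))))"
    using T.F.act_in[of "Fm l ?c" f] IH(2) B B' wf Abs_stack.hyps by simp
  moreover have "nu n (act \<Delta> (Suc l) (Fm l ?c) f) = act (\<Gamma> # \<Delta>) (Suc l) (Fm l ?c) (nu n f)"
    using T.trans_act[of "Fm l ?c" f] IH(2) B B' wf Abs_stack.hyps by simp
  moreover have "butlast (\<Gamma> # \<Delta> @ [\<Gamma>']) = \<Gamma> # \<Delta>" "cur (\<Gamma> # \<Delta> @ [\<Gamma>']) = \<Gamma>'" by (simp_all add: butlast_append)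
  ultimately show ?case
    using IH B' Abs_stack.hyps by (simp add: EW_snoc Let_def tyof act_def)
next
  case (App \<Gamma> \<Delta> l M A B f N g X Y n)
  from App.prems obtain A0 where A0: "ity (\<Gamma> # \<Delta>) l M (A0 \<rightarrow> A')" "ity (\<Gamma> # \<Delta>) l N A0" by auto
  have IH: "A' = B" "A0 = A" "f \<in> EW (cx n \<Gamma>) \<Delta> l (Expo (CAT l) X Y)" "g \<in> EW (cx n \<Gamma>) \<Delta> l X"
    "nu n f = sem (\<Gamma> # \<Delta>) l M" "nu n g = sem (\<Gamma> # \<Delta>) l N"
    using App.IH(1)[OF App.prems(1) A0(1)] App.IH(2)[OF App.prems(1) A0(2)] App.hyps by auto
  have wf: "wf_ty l A" "wf_ty l B" using ity_wf_ty[OF A0(1) App.prems(1)] IH by auto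
  interpret T: fpp_trans "CAT l" "EW (cx (l + length \<Delta>) \<Gamma>) \<Delta> l" "act \<Delta> l" "El (\<Gamma> # \<Delta>) l" "act (\<Gamma> # \<Delta>) l" "\<lambda>_. nu (l + length \<Delta>)"
    by (rule fpp_trans_nu) fact
  have "stack_prod_iso \<CC> \<beta> l \<Delta> (Expo (CAT l) X Y) X \<cdot>\<^bsub>CAT n\<^esub> tuple (CAT n) f g = T.F.pr (Expo (CAT l) X Y) X f g"
    using stack_prod_iso_tuple[of l \<Delta> "Expo (CAT l) X Y" X "cx n \<Gamma>" f g] App.prems App.hyps wf IH by simp
  then show ?case
    using T.trans_act[of "Eval (CAT l) X Y" "T.F.pr (Expo (CAT l) X Y) X f g"] App.prems App.hyps wf IH A0
      T.trans_pr[of "Expo (CAT l) X Y" X f g] T.F.pr_props[of "Expo (CAT l) X Y" X f g]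
      T.F.act_in[of "Eval (CAT l) X Y" "T.F.pr (Expo (CAT l) X Y) X f g"]
    by (simp add: Let_def tyof act_def[of \<Delta>])
next
  case (Pair \<Gamma> \<Delta> l M A f N B g n)
  from Pair.prems obtain A0 B0 where A0: "ity (\<Gamma> # \<Delta>) l M A0" "ity (\<Gamma> # \<Delta>) l N B0" "A' = Prod A0 B0" by auto
  have IH: "A0 = A" "B0 = B" "f \<in> EW (cx n \<Gamma>) \<Delta> l (ty l A)" "g \<in> EW (cx n \<Gamma>) \<Delta> l (ty l B)"
    "nu n f = sem (\<Gamma> # \<Delta>) l M" "nu n g = sem (\<Gamma> # \<Delta>) l N"
    using Pair.IH(1)[OF Pair.prems(1) A0(1)] Pair.IH(2)[OF Pair.prems(1) A0(2)] Pair.hyps by auto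
  have wf: "wf_ty l A" "wf_ty l B" using ity_wf_ty[OF A0(1) Pair.prems(1)] ity_wf_ty[OF A0(2) Pair.prems(1)] IH by auto
  interpret T: fpp_trans "CAT l" "EW (cx (l + length \<Delta>) \<Gamma>) \<Delta> l" "act \<Delta> l" "El (\<Gamma> # \<Delta>) l" "act (\<Gamma> # \<Delta>) l" "\<lambda>_. nu (l + length \<Delta>)"
    by (rule fpp_trans_nu) fact
  show ?case
    using stack_prod_iso_tuple[of l \<Delta> "ty l A" "ty l B" "cx n \<Gamma>" f g] Pair.prems(1) Pair.hyps wf IH A0
      T.trans_pr[of "ty l A" "ty l B" f g] T.F.pr_props[of "ty l A" "ty l B" f g]
    by (simp add: tyof)
next
  case (Fst \<Gamma> \<Delta> l M A B f n)
  from Fst.prems obtain B0 where A0: "ity (\<Gamma> # \<Delta>) l M (Prod A' B0)" by auto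
  have IH: "A' = A" "B0 = B" "f \<in> EW (cx n \<Gamma>) \<Delta> l (ty l (Prod A B))" "nu n f = sem (\<Gamma> # \<Delta>) l M"
    using Fst.IH[OF Fst.prems(1) A0(1)] Fst.hyps by auto
  have wf: "wf_ty l A" "wf_ty l B" using ity_wf_ty[OF A0(1) Fst.prems(1)] IH by auto
  interpret T: fpp_trans "CAT l" "EW (cx (l + length \<Delta>) \<Gamma>) \<Delta> l" "act \<Delta> l" "El (\<Gamma> # \<Delta>) l" "act (\<Gamma> # \<Delta>) l" "\<lambda>_. nu (l + length \<Delta>)"
    by (rule fpp_trans_nu) fact
  show ?case
    using T.trans_act[of "Proj1 (CAT l) (ty l A) (ty l B)" f] T.F.act_in[of "Proj1 (CAT l) (ty l A) (ty l B)" f]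
      Fst.prems(1) Fst.hyps wf IH A0
    by (simp add: tyof act_def[of \<Delta>])
next
  case (Snd \<Gamma> \<Delta> l M A B f n)
  from Snd.prems obtain B0 where A0: "ity (\<Gamma> # \<Delta>) l M (Prod B0 A')" by auto
  have IH: "A' = B" "B0 = A" "f \<in> EW (cx n \<Gamma>) \<Delta> l (ty l (Prod A B))" "nu n f = sem (\<Gamma> # \<Delta>) l M"
    using Snd.IH[OF Snd.prems(1) A0(1)] Snd.hyps by auto
  have wf: "wf_ty l A" "wf_ty l B" using ity_wf_ty[OF A0(1) Snd.prems(1)] IH by auto
  interpret T: fpp_trans "CAT l" "EW (cx (l + length \<Delta>) \<Gamma>) \<Delta> l" "act \<Delta> l" "El (\<Gamma> # \<Delta>) l" "act (\<Gamma> # \<Delta>) l" "\<lambda>_. nu (l + length \<Delta>)"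
    by (rule fpp_trans_nu) fact
  show ?case
    using T.trans_act[of "Proj2 (CAT l) (ty l A) (ty l B)" f] T.F.act_in[of "Proj2 (CAT l) (ty l A) (ty l B)" f]
      Snd.prems(1) Snd.hyps wf IH A0
    by (simp add: tyof act_def[of \<Delta>])
next
  case (Star n l \<Delta> \<Gamma>)
  interpret T: fpp_trans "CAT l" "EW (cx (l + length \<Delta>) \<Gamma>) \<Delta> l" "act \<Delta> l" "El (\<Gamma> # \<Delta>) l" "act (\<Gamma> # \<Delta>) l" "\<lambda>_. nu (l + length \<Delta>)"
    by (rule fpp_trans_nu) fact
  show ?case
    using Star stack_unit_iso_bang[of l \<Delta> "cx n \<Gamma>"] T.trans_un T.F.un_in by auto
next
  case (Quo \<Gamma> \<Delta> l M A f n)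
  from Quo.prems obtain A0 where A0: "A' = Box A0" "ity (\<Gamma> # \<Delta> @ [[]]) l M A0" by auto
  have wf: "wf_ctx n \<Gamma>" "wf_stack (Suc l) \<Delta>" using Quo.prems Quo.hyps by simp_all
  have IH: "A0 = A" "f \<in> EW (cx n \<Gamma>) \<Delta> (Suc l) (Fo l (Expo (CAT l) (Unit (CAT l)) (ty l A)))" "nu n f = sem (\<Gamma> # \<Delta> @ [[]]) l M"
    using Quo.IH[of A0] Quo.prems Quo.hyps A0 by (auto simp: EW_snoc)
  have A: "wf_ty l A" using ity_wf_ty[OF A0(2)] wf IH Quo.hyps by simp
  interpret T: fpp_trans "CAT (Suc l)" "EW (cx (Suc l + length \<Delta>) \<Gamma>) \<Delta> (Suc l)" "act \<Delta> (Suc l)"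
    "El (\<Gamma> # \<Delta>) (Suc l)" "act (\<Gamma> # \<Delta>) (Suc l)" "\<lambda>_. nu (Suc l + length \<Delta>)"
    by (rule fpp_trans_nu) (use wf Quo.hyps in simp)
  let ?c = "unit_expo_iso (CAT l) (ty l A)"
  have "act \<Delta> (Suc l) (Fm l ?c) f \<in> EW (cx n \<Gamma>) \<Delta> (Suc l) (Fo l (ty l A))"
    using T.F.act_in[of "Fm l ?c" f] IH(2) A wf Quo.hyps by simp
  moreover have "nu n (act \<Delta> (Suc l) (Fm l ?c) f) = act (\<Gamma> # \<Delta>) (Suc l) (Fm l ?c) (nu n f)"
    using T.trans_act[of "Fm l ?c" f] IH(2) A wf Quo.hyps by simp
  ultimately show ?case
    using IH A0 Quo.hyps by (simp add: tyof act_def[of \<Delta>])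
next
  case (Quo_empty l M A f)
  from Quo_empty.prems obtain A0 where A0: "A' = Box A0" "ity [[]] l M A0" by auto
  have IH: "A0 = A" "f \<in> El [] l (ty l A)" "nu l f = sem [[]] l M"
    using Quo_empty.IH[of A0] A0 by (auto simp: EW_Nil El_Nil)
  have A: "wf_ty l A" using ity_wf_ty[OF A0(2)] IH by simp
  show ?case
    using IH A A0 nu_Unit[of f l "ty l A"] sem_in[of "[]" "Suc l" "Quo M" "Box A"] Quo_empty.prems
    by (simp add: El_Nil C.in_hom_iff act_Nil tyof)
next
  case (Unq \<Gamma> \<Delta> l M A f n X Y \<Gamma>')
  have A0: "ity (\<Gamma> # \<Delta>) (Suc l) M (Box A')" using Unq.prems(2) by (auto simp: butlast_append)
  have wf: "wf_ctx n \<Gamma>" "wf_stack (Suc l) \<Delta>" "wf_ctx l \<Gamma>'" using Unq.prems Unq.hyps by (simp_all add: wf_stack_append)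
  have IH: "A' = A" "f \<in> EW (cx n \<Gamma>) \<Delta> (Suc l) (Fo l (ty l A))" "nu n f = sem (\<Gamma> # \<Delta>) (Suc l) M"
    using Unq.IH[OF _ A0] wf Unq.hyps by auto
  have A: "wf_ty l A" using ity_wf_ty[OF A0] wf IH Unq.hyps by simp
  interpret T: fpp_trans "CAT (Suc l)" "EW (cx (Suc l + length \<Delta>) \<Gamma>) \<Delta> (Suc l)" "act \<Delta> (Suc l)"
    "El (\<Gamma> # \<Delta>) (Suc l)" "act (\<Gamma> # \<Delta>) (Suc l)" "\<lambda>_. nu (Suc l + length \<Delta>)"
    by (rule fpp_trans_nu) (use wf Unq.hyps in simp)
  let ?c = "konst (CAT l) (ty l A) (cx l \<Gamma>')"
  have "act \<Delta> (Suc l) (Fm l ?c) f \<in> EW (cx n \<Gamma>) \<Delta> (Suc l) (Fo l (Expo (CAT l) (cx l \<Gamma>') (ty l A)))"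
    using T.F.act_in[of "Fm l ?c" f] IH(2) A wf Unq.hyps by simp
  moreover have "nu n (act \<Delta> (Suc l) (Fm l ?c) f) = act (\<Gamma> # \<Delta>) (Suc l) (Fm l ?c) (nu n f)"
    using T.trans_act[of "Fm l ?c" f] IH(2) A wf Unq.hyps by simp
  moreover have "butlast (\<Gamma> # \<Delta> @ [\<Gamma>']) = \<Gamma> # \<Delta>" "cur (\<Gamma> # \<Delta> @ [\<Gamma>']) = \<Gamma>'" by (simp_all add: butlast_append)
  ultimately show ?case
    using IH A0 Unq.hyps by (simp add: EW_snoc Let_def tyof act_def)
next
  case (Unq_empty l M A f \<Gamma>')
  have A0: "ity [] (Suc l) M (Box A')" using Unq_empty.prems(2) by auto
  have IH: "A' = A" "f \<in> El [] (Suc l) (Fo l (ty l A))" "f = sem [] (Suc l) M"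
    using Unq_empty.IH[OF _ A0] by auto
  have A: "wf_ty l A" using ity_wf_ty[OF A0] IH by simp
  let ?N = "normal_map (CAT l) (CAT (Suc l)) (BOX \<CC> l)" and ?H = "hom (CAT l) (Unit (CAT l)) (ty l A)"
  have "f \<in> ?N ` ?H"
    using BOX_normal[of l] A IH(2) by (simp add: is_normal_def bij_betw_def El_Nil)
  then have "inv_into ?H ?N f \<in> ?H" "?N (inv_into ?H ?N f) = f"
    by (auto intro: inv_into_into f_inv_into_f)
  then show ?case
    using IH A A0 Unq_empty.prems nu_const[of "inv_into ?H ?N f" l "ty l A" "cx l \<Gamma>'"]
    by (simp add: EW_Nil C.in_hom_iff act_Nil Let_def tyof)
next
  case (Emp l M A f)
  then have "ity [[]] l M A'" by (simp add: ity_Nil_iff)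
  then have IH: "A' = A" "f \<in> El [] l (ty l A)" "nu l f = sem [[]] l M"
    using Emp.IH by (auto simp: EW_Nil El_Nil)
  have A: "wf_ty l A" using ity_wf_ty[OF Emp.prems(2)] IH by simp
  have "nu l (sem [] l M) = sem [[]] l M" "sem [] l M \<in> El [] l (ty l A)"
    using sem_pad[OF Emp.prems(2)] sem_in[OF Emp.prems(2)] IH by auto
  then have "sem [] l M = f" using nu_inj[of "Unit (CAT l)" l "ty l A" f "sem [] l M"] IH A by (simp add: El_Nil)
  then show ?case using IH by simp
next
  case (Emp' l M A f)
  then have i: "ity [] l M A'" by (simp add: ity_Nil_iff)
  then have IH: "A' = A" "f \<in> El [] l (ty l A)" "f = sem [] l M"
    using Emp'.IH by auto
  then show ?case using sem_pad[OF i] by (simp add: EW_Nil El_Nil)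
qed

text \<open>The clauses for application, pairs, projections and unit require a leftmost context; the
  empty stack is handled by reading it as \<open>[[]]\<close>.\<close>

lemma interp_stack: "\<exists>\<Gamma> \<Delta>. \<forall>l M A f. interp \<CC> \<beta> S l M A f \<longleftrightarrow> interp \<CC> \<beta> (\<Gamma> # \<Delta>) l M A f"
  by (cases S) (auto intro: interp.Emp interp.Emp')

lemma interp_exists: "S \<turnstile>\<^bsub>l\<^esub> M : A \<Longrightarrow> \<exists>f. interp \<CC> \<beta> S l M A f"
proof (induction rule: typing.induct)
  case (Var l \<Delta> \<Gamma> i)
  then show ?case
  proof (induction \<Delta>)
    case Nil
    then show ?case using interp.Var[of i \<Gamma> \<CC> \<beta> l] by auto
  next
    case (Cons \<Gamma>0 \<Delta>)
    then obtain f where "interp \<CC> \<beta> (\<Delta> @ [\<Gamma>]) l (Var i) (\<Gamma> ! i) f" by auto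
    then show ?case
      by (cases "\<Delta> @ [\<Gamma>]" rule: list.exhaust) (auto dest: interp.Var_stack[OF _ refl])
  qed
next
  case (Abs \<Delta> A \<Gamma> l M B)
  then obtain f where "interp \<CC> \<beta> (\<Delta> @ [A # \<Gamma>]) l M B f" by blast
  then show ?case
    by (cases \<Delta> rule: list.exhaust) (auto dest: interp.Abs interp.Abs_stack[OF _ refl])
next
  case (App \<Delta> l M A B N)
  then show ?case
    using interp_stack[of \<Delta>] interp.App[OF _ _ refl refl refl] by metis
next
  case (Pair \<Delta> l M A N B)
  then show ?case
    using interp_stack[of \<Delta>] interp.Pair[OF _ _ refl] by metis
next
  case (Fst \<Delta> l M A B)
  then show ?case
    using interp_stack[of \<Delta>] interp.Fst[OF _ refl] by metis
next
  case (Snd \<Delta> l M A B)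
  then show ?case
    using interp_stack[of \<Delta>] interp.Snd[OF _ refl] by metis
next
  case (Star l \<Delta>)
  then show ?case
    using interp_stack[of \<Delta>] interp.Star[OF refl] by metis
next
  case (Quo \<Delta> l M A)
  then obtain f where "interp \<CC> \<beta> (\<Delta> @ [[]]) l M A f" by blast
  then show ?case
    by (cases \<Delta> rule: list.exhaust) (auto dest: interp.Quo_empty interp.Quo[OF _ refl])
next
  case (Unq \<Delta> l M A \<Gamma>)
  then obtain f where "interp \<CC> \<beta> \<Delta> (Suc l) M (Box A) f" by blast
  then show ?case
    by (cases \<Delta> rule: list.exhaust) (auto dest: interp.Unq_empty interp.Unq[OF _ refl refl refl])
qed (auto dest: interp.Emp interp.Emp')

text \<open>An element determines its arrow (\<open>den_inj\<close>), so \<open>interp_sem\<close>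
  leaves only one candidate for the description in \<open>denotation\<close>.\<close>

lemma denotation_den:
  assumes "S \<turnstile>\<^bsub>l\<^esub> M : A"
  shows "den S l (ty l A) (denotation \<CC> \<beta> S l M A) (sem S l M)"
proof -
  note i = typing_imp_ity[OF assms]
  obtain f where f: "interp \<CC> \<beta> S l M A f" using interp_exists[OF assms] by blast
  have "g = f" if "interp \<CC> \<beta> S l M A g" for g
    using interp_sem[OF that, of A] interp_sem[OF f, of A] i den_inj[of l S "ty l A" g _ f] ity_wf_ty[of S l M A] by auto
  then have "denotation \<CC> \<beta> S l M A = f" unfolding denotation_def using f by blast
  then show ?thesis using interp_sem[OF f] i by blast
qed

lemma denotation_eq_iff:
  assumes "S \<turnstile>\<^bsub>l\<^esub> M : A" "S \<turnstile>\<^bsub>l\<^esub> N : A"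
  shows "denotation \<CC> \<beta> S l M A = denotation \<CC> \<beta> S l N A \<longleftrightarrow> sem S l M = sem S l N"
  using assms[THEN denotation_den] typing_imp_ity[OF assms(1)] ity_wf_ty[of S l M A]
  by (intro den_inj[of l S "ty l A"]) auto

end

section \<open>Substitution and soundness\<close>

text \<open>Substituting into a weakened variable weakens the result of substituting into the
  variable: the semantic counterpart of \<open>up\<close> on old variables.\<close>

lemma (in fpp) star_lft_Proj1:
  assumes "f \<in> Ar C" "Dom C f = X" "Cod C f = Y" "X' \<in> Ob C" "A \<in> Ob C" "s \<in> E (Expo C X' X)"
  shows "star (Times C X' A) (Times C X A) Y (lft X' X A s) (nm (f \<cdot> Proj1 C X A)) =
    star (Times C X' A) X' Y (nm (Proj1 C X' A)) (star X' X Y s (nm f))"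
proof -
  have X: "X \<in> Ob C" "Y \<in> Ob C" using assms by auto
  have "star (Times C X' A) (Times C X A) Y (lft X' X A s) (nm (f \<cdot> Proj1 C X A)) =
      act (expo_map C (Times C X' A) f) (act (expo_map C (Times C X' A) (Proj1 C X A)) (lft X' X A s))"
    using assms X by (simp add: star_nm expo_map_Comp act_Comp)
  also have "\<dots> = star (Times C X' A) X' Y (nm (Proj1 C X' A)) (act (expo_map C X' f) s)"
    using assms X by (simp add: lft_Proj1 star_expo_map)
  also have "\<dots> = star (Times C X' A) X' Y (nm (Proj1 C X' A)) (star X' X Y s (nm f))"
    using assms X by (simp add: star_nm)
  finally show ?thesis .
qed

lemma (in fpp) star_lft_Proj2:
  assumes "X \<in> Ob C" "X' \<in> Ob C" "A \<in> Ob C" "s \<in> E (Expo C X' X)"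
  shows "star (Times C X' A) (Times C X A) A (lft X' X A s) (nm (Proj2 C X A)) = nm (Proj2 C X' A)"
  using assms by (simp add: star_nm lft_Proj2)

section \<open>The substitution lemma\<close>

context model
begin

abbreviation "St S m \<equiv> fpp.star (CAT m) (EB S m) (actB S m)"
abbreviation "Nm S m \<equiv> fpp.nm (CAT m) (EB S m) (actB S m)"
abbreviation "\<pi> \<equiv> ctx_proj \<CC> \<beta>"

lemma El_append: "El (S @ \<Gamma> # T) l = (\<lambda>X. EB S (l + length T) (Expo (CAT (l + length T)) (cx (l + length T) \<Gamma>) (so l T X)))"
  by (simp add: El_def EW_def fun_eq_iff so_append Let_def add_ac)

lemma act_append: "act (S @ \<Gamma> # T) l = (\<lambda>f. actB S (l + length T) (expo_map (CAT (l + length T)) (cx (l + length T) \<Gamma>) (sm l T f)))"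
  by (simp add: act_def fun_eq_iff sm_append Let_def add_ac)

text \<open>Precomposition with \<open>s\<close> takes place at the level \<open>m\<close> of the
  substituted context, whereas terms act at the level \<open>l\<close> at the right end. An arrow of
  level \<open>l\<close> acts through \<open>T\<close> as an arrow of level \<open>m\<close>, so
  \<open>star_expo_map\<close> gives naturality.\<close>

lemma fpp_trans_star:
  assumes "m = l + length T" "wf_stack l T" "wf_stack (Suc m) S" "wf_ctx m \<Gamma>" "wf_ctx m \<Gamma>'"
    "s \<in> EB S m (Expo (CAT m) (cx m \<Gamma>') (cx m \<Gamma>))"
  shows "fpp_trans (CAT l) (El (S @ \<Gamma> # T) l) (act (S @ \<Gamma> # T) l) (El (S @ \<Gamma>' # T) l) (act (S @ \<Gamma>' # T) l)
    (\<lambda>X. St S m (cx m \<Gamma>') (cx m \<Gamma>) (so l T X) s)"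
proof -
  interpret F: fpp "CAT l" "El (S @ \<Gamma> # T) l" "act (S @ \<Gamma> # T) l"
    by (rule fpp_El) (use assms in \<open>simp add: wf_stack_append\<close>)
  interpret G: fpp "CAT l" "El (S @ \<Gamma>' # T) l" "act (S @ \<Gamma>' # T) l"
    by (rule fpp_El) (use assms in \<open>simp add: wf_stack_append\<close>)
  interpret B: fpp "CAT m" "EB S m" "actB S m" by (rule fpp_EB) fact
  show ?thesis
  proof
    show "B.star (cx m \<Gamma>') (cx m \<Gamma>) (so l T X) s a \<in> El (S @ \<Gamma>' # T) l X"
      if "X \<in> Ob (CAT l)" "a \<in> El (S @ \<Gamma> # T) l X" for X a
      using that assms so_Ob[of l T X] B.star_in[of "cx m \<Gamma>" "cx m \<Gamma>'" "so l T X" s a] by (simp add: El_append)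
    show "B.star (cx m \<Gamma>') (cx m \<Gamma>) (so l T (Cod (CAT l) f)) s (act (S @ \<Gamma> # T) l f a) =
        act (S @ \<Gamma>' # T) l f (B.star (cx m \<Gamma>') (cx m \<Gamma>) (so l T (Dom (CAT l) f)) s a)"
      if "f \<in> Ar (CAT l)" "a \<in> El (S @ \<Gamma> # T) l (Dom (CAT l) f)" for f a
      unfolding act_append
      using that assms sm_simps[of l T f]
        B.star_expo_map[of "sm l T f" "cx m \<Gamma>" "cx m \<Gamma>'" a s "so l T (Cod (CAT l) f)" "so l T (Dom (CAT l) f)"]
      by (simp add: El_append)
  qed
qed

text \<open>The morphism \<open>s\<close> interprets the substitution \<open>\<sigma>\<close>.\<close>

definition sub_sem :: "'b stack \<Rightarrow> nat \<Rightarrow> 'b ctx \<Rightarrow> 'b ctx \<Rightarrow> (nat \<Rightarrow> 'b tm) \<Rightarrow> 'm \<Rightarrow> bool" where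
  "sub_sem S m \<Gamma> \<Gamma>' \<sigma> s \<longleftrightarrow> wf_ctx m \<Gamma> \<and> wf_ctx m \<Gamma>' \<and> s \<in> EB S m (Expo (CAT m) (cx m \<Gamma>') (cx m \<Gamma>)) \<and>
     (\<forall>i<length \<Gamma>. ity (S @ [\<Gamma>']) m (\<sigma> i) (\<Gamma> ! i) \<and>
        St S m (cx m \<Gamma>') (cx m \<Gamma>) (ty m (\<Gamma> ! i)) s (Nm S m (\<pi> m \<Gamma> i)) = sem (S @ [\<Gamma>']) m (\<sigma> i))"

text \<open>The class \<open>P\<close> of substitutions is left open to avoid a circularity: that
  \<open>sub_sem\<close> is stable under \<open>up\<close> needs the semantics of
  \<open>lift\<close>, which is itself a substitution. The lemma is applied first to renamings,
  which gives \<open>sem_lift\<close>, and then to \<open>sub_sem\<close>. The stack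
  \<open>T\<close> lies to the right of the substituted context, and its length is the depth of the
  substitution.\<close>

lemma sem_sub:
  assumes S: "wf_stack (Suc m) S"
    and P_sub_sem: "\<And>\<Gamma> \<Gamma>' \<sigma> s. P \<Gamma> \<Gamma>' \<sigma> s \<Longrightarrow> sub_sem S m \<Gamma> \<Gamma>' \<sigma> s"
    and P_up: "\<And>\<Gamma> \<Gamma>' \<sigma> s A. P \<Gamma> \<Gamma>' \<sigma> s \<Longrightarrow> wf_ty m A \<Longrightarrow> P (A # \<Gamma>) (A # \<Gamma>') (up \<sigma>)
      (fpp.lft (CAT m) (actB S m) (cx m \<Gamma>') (cx m \<Gamma>) (ty m A) s)"
  shows "ity W l M A \<Longrightarrow> W = S @ \<Gamma> # T \<Longrightarrow> m = l + length T \<Longrightarrow> wf_stack l T \<Longrightarrow> P \<Gamma> \<Gamma>' \<sigma> s \<Longrightarrow>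
    ity (S @ \<Gamma>' # T) l (sub (length T) \<sigma> M) A \<and>
    sem (S @ \<Gamma>' # T) l (sub (length T) \<sigma> M) = St S m (cx m \<Gamma>') (cx m \<Gamma>) (so l T (ty l A)) s (sem W l M)"
proof (induction arbitrary: \<Gamma> \<Gamma>' \<sigma> s T rule: ity.induct)
  case (Var i W l)
  note R = P_sub_sem[OF Var.prems(4), unfolded sub_sem_def]
  \<comment> \<open>For empty \<open>T\<close> the variable belongs to the substituted context and
    the claim is part of \<open>sub_sem\<close>. Otherwise it belongs to the last context of
    \<open>T\<close>; its element is then a named arrow, which natural transformations
    preserve.\<close>
  show ?case
  proof (cases T rule: rev_cases)
    case Nil
    then show ?thesis using R Var.hyps Var.prems(1,2) by simp
  next
    case (snoc T' \<Delta>)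
    have m: "m = Suc l + length T'" "wf_stack (Suc l) T'" "wf_ctx l \<Delta>" using Var.prems snoc by simp_all
    have b: "butlast (S @ \<Gamma> # T' @ [\<Delta>]) = S @ \<Gamma> # T'" "cur (S @ \<Gamma> # T' @ [\<Delta>]) = \<Delta>" for \<Gamma>
      by (simp_all add: butlast_append cur_def)
    interpret T: fpp_trans "CAT (Suc l)" "El (S @ \<Gamma> # T') (Suc l)" "act (S @ \<Gamma> # T') (Suc l)"
      "El (S @ \<Gamma>' # T') (Suc l)" "act (S @ \<Gamma>' # T') (Suc l)" "\<lambda>X. St S m (cx m \<Gamma>') (cx m \<Gamma>) (so (Suc l) T' X) s"
      by (rule fpp_trans_star) (use m R S in simp_all)
    interpret T': fpp_trans "CAT l" "EB (S @ \<Gamma> # T') l" "actB (S @ \<Gamma> # T') l"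
      "EB (S @ \<Gamma>' # T') l" "actB (S @ \<Gamma>' # T') l" "\<lambda>X. St S m (cx m \<Gamma>') (cx m \<Gamma>) (so (Suc l) T' (Fo l X)) s"
      by (rule T.fpp_trans_functor[OF is_ccc_CAT BOX_functor BOX_products])
    have i: "i < length \<Delta>" using Var.hyps Var.prems(1) snoc by (simp add: b)
    have "ity (S @ \<Gamma>' # T' @ [\<Delta>]) l (Var i) (\<Delta> ! i)"
      using ity.Var[of i "S @ \<Gamma>' # T' @ [\<Delta>]" l] i by (simp only: b)
    then show ?thesis
      using T'.trans_nm[of "\<pi> l \<Delta> i", OF _ refl refl] m i Var.prems(1) snoc by (simp add: b so_append Let_def)
  qed
next
  case (Lam l A W M B)
  note R = P_sub_sem[OF Lam.prems(4), unfolded sub_sem_def]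
  have W: "wf_stack l W" using Lam.prems R S by (simp add: wf_stack_append)
  have B: "wf_ty l B" using ity_wf_ty[OF Lam.hyps(2)] Lam.hyps(1) wf_butlast_cur[OF W] by simp
  \<comment> \<open>Only for empty \<open>T\<close> does the binder extend the substituted context,
    which calls for \<open>up\<close> and \<open>star_curry\<close>. Otherwise it extends the last
    context of \<open>T\<close>, and naturality suffices.\<close>
  show ?case
  proof (cases T rule: rev_cases)
    case Nil
    have m: "m = l" "W = S @ [\<Gamma>]" using Lam.prems Nil by simp_all
    interpret B: fpp "CAT m" "EB S m" "actB S m" by (rule fpp_EB) fact
    note IH = Lam.IH[of "A # \<Gamma>" "[]", OF _ _ _ P_up[OF Lam.prems(4)]]
    have M: "sem (S @ [A # \<Gamma>]) l M \<in> EB S l (Expo (CAT l) (Times (CAT l) (cx l \<Gamma>) (ty l A)) (ty l B))"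
      using sem_in[OF Lam.hyps(2)] m S R Lam.hyps by (simp add: El_snoc)
    have IH: "ity (S @ [A # \<Gamma>']) l (sub 0 (up \<sigma>) M) B"
      "sem (S @ [A # \<Gamma>']) l (sub 0 (up \<sigma>) M) = B.star (cx l (A # \<Gamma>')) (cx l (A # \<Gamma>)) (ty l B)
         (B.lft (cx l \<Gamma>') (cx l \<Gamma>) (ty l A) s) (sem (S @ [A # \<Gamma>]) l M)"
      using IH m Lam.hyps(1) by simp_all
    have "ity (S @ [\<Gamma>']) l (Lam A (sub 0 (up \<sigma>) M)) (A \<rightarrow> B)"
      using IH Lam.hyps(1) by (auto intro: ity.Lam)
    then show ?thesis
      using B.star_curry[of "cx m \<Gamma>" "cx m \<Gamma>'" "ty m A" "ty m B" s "sem (S @ [A # \<Gamma>]) m M"]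
        R Lam.hyps B M IH Nil m tyof[OF IH(1)] tyof[OF Lam.hyps(2)]
      by (simp add: Let_def)
  next
    case (snoc T' \<Delta>)
    have m: "m = Suc l + length T'" "wf_stack (Suc l) T'" "wf_ctx l \<Delta>" using Lam.prems snoc by simp_all
    have b: "butlast (S @ \<Gamma> # T' @ [\<Delta>]) = S @ \<Gamma> # T'" "cur (S @ \<Gamma> # T' @ [\<Delta>]) = \<Delta>" for \<Gamma>
      by (simp_all add: butlast_append cur_def)
    have dn: "dn (S @ \<Gamma> # T' @ [\<Delta>]) l X a = a" for \<Gamma> X a by (simp add: dn_def)
    have W: "W = S @ \<Gamma> # T' @ [\<Delta>]" using Lam.prems snoc by simp
    interpret T: fpp_trans "CAT (Suc l)" "El (S @ \<Gamma> # T') (Suc l)" "act (S @ \<Gamma> # T') (Suc l)"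
      "El (S @ \<Gamma>' # T') (Suc l)" "act (S @ \<Gamma>' # T') (Suc l)" "\<lambda>X. St S m (cx m \<Gamma>') (cx m \<Gamma>) (so (Suc l) T' X) s"
      by (rule fpp_trans_star) (use m R S in simp_all)
    have IH: "ity (S @ \<Gamma>' # T' @ [A # \<Delta>]) l (sub (length T) \<sigma> M) B"
      "sem (S @ \<Gamma>' # T' @ [A # \<Delta>]) l (sub (length T) \<sigma> M) =
        St S m (cx m \<Gamma>') (cx m \<Gamma>) (so l (T' @ [A # \<Delta>]) (ty l B)) s (sem (S @ \<Gamma> # T' @ [A # \<Delta>]) l M)"
      using Lam.IH[of \<Gamma> "T' @ [A # \<Delta>]", OF _ _ _ Lam.prems(4)] Lam.hyps(1) m snoc by (simp_all add: b W)
    have "ity (S @ \<Gamma>' # T' @ [\<Delta>]) l (Lam A (sub (length T) \<sigma> M)) (A \<rightarrow> B)"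
      using IH(1) Lam.hyps(1) by (intro ity.Lam) (simp_all add: b)
    moreover have "sem (S @ \<Gamma> # T' @ [A # \<Delta>]) l M \<in> EB (S @ \<Gamma> # T') l (Expo (CAT l) (cx l (A # \<Delta>)) (ty l B))"
      using sem_in[OF Lam.hyps(2)] m S R Lam.hyps El_snoc[of "S @ \<Gamma> # T'" "A # \<Delta>" l]
      by (simp add: W b wf_stack_append)
    ultimately show ?thesis
      using T.trans_act[of "Fm l (curry_iso (CAT l) (cx l \<Delta>) (ty l A) (ty l B))" "sem (S @ \<Gamma> # T' @ [A # \<Delta>]) l M"]
        m IH B Lam.hyps tyof[OF IH(1)] tyof[OF Lam.hyps(2)[unfolded W]] snoc
      by (simp add: W b dn so_append Let_def)
  qed
next
  case (App W l M A B N)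
  note R = P_sub_sem[OF App.prems(4), unfolded sub_sem_def]
  have W: "wf_stack l W" using App.prems R S by (simp add: wf_stack_append)
  interpret T: fpp_trans "CAT l" "El (S @ \<Gamma> # T) l" "act (S @ \<Gamma> # T) l"
    "El (S @ \<Gamma>' # T) l" "act (S @ \<Gamma>' # T) l" "\<lambda>X. St S m (cx m \<Gamma>') (cx m \<Gamma>) (so l T X) s"
    by (rule fpp_trans_star) (use App.prems R S in simp_all)
  note IH = App.IH(1)[OF App.prems] App.IH(2)[OF App.prems]
  have wf: "wf_ty l A" "wf_ty l B" using ity_wf_ty[OF App.hyps(1) W] by auto
  have M: "sem (S @ \<Gamma> # T) l M \<in> El (S @ \<Gamma> # T) l (Expo (CAT l) (ty l A) (ty l B))"
    using sem_in[OF App.hyps(1) W] App.prems by simp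
  have N: "sem (S @ \<Gamma> # T) l N \<in> El (S @ \<Gamma> # T) l (ty l A)"
    using sem_in[OF App.hyps(2) W] App.prems by simp
  show ?case
    using IH App.hyps wf M N App.prems(1)
      T.trans_pr[of "Expo (CAT l) (ty l A) (ty l B)" "ty l A" "sem (S @ \<Gamma> # T) l M" "sem (S @ \<Gamma> # T) l N"]
      T.trans_act[of "Eval (CAT l) (ty l A) (ty l B)"
        "T.F.pr (Expo (CAT l) (ty l A) (ty l B)) (ty l A) (sem (S @ \<Gamma> # T) l M) (sem (S @ \<Gamma> # T) l N)"]
    by (auto intro: ity.App simp: Let_def T.F.pr_props App.hyps[unfolded App.prems(1), THEN tyof] IH[THEN conjunct1, THEN tyof])
next
  case (Pair W l M A N B)
  note R = P_sub_sem[OF Pair.prems(4), unfolded sub_sem_def]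
  have W: "wf_stack l W" using Pair.prems R S by (simp add: wf_stack_append)
  interpret T: fpp_trans "CAT l" "El (S @ \<Gamma> # T) l" "act (S @ \<Gamma> # T) l"
    "El (S @ \<Gamma>' # T) l" "act (S @ \<Gamma>' # T) l" "\<lambda>X. St S m (cx m \<Gamma>') (cx m \<Gamma>) (so l T X) s"
    by (rule fpp_trans_star) (use Pair.prems R S in simp_all)
  note IH = Pair.IH(1)[OF Pair.prems] Pair.IH(2)[OF Pair.prems]
  have wf: "wf_ty l A" "wf_ty l B" using ity_wf_ty[OF _ W] Pair.hyps by blast+
  have M: "sem (S @ \<Gamma> # T) l M \<in> El (S @ \<Gamma> # T) l (ty l A)"
    using sem_in[OF Pair.hyps(1) W] Pair.prems by simp
  have N: "sem (S @ \<Gamma> # T) l N \<in> El (S @ \<Gamma> # T) l (ty l B)"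
    using sem_in[OF Pair.hyps(2) W] Pair.prems by simp
  show ?case
    using IH Pair.hyps wf M N Pair.prems(1)
      T.trans_pr[of "ty l A" "ty l B" "sem (S @ \<Gamma> # T) l M" "sem (S @ \<Gamma> # T) l N"]
    by (auto intro: ity.Pair simp: Pair.hyps[unfolded Pair.prems(1), THEN tyof] IH[THEN conjunct1, THEN tyof])
next
  case (Fst W l M A B)
  note R = P_sub_sem[OF Fst.prems(4), unfolded sub_sem_def]
  have W: "wf_stack l W" using Fst.prems R S by (simp add: wf_stack_append)
  interpret T: fpp_trans "CAT l" "El (S @ \<Gamma> # T) l" "act (S @ \<Gamma> # T) l"
    "El (S @ \<Gamma>' # T) l" "act (S @ \<Gamma>' # T) l" "\<lambda>X. St S m (cx m \<Gamma>') (cx m \<Gamma>) (so l T X) s"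
    by (rule fpp_trans_star) (use Fst.prems R S in simp_all)
  have wf: "wf_ty l A" "wf_ty l B" using ity_wf_ty[OF Fst.hyps W] by auto
  show ?case
    using Fst.IH[OF Fst.prems] Fst.hyps wf sem_in[OF Fst.hyps W] Fst.prems(1)
      T.trans_act[of "Proj1 (CAT l) (ty l A) (ty l B)" "sem (S @ \<Gamma> # T) l M"]
    by (auto intro: ity.Fst simp: Fst.hyps[unfolded Fst.prems(1), THEN tyof] Fst.IH[OF Fst.prems, THEN conjunct1, THEN tyof])
next
  case (Snd W l M A B)
  note R = P_sub_sem[OF Snd.prems(4), unfolded sub_sem_def]
  have W: "wf_stack l W" using Snd.prems R S by (simp add: wf_stack_append)
  interpret T: fpp_trans "CAT l" "El (S @ \<Gamma> # T) l" "act (S @ \<Gamma> # T) l"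
    "El (S @ \<Gamma>' # T) l" "act (S @ \<Gamma>' # T) l" "\<lambda>X. St S m (cx m \<Gamma>') (cx m \<Gamma>) (so l T X) s"
    by (rule fpp_trans_star) (use Snd.prems R S in simp_all)
  have wf: "wf_ty l A" "wf_ty l B" using ity_wf_ty[OF Snd.hyps W] by auto
  show ?case
    using Snd.IH[OF Snd.prems] Snd.hyps wf sem_in[OF Snd.hyps W] Snd.prems(1)
      T.trans_act[of "Proj2 (CAT l) (ty l A) (ty l B)" "sem (S @ \<Gamma> # T) l M"]
    by (auto intro: ity.Snd simp: Snd.hyps[unfolded Snd.prems(1), THEN tyof] Snd.IH[OF Snd.prems, THEN conjunct1, THEN tyof])
next
  case (Star W l)
  note R = P_sub_sem[OF Star.prems(4), unfolded sub_sem_def]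
  interpret T: fpp_trans "CAT l" "El (S @ \<Gamma> # T) l" "act (S @ \<Gamma> # T) l"
    "El (S @ \<Gamma>' # T) l" "act (S @ \<Gamma>' # T) l" "\<lambda>X. St S m (cx m \<Gamma>') (cx m \<Gamma>) (so l T X) s"
    by (rule fpp_trans_star) (use Star.prems R S in simp_all)
  show ?case using T.trans_un Star.prems(1) by (simp add: ity.Star)
next
  case (Quo W l M A)
  note R = P_sub_sem[OF Quo.prems(4), unfolded sub_sem_def]
  have W: "wf_stack (Suc l) W" using Quo.prems R S by (simp add: wf_stack_append)
  interpret T: fpp_trans "CAT (Suc l)" "El (S @ \<Gamma> # T) (Suc l)" "act (S @ \<Gamma> # T) (Suc l)"
    "El (S @ \<Gamma>' # T) (Suc l)" "act (S @ \<Gamma>' # T) (Suc l)" "\<lambda>X. St S m (cx m \<Gamma>') (cx m \<Gamma>) (so (Suc l) T X) s"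
    by (rule fpp_trans_star) (use Quo.prems R S in simp_all)
  have A: "wf_ty l A" using ity_wf_ty[OF Quo.hyps] W by simp
  have IH: "ity (S @ \<Gamma>' # T @ [[]]) l (sub (Suc (length T)) \<sigma> M) A"
    "sem (S @ \<Gamma>' # T @ [[]]) l (sub (Suc (length T)) \<sigma> M) =
      St S m (cx m \<Gamma>') (cx m \<Gamma>) (so l (T @ [[]]) (ty l A)) s (sem (S @ \<Gamma> # T @ [[]]) l M)"
    using Quo.IH[of \<Gamma> "T @ [[]]", OF _ _ _ Quo.prems(4)] Quo.prems by simp_all
  have "sem (S @ \<Gamma> # T @ [[]]) l M \<in> EB (S @ \<Gamma> # T) l (Expo (CAT l) (Unit (CAT l)) (ty l A))"
    using sem_in[OF Quo.hyps] W Quo.prems(1) El_snoc[of "S @ \<Gamma> # T" "[]" l] by (simp add: wf_stack_append)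
  then show ?case
    using T.trans_act[of "Fm l (unit_expo_iso (CAT l) (ty l A))" "sem (S @ \<Gamma> # T @ [[]]) l M"]
      IH A Quo.prems tyof[OF IH(1)] tyof[OF Quo.hyps[unfolded Quo.prems(1)]]
    by (auto intro: ity.Quo simp: so_append Let_def)
next
  case (Unq W l M A)
  note R = P_sub_sem[OF Unq.prems(4), unfolded sub_sem_def]
  have W: "wf_stack l W" using Unq.prems R S by (simp add: wf_stack_append)
  have A: "wf_ty l A" using ity_wf_ty[OF Unq.hyps] wf_butlast_cur[OF W] by simp
  \<comment> \<open>For empty \<open>T\<close> the unquotation discards the substituted context:
    \<open>M\<close> stays as it is and \<open>star_konst\<close> absorbs \<open>s\<close>.
    Otherwise the substitution passes to \<open>M\<close> with the last context of \<open>T\<close>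
    removed.\<close>
  show ?case
  proof (cases T rule: rev_cases)
    case Nil
    have m: "m = l" "W = S @ [\<Gamma>]" using Unq.prems Nil by simp_all
    interpret B: fpp "CAT m" "EB S m" "actB S m" by (rule fpp_EB) fact
    have "sem S (Suc l) M \<in> EB S l (ty l A)" "ity S (Suc l) M (Box A)" "tyof S M = Box A"
      using sem_in[OF Unq.hyps] Unq.hyps tyof[OF Unq.hyps] m S by simp_all
    then show ?thesis
      using B.star_konst[of "cx m \<Gamma>" "cx m \<Gamma>'" "ty m A" "sem S (Suc l) M" s] m Nil A R
      by (auto intro: ity.Unq simp: Let_def)
  next
    case (snoc T' \<Delta>)
    have m: "m = Suc l + length T'" "wf_stack (Suc l) T'" "wf_ctx l \<Delta>" using Unq.prems snoc by simp_all
    have b: "butlast (S @ \<Gamma> # T' @ [\<Delta>]) = S @ \<Gamma> # T'" "cur (S @ \<Gamma> # T' @ [\<Delta>]) = \<Delta>" for \<Gamma>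
      by (simp_all add: butlast_append cur_def)
    have dn: "dn (S @ \<Gamma> # T' @ [\<Delta>]) l X a = a" for \<Gamma> X a by (simp add: dn_def)
    have W': "W = S @ \<Gamma> # T' @ [\<Delta>]" using Unq.prems snoc by simp
    interpret T: fpp_trans "CAT (Suc l)" "El (S @ \<Gamma> # T') (Suc l)" "act (S @ \<Gamma> # T') (Suc l)"
      "El (S @ \<Gamma>' # T') (Suc l)" "act (S @ \<Gamma>' # T') (Suc l)" "\<lambda>X. St S m (cx m \<Gamma>') (cx m \<Gamma>) (so (Suc l) T' X) s"
      by (rule fpp_trans_star) (use m R S in simp_all)
    have IH: "ity (S @ \<Gamma>' # T') (Suc l) (sub (length T') \<sigma> M) (Box A)"
      "sem (S @ \<Gamma>' # T') (Suc l) (sub (length T') \<sigma> M) =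
        St S m (cx m \<Gamma>') (cx m \<Gamma>) (so (Suc l) T' (ty (Suc l) (Box A))) s (sem (S @ \<Gamma> # T') (Suc l) M)"
      using Unq.IH[of \<Gamma> T', OF _ _ _ Unq.prems(4)] m by (simp_all add: b W')
    have "ity (S @ \<Gamma>' # T' @ [\<Delta>]) l (Unq (sub (length T') \<sigma> M)) A"
      using IH(1) by (intro ity.Unq) (simp add: b)
    moreover have "sem (S @ \<Gamma> # T') (Suc l) M \<in> EB (S @ \<Gamma> # T') l (ty l A)"
      using sem_in[OF Unq.hyps] wf_butlast_cur[OF W] by (simp add: W' b)
    moreover have "tyof (S @ \<Gamma> # T') M = Box A" using tyof[OF Unq.hyps] by (simp add: W' b)
    ultimately show ?thesis
      using T.trans_act[of "Fm l (konst (CAT l) (ty l A) (cx l \<Delta>))" "sem (S @ \<Gamma> # T') (Suc l) M"]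
        m IH A tyof[OF IH(1)] snoc
      by (simp add: W' b dn so_append Let_def)
  qed
qed

lemma sem_Var_snoc [simp]: "sem (S @ [\<Gamma>]) l (Var i) = Nm S l (\<pi> l \<Gamma> i)"
  by simp

lemma sem_lift:
  assumes "ity (S @ [\<Gamma>]) l M A" "wf_stack l (S @ [\<Gamma>])" "wf_ty l B"
  shows "ity (S @ [B # \<Gamma>]) l (lift 0 0 M) A"
    "sem (S @ [B # \<Gamma>]) l (lift 0 0 M) =
      St S l (cx l (B # \<Gamma>)) (cx l \<Gamma>) (ty l A) (Nm S l (Proj1 (CAT l) (cx l \<Gamma>) (ty l B))) (sem (S @ [\<Gamma>]) l M)"
proof -
  have S: "wf_stack (Suc l) S" "wf_ctx l \<Gamma>" using assms by simp_all
  interpret B: fpp "CAT l" "EB S l" "actB S l" by (rule fpp_EB) fact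
  \<comment> \<open>Substitutions of variables for variables. Stability under \<open>up\<close> is
    here a computation with projections and needs no weakening lemma.\<close>
  define P where "P \<Gamma> \<Gamma>' \<sigma> s \<longleftrightarrow> wf_ctx l \<Gamma> \<and> wf_ctx l \<Gamma>' \<and> s \<in> EB S l (Expo (CAT l) (cx l \<Gamma>') (cx l \<Gamma>)) \<and>
    (\<exists>\<rho>. \<sigma> = (\<lambda>i. Var (\<rho> i)) \<and> (\<forall>i<length \<Gamma>. \<rho> i < length \<Gamma>' \<and> \<Gamma>' ! \<rho> i = \<Gamma> ! i \<and>
      B.star (cx l \<Gamma>') (cx l \<Gamma>) (ty l (\<Gamma> ! i)) s (B.nm (\<pi> l \<Gamma> i)) = B.nm (\<pi> l \<Gamma>' (\<rho> i))))"
    for \<Gamma> \<Gamma>' :: "'b ctx" and \<sigma> :: "nat \<Rightarrow> 'b tm" and s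
  have P1: "sub_sem S l \<Gamma> \<Gamma>' \<sigma> s" if P: "P \<Gamma> \<Gamma>' \<sigma> s" for \<Gamma> \<Gamma>' \<sigma> s
  proof -
    obtain \<rho> where \<rho>: "\<sigma> = (\<lambda>i. Var (\<rho> i))" "\<And>i. i < length \<Gamma> \<Longrightarrow> \<rho> i < length \<Gamma>' \<and> \<Gamma>' ! \<rho> i = \<Gamma> ! i \<and>
      B.star (cx l \<Gamma>') (cx l \<Gamma>) (ty l (\<Gamma> ! i)) s (B.nm (\<pi> l \<Gamma> i)) = B.nm (\<pi> l \<Gamma>' (\<rho> i))"
      using P unfolding P_def by blast
    have "ity (S @ [\<Gamma>']) l (\<sigma> i) (\<Gamma> ! i)" if "i < length \<Gamma>" for i
      using \<rho>(2)[OF that] ity.Var[of "\<rho> i" "S @ [\<Gamma>']" l] by (simp add: \<rho>(1))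
    then show ?thesis using P \<rho> by (simp add: P_def sub_sem_def)
  qed
  have P2: "P (A # \<Gamma>) (A # \<Gamma>') (up \<sigma>) (B.lft (cx l \<Gamma>') (cx l \<Gamma>) (ty l A) s)"
    if P: "P \<Gamma> \<Gamma>' \<sigma> s" and A: "wf_ty l A" for \<Gamma> \<Gamma>' \<sigma> s A
  proof -
    obtain \<rho> where \<rho>: "\<sigma> = (\<lambda>i. Var (\<rho> i))" "\<And>i. i < length \<Gamma> \<Longrightarrow> \<rho> i < length \<Gamma>' \<and> \<Gamma>' ! \<rho> i = \<Gamma> ! i \<and>
      B.star (cx l \<Gamma>') (cx l \<Gamma>) (ty l (\<Gamma> ! i)) s (B.nm (\<pi> l \<Gamma> i)) = B.nm (\<pi> l \<Gamma>' (\<rho> i))"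
      using P unfolding P_def by blast
    have wf: "wf_ctx l \<Gamma>" "wf_ctx l \<Gamma>'" "s \<in> EB S l (Expo (CAT l) (cx l \<Gamma>') (cx l \<Gamma>))"
      using P unfolding P_def by blast+
    let ?\<rho> = "case_nat 0 (\<lambda>i. Suc (\<rho> i))"
    have "up \<sigma> = (\<lambda>i. Var (?\<rho> i))" by (auto simp: \<rho>(1) up_def fun_eq_iff split: nat.splits)
    moreover have "?\<rho> i < length (A # \<Gamma>') \<and> (A # \<Gamma>') ! ?\<rho> i = (A # \<Gamma>) ! i \<and>
      B.star (cx l (A # \<Gamma>')) (cx l (A # \<Gamma>)) (ty l ((A # \<Gamma>) ! i)) (B.lft (cx l \<Gamma>') (cx l \<Gamma>) (ty l A) s) (B.nm (\<pi> l (A # \<Gamma>) i))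
        = B.nm (\<pi> l (A # \<Gamma>') (?\<rho> i))"
      if "i < length (A # \<Gamma>)" for i
    proof (cases i)
      case 0
      then show ?thesis using wf A by (simp add: B.star_lft_Proj2)
    next
      case (Suc j)
      then show ?thesis
        using wf A \<rho>(2)[of j] that wf_ty_nth[of l \<Gamma> j]
          B.star_lft_Proj1[of "\<pi> l \<Gamma> j" "cx l \<Gamma>" "ty l (\<Gamma> ! j)" "cx l \<Gamma>'" "ty l A" s]
        by (simp add: B.star_nm B.expo_map_nm)
    qed
    ultimately show ?thesis unfolding P_def using wf A by (auto intro!: exI[of _ ?\<rho>])
  qed
  have "P \<Gamma> (B # \<Gamma>) (ren 0) (B.nm (Proj1 (CAT l) (cx l \<Gamma>) (ty l B)))"
    unfolding P_def
  proof (intro conjI exI[of _ Suc] allI impI)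
    fix i assume i: "i < length \<Gamma>"
    then show "B.star (cx l (B # \<Gamma>)) (cx l \<Gamma>) (ty l (\<Gamma> ! i)) (B.nm (Proj1 (CAT l) (cx l \<Gamma>) (ty l B))) (B.nm (\<pi> l \<Gamma> i)) =
        B.nm (\<pi> l (B # \<Gamma>) (Suc i))"
      using S assms(3) by (simp add: B.star_nm B.expo_map_nm)
  qed (use S assms(3) in \<open>auto simp: ren_def\<close>)
  then show "ity (S @ [B # \<Gamma>]) l (lift 0 0 M) A"
    "sem (S @ [B # \<Gamma>]) l (lift 0 0 M) =
      B.star (cx l (B # \<Gamma>)) (cx l \<Gamma>) (ty l A) (B.nm (Proj1 (CAT l) (cx l \<Gamma>) (ty l B))) (sem (S @ [\<Gamma>]) l M)"
    using sem_sub[of l S P, OF S(1) P1 P2 assms(1), of \<Gamma> "[]" "B # \<Gamma>"] by (simp_all add: lift_sub)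
qed

lemma sub_sem_up:
  assumes "wf_stack (Suc l) S" "sub_sem S l \<Gamma> \<Gamma>' \<sigma> s" and A: "wf_ty l A"
  shows "sub_sem S l (A # \<Gamma>) (A # \<Gamma>') (up \<sigma>) (fpp.lft (CAT l) (actB S l) (cx l \<Gamma>') (cx l \<Gamma>) (ty l A) s)"
proof -
  interpret B: fpp "CAT l" "EB S l" "actB S l" by (rule fpp_EB) fact
  note R = assms(2)[unfolded sub_sem_def]
  have "ity (S @ [A # \<Gamma>']) l (up \<sigma> i) ((A # \<Gamma>) ! i) \<and>
      B.star (cx l (A # \<Gamma>')) (cx l (A # \<Gamma>)) (ty l ((A # \<Gamma>) ! i)) (B.lft (cx l \<Gamma>') (cx l \<Gamma>) (ty l A) s) (B.nm (\<pi> l (A # \<Gamma>) i))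
        = sem (S @ [A # \<Gamma>']) l (up \<sigma> i)" if i: "i < length (A # \<Gamma>)" for i
  proof (cases i)
    case 0
    then show ?thesis using R A ity.Var[of 0 "S @ [A # \<Gamma>']" l] by (simp add: B.star_lft_Proj2)
  next
    case (Suc j)
    have "ity (S @ [\<Gamma>']) l (\<sigma> j) (\<Gamma> ! j)" using R i Suc by simp
    note * = sem_lift[OF this _ A]
    show ?thesis
      using R A * i assms(1) Suc wf_ty_nth[of l \<Gamma> j]
        B.star_lft_Proj1[of "\<pi> l \<Gamma> j" "cx l \<Gamma>" "ty l (\<Gamma> ! j)" "cx l \<Gamma>'" "ty l A" s]
      by simp
  qed
  then show ?thesis unfolding sub_sem_def using R A by simp
qed

lemma sem_subst:
  assumes "wf_stack (Suc l) S" "sub_sem S l \<Gamma> \<Gamma>' \<sigma> s" "ity (S @ [\<Gamma>]) l M A"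
  shows "ity (S @ [\<Gamma>']) l (sub 0 \<sigma> M) A"
    "sem (S @ [\<Gamma>']) l (sub 0 \<sigma> M) = St S l (cx l \<Gamma>') (cx l \<Gamma>) (ty l A) s (sem (S @ [\<Gamma>]) l M)"
  using sem_sub[of l S "sub_sem S l", OF assms(1) _ sub_sem_up[OF assms(1)] assms(3), of \<Gamma> "[]" \<Gamma>' \<sigma> s] assms(2)
  by simp_all

section \<open>Soundness of the equations\<close>

lemma sem_beta:
  assumes M: "ity (S @ [A # \<Gamma>]) l M B" and N: "ity (S @ [\<Gamma>]) l N A" and wf: "wf_stack l (S @ [A # \<Gamma>])"
  shows "ity (S @ [\<Gamma>]) l (subst 0 0 N M) B"
    "sem (S @ [\<Gamma>]) l (App (Lam A M) N) = sem (S @ [\<Gamma>]) l (subst 0 0 N M)"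
proof -
  have S: "wf_stack (Suc l) S" "wf_ctx l \<Gamma>" "wf_ty l A" using wf by simp_all
  have B: "wf_ty l B" by (rule ity_wf_ty[OF M wf])
  interpret B: fpp "CAT l" "EB S l" "actB S l" by (rule fpp_EB) fact
  interpret F: fpp "CAT l" "El (S @ [\<Gamma>]) l" "act (S @ [\<Gamma>]) l" by (rule fpp_El) (use S in simp)
  let ?n = "sem (S @ [\<Gamma>]) l N" and ?X = "cx l \<Gamma>" and ?A = "ty l A" and ?B = "ty l B"
  let ?F = "Expo (CAT l) ?A ?B"
  have n: "?n \<in> EB S l (Expo (CAT l) ?X ?A)" using sem_in[OF N] S by (simp add: El_snoc)
  have m: "sem (S @ [A # \<Gamma>]) l M \<in> EB S l (Expo (CAT l) (Times (CAT l) ?X ?A) ?B)" using sem_in[OF M] wf by (simp add: El_snoc)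
  let ?m = "actB S l (curry_iso (CAT l) ?X ?A ?B) (sem (S @ [A # \<Gamma>]) l M)"
  \<comment> \<open>Index 0 becomes \<open>N\<close>, read off by the second projection
    (\<open>sgl_Proj2\<close>); the other indices drop by one and are read off the identity in the
    first component (\<open>sgl_Proj1\<close>).\<close>
  have "sub_sem S l (A # \<Gamma>) \<Gamma> (single 0 N) (B.sgl ?X ?A ?n)"
  proof -
    have "ity (S @ [\<Gamma>]) l (single 0 N i) ((A # \<Gamma>) ! i) \<and>
        B.star ?X (cx l (A # \<Gamma>)) (ty l ((A # \<Gamma>) ! i)) (B.sgl ?X ?A ?n) (B.nm (\<pi> l (A # \<Gamma>) i)) = sem (S @ [\<Gamma>]) l (single 0 N i)"
      if i: "i < length (A # \<Gamma>)" for i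
    proof (cases i)
      case 0
      then show ?thesis using n S N by (simp add: single_def B.star_nm B.sgl_Proj2)
    next
      case (Suc j)
      have "actB S l (expo_map (CAT l) ?X (\<pi> l \<Gamma> j \<cdot>\<^bsub>CAT l\<^esub> Proj1 (CAT l) ?X ?A)) (B.sgl ?X ?A ?n) = B.nm (\<pi> l \<Gamma> j)"
        using B.act_Comp[of "expo_map (CAT l) ?X (Proj1 (CAT l) ?X ?A)" "expo_map (CAT l) ?X (\<pi> l \<Gamma> j)" "B.sgl ?X ?A ?n"]
          i Suc S n by (simp add: B.expo_map_Comp B.sgl_Proj1 B.expo_map_nm)
      then show ?thesis
        using n S i Suc ity.Var[of j "S @ [\<Gamma>]" l] wf_ty_nth[of l \<Gamma> j] by (simp add: single_def B.star_nm)
    qed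
    then show ?thesis using S n by (simp add: sub_sem_def)
  qed
  note sub = sem_subst[OF S(1) this M]
  then show "ity (S @ [\<Gamma>]) l (subst 0 0 N M) B" by (simp add: subst_sub)
  have fm: "?m \<in> El (S @ [\<Gamma>]) l ?F" "?n \<in> El (S @ [\<Gamma>]) l ?A" using m n S B by (simp_all add: El_snoc)
  note pr = F.pr_props[OF _ _ this]
  have "act (S @ [\<Gamma>]) l (Eval (CAT l) ?A ?B) (F.pr ?F ?A ?m ?n) =
      B.star ?X (cx l (A # \<Gamma>)) ?B (B.sgl ?X ?A ?n) (sem (S @ [A # \<Gamma>]) l M)"
    using B.star_beta[of ?X ?A ?B "sem (S @ [A # \<Gamma>]) l M" ?n "F.pr ?F ?A ?m ?n"] pr S B m n
    by (simp add: act_snoc El_snoc)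
  then show "sem (S @ [\<Gamma>]) l (App (Lam A M) N) = sem (S @ [\<Gamma>]) l (subst 0 0 N M)"
    using sub(2) tyof[OF M] tyof[OF N] by (simp add: Let_def subst_sub)
qed

lemma sem_eta:
  assumes M: "ity (S @ [\<Gamma>]) l M (A \<rightarrow> B)" and wf: "wf_stack l (S @ [\<Gamma>])"
  shows "ity (S @ [\<Gamma>]) l (Lam A (App (lift 0 0 M) (Var 0))) (A \<rightarrow> B)"
    "sem (S @ [\<Gamma>]) l (Lam A (App (lift 0 0 M) (Var 0))) = sem (S @ [\<Gamma>]) l M"
proof -
  have S: "wf_stack (Suc l) S" "wf_ctx l \<Gamma>" "wf_ty l A" "wf_ty l B" using wf ity_wf_ty[OF M wf] by simp_all
  interpret B: fpp "CAT l" "EB S l" "actB S l" by (rule fpp_EB) fact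
  interpret F: fpp "CAT l" "El (S @ [A # \<Gamma>]) l" "act (S @ [A # \<Gamma>]) l" by (rule fpp_El) (use S in simp)
  note L = sem_lift[OF M wf S(3)]
  have V: "ity (S @ [A # \<Gamma>]) l (Var 0) A" using ity.Var[of 0 "S @ [A # \<Gamma>]" l] by simp
  show i: "ity (S @ [\<Gamma>]) l (Lam A (App (lift 0 0 M) (Var 0))) (A \<rightarrow> B)"
    by (rule ity.Lam[OF S(3)]) (use ity.App[OF L(1) V] in simp)
  let ?X = "cx l \<Gamma>" and ?A = "ty l A" and ?B = "ty l B"
  let ?F = "Expo (CAT l) ?A ?B"
  let ?m = "sem (S @ [A # \<Gamma>]) l (lift 0 0 M)" and ?v = "sem (S @ [A # \<Gamma>]) l (Var 0)"
  have "?m \<in> El (S @ [A # \<Gamma>]) l ?F" "?v \<in> El (S @ [A # \<Gamma>]) l ?A"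
    using sem_in[OF L(1)] sem_in[OF V] S by simp_all
  note pr = F.pr_props[OF _ _ this]
  have "sem (S @ [\<Gamma>]) l M \<in> EB S l (Expo (CAT l) ?X ?F)" using sem_in[OF M wf] by (simp add: El_snoc)
  then have "actB S l (curry_iso (CAT l) ?X ?A ?B) (act (S @ [A # \<Gamma>]) l (Eval (CAT l) ?A ?B) (F.pr ?F ?A ?m ?v)) = sem (S @ [\<Gamma>]) l M"
    using B.star_eta[of ?X ?A ?B "sem (S @ [\<Gamma>]) l M" "F.pr ?F ?A ?m ?v"] pr S L(2)
    by (simp add: act_snoc El_snoc)
  then show "sem (S @ [\<Gamma>]) l (Lam A (App (lift 0 0 M) (Var 0))) = sem (S @ [\<Gamma>]) l M"
    using tyof[OF L(1)] by (simp add: Let_def)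
qed

lemma sem_weaken:
  assumes M: "ity (S @ [[]]) l M A" and wf: "wf_stack l (S @ [\<Gamma>])"
  shows "sem (S @ [\<Gamma>]) l (Unq (Quo M)) = sem (S @ [\<Gamma>]) l M"
proof -
  have S: "wf_stack (Suc l) S" "wf_ctx l \<Gamma>" using wf by simp_all
  interpret B: fpp "CAT l" "EB S l" "actB S l" by (rule fpp_EB) fact
  have A: "wf_ty l A" using ity_wf_ty[OF M] S by simp
  \<comment> \<open>Weakening from the empty context, seen as a substitution: with no variable to
    replace, every condition on the terms is vacuous, and \<open>Var\<close> is chosen because it
    leaves the term unchanged.\<close>
  have "sub_sem S l [] \<Gamma> Var (B.nm (bang (CAT l) (cx l \<Gamma>)))" using S by (simp add: sub_sem_def)
  note * = sem_subst(2)[OF S(1) this M, unfolded sub_Var]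
  have "sem (S @ [[]]) l M \<in> EB S l (Expo (CAT l) (Unit (CAT l)) (ty l A))"
    using sem_in[OF M] S by (simp add: El_snoc)
  then show ?thesis
    using B.star_bang[of "cx l \<Gamma>" "ty l A" "sem (S @ [[]]) l M"] S A tyof[OF M] * by (simp add: Let_def)
qed

lemma sem_Nil_eq_iff:
  assumes "ity [] l M A" "ity [] l N A"
  shows "sem [[]] l M = sem [[]] l N \<longleftrightarrow> sem [] l M = sem [] l N"
  using sem_pad[OF assms(1)] sem_pad[OF assms(2)] sem_in[OF assms(1)] sem_in[OF assms(2)]
    nu_inj[of "Unit (CAT l)" l "ty l A" "sem [] l M" "sem [] l N"] ity_wf_ty[OF assms(1)]
  by (simp add: El_Nil)

text \<open>Typability of both sides is carried along because \<open>sem\<close> reads the types of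
  subterms off by \<open>tyof\<close>: in the congruence cases both sides must be known to have the
  same types.\<close>

theorem soundness:
  "S \<turnstile>\<^bsub>l\<^esub> M \<approx> N : A \<Longrightarrow> ity S l M A \<and> ity S l N A \<and> wf_stack l S \<and> sem S l M = sem S l N"
proof (induction rule: eqth.induct)
  case (Refl \<Delta> l M A)
  then show ?case using typing_imp_ity by blast
next
  case (CAbs \<Delta> A \<Gamma> l M M' B)
  then show ?case using tyof[of "\<Delta> @ [A # \<Gamma>]" l M B] tyof[of "\<Delta> @ [A # \<Gamma>]" l M' B]
    by (auto intro!: ity.Lam simp: Let_def)
next
  case (CApp \<Delta> l M M' A B N N')
  then show ?case
    using tyof[of \<Delta> l M "A \<rightarrow> B"] tyof[of \<Delta> l M' "A \<rightarrow> B"] tyof[of \<Delta> l N A] tyof[of \<Delta> l N' A]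
    by (auto intro: ity.App simp: Let_def)
next
  case (CPair \<Delta> l M M' A N N' B)
  then show ?case
    using tyof[of \<Delta> l M A] tyof[of \<Delta> l M' A] tyof[of \<Delta> l N B] tyof[of \<Delta> l N' B]
    by (auto intro: ity.Pair)
next
  case (CFst \<Delta> l M M' A B)
  then show ?case
    using tyof[of \<Delta> l M "Prod A B"] tyof[of \<Delta> l M' "Prod A B"] by (auto intro: ity.Fst)
next
  case (CSnd \<Delta> l M M' A B)
  then show ?case
    using tyof[of \<Delta> l M "Prod A B"] tyof[of \<Delta> l M' "Prod A B"] by (auto intro: ity.Snd)
next
  case (CQuo \<Delta> l M M' A)
  then show ?case
    using tyof[of "\<Delta> @ [[]]" l M A] tyof[of "\<Delta> @ [[]]" l M' A] by (auto intro: ity.Quo)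
next
  case (CUnq \<Delta> l M M' A \<Gamma>)
  then show ?case
    using tyof[of \<Delta> "Suc l" M "Box A"] tyof[of \<Delta> "Suc l" M' "Box A"] by (auto intro: ity.Unq simp: Let_def)
next
  case (CEmp l M N A)
  then show ?case using sem_Nil_eq_iff by (auto simp: ity_Nil_iff)
next
  case (CEmp' l M N A)
  then show ?case using sem_Nil_eq_iff by (auto simp: ity_Nil_iff)
next
  case (Fun_beta \<Delta> A \<Gamma> l M B N)
  then have i: "ity (\<Delta> @ [A # \<Gamma>]) l M B" "ity (\<Delta> @ [\<Gamma>]) l N A" "wf_stack l (\<Delta> @ [A # \<Gamma>])"
    by (simp_all add: typing_iff)
  moreover have "ity (\<Delta> @ [\<Gamma>]) l (App (Lam A M) N) B" using i by (auto intro!: ity.App ity.Lam)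
  ultimately show ?case using sem_beta[OF i] by simp
next
  case (Fun_eta \<Delta> l M A B)
  then have i: "ity \<Delta> l M (A \<rightarrow> B)" "wf_stack l \<Delta>" by (simp_all add: typing_iff)
  show ?case
  proof (cases \<Delta> rule: rev_cases)
    case Nil
    have "ity [[]] l M (A \<rightarrow> B)" using i Nil by (simp add: ity_Nil_iff)
    then show ?thesis
      using sem_eta[of "[]" "[]" l M A B] Nil i sem_Nil_eq_iff[of l M "A \<rightarrow> B" "Lam A (App (lift 0 0 M) (Var 0))"]
      by (simp add: ity_Nil_iff del: sem.simps)
  next
    case (snoc S \<Gamma>)
    then show ?thesis using sem_eta[of S \<Gamma> l M A B] i by simp
  qed
next
  case (Fst_beta \<Delta> l M A N B)
  then have i: "ity \<Delta> l M A" "ity \<Delta> l N B" "wf_stack l \<Delta>" by (simp_all add: typing_iff)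
  interpret F: fpp "CAT l" "El \<Delta> l" "act \<Delta> l" by (rule fpp_El) fact
  show ?case
    using i tyof[OF i(1)] tyof[OF i(2)] F.pr_props[of "ty l A" "ty l B"] sem_in[OF i(1,3)] sem_in[OF i(2,3)]
      ity_wf_ty[OF i(1,3)] ity_wf_ty[OF i(2,3)] by (auto intro: ity.intros)
next
  case (Snd_beta \<Delta> l M A N B)
  then have i: "ity \<Delta> l M A" "ity \<Delta> l N B" "wf_stack l \<Delta>" by (simp_all add: typing_iff)
  interpret F: fpp "CAT l" "El \<Delta> l" "act \<Delta> l" by (rule fpp_El) fact
  show ?case
    using i tyof[OF i(1)] tyof[OF i(2)] F.pr_props[of "ty l A" "ty l B"] sem_in[OF i(1,3)] sem_in[OF i(2,3)]
      ity_wf_ty[OF i(1,3)] ity_wf_ty[OF i(2,3)] by (auto intro: ity.intros)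
next
  case (Prod_eta \<Delta> l M A B)
  then have i: "ity \<Delta> l M (Prod A B)" "wf_stack l \<Delta>" by (simp_all add: typing_iff)
  interpret F: fpp "CAT l" "El \<Delta> l" "act \<Delta> l" by (rule fpp_El) fact
  show ?case
    using i tyof[OF i(1)] F.pr_unique[of "ty l A" "ty l B" "sem \<Delta> l M"] sem_in[OF i]
      ity_wf_ty[OF i] by (auto intro: ity.intros)
next
  case (One_eta \<Delta> l M)
  then have i: "ity \<Delta> l M One" "wf_stack l \<Delta>" by (simp_all add: typing_iff)
  interpret F: fpp "CAT l" "El \<Delta> l" "act \<Delta> l" by (rule fpp_El) fact
  show ?case using i F.un_eqI[of "sem \<Delta> l M"] sem_in[OF i] by (auto intro: ity.intros)
next
  case (Box_beta \<Delta> l M A \<Gamma>)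
  then have i: "ity (\<Delta> @ [[]]) l M A" "wf_stack l (\<Delta> @ [\<Gamma>])" by (simp_all add: typing_iff)
  have "ity (\<Delta> @ [\<Gamma>]) l M A"
    by (rule ity_weaken[OF i(1)]) (metis append_Nil nthc_simps(2,3) old.nat.exhaust append_Nil2)
  moreover have "ity (\<Delta> @ [\<Gamma>]) l (Unq (Quo M)) A" using i(1) by (auto intro!: ity.Unq ity.Quo)
  ultimately show ?case using sem_weaken[OF i] i by simp
next
  case (Box_eta \<Delta> l M A)
  then have i: "ity \<Delta> (Suc l) M (Box A)" "wf_stack (Suc l) \<Delta>" by (simp_all add: typing_iff)
  interpret B: fpp "CAT l" "EB \<Delta> l" "actB \<Delta> l" by (rule fpp_EB) fact
  have "ity \<Delta> (Suc l) (Quo (Unq M)) (Box A)" using i(1) by (auto intro!: ity.Unq ity.Quo)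
  then show ?case
    using i tyof[OF i(1)] sem_in[OF i] ity_wf_ty[OF i] B.unit_expo_konst[of "ty l A" "sem \<Delta> (Suc l) M"]
    by (simp add: Let_def)
qed simp_all

end

section \<open>The syntactic category\<close>

text \<open>
  The typing part of soundness holds in any model, so the one-point model yields that both sides of
  a derivable equation are well typed.
\<close>

lemma one_point_model: "\<exists>\<CC> :: (unit, unit) enriched. model \<CC> (\<lambda>(_ :: nat) (_ :: 'b). ())"
proof -
  define C :: "(unit, unit) ccc" where
    "C = \<lparr>Ob = UNIV, Ar = UNIV, Dom = (\<lambda>_. ()), Cod = (\<lambda>_. ()), Id = (\<lambda>_. ()), Comp = (\<lambda>_ _. ()),
      Unit = (), Times = (\<lambda>_ _. ()), Proj1 = (\<lambda>_ _. ()), Proj2 = (\<lambda>_ _. ()), Expo = (\<lambda>_ _. ()), Eval = (\<lambda>_ _. ())\<rparr>"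
  define \<CC> :: "(unit, unit) enriched" where
    "\<CC> = \<lparr>Cat = (\<lambda>_. C), BOX = (\<lambda>_. \<lparr>FO = (\<lambda>_. ()), FM = (\<lambda>_. ())\<rparr>)\<rparr>"
  have "is_category C" by (auto simp: is_category_def C_def hom_def)
  then have "is_ccc C" by (auto simp: is_ccc_def hom_def is_transpose_def C_def)
  moreover have "is_functor C C \<lparr>FO = (\<lambda>_. ()), FM = (\<lambda>_. ())\<rparr>"
    by (auto simp: is_functor_def hom_def C_def)
  moreover have "preserves_finite_products C C \<lparr>FO = (\<lambda>_. ()), FM = (\<lambda>_. ())\<rparr>"
    by (auto simp: preserves_finite_products_def is_iso_def inverse_arrows_def hom_def C_def)
  moreover have "is_normal C C \<lparr>FO = (\<lambda>_. ()), FM = (\<lambda>_. ())\<rparr>"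
    by (auto simp: is_normal_def hom_def C_def bij_betw_def inj_on_def)
  ultimately have "model \<CC> (\<lambda>(_ :: nat) (_ :: 'b). ())"
    by (auto simp: model_def cartesian_infinitely_enriched_def base_interpretation_def \<CC>_def) (simp add: C_def)
  then show ?thesis by blast
qed

lemma eqth_typing: "S \<turnstile>\<^bsub>l\<^esub> M \<approx> N : A \<Longrightarrow> S \<turnstile>\<^bsub>l\<^esub> M : A" "S \<turnstile>\<^bsub>l\<^esub> M \<approx> N : A \<Longrightarrow> S \<turnstile>\<^bsub>l\<^esub> N : A"
  using one_point_model model.soundness by (fastforce simp: typing_iff)+

lemma eqth_Nil_iff: "[[]] \<turnstile>\<^bsub>l\<^esub> M \<approx> N : A \<longleftrightarrow> [] \<turnstile>\<^bsub>l\<^esub> M \<approx> N : A"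
  by (auto intro: CEmp CEmp')

lemma typing_weaken:
  assumes "S \<turnstile>\<^bsub>l\<^esub> M : A" "\<And>n. \<exists>\<Gamma>. nthc S' n = nthc S n @ \<Gamma>" "wf_stack l S'"
  shows "S' \<turnstile>\<^bsub>l\<^esub> M : A"
  using assms by (auto simp: typing_iff intro: ity_weaken)

lemma typing_weaken_Nil: "[] \<turnstile>\<^bsub>l\<^esub> M : A \<Longrightarrow> wf_stack l S \<Longrightarrow> S \<turnstile>\<^bsub>l\<^esub> M : A"
  by (erule typing_weaken) auto

text \<open>Quoting a closed term and unquoting it under another stack weakens its stack.\<close>

lemma eqth_weaken_Nil: "[] \<turnstile>\<^bsub>l\<^esub> M \<approx> N : A \<Longrightarrow> wf_stack l S \<Longrightarrow> S \<turnstile>\<^bsub>l\<^esub> M \<approx> N : A"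
proof (induction S arbitrary: l M N A rule: rev_induct)
  case (snoc \<Gamma> S)
  have "[] \<turnstile>\<^bsub>Suc l\<^esub> Quo M \<approx> Quo N : Box A"
    using CQuo[of "[]"] snoc.prems(1) by (simp add: eqth_Nil_iff)
  then have "S \<turnstile>\<^bsub>Suc l\<^esub> Quo M \<approx> Quo N : Box A" using snoc by simp
  then have "S @ [\<Gamma>] \<turnstile>\<^bsub>l\<^esub> Unq (Quo M) \<approx> Unq (Quo N) : A" using snoc.prems by (intro CUnq) simp_all
  moreover have "S @ [[]] \<turnstile>\<^bsub>l\<^esub> M : A" "S @ [[]] \<turnstile>\<^bsub>l\<^esub> N : A"
    using eqth_typing[OF snoc.prems(1)] snoc.prems(2) by (auto intro!: typing_weaken_Nil)
  then have "S @ [\<Gamma>] \<turnstile>\<^bsub>l\<^esub> Unq (Quo M) \<approx> M : A" "S @ [\<Gamma>] \<turnstile>\<^bsub>l\<^esub> Unq (Quo N) \<approx> N : A"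
    using snoc.prems by (auto intro!: Box_beta)
  ultimately show ?case by (meson eqth.Sym eqth.Trans)
qed simp

lemma closed_lift: "[] \<turnstile>\<^bsub>l\<^esub> M : A \<Longrightarrow> lift n k M = M"
  and closed_subst: "[] \<turnstile>\<^bsub>l\<^esub> M : A \<Longrightarrow> subst n k N M = M"
  using closed_invariant[of "[]" l M A n k] by (auto simp: typing_iff)

lemma subst_lift [simp]: "subst n k N (lift n k M) = M"
  by (induction M arbitrary: n k N) auto

section \<open>Rules for arbitrary stacks, the empty one included\<close>

definition extend :: "'b ty \<Rightarrow> 'b stack \<Rightarrow> 'b stack" where
  "extend A S = butlast S @ [A # cur S]"

lemma extend_simps [simp]: "extend A (S @ [\<Gamma>]) = S @ [A # \<Gamma>]" "extend A [] = [[A]]" "extend A [\<Gamma>] = [A # \<Gamma>]"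
  "cur (extend A S) = A # cur S" "butlast (extend A S) = butlast S"
  by (simp_all add: extend_def)

lemma wf_stack_extend [simp]: "wf_stack l (extend A S) \<longleftrightarrow> wf_stack l S \<and> wf_ty l A"
  by (cases S rule: rev_cases) (auto simp: extend_def)

lemma wf_butlast [simp]: "wf_stack l S \<Longrightarrow> wf_stack (Suc l) (butlast S)"
  using wf_butlast_cur by blast

lemma typing_wf: "S \<turnstile>\<^bsub>l\<^esub> M : A \<Longrightarrow> wf_stack l S" "S \<turnstile>\<^bsub>l\<^esub> M : A \<Longrightarrow> wf_ty l A"
  using ity_wf_ty by (auto simp: typing_iff)

lemma typing_Var: "wf_stack l S \<Longrightarrow> i < length (cur S) \<Longrightarrow> cur S ! i = A \<Longrightarrow> S \<turnstile>\<^bsub>l\<^esub> Var i : A"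
  using ity.Var[of i S l] by (auto simp: typing_iff)

lemma typing_Lam: "extend A S \<turnstile>\<^bsub>l\<^esub> M : B \<Longrightarrow> S \<turnstile>\<^bsub>l\<^esub> Lam A M : A \<rightarrow> B"
  by (auto simp: typing_iff extend_def[symmetric] intro!: ity.Lam[unfolded extend_def[symmetric]])

lemma typing_Unq: "butlast S \<turnstile>\<^bsub>Suc l\<^esub> M : Box A \<Longrightarrow> wf_stack l S \<Longrightarrow> S \<turnstile>\<^bsub>l\<^esub> Unq M : A"
  by (auto simp: typing_iff intro: ity.Unq)

lemma eqth_Lam: "extend A S \<turnstile>\<^bsub>l\<^esub> M \<approx> N : B \<Longrightarrow> S \<turnstile>\<^bsub>l\<^esub> Lam A M \<approx> Lam A N : A \<rightarrow> B"
  by (cases S rule: rev_cases) (auto intro: CAbs CEmp CAbs[of "[]", simplified])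

lemma eqth_Unq: "butlast S \<turnstile>\<^bsub>Suc l\<^esub> M \<approx> N : Box A \<Longrightarrow> wf_stack l S \<Longrightarrow> S \<turnstile>\<^bsub>l\<^esub> Unq M \<approx> Unq N : A"
  using CUnq[of "[]" l M N A "[]"] by (cases S rule: rev_cases) (auto intro: CUnq CEmp)

lemma eqth_beta:
  "extend A S \<turnstile>\<^bsub>l\<^esub> M : B \<Longrightarrow> S \<turnstile>\<^bsub>l\<^esub> N : A \<Longrightarrow> S \<turnstile>\<^bsub>l\<^esub> App (Lam A M) N \<approx> subst 0 0 N M : B"
  using Fun_beta[of "[]" A "[]" l M B N]
  by (cases S rule: rev_cases) (auto simp: typing_Nil_iff intro: Fun_beta CEmp)

lemma eqth_Unq_Quo:
  assumes "butlast S @ [[]] \<turnstile>\<^bsub>l\<^esub> M : A" "wf_stack l S"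
  shows "S \<turnstile>\<^bsub>l\<^esub> Unq (Quo M) \<approx> M : A"
  using Box_beta[of "[]" l M A "[]"] assms
  by (cases S rule: rev_cases) (auto intro: Box_beta CEmp)

lemmas tyI = typing_Lam typing_Unq typing.App typing.Pair typing.Fst typing.Snd typing.Star typing.Quo typing_Var

text \<open>\<open>lift\<close> fixes closed terms, so their eta expansions differ only in the head,
  and comparing them on one variable is enough.\<close>

lemma eqth_closed_ext:
  assumes "[] \<turnstile>\<^bsub>l\<^esub> f : A \<rightarrow> B" "[] \<turnstile>\<^bsub>l\<^esub> g : A \<rightarrow> B" "[[A]] \<turnstile>\<^bsub>l\<^esub> App f (Var 0) \<approx> App g (Var 0) : B"
  shows "[] \<turnstile>\<^bsub>l\<^esub> f \<approx> g : A \<rightarrow> B"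
proof -
  have "[] \<turnstile>\<^bsub>l\<^esub> f \<approx> Lam A (App f (Var 0)) : A \<rightarrow> B" "[] \<turnstile>\<^bsub>l\<^esub> g \<approx> Lam A (App g (Var 0)) : A \<rightarrow> B"
    using Fun_eta[OF assms(1)] Fun_eta[OF assms(2)] assms(1,2)[THEN closed_lift] by simp_all
  moreover have "[] \<turnstile>\<^bsub>l\<^esub> Lam A (App f (Var 0)) \<approx> Lam A (App g (Var 0)) : A \<rightarrow> B"
    by (rule eqth_Lam) (use assms(3) in simp)
  ultimately show ?thesis by (meson eqth.Sym eqth.Trans)
qed

lemma eqth_App_closed:
  assumes "[] \<turnstile>\<^bsub>l\<^esub> f \<approx> g : A \<rightarrow> B" "S \<turnstile>\<^bsub>l\<^esub> t \<approx> u : A"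
  shows "S \<turnstile>\<^bsub>l\<^esub> App f t \<approx> App g u : B"
  by (rule CApp[OF eqth_weaken_Nil[OF assms(1)] assms(2)]) (rule typing_wf(1)[OF eqth_typing(1)[OF assms(2)]])

section \<open>Closed combinators and their computation rules\<close>

definition idc :: "'b ty \<Rightarrow> 'b tm" where "idc A = Lam A (Var 0)"
definition cmpc :: "'b ty \<Rightarrow> 'b tm \<Rightarrow> 'b tm \<Rightarrow> 'b tm" where "cmpc A g f = Lam A (App g (App f (Var 0)))"
definition fstc :: "'b ty \<Rightarrow> 'b ty \<Rightarrow> 'b tm" where "fstc A B = Lam (Prod A B) (Fst (Var 0))"
definition sndc :: "'b ty \<Rightarrow> 'b ty \<Rightarrow> 'b tm" where "sndc A B = Lam (Prod A B) (Snd (Var 0))"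
definition bangc :: "'b ty \<Rightarrow> 'b tm" where "bangc A = Lam A Star"
definition tupc :: "'b ty \<Rightarrow> 'b tm \<Rightarrow> 'b tm \<Rightarrow> 'b tm" where
  "tupc A f g = Lam A (Pair (App f (Var 0)) (App g (Var 0)))"
definition evc :: "'b ty \<Rightarrow> 'b ty \<Rightarrow> 'b tm" where "evc A B = Lam (Prod (A \<rightarrow> B) A) (App (Fst (Var 0)) (Snd (Var 0)))"
definition trc :: "'b ty \<Rightarrow> 'b ty \<Rightarrow> 'b tm \<Rightarrow> 'b tm" where
  "trc Z X f = Lam Z (Lam X (App f (Pair (Var 1) (Var 0))))"
definition boxc :: "'b ty \<Rightarrow> 'b tm \<Rightarrow> 'b tm" where "boxc A f = Lam (Box A) (Quo (App f (Unq (Var 0))))"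

lemma wf_closed_fun: "[] \<turnstile>\<^bsub>l\<^esub> f : A \<rightarrow> B \<Longrightarrow> wf_ty l A" "[] \<turnstile>\<^bsub>l\<^esub> f : A \<rightarrow> B \<Longrightarrow> wf_ty l B"
  using typing_wf(2) by fastforce+

lemma wf_closed_prod: "[] \<turnstile>\<^bsub>l\<^esub> f : Prod A B \<rightarrow> D \<Longrightarrow> wf_ty l A" "[] \<turnstile>\<^bsub>l\<^esub> f : Prod A B \<rightarrow> D \<Longrightarrow> wf_ty l B"
  using wf_closed_fun(1) by fastforce+

lemma typing_idc: "wf_ty l A \<Longrightarrow> [] \<turnstile>\<^bsub>l\<^esub> idc A : A \<rightarrow> A"
  unfolding idc_def by (rule tyI | simp)+

lemma typing_cmpc:
  assumes g: "[] \<turnstile>\<^bsub>l\<^esub> g : B \<rightarrow> D" and f: "[] \<turnstile>\<^bsub>l\<^esub> f : A \<rightarrow> B"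
  shows "[] \<turnstile>\<^bsub>l\<^esub> cmpc A g f : A \<rightarrow> D"
  unfolding cmpc_def
  by (rule typing_weaken_Nil[OF g] typing_weaken_Nil[OF f] tyI | simp add: wf_closed_fun[OF f])+

lemma typing_fstc: "wf_ty l A \<Longrightarrow> wf_ty l B \<Longrightarrow> [] \<turnstile>\<^bsub>l\<^esub> fstc A B : Prod A B \<rightarrow> A"
  unfolding fstc_def by (rule tyI | simp)+

lemma typing_sndc: "wf_ty l A \<Longrightarrow> wf_ty l B \<Longrightarrow> [] \<turnstile>\<^bsub>l\<^esub> sndc A B : Prod A B \<rightarrow> B"
  unfolding sndc_def by (rule tyI | simp)+

lemma typing_bangc: "wf_ty l A \<Longrightarrow> [] \<turnstile>\<^bsub>l\<^esub> bangc A : A \<rightarrow> One"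
  unfolding bangc_def by (rule tyI | simp)+

lemma typing_tupc:
  assumes f: "[] \<turnstile>\<^bsub>l\<^esub> f : Z \<rightarrow> A" and g: "[] \<turnstile>\<^bsub>l\<^esub> g : Z \<rightarrow> B"
  shows "[] \<turnstile>\<^bsub>l\<^esub> tupc Z f g : Z \<rightarrow> Prod A B"
  unfolding tupc_def
  by (rule typing_weaken_Nil[OF g] typing_weaken_Nil[OF f] tyI | simp add: wf_closed_fun[OF f])+

lemma typing_evc: "wf_ty l A \<Longrightarrow> wf_ty l B \<Longrightarrow> [] \<turnstile>\<^bsub>l\<^esub> evc A B : Prod (A \<rightarrow> B) A \<rightarrow> B"
  unfolding evc_def by (rule tyI | simp)+

lemma typing_trc:
  assumes f: "[] \<turnstile>\<^bsub>l\<^esub> f : Prod Z X \<rightarrow> Y"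
  shows "[] \<turnstile>\<^bsub>l\<^esub> trc Z X f : Z \<rightarrow> X \<rightarrow> Y"
  unfolding trc_def
  by (rule typing_weaken_Nil[OF f] tyI | simp add: wf_closed_prod[OF f])+

lemma typing_boxc:
  assumes f: "[] \<turnstile>\<^bsub>l\<^esub> f : A \<rightarrow> B"
  shows "[] \<turnstile>\<^bsub>Suc l\<^esub> boxc A f : Box A \<rightarrow> Box B"
  unfolding boxc_def
  by (rule typing_weaken_Nil[OF f] tyI | simp add: wf_closed_fun[OF f])+

text \<open>This rule and the similar ones for the other combinators evaluate an application in an
  arbitrary stack. Most take the further evaluation of the result as a premise, so that long
  computations are composed with \<open>OF\<close>.\<close>

lemma App_idc:
  assumes "S \<turnstile>\<^bsub>l\<^esub> t \<approx> u : A"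
  shows "S \<turnstile>\<^bsub>l\<^esub> App (idc A) t \<approx> u : A"
proof -
  note t = eqth_typing(1)[OF assms]
  have "S \<turnstile>\<^bsub>l\<^esub> App (idc A) t \<approx> subst 0 0 t (Var 0) : A"
    unfolding idc_def by (rule eqth_beta[OF _ t]) (rule typing_Var, simp_all add: typing_wf[OF t])
  then show ?thesis using assms by (auto intro: eqth.Trans)
qed

lemma App_cmpc:
  assumes g: "[] \<turnstile>\<^bsub>l\<^esub> g : B \<rightarrow> D" and f: "[] \<turnstile>\<^bsub>l\<^esub> f : A \<rightarrow> B"
    and 1: "S \<turnstile>\<^bsub>l\<^esub> t : A" and 2: "S \<turnstile>\<^bsub>l\<^esub> App f t \<approx> v : B" and 3: "S \<turnstile>\<^bsub>l\<^esub> App g v \<approx> u : D"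
  shows "S \<turnstile>\<^bsub>l\<^esub> App (cmpc A g f) t \<approx> u : D"
proof -
  have S: "wf_stack l S" "wf_ty l A" using typing_wf[OF 1] by auto
  have "S \<turnstile>\<^bsub>l\<^esub> App (cmpc A g f) t \<approx> subst 0 0 t (App g (App f (Var 0))) : D"
    unfolding cmpc_def
    by (rule eqth_beta[OF _ 1]) (rule typing_weaken_Nil[OF g] typing_weaken_Nil[OF f] tyI | simp add: S)+
  then have "S \<turnstile>\<^bsub>l\<^esub> App (cmpc A g f) t \<approx> App g (App f t) : D" by (simp add: closed_subst[OF f] closed_subst[OF g])
  moreover have "S \<turnstile>\<^bsub>l\<^esub> App g (App f t) \<approx> App g v : D"
    by (rule CApp[OF eqth.Refl[OF typing_weaken_Nil[OF g S(1)]] 2])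
  ultimately show ?thesis using 3 by (meson eqth.Trans)
qed

lemma App_fstc:
  assumes "wf_ty l B" "S \<turnstile>\<^bsub>l\<^esub> t : Prod A B" "S \<turnstile>\<^bsub>l\<^esub> Fst t \<approx> u : A"
  shows "S \<turnstile>\<^bsub>l\<^esub> App (fstc A B) t \<approx> u : A"
proof -
  have "S \<turnstile>\<^bsub>l\<^esub> App (fstc A B) t \<approx> subst 0 0 t (Fst (Var 0)) : A"
    unfolding fstc_def by (rule eqth_beta[OF _ assms(2)], rule typing.Fst[where B = B], rule typing_Var)
      (use typing_wf[OF assms(2)] in simp_all)
  then show ?thesis using assms(3) by (auto intro: eqth.Trans)
qed

lemma App_sndc:
  assumes "wf_ty l A" "S \<turnstile>\<^bsub>l\<^esub> t : Prod A B" "S \<turnstile>\<^bsub>l\<^esub> Snd t \<approx> u : B"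
  shows "S \<turnstile>\<^bsub>l\<^esub> App (sndc A B) t \<approx> u : B"
proof -
  have "S \<turnstile>\<^bsub>l\<^esub> App (sndc A B) t \<approx> subst 0 0 t (Snd (Var 0)) : B"
    unfolding sndc_def by (rule eqth_beta[OF _ assms(2)], rule typing.Snd[where A = A], rule typing_Var)
      (use typing_wf[OF assms(2)] in simp_all)
  then show ?thesis using assms(3) by (auto intro: eqth.Trans)
qed

lemma App_bangc:
  assumes "S \<turnstile>\<^bsub>l\<^esub> t : A"
  shows "S \<turnstile>\<^bsub>l\<^esub> App (bangc A) t \<approx> Star : One"
  using eqth_beta[of A S l Star One t] assms typing_wf[OF assms] by (simp add: bangc_def typing.Star)

lemma App_tupc:
  assumes g: "[] \<turnstile>\<^bsub>l\<^esub> g : Z \<rightarrow> B" and f: "[] \<turnstile>\<^bsub>l\<^esub> f : Z \<rightarrow> A"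
    and 1: "S \<turnstile>\<^bsub>l\<^esub> t : Z" and 2: "S \<turnstile>\<^bsub>l\<^esub> App f t \<approx> u : A" and 3: "S \<turnstile>\<^bsub>l\<^esub> App g t \<approx> v : B"
  shows "S \<turnstile>\<^bsub>l\<^esub> App (tupc Z f g) t \<approx> Pair u v : Prod A B"
proof -
  have S: "wf_stack l S" "wf_ty l Z" using typing_wf[OF 1] by auto
  have "S \<turnstile>\<^bsub>l\<^esub> App (tupc Z f g) t \<approx> subst 0 0 t (Pair (App f (Var 0)) (App g (Var 0))) : Prod A B"
    unfolding tupc_def
    by (rule eqth_beta[OF _ 1]) (rule typing_weaken_Nil[OF g] typing_weaken_Nil[OF f] tyI | simp add: S)+
  then have "S \<turnstile>\<^bsub>l\<^esub> App (tupc Z f g) t \<approx> Pair (App f t) (App g t) : Prod A B"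
    by (simp add: closed_subst[OF f] closed_subst[OF g])
  then show ?thesis using CPair[OF 2 3] by (meson eqth.Trans)
qed

lemma App_evc:
  assumes 1: "S \<turnstile>\<^bsub>l\<^esub> t : Prod (A \<rightarrow> B) A" and 2: "S \<turnstile>\<^bsub>l\<^esub> App (Fst t) (Snd t) \<approx> u : B"
  shows "S \<turnstile>\<^bsub>l\<^esub> App (evc A B) t \<approx> u : B"
proof -
  have S: "wf_stack l S" "wf_ty l A" "wf_ty l B" using typing_wf[OF 1] by auto
  have v: "extend (Prod (A \<rightarrow> B) A) S \<turnstile>\<^bsub>l\<^esub> Var 0 : Prod (A \<rightarrow> B) A" by (rule typing_Var) (simp_all add: S)
  have "S \<turnstile>\<^bsub>l\<^esub> App (evc A B) t \<approx> subst 0 0 t (App (Fst (Var 0)) (Snd (Var 0))) : B"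
    unfolding evc_def
    by (rule eqth_beta[OF typing.App[OF typing.Fst[OF v] typing.Snd[OF v]] 1])
  then show ?thesis using 2 by (auto intro: eqth.Trans)
qed

text \<open>The typing half of \<open>sem_lift\<close> does not mention the model, so any model
  provides it.\<close>

lemma typing_lift:
  assumes "S \<turnstile>\<^bsub>l\<^esub> M : (A :: 'b ty)" "wf_ty l B"
  shows "extend B S \<turnstile>\<^bsub>l\<^esub> lift 0 0 M : A"
proof -
  obtain \<CC> :: "(unit, unit) enriched" where "model \<CC> (\<lambda>(_ :: nat) (_ :: 'b). ())"
    using one_point_model by blast
  note * = model.sem_lift(1)[OF this, of "butlast S" "cur S" l M A B]
  have "ity (butlast S @ [cur S]) l M A" "wf_stack l (butlast S @ [cur S])"
    using assms(1) by (cases S rule: rev_cases; auto simp: typing_iff ity_Nil_iff)+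
  with * assms show ?thesis by (auto simp: typing_iff extend_def)
qed

text \<open>The argument \<open>z\<close> crosses the inner binder in the first beta step and is
  lifted; the second beta step cancels the lift by \<open>subst_lift\<close>.\<close>

lemma App_trc:
  assumes f: "[] \<turnstile>\<^bsub>l\<^esub> f : Prod Z X \<rightarrow> Y" and z: "S \<turnstile>\<^bsub>l\<^esub> z : Z" and x: "S \<turnstile>\<^bsub>l\<^esub> x : X"
    and u: "S \<turnstile>\<^bsub>l\<^esub> App f (Pair z x) \<approx> u : Y"
  shows "S \<turnstile>\<^bsub>l\<^esub> App (App (trc Z X f) z) x \<approx> u : Y"
proof -
  note S = typing_wf[OF z] typing_wf[OF x]
  have "S \<turnstile>\<^bsub>l\<^esub> App (trc Z X f) z \<approx> subst 0 0 z (Lam X (App f (Pair (Var 1) (Var 0)))) : X \<rightarrow> Y"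
    unfolding trc_def
    by (rule eqth_beta[OF _ z]) (rule typing_weaken_Nil[OF f] tyI | simp add: S)+
  then have "S \<turnstile>\<^bsub>l\<^esub> App (trc Z X f) z \<approx> Lam X (App f (Pair (lift 0 0 z) (Var 0))) : X \<rightarrow> Y"
    by (simp add: closed_subst[OF f])
  then have "S \<turnstile>\<^bsub>l\<^esub> App (App (trc Z X f) z) x \<approx> App (Lam X (App f (Pair (lift 0 0 z) (Var 0)))) x : Y"
    by (rule CApp[OF _ eqth.Refl[OF x]])
  moreover have "S \<turnstile>\<^bsub>l\<^esub> App (Lam X (App f (Pair (lift 0 0 z) (Var 0)))) x \<approx>
      subst 0 0 x (App f (Pair (lift 0 0 z) (Var 0))) : Y"
    by (rule eqth_beta[OF _ x]) (rule typing_weaken_Nil[OF f] typing_lift[OF z] tyI | simp add: S)+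
  then have "S \<turnstile>\<^bsub>l\<^esub> App (Lam X (App f (Pair (lift 0 0 z) (Var 0)))) x \<approx> App f (Pair z x) : Y"
    by (simp add: closed_subst[OF f])
  ultimately show ?thesis using u by (meson eqth.Trans)
qed

lemma App_boxc:
  assumes f: "[] \<turnstile>\<^bsub>l\<^esub> f : A \<rightarrow> B" and t: "S \<turnstile>\<^bsub>Suc l\<^esub> t : Box A"
    and u: "S @ [[]] \<turnstile>\<^bsub>l\<^esub> App f (Unq t) \<approx> u : B"
  shows "S \<turnstile>\<^bsub>Suc l\<^esub> App (boxc A f) t \<approx> Quo u : Box B"
proof -
  note S = typing_wf[OF t]
  have "S \<turnstile>\<^bsub>Suc l\<^esub> App (boxc A f) t \<approx> subst 0 0 t (Quo (App f (Unq (Var 0)))) : Box B"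
    unfolding boxc_def
    by (rule eqth_beta[OF _ t]) (rule typing_weaken_Nil[OF f] tyI | use S in simp)+
  then have "S \<turnstile>\<^bsub>Suc l\<^esub> App (boxc A f) t \<approx> Quo (App f (Unq t)) : Box B" by (simp add: closed_subst[OF f])
  then show ?thesis using CQuo[OF u] by (meson eqth.Trans)
qed

lemma eqth_Fst: "S \<turnstile>\<^bsub>l\<^esub> t \<approx> Pair u v : Prod A B \<Longrightarrow> S \<turnstile>\<^bsub>l\<^esub> Fst t \<approx> u : A"
  and eqth_Snd: "S \<turnstile>\<^bsub>l\<^esub> t \<approx> Pair u v : Prod A B \<Longrightarrow> S \<turnstile>\<^bsub>l\<^esub> Snd t \<approx> v : B"
proof -
  assume t: "S \<turnstile>\<^bsub>l\<^esub> t \<approx> Pair u v : Prod A B"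
  then have "S \<turnstile>\<^bsub>l\<^esub> u : A" "S \<turnstile>\<^bsub>l\<^esub> v : B" using eqth_typing(2)[OF t] by (auto simp: typing_iff)
  then show "S \<turnstile>\<^bsub>l\<^esub> Fst t \<approx> u : A" "S \<turnstile>\<^bsub>l\<^esub> Snd t \<approx> v : B"
    using CFst[OF t] CSnd[OF t] by (meson eqth.Trans Fst_beta Snd_beta)+
qed

lemma eqth_Unq_Quo': "butlast S \<turnstile>\<^bsub>Suc l\<^esub> t \<approx> Quo u : Box A \<Longrightarrow> wf_stack l S \<Longrightarrow> S \<turnstile>\<^bsub>l\<^esub> Unq t \<approx> u : A"
proof -
  assume t: "butlast S \<turnstile>\<^bsub>Suc l\<^esub> t \<approx> Quo u : Box A" and S: "wf_stack l S"
  have "butlast S @ [[]] \<turnstile>\<^bsub>l\<^esub> u : A" using eqth_typing(2)[OF t] by (auto simp: typing_iff)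
  then show "S \<turnstile>\<^bsub>l\<^esub> Unq t \<approx> u : A" using eqth_Unq[OF t S] eqth_Unq_Quo S by (meson eqth.Trans)
qed

lemma eqth_ext:
  assumes "S \<turnstile>\<^bsub>l\<^esub> M : A \<rightarrow> B" "S \<turnstile>\<^bsub>l\<^esub> N : A \<rightarrow> B"
    "extend A S \<turnstile>\<^bsub>l\<^esub> App (lift 0 0 M) (Var 0) \<approx> u : B" "extend A S \<turnstile>\<^bsub>l\<^esub> App (lift 0 0 N) (Var 0) \<approx> u : B"
  shows "S \<turnstile>\<^bsub>l\<^esub> M \<approx> N : A \<rightarrow> B"
  using Fun_eta[OF assms(1)] Fun_eta[OF assms(2)] eqth_Lam[OF assms(3)] eqth_Lam[OF assms(4)]
  by (meson eqth.Sym eqth.Trans)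

section \<open>Cartesian closed categories of closed terms\<close>

locale term_model =
  fixes eo :: "'c ty \<Rightarrow> 'o" and em :: "'c ty \<times> 'c ty \<times> 'c tm \<Rightarrow> 'm"
  assumes inj_eo: "inj eo" and inj_em: "inj em"
begin

definition ob :: "'o \<Rightarrow> 'c ty" where "ob = inv eo"
definition src :: "'m \<Rightarrow> 'c ty" where "src m = fst (inv em m)"
definition tgt :: "'m \<Rightarrow> 'c ty" where "tgt m = fst (snd (inv em m))"
definition trm :: "'m \<Rightarrow> 'c tm" where "trm m = snd (snd (inv em m))"

text \<open>One representative for each class of derivable equality: provably equal terms then give
  the same arrow, while an arrow remains a code of a single term together with its source and
  target. A set of terms could not be coded as economically.\<close>

definition rep :: "nat \<Rightarrow> 'c ty \<Rightarrow> 'c tm \<Rightarrow> 'c tm" where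
  "rep l T t = (SOME u. [] \<turnstile>\<^bsub>l\<^esub> t \<approx> u : T)"

definition mk :: "nat \<Rightarrow> 'c ty \<Rightarrow> 'c ty \<Rightarrow> 'c tm \<Rightarrow> 'm" where
  "mk l A B t = em (A, B, rep l (A \<rightarrow> B) t)"

lemma ob_eo [simp]: "ob (eo A) = A" by (simp add: ob_def inj_eo)
lemma eo_eq_iff [simp]: "eo A = eo B \<longleftrightarrow> A = B" using inj_eo by (auto dest: injD)

lemma mk_simps [simp]: "src (mk l A B t) = A" "tgt (mk l A B t) = B" "trm (mk l A B t) = rep l (A \<rightarrow> B) t"
  by (simp_all add: src_def tgt_def trm_def mk_def inj_em)

lemma rep: "[] \<turnstile>\<^bsub>l\<^esub> t : T \<Longrightarrow> [] \<turnstile>\<^bsub>l\<^esub> t \<approx> rep l T t : T"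
  unfolding rep_def by (rule someI[of _ t]) (rule eqth.Refl)

lemma rep_cong: "[] \<turnstile>\<^bsub>l\<^esub> t \<approx> u : T \<Longrightarrow> rep l T t = rep l T u"
  unfolding rep_def by (rule arg_cong[of _ _ Eps]) (auto intro: eqth.Sym eqth.Trans)

lemma mk_eq_iff:
  assumes "[] \<turnstile>\<^bsub>l\<^esub> t : A \<rightarrow> B" "[] \<turnstile>\<^bsub>l\<^esub> u : A \<rightarrow> B"
  shows "mk l A B t = mk l A B u \<longleftrightarrow> [] \<turnstile>\<^bsub>l\<^esub> t \<approx> u : A \<rightarrow> B"
proof
  assume "mk l A B t = mk l A B u"
  then have "rep l (A \<rightarrow> B) t = rep l (A \<rightarrow> B) u" using mk_simps(3) by metis
  then show "[] \<turnstile>\<^bsub>l\<^esub> t \<approx> u : A \<rightarrow> B" using rep[OF assms(1)] rep[OF assms(2)] by (metis eqth.Sym eqth.Trans)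
qed (auto simp: mk_def dest: rep_cong)

lemma mk_cong: "[] \<turnstile>\<^bsub>l\<^esub> t \<approx> u : A \<rightarrow> B \<Longrightarrow> mk l A B t = mk l A B u"
  by (simp add: mk_def rep_cong)

text \<open>Two arrows are compared by evaluating both on a variable to a common result
  \<open>w\<close>. The laws of the category and of the box functor are checked in this
  form.\<close>

lemma mk_eqI:
  assumes "[] \<turnstile>\<^bsub>l\<^esub> t : A \<rightarrow> B" "[] \<turnstile>\<^bsub>l\<^esub> u : A \<rightarrow> B"
    "[[A]] \<turnstile>\<^bsub>l\<^esub> App t (Var 0) \<approx> w : B" "[[A]] \<turnstile>\<^bsub>l\<^esub> App u (Var 0) \<approx> w : B"
  shows "mk l A B t = mk l A B u"
  using eqth_ext[OF assms(1,2)] assms(3,4) by (intro mk_cong) (simp add: assms(1,2)[THEN closed_lift])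

definition syn_cat :: "nat \<Rightarrow> ('o, 'm) ccc" where
  "syn_cat l = \<lparr>Ob = eo ` {A. wf_ty l A}, Ar = {m. \<exists>A B t. m = mk l A B t \<and> [] \<turnstile>\<^bsub>l\<^esub> t : A \<rightarrow> B},
    Dom = (\<lambda>m. eo (src m)), Cod = (\<lambda>m. eo (tgt m)), Id = (\<lambda>X. mk l (ob X) (ob X) (idc (ob X))),
    Comp = (\<lambda>g f. mk l (src f) (tgt g) (cmpc (src f) (trm g) (trm f))),
    Unit = eo One, Times = (\<lambda>X Y. eo (Prod (ob X) (ob Y))),
    Proj1 = (\<lambda>X Y. mk l (Prod (ob X) (ob Y)) (ob X) (fstc (ob X) (ob Y))),
    Proj2 = (\<lambda>X Y. mk l (Prod (ob X) (ob Y)) (ob Y) (sndc (ob X) (ob Y))),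
    Expo = (\<lambda>X Y. eo (ob X \<rightarrow> ob Y)),
    Eval = (\<lambda>X Y. mk l (Prod (ob X \<rightarrow> ob Y) (ob X)) (ob Y) (evc (ob X) (ob Y)))\<rparr>"

lemma syn_cat_simps [simp]:
  "X \<in> Ob (syn_cat l) \<longleftrightarrow> (\<exists>A. X = eo A \<and> wf_ty l A)"
  "Dom (syn_cat l) m = eo (src m)" "Cod (syn_cat l) m = eo (tgt m)"
  "Id (syn_cat l) (eo A) = mk l A A (idc A)"
  "Unit (syn_cat l) = eo One" "Times (syn_cat l) (eo A) (eo B) = eo (Prod A B)"
  "Proj1 (syn_cat l) (eo A) (eo B) = mk l (Prod A B) A (fstc A B)"
  "Proj2 (syn_cat l) (eo A) (eo B) = mk l (Prod A B) B (sndc A B)"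
  "Expo (syn_cat l) (eo A) (eo B) = eo (A \<rightarrow> B)"
  "Eval (syn_cat l) (eo A) (eo B) = mk l (Prod (A \<rightarrow> B) A) B (evc A B)"
  by (auto simp: syn_cat_def)

lemma in_ArE: assumes "m \<in> Ar (syn_cat l)" obtains A B t where "m = mk l A B t" "[] \<turnstile>\<^bsub>l\<^esub> t : A \<rightarrow> B"
  using assms by (auto simp: syn_cat_def)

lemma mk_Ar [simp]: "[] \<turnstile>\<^bsub>l\<^esub> t : A \<rightarrow> B \<Longrightarrow> mk l A B t \<in> Ar (syn_cat l)"
  by (auto simp: syn_cat_def)

lemma mk_hom [simp]: "[] \<turnstile>\<^bsub>l\<^esub> t : A \<rightarrow> B \<Longrightarrow> mk l A B t \<in> hom (syn_cat l) (eo A) (eo B)"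
  by (simp add: hom_def)

lemma homE: assumes "m \<in> hom (syn_cat l) (eo A) (eo B)" obtains t where "m = mk l A B t" "[] \<turnstile>\<^bsub>l\<^esub> t : A \<rightarrow> B"
  using assms by (auto simp: hom_def elim: in_ArE)

text \<open>Composition is defined on the chosen representatives; by congruence, other terms of the
  same classes give the same composite.\<close>

lemma Comp_mk [simp]:
  assumes g: "[] \<turnstile>\<^bsub>l\<^esub> g : B \<rightarrow> D" and f: "[] \<turnstile>\<^bsub>l\<^esub> f : A \<rightarrow> B"
  shows "mk l B D g \<cdot>\<^bsub>syn_cat l\<^esub> mk l A B f = mk l A D (cmpc A g f)"
proof -
  have "[] \<turnstile>\<^bsub>l\<^esub> cmpc A g f \<approx> cmpc A (rep l (B \<rightarrow> D) g) (rep l (A \<rightarrow> B) f) : A \<rightarrow> D"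
    unfolding cmpc_def
    by (intro eqth_Lam eqth_App_closed[OF rep[OF g]] eqth_App_closed[OF rep[OF f]] eqth.Refl typing_Var)
      (simp_all add: wf_closed_fun[OF f])
  then show ?thesis by (simp add: syn_cat_def mk_cong)
qed

lemma typing_Var0: "wf_ty l A \<Longrightarrow> [[A]] \<turnstile>\<^bsub>l\<^esub> Var 0 : A"
  by (rule typing_Var) simp_all

lemma typing_App_closed: "[] \<turnstile>\<^bsub>l\<^esub> t : A \<rightarrow> B \<Longrightarrow> S \<turnstile>\<^bsub>l\<^esub> u : A \<Longrightarrow> S \<turnstile>\<^bsub>l\<^esub> App t u : B"
  by (rule typing.App[OF typing_weaken_Nil]) (auto dest: typing_wf(1))

lemma is_category_syn_cat: "is_category (syn_cat l)"
  unfolding is_category_def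
proof (intro conjI ballI)
  fix f assume "f \<in> Ar (syn_cat l)"
  then show "Dom (syn_cat l) f \<in> Ob (syn_cat l)" "Cod (syn_cat l) f \<in> Ob (syn_cat l)"
    by (auto elim!: in_ArE dest: wf_closed_fun)
next
  fix X assume "X \<in> Ob (syn_cat l)"
  then show "Id (syn_cat l) X \<in> hom (syn_cat l) X X" by (auto simp: typing_idc)
next
  fix X Y Z f g
  assume "X \<in> Ob (syn_cat l)" "Y \<in> Ob (syn_cat l)" "Z \<in> Ob (syn_cat l)" "f \<in> hom (syn_cat l) X Y" "g \<in> hom (syn_cat l) Y Z"
  then show "g \<cdot>\<^bsub>syn_cat l\<^esub> f \<in> hom (syn_cat l) X Z"
    by (auto elim!: homE simp: typing_cmpc)
next
  fix X Y f
  assume "X \<in> Ob (syn_cat l)" "Y \<in> Ob (syn_cat l)" and f: "f \<in> hom (syn_cat l) X Y"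
  then obtain A B where X: "X = eo A" "Y = eo B" "wf_ty l A" "wf_ty l B" by auto
  then obtain t where t: "f = mk l A B t" "[] \<turnstile>\<^bsub>l\<^esub> t : A \<rightarrow> B" using f by (auto elim: homE)
  note v = typing_Var0[OF X(3)] and a = typing_idc[OF X(3)] typing_idc[OF X(4)]
  have 1: "[[A]] \<turnstile>\<^bsub>l\<^esub> App (cmpc A t (idc A)) (Var 0) \<approx> App t (Var 0) : B"
    by (rule App_cmpc[OF t(2) a(1) v App_idc[OF eqth.Refl[OF v]] eqth.Refl[OF typing_App_closed[OF t(2) v]]])
  have 2: "[[A]] \<turnstile>\<^bsub>l\<^esub> App (cmpc A (idc B) t) (Var 0) \<approx> App t (Var 0) : B"
    by (rule App_cmpc[OF a(2) t(2) v eqth.Refl App_idc[OF eqth.Refl]]) (rule typing_App_closed[OF t(2) v])+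
  note R = eqth.Refl[OF typing_App_closed[OF t(2) v]]
  show "f \<cdot>\<^bsub>syn_cat l\<^esub> Id (syn_cat l) X = f"
    using X t a mk_eqI[OF typing_cmpc[OF t(2) a(1)] t(2) 1 R] by simp
  show "Id (syn_cat l) Y \<cdot>\<^bsub>syn_cat l\<^esub> f = f"
    using X t a mk_eqI[OF typing_cmpc[OF a(2) t(2)] t(2) 2 R] by simp
next
  fix W X Y Z f g h
  assume "W \<in> Ob (syn_cat l)" "X \<in> Ob (syn_cat l)" "Y \<in> Ob (syn_cat l)" "Z \<in> Ob (syn_cat l)"
    and fgh: "f \<in> hom (syn_cat l) W X" "g \<in> hom (syn_cat l) X Y" "h \<in> hom (syn_cat l) Y Z"
  then obtain A B D E where X: "W = eo A" "X = eo B" "Y = eo D" "Z = eo E" "wf_ty l A" by auto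
  then obtain t u s where t: "f = mk l A B t" "[] \<turnstile>\<^bsub>l\<^esub> t : A \<rightarrow> B" "g = mk l B D u" "[] \<turnstile>\<^bsub>l\<^esub> u : B \<rightarrow> D"
      "h = mk l D E s" "[] \<turnstile>\<^bsub>l\<^esub> s : D \<rightarrow> E"
    using fgh by (auto elim!: homE)
  note v = typing_Var0[OF X(5)]
  note w1 = typing_App_closed[OF t(2) v] note w2 = typing_App_closed[OF t(4) w1] note w3 = typing_App_closed[OF t(6) w2]
  note c1 = typing_cmpc[OF t(4,2)] note c2 = typing_cmpc[OF t(6,4)]
  have 1: "[[A]] \<turnstile>\<^bsub>l\<^esub> App (cmpc A (cmpc B s u) t) (Var 0) \<approx> App s (App u (App t (Var 0))) : E"
    by (rule App_cmpc[OF c2 t(2) v eqth.Refl[OF w1] App_cmpc[OF t(6,4) w1 eqth.Refl[OF w2] eqth.Refl[OF w3]]])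
  have 2: "[[A]] \<turnstile>\<^bsub>l\<^esub> App (cmpc A s (cmpc A u t)) (Var 0) \<approx> App s (App u (App t (Var 0))) : E"
    by (rule App_cmpc[OF t(6) c1 v App_cmpc[OF t(4,2) v eqth.Refl[OF w1] eqth.Refl[OF w2]] eqth.Refl[OF w3]])
  show "(h \<cdot>\<^bsub>syn_cat l\<^esub> g) \<cdot>\<^bsub>syn_cat l\<^esub> f = h \<cdot>\<^bsub>syn_cat l\<^esub> g \<cdot>\<^bsub>syn_cat l\<^esub> f"
    using t c1 c2 mk_eqI[OF typing_cmpc[OF c2 t(2)] typing_cmpc[OF t(6) c1] 1 2] by simp
qed

lemma syn_cat_unit_ex1: "wf_ty l A \<Longrightarrow> \<exists>!f. f \<in> hom (syn_cat l) (eo A) (eo One)"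
proof (rule ex1I[of _ "mk l A One (bangc A)"])
  assume A: "wf_ty l A"
  show "mk l A One (bangc A) \<in> hom (syn_cat l) (eo A) (eo One)" by (simp add: typing_bangc A)
  fix f assume "f \<in> hom (syn_cat l) (eo A) (eo One)"
  then obtain t where t: "f = mk l A One t" "[] \<turnstile>\<^bsub>l\<^esub> t : A \<rightarrow> One" by (auto elim: homE)
  show "f = mk l A One (bangc A)"
    unfolding t(1) by (rule mk_eqI[OF t(2) typing_bangc[OF A] One_eta[OF typing_App_closed[OF t(2) typing_Var0[OF A]]] App_bangc[OF typing_Var0[OF A]]])
qed

lemma syn_cat_bang: "wf_ty l A \<Longrightarrow> bang (syn_cat l) (eo A) = mk l A One (bangc A)"
  unfolding bang_def using the1_equality[OF syn_cat_unit_ex1] by (simp add: typing_bangc)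

text \<open>Existence is the two projection rules, uniqueness is surjective pairing applied to
  \<open>App t (Var 0)\<close>.\<close>

lemma syn_cat_tuple_ex1:
  assumes f: "[] \<turnstile>\<^bsub>l\<^esub> f : Z \<rightarrow> A" and g: "[] \<turnstile>\<^bsub>l\<^esub> g : Z \<rightarrow> B"
  defines "P \<equiv> \<lambda>h. h \<in> hom (syn_cat l) (eo Z) (eo (Prod A B)) \<and>
    mk l (Prod A B) A (fstc A B) \<cdot>\<^bsub>syn_cat l\<^esub> h = mk l Z A f \<and> mk l (Prod A B) B (sndc A B) \<cdot>\<^bsub>syn_cat l\<^esub> h = mk l Z B g"
  shows "P (mk l Z (Prod A B) (tupc Z f g))" "\<exists>!h. P h"
proof -
  note wf = wf_closed_fun[OF f] wf_closed_fun(2)[OF g]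
  note p = typing_fstc[OF wf(2,3)] typing_sndc[OF wf(2,3)] and v = typing_Var0[OF wf(1)]
  note T = typing_tupc[OF f g]
  note F = typing_App_closed[OF f v] and G = typing_App_closed[OF g v]
  note TT = App_tupc[OF g f v eqth.Refl[OF F] eqth.Refl[OF G]]
  have 1: "[[Z]] \<turnstile>\<^bsub>l\<^esub> App (cmpc Z (fstc A B) (tupc Z f g)) (Var 0) \<approx> App f (Var 0) : A"
    by (rule App_cmpc[OF p(1) T v TT App_fstc[OF wf(3) eqth_typing(2)[OF TT] Fst_beta[OF F G]]])
  have 2: "[[Z]] \<turnstile>\<^bsub>l\<^esub> App (cmpc Z (sndc A B) (tupc Z f g)) (Var 0) \<approx> App g (Var 0) : B"
    by (rule App_cmpc[OF p(2) T v TT App_sndc[OF wf(2) eqth_typing(2)[OF TT] Snd_beta[OF F G]]])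
  show P: "P (mk l Z (Prod A B) (tupc Z f g))"
    unfolding P_def using T p
      mk_eqI[OF typing_cmpc[OF p(1) T] f 1 eqth.Refl[OF F]] mk_eqI[OF typing_cmpc[OF p(2) T] g 2 eqth.Refl[OF G]] by simp
  show "\<exists>!h. P h"
  proof (rule ex1I[of P, OF P])
    fix h assume h: "P h"
    then obtain t where t: "h = mk l Z (Prod A B) t" "[] \<turnstile>\<^bsub>l\<^esub> t : Z \<rightarrow> Prod A B"
      unfolding P_def by (auto elim: homE)
    note W = typing_App_closed[OF t(2) v]
    have "[] \<turnstile>\<^bsub>l\<^esub> cmpc Z (fstc A B) t \<approx> f : Z \<rightarrow> A" "[] \<turnstile>\<^bsub>l\<^esub> cmpc Z (sndc A B) t \<approx> g : Z \<rightarrow> B"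
      using h p t(2) typing_cmpc[OF p(1) t(2)] typing_cmpc[OF p(2) t(2)] f g
      unfolding P_def t(1) by (simp_all add: mk_eq_iff)
    from this[THEN eqth_App_closed, OF eqth.Refl[OF v]]
    have "[[Z]] \<turnstile>\<^bsub>l\<^esub> Fst (App t (Var 0)) \<approx> App f (Var 0) : A" "[[Z]] \<turnstile>\<^bsub>l\<^esub> Snd (App t (Var 0)) \<approx> App g (Var 0) : B"
      using App_cmpc[OF p(1) t(2) v eqth.Refl[OF W] App_fstc[OF wf(3) W eqth.Refl[OF typing.Fst[OF W]]]]
        App_cmpc[OF p(2) t(2) v eqth.Refl[OF W] App_sndc[OF wf(2) W eqth.Refl[OF typing.Snd[OF W]]]]
      by (meson eqth.Sym eqth.Trans)+
    then have "[[Z]] \<turnstile>\<^bsub>l\<^esub> App t (Var 0) \<approx> Pair (App f (Var 0)) (App g (Var 0)) : Prod A B"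
      by (rule eqth.Trans[OF Prod_eta[OF W] CPair])
    then show "h = mk l Z (Prod A B) (tupc Z f g)"
      unfolding t(1) by (rule mk_eqI[OF t(2) T _ TT])
  qed
qed

lemma syn_cat_tuple [simp]:
  assumes "[] \<turnstile>\<^bsub>l\<^esub> f : Z \<rightarrow> A" "[] \<turnstile>\<^bsub>l\<^esub> g : Z \<rightarrow> B"
  shows "tuple (syn_cat l) (mk l Z A f) (mk l Z B g) = mk l Z (Prod A B) (tupc Z f g)"
  unfolding tuple_def using the1_equality[OF syn_cat_tuple_ex1(2)[OF assms] syn_cat_tuple_ex1(1)[OF assms]] by simp

text \<open>Represents \<open>Eval \<cdot> (h \<times> Id)\<close> as it occurs in \<open>is_transpose\<close>.\<close>

definition unc :: "'c ty \<Rightarrow> 'c ty \<Rightarrow> 'c ty \<Rightarrow> 'c tm \<Rightarrow> 'c tm" where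
  "unc Z X Y h = cmpc (Prod Z X) (evc X Y)
     (tupc (Prod Z X) (cmpc (Prod Z X) h (fstc Z X)) (cmpc (Prod Z X) (idc X) (sndc Z X)))"

lemma unc:
  assumes h: "[] \<turnstile>\<^bsub>l\<^esub> h : Z \<rightarrow> X \<rightarrow> Y"
  shows "[] \<turnstile>\<^bsub>l\<^esub> unc Z X Y h : Prod Z X \<rightarrow> Y"
    and "S \<turnstile>\<^bsub>l\<^esub> p : Prod Z X \<Longrightarrow> S \<turnstile>\<^bsub>l\<^esub> Fst p \<approx> z : Z \<Longrightarrow> S \<turnstile>\<^bsub>l\<^esub> Snd p \<approx> x : X \<Longrightarrow>
      S \<turnstile>\<^bsub>l\<^esub> App (unc Z X Y h) p \<approx> App (App h z) x : Y"
proof -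
  have wf: "wf_ty l Z" "wf_ty l X" "wf_ty l Y" using wf_closed_fun[OF h] by auto
  note c = typing_cmpc[OF h typing_fstc[OF wf(1,2)]] typing_cmpc[OF typing_idc[OF wf(2)] typing_sndc[OF wf(1,2)]]
  show "[] \<turnstile>\<^bsub>l\<^esub> unc Z X Y h : Prod Z X \<rightarrow> Y"
    unfolding unc_def by (rule typing_cmpc[OF typing_evc[OF wf(2,3)] typing_tupc[OF c]])
  assume p: "S \<turnstile>\<^bsub>l\<^esub> p : Prod Z X" and z: "S \<turnstile>\<^bsub>l\<^esub> Fst p \<approx> z : Z" and x: "S \<turnstile>\<^bsub>l\<^esub> Snd p \<approx> x : X"
  have 1: "S \<turnstile>\<^bsub>l\<^esub> App (cmpc (Prod Z X) h (fstc Z X)) p \<approx> App h z : X \<rightarrow> Y"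
    by (rule App_cmpc[OF h typing_fstc[OF wf(1,2)] p App_fstc[OF wf(2) p z] eqth.Refl[OF typing_App_closed[OF h eqth_typing(2)[OF z]]]])
  have 2: "S \<turnstile>\<^bsub>l\<^esub> App (cmpc (Prod Z X) (idc X) (sndc Z X)) p \<approx> x : X"
    by (rule App_cmpc[OF typing_idc[OF wf(2)] typing_sndc[OF wf(1,2)] p App_sndc[OF wf(1) p x]
        App_idc[OF eqth.Refl[OF eqth_typing(2)[OF x]]]])
  note a = eqth_typing(2)[OF 1] eqth_typing(2)[OF 2]
  note q = typing.Pair[OF a]
  have "S \<turnstile>\<^bsub>l\<^esub> App (evc X Y) (Pair (App h z) x) \<approx> App (App h z) x : Y"
    by (rule App_evc[OF q CApp[OF Fst_beta[OF a] Snd_beta[OF a]]])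
  then show "S \<turnstile>\<^bsub>l\<^esub> App (unc Z X Y h) p \<approx> App (App h z) x : Y"
    unfolding unc_def
    by (rule App_cmpc[OF typing_evc[OF wf(2,3)] typing_tupc[OF c] p App_tupc[OF c(2,1) p 1 2]])
qed

text \<open>Moves the universal property of exponentials from arrows to terms, where it can be
  checked by evaluation.\<close>

lemma is_transpose_syn_cat:
  assumes f: "[] \<turnstile>\<^bsub>l\<^esub> f : Prod Z X \<rightarrow> Y"
  shows "is_transpose (syn_cat l) (eo Z) (eo X) (mk l (Prod Z X) Y f) m \<longleftrightarrow>
    (\<exists>h. m = mk l Z (X \<rightarrow> Y) h \<and> [] \<turnstile>\<^bsub>l\<^esub> h : Z \<rightarrow> X \<rightarrow> Y \<and> [] \<turnstile>\<^bsub>l\<^esub> unc Z X Y h \<approx> f : Prod Z X \<rightarrow> Y)"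
proof -
  note wf = wf_closed_prod[OF f] wf_closed_fun(2)[OF f]
  let ?e = "\<lambda>m. Eval (syn_cat l) (eo X) (eo Y) \<cdot>\<^bsub>syn_cat l\<^esub> times_map (syn_cat l) m (Id (syn_cat l) (eo X))"
  have 1: "Eval (syn_cat l) (eo X) (eo Y) \<cdot>\<^bsub>syn_cat l\<^esub> times_map (syn_cat l) (mk l Z (X \<rightarrow> Y) h) (Id (syn_cat l) (eo X)) = mk l (Prod Z X) Y (unc Z X Y h)"
    if h: "[] \<turnstile>\<^bsub>l\<^esub> h : Z \<rightarrow> X \<rightarrow> Y" for h
  proof -
    note c = typing_cmpc[OF h typing_fstc[OF wf(1,2)]] typing_cmpc[OF typing_idc[OF wf(2)] typing_sndc[OF wf(1,2)]]
    show ?thesis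
      using h wf c typing_tupc[OF c]
      by (simp add: times_map_def typing_idc typing_fstc typing_sndc typing_evc unc_def)
  qed
  have "is_transpose (syn_cat l) (eo Z) (eo X) (mk l (Prod Z X) Y f) m \<longleftrightarrow>
      m \<in> hom (syn_cat l) (eo Z) (eo (X \<rightarrow> Y)) \<and> ?e m = mk l (Prod Z X) Y f"
    by (simp add: is_transpose_def)
  also have "\<dots> \<longleftrightarrow> (\<exists>h. m = mk l Z (X \<rightarrow> Y) h \<and> [] \<turnstile>\<^bsub>l\<^esub> h : Z \<rightarrow> X \<rightarrow> Y \<and> [] \<turnstile>\<^bsub>l\<^esub> unc Z X Y h \<approx> f : Prod Z X \<rightarrow> Y)"
    (is "?L \<longleftrightarrow> ?R")
  proof
    assume L: ?L
    then obtain h where h: "m = mk l Z (X \<rightarrow> Y) h" "[] \<turnstile>\<^bsub>l\<^esub> h : Z \<rightarrow> X \<rightarrow> Y" by (auto elim: homE)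
    have "mk l (Prod Z X) Y (unc Z X Y h) = mk l (Prod Z X) Y f" using L 1[OF h(2)] unfolding h(1) by (rule_tac trans[OF sym]) auto
    then show ?R using h mk_eq_iff[OF unc(1)[OF h(2)] f] by blast
  next
    assume ?R
    then obtain h where h: "m = mk l Z (X \<rightarrow> Y) h" "[] \<turnstile>\<^bsub>l\<^esub> h : Z \<rightarrow> X \<rightarrow> Y"
      "[] \<turnstile>\<^bsub>l\<^esub> unc Z X Y h \<approx> f : Prod Z X \<rightarrow> Y" by blast
    show ?L unfolding h(1) using trans[OF 1[OF h(2)] mk_cong[OF h(3)]] mk_hom[OF h(2)] by (rule_tac conjI)
  qed
  finally show ?thesis .
qed

lemma syn_cat_transpose_ex1:
  assumes f: "[] \<turnstile>\<^bsub>l\<^esub> f : Prod Z X \<rightarrow> Y"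
  shows "is_transpose (syn_cat l) (eo Z) (eo X) (mk l (Prod Z X) Y f) (mk l Z (X \<rightarrow> Y) (trc Z X f))"
    "\<exists>!m. is_transpose (syn_cat l) (eo Z) (eo X) (mk l (Prod Z X) Y f) m"
proof -
  note wf = wf_closed_prod[OF f] wf_closed_fun(2)[OF f]
  have p: "[[Prod Z X]] \<turnstile>\<^bsub>l\<^esub> Var 0 : Prod Z X" by (rule typing_Var0) (simp add: wf)
  note T = typing_trc[OF f]
  note z = eqth.Refl[OF typing.Fst[OF p]] and x = eqth.Refl[OF typing.Snd[OF p]]
  have "[[Prod Z X]] \<turnstile>\<^bsub>l\<^esub> App (unc Z X Y (trc Z X f)) (Var 0) \<approx> App (App (trc Z X f) (Fst (Var 0))) (Snd (Var 0)) : Y"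
    by (rule unc(2)[OF T p z x])
  moreover have "[[Prod Z X]] \<turnstile>\<^bsub>l\<^esub> App (App (trc Z X f) (Fst (Var 0))) (Snd (Var 0)) \<approx> App f (Var 0) : Y"
    by (rule App_trc[OF f typing.Fst[OF p] typing.Snd[OF p]])
      (rule eqth_App_closed[OF eqth.Refl[OF f] eqth.Sym[OF Prod_eta[OF p]]])
  ultimately have "[[Prod Z X]] \<turnstile>\<^bsub>l\<^esub> App (unc Z X Y (trc Z X f)) (Var 0) \<approx> App f (Var 0) : Y" by (rule eqth.Trans)
  from eqth_closed_ext[OF unc(1)[OF T] f this]
  show ex: "is_transpose (syn_cat l) (eo Z) (eo X) (mk l (Prod Z X) Y f) (mk l Z (X \<rightarrow> Y) (trc Z X f))"
    unfolding is_transpose_syn_cat[OF f] using T by blast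
  show "\<exists>!m. is_transpose (syn_cat l) (eo Z) (eo X) (mk l (Prod Z X) Y f) m"
  proof (rule ex1I[of _ "mk l Z (X \<rightarrow> Y) (trc Z X f)"], rule ex)
    fix m assume "is_transpose (syn_cat l) (eo Z) (eo X) (mk l (Prod Z X) Y f) m"
    then obtain h where m: "m = mk l Z (X \<rightarrow> Y) h" and h: "[] \<turnstile>\<^bsub>l\<^esub> h : Z \<rightarrow> X \<rightarrow> Y" and e: "[] \<turnstile>\<^bsub>l\<^esub> unc Z X Y h \<approx> f : Prod Z X \<rightarrow> Y"
      unfolding is_transpose_syn_cat[OF f] by blast
    \<comment> \<open>Uniqueness uses eta twice, so the two candidates are compared on two
      variables: \<open>Var 1\<close> of type \<open>Z\<close> and the more recent
      \<open>Var 0\<close> of type \<open>X\<close>.\<close>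
    let ?S = "[[X, Z]]"
    have v: "?S \<turnstile>\<^bsub>l\<^esub> Var 1 : Z" "?S \<turnstile>\<^bsub>l\<^esub> Var 0 : X" by (rule typing_Var; simp add: wf)+
    note q = typing.Pair[OF v]
    have "?S \<turnstile>\<^bsub>l\<^esub> App (App h (Var 1)) (Var 0) \<approx> App f (Pair (Var 1) (Var 0)) : Y"
      by (rule eqth.Trans[OF eqth.Sym[OF unc(2)[OF h q Fst_beta[OF v] Snd_beta[OF v]]]
            eqth_App_closed[OF e eqth.Refl[OF q]]])
    moreover have "?S \<turnstile>\<^bsub>l\<^esub> App (App (trc Z X f) (Var 1)) (Var 0) \<approx> App f (Pair (Var 1) (Var 0)) : Y"
      by (rule App_trc[OF f v eqth.Refl[OF typing_App_closed[OF f q]]])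
    moreover note w = typing_App_closed[OF h typing_Var0[OF wf(1)]] typing_App_closed[OF T typing_Var0[OF wf(1)]]
    ultimately have "[[Z]] \<turnstile>\<^bsub>l\<^esub> App h (Var 0) \<approx> App (trc Z X f) (Var 0) : X \<rightarrow> Y"
      using eqth_ext[OF w, of "App f (Pair (Var 1) (Var 0))"] by (simp add: closed_lift[OF h] closed_lift[OF T])
    then show "m = mk l Z (X \<rightarrow> Y) (trc Z X f)"
      unfolding m by (rule mk_eqI[OF h T _ eqth.Refl[OF w(2)]])
  qed
qed

lemma syn_cat_transpose [simp]:
  assumes "[] \<turnstile>\<^bsub>l\<^esub> f : Prod Z X \<rightarrow> Y"
  shows "transpose (syn_cat l) (eo Z) (eo X) (mk l (Prod Z X) Y f) = mk l Z (X \<rightarrow> Y) (trc Z X f)"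
  unfolding transpose_def by (rule the1_equality[OF syn_cat_transpose_ex1(2,1)[OF assms]])

lemma is_ccc_syn_cat: "is_ccc (syn_cat l)"
  unfolding is_ccc_def
proof (intro conjI ballI)
  show "is_category (syn_cat l)" by (rule is_category_syn_cat)
  show "Unit (syn_cat l) \<in> Ob (syn_cat l)" by simp
next
  fix X assume "X \<in> Ob (syn_cat l)"
  then obtain A where "X = eo A" "wf_ty l A" by auto
  then show "\<exists>!f. f \<in> hom (syn_cat l) X (Unit (syn_cat l))" using syn_cat_unit_ex1[of l A] by simp
next
  fix X Y assume "X \<in> Ob (syn_cat l)" "Y \<in> Ob (syn_cat l)"
  then show "Times (syn_cat l) X Y \<in> Ob (syn_cat l)" "Proj1 (syn_cat l) X Y \<in> hom (syn_cat l) (Times (syn_cat l) X Y) X"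
    "Proj2 (syn_cat l) X Y \<in> hom (syn_cat l) (Times (syn_cat l) X Y) Y" "Expo (syn_cat l) X Y \<in> Ob (syn_cat l)"
    "Eval (syn_cat l) X Y \<in> hom (syn_cat l) (Times (syn_cat l) (Expo (syn_cat l) X Y) X) Y"
    by (auto simp: typing_fstc typing_sndc typing_evc)
next
  fix X Y Z f g
  assume "X \<in> Ob (syn_cat l)" "Y \<in> Ob (syn_cat l)" "Z \<in> Ob (syn_cat l)" and fg: "f \<in> hom (syn_cat l) Z X" "g \<in> hom (syn_cat l) Z Y"
  then obtain A B D where X: "X = eo A" "Y = eo B" "Z = eo D" by auto
  obtain t u where "f = mk l D A t" "[] \<turnstile>\<^bsub>l\<^esub> t : D \<rightarrow> A" "g = mk l D B u" "[] \<turnstile>\<^bsub>l\<^esub> u : D \<rightarrow> B"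
    using fg X by (auto elim!: homE)
  then show "\<exists>!h. h \<in> hom (syn_cat l) Z (Times (syn_cat l) X Y) \<and> Proj1 (syn_cat l) X Y \<cdot>\<^bsub>syn_cat l\<^esub> h = f \<and> Proj2 (syn_cat l) X Y \<cdot>\<^bsub>syn_cat l\<^esub> h = g"
    using syn_cat_tuple_ex1(2)[of l t D A u B] X by simp
next
  fix X Y Z f
  assume "X \<in> Ob (syn_cat l)" "Y \<in> Ob (syn_cat l)" "Z \<in> Ob (syn_cat l)" and f: "f \<in> hom (syn_cat l) (Times (syn_cat l) Z X) Y"
  then obtain A B D where X: "X = eo A" "Y = eo B" "Z = eo D" by auto
  obtain t where "f = mk l (Prod D A) B t" "[] \<turnstile>\<^bsub>l\<^esub> t : Prod D A \<rightarrow> B"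
    using f X by (auto elim!: homE)
  then show "\<exists>!h. is_transpose (syn_cat l) Z X f h"
    using syn_cat_transpose_ex1(2)[of l t D A B] X by simp
qed

section \<open>The box functor on closed terms\<close>

definition syn_box :: "nat \<Rightarrow> ('o, 'm) ftor" where
  "syn_box l = \<lparr>FO = (\<lambda>X. eo (Box (ob X))), FM = (\<lambda>m. mk (Suc l) (Box (src m)) (Box (tgt m)) (boxc (src m) (trm m)))\<rparr>"

lemma syn_box_FO [simp]: "FO (syn_box l) (eo A) = eo (Box A)"
  by (simp add: syn_box_def)

lemma syn_box_FM [simp]:
  assumes t: "[] \<turnstile>\<^bsub>l\<^esub> t : A \<rightarrow> B"
  shows "FM (syn_box l) (mk l A B t) = mk (Suc l) (Box A) (Box B) (boxc A t)"
proof -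
  have v: "[[Box A], []] \<turnstile>\<^bsub>l\<^esub> Unq (Var 0) : A"
    by (rule typing_Unq) (simp_all add: typing_Var0 wf_closed_fun[OF t])
  have "[] \<turnstile>\<^bsub>Suc l\<^esub> boxc A t \<approx> boxc A (rep l (A \<rightarrow> B) t) : Box A \<rightarrow> Box B"
    unfolding boxc_def
    by (intro eqth_Lam CQuo eqth_App_closed[OF rep[OF t]] eqth.Refl) (use v in simp)
  then show ?thesis by (simp add: syn_box_def mk_cong)
qed

lemma typing_Unq_snoc: "S \<turnstile>\<^bsub>Suc l\<^esub> t : Box A \<Longrightarrow> S @ [[]] \<turnstile>\<^bsub>l\<^esub> Unq t : A"
  by (rule typing_Unq) (auto dest: typing_wf(1))

text \<open>Preservation of identities is \<open>Box_eta\<close>. For composites, the quotation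
  produced by the first arrow is unquoted by the second, and \<open>Box_beta\<close> cancels the
  two.\<close>

lemma is_functor_syn_box: "is_functor (syn_cat l) (syn_cat (Suc l)) (syn_box l)"
  unfolding is_functor_def
proof (intro conjI ballI)
  fix X assume "X \<in> Ob (syn_cat l)"
  then obtain A where X: "X = eo A" "wf_ty l A" by auto
  then show "FO (syn_box l) X \<in> Ob (syn_cat (Suc l))" by simp
  have v: "[[Box A]] \<turnstile>\<^bsub>Suc l\<^esub> Var 0 : Box A" by (rule typing_Var0) (simp add: X)
  have "[[Box A]] \<turnstile>\<^bsub>Suc l\<^esub> App (boxc A (idc A)) (Var 0) \<approx> Quo (Unq (Var 0)) : Box A"
    by (rule App_boxc[OF typing_idc[OF X(2)] v App_idc[OF eqth.Refl[OF typing_Unq_snoc[OF v]]]])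
  then have "[[Box A]] \<turnstile>\<^bsub>Suc l\<^esub> App (boxc A (idc A)) (Var 0) \<approx> Var 0 : Box A"
    using Box_eta[OF v] by (meson eqth.Sym eqth.Trans)
  then have "mk (Suc l) (Box A) (Box A) (boxc A (idc A)) = mk (Suc l) (Box A) (Box A) (idc (Box A))"
    using X by (intro mk_eqI[OF typing_boxc[OF typing_idc[OF X(2)]] typing_idc _ App_idc[OF eqth.Refl[OF v]]]) simp_all
  then show "FM (syn_box l) (Id (syn_cat l) X) = Id (syn_cat (Suc l)) (FO (syn_box l) X)"
    using X by (simp add: typing_idc)
next
  fix X Y f assume "X \<in> Ob (syn_cat l)" "Y \<in> Ob (syn_cat l)" "f \<in> hom (syn_cat l) X Y"
  then show "FM (syn_box l) f \<in> hom (syn_cat (Suc l)) (FO (syn_box l) X) (FO (syn_box l) Y)"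
    by (auto elim!: homE simp: typing_boxc)
next
  fix X Y Z f g
  assume "X \<in> Ob (syn_cat l)" "Y \<in> Ob (syn_cat l)" "Z \<in> Ob (syn_cat l)" and fg: "f \<in> hom (syn_cat l) X Y" "g \<in> hom (syn_cat l) Y Z"
  then obtain A B D where X: "X = eo A" "Y = eo B" "Z = eo D" "wf_ty l A" by auto
  then obtain t u where t: "f = mk l A B t" "[] \<turnstile>\<^bsub>l\<^esub> t : A \<rightarrow> B" "g = mk l B D u" "[] \<turnstile>\<^bsub>l\<^esub> u : B \<rightarrow> D"
    using fg by (auto elim!: homE)
  have v: "[[Box A]] \<turnstile>\<^bsub>Suc l\<^esub> Var 0 : Box A" by (rule typing_Var0) (simp add: X)
  note c = typing_cmpc[OF t(4,2)]
  note w = typing_Unq_snoc[OF v]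
  note w1 = typing_App_closed[OF t(2) w] note w2 = typing_App_closed[OF t(4) w1]
  have 1: "[[Box A]] \<turnstile>\<^bsub>Suc l\<^esub> App (boxc A (cmpc A u t)) (Var 0) \<approx> Quo (App u (App t (Unq (Var 0)))) : Box D"
    by (rule App_boxc[OF c v App_cmpc[OF t(4,2) w eqth.Refl[OF w1] eqth.Refl[OF w2]]])
  have "[[Box A]] @ [[]] \<turnstile>\<^bsub>l\<^esub> Unq (Quo (App t (Unq (Var 0)))) \<approx> App t (Unq (Var 0)) : B"
    by (rule eqth_Unq_Quo) (use w1 typing_wf(1)[OF w] in simp_all)
  then have 2: "[[Box A]] @ [[]] \<turnstile>\<^bsub>l\<^esub> App u (Unq (Quo (App t (Unq (Var 0))))) \<approx> App u (App t (Unq (Var 0))) : D"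
    by (rule eqth_App_closed[OF eqth.Refl[OF t(4)]])
  have "[[Box A]] \<turnstile>\<^bsub>Suc l\<^esub> App (cmpc (Box A) (boxc B u) (boxc A t)) (Var 0) \<approx> Quo (App u (App t (Unq (Var 0)))) : Box D"
    by (rule App_cmpc[OF typing_boxc[OF t(4)] typing_boxc[OF t(2)] v App_boxc[OF t(2) v eqth.Refl[OF w1]]
          App_boxc[OF t(4) typing.Quo[OF w1] 2]])
  from mk_eqI[OF typing_boxc[OF c] typing_cmpc[OF typing_boxc[OF t(4)] typing_boxc[OF t(2)]] 1 this]
  show "FM (syn_box l) (g \<cdot>\<^bsub>syn_cat l\<^esub> f) = FM (syn_box l) g \<cdot>\<^bsub>syn_cat (Suc l)\<^esub> FM (syn_box l) f"
    using t c by (simp add: typing_boxc)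
qed

text \<open>The unit \<open>One \<rightarrow> Box One\<close> of the monoidal structure, inverse to
  the arrow into the terminal object.\<close>

definition qsc :: "'c tm" where "qsc = Lam One (Quo Star)"

lemma typing_qsc: "[] \<turnstile>\<^bsub>Suc l\<^esub> qsc : One \<rightarrow> Box One"
  unfolding qsc_def by (rule tyI | simp)+

lemma App_qsc: "S \<turnstile>\<^bsub>Suc l\<^esub> t : One \<Longrightarrow> S \<turnstile>\<^bsub>Suc l\<^esub> App qsc t \<approx> Quo Star : Box One"
proof -
  assume t: "S \<turnstile>\<^bsub>Suc l\<^esub> t : One"
  have "S \<turnstile>\<^bsub>Suc l\<^esub> App qsc t \<approx> subst 0 0 t (Quo Star) : Box One"
    unfolding qsc_def by (rule eqth_beta[OF _ t]) (rule tyI | simp add: typing_wf[OF t])+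
  then show ?thesis by simp
qed

text \<open>Inverse of the comparison arrow from \<open>Box (Prod A B)\<close> to
  \<open>Prod (Box A) (Box B)\<close>: both components are unquoted inside one quotation.\<close>

definition pqc :: "'c ty \<Rightarrow> 'c ty \<Rightarrow> 'c tm" where
  "pqc A B = Lam (Prod (Box A) (Box B)) (Quo (Pair (Unq (Fst (Var 0))) (Unq (Snd (Var 0)))))"

lemma App_pqc:
  assumes t: "S \<turnstile>\<^bsub>Suc l\<^esub> t : Prod (Box A) (Box B)"
  shows "S \<turnstile>\<^bsub>Suc l\<^esub> App (pqc A B) t \<approx> Quo (Pair (Unq (Fst t)) (Unq (Snd t))) : Box (Prod A B)"
proof -
  note wf = typing_wf[OF t]
  have v: "extend (Prod (Box A) (Box B)) S \<turnstile>\<^bsub>Suc l\<^esub> Var 0 : Prod (Box A) (Box B)"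
    by (rule typing_Var) (use wf in simp_all)
  have "S \<turnstile>\<^bsub>Suc l\<^esub> App (pqc A B) t \<approx> subst 0 0 t (Quo (Pair (Unq (Fst (Var 0))) (Unq (Snd (Var 0))))) : Box (Prod A B)"
    unfolding pqc_def
    by (rule eqth_beta[OF _ t]) (intro typing.Quo typing.Pair typing_Unq_snoc typing.Fst[OF v] typing.Snd[OF v])
  then show ?thesis by simp
qed

lemma typing_pqc: "wf_ty l A \<Longrightarrow> wf_ty l B \<Longrightarrow> [] \<turnstile>\<^bsub>Suc l\<^esub> pqc A B : Prod (Box A) (Box B) \<rightarrow> Box (Prod A B)"
proof -
  assume wf: "wf_ty l A" "wf_ty l B"
  have v: "extend (Prod (Box A) (Box B)) [] \<turnstile>\<^bsub>Suc l\<^esub> Var 0 : Prod (Box A) (Box B)"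
    by (rule typing_Var) (use wf in simp_all)
  show ?thesis unfolding pqc_def
    by (intro typing_Lam typing.Quo typing.Pair typing_Unq_snoc typing.Fst[OF v] typing.Snd[OF v])
qed

lemma is_isoI:
  assumes f: "[] \<turnstile>\<^bsub>l\<^esub> f : A \<rightarrow> B" and g: "[] \<turnstile>\<^bsub>l\<^esub> g : B \<rightarrow> A"
    and 1: "[[A]] \<turnstile>\<^bsub>l\<^esub> App (cmpc A g f) (Var 0) \<approx> Var 0 : A" and 2: "[[B]] \<turnstile>\<^bsub>l\<^esub> App (cmpc B f g) (Var 0) \<approx> Var 0 : B"
  shows "inverse_arrows (syn_cat l) (mk l A B f) (mk l B A g)"
proof -
  note v = typing_Var0[OF wf_closed_fun(1)[OF f]] typing_Var0[OF wf_closed_fun(1)[OF g]]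
  have "mk l A A (cmpc A g f) = mk l A A (idc A)" "mk l B B (cmpc B f g) = mk l B B (idc B)"
    using f g v 1 2 by (auto intro!: mk_eqI typing_cmpc typing_idc App_idc[OF eqth.Refl] wf_closed_fun(1))
  then show ?thesis using f g by (simp add: inverse_arrows_def)
qed

lemma bang_inverse: "inverse_arrows (syn_cat (Suc l)) (bang (syn_cat (Suc l)) (eo (Box One))) (mk (Suc l) One (Box One) qsc)"
proof -
  have v: "[[Box One]] \<turnstile>\<^bsub>Suc l\<^esub> Var 0 : Box One" "[[One]] \<turnstile>\<^bsub>Suc l\<^esub> Var 0 : One" by (rule typing_Var0; simp)+
  have b: "[] \<turnstile>\<^bsub>Suc l\<^esub> bangc (Box One) : Box One \<rightarrow> One" by (rule typing_bangc) simp
  have "[[Box One]] \<turnstile>\<^bsub>Suc l\<^esub> Var 0 \<approx> Quo Star : Box One"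
    by (rule eqth.Trans[OF Box_eta[OF v(1)] CQuo[OF One_eta[OF typing_Unq_snoc[OF v(1)]]]])
  moreover have "[[Box One]] \<turnstile>\<^bsub>Suc l\<^esub> App (cmpc (Box One) qsc (bangc (Box One))) (Var 0) \<approx> Quo Star : Box One"
    by (rule App_cmpc[OF typing_qsc b v(1) App_bangc[OF v(1)] App_qsc]) (simp add: typing.Star)
  ultimately have 1: "[[Box One]] \<turnstile>\<^bsub>Suc l\<^esub> App (cmpc (Box One) qsc (bangc (Box One))) (Var 0) \<approx> Var 0 : Box One"
    by (meson eqth.Sym eqth.Trans)
  have "[[One]] \<turnstile>\<^bsub>Suc l\<^esub> App (cmpc One (bangc (Box One)) qsc) (Var 0) \<approx> Star : One"
    by (rule One_eta[OF typing_App_closed[OF typing_cmpc[OF b typing_qsc] v(2)]])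
  then have 2: "[[One]] \<turnstile>\<^bsub>Suc l\<^esub> App (cmpc One (bangc (Box One)) qsc) (Var 0) \<approx> Var 0 : One"
    using One_eta[OF v(2)] by (meson eqth.Sym eqth.Trans)
  show ?thesis using is_isoI[OF b typing_qsc 1 2] by (simp add: syn_cat_bang)
qed

lemma products_syn_box: "preserves_finite_products (syn_cat l) (syn_cat (Suc l)) (syn_box l)"
  unfolding preserves_finite_products_def
proof (intro conjI ballI)
  show "is_iso (syn_cat (Suc l)) (bang (syn_cat (Suc l)) (FO (syn_box l) (Unit (syn_cat l))))"
    using bang_inverse by (auto simp: is_iso_def)
next
  fix X Y assume "X \<in> Ob (syn_cat l)" "Y \<in> Ob (syn_cat l)"
  then obtain A B where X: "X = eo A" "Y = eo B" and wf: "wf_ty l A" "wf_ty l B" by auto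
  let ?P = "Box (Prod A B)" and ?Q = "Prod (Box A) (Box B)"
  note p = typing_fstc[OF wf] typing_sndc[OF wf]
  note bp = p[THEN typing_boxc]
  note t = typing_tupc[OF bp]
  note q = typing_pqc[OF wf]
  have v: "[[?P]] \<turnstile>\<^bsub>Suc l\<^esub> Var 0 : ?P" "[[?Q]] \<turnstile>\<^bsub>Suc l\<^esub> Var 0 : ?Q" by (rule typing_Var0; simp add: wf)+
  have tup: "S \<turnstile>\<^bsub>Suc l\<^esub> App (tupc ?P (boxc (Prod A B) (fstc A B)) (boxc (Prod A B) (sndc A B))) s \<approx> Pair (Quo a) (Quo b) : ?Q"
    if s: "S \<turnstile>\<^bsub>Suc l\<^esub> s : ?P" and a: "S @ [[]] \<turnstile>\<^bsub>l\<^esub> Fst (Unq s) \<approx> a : A" and b: "S @ [[]] \<turnstile>\<^bsub>l\<^esub> Snd (Unq s) \<approx> b : B" for S s a b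
    by (rule App_tupc[OF bp(2,1) s App_boxc[OF p(1) s App_fstc[OF wf(2) typing_Unq_snoc[OF s] a]]
          App_boxc[OF p(2) s App_sndc[OF wf(1) typing_Unq_snoc[OF s] b]]])
  note w = typing_Unq_snoc[OF v(1)]
  note T = tup[OF v(1) eqth.Refl[OF typing.Fst[OF w]] eqth.Refl[OF typing.Snd[OF w]]]
  let ?a = "Fst (Unq (Var 0))" and ?b = "Snd (Unq (Var 0))"
  have ab: "[[?P]] \<turnstile>\<^bsub>Suc l\<^esub> Quo ?a : Box A" "[[?P]] \<turnstile>\<^bsub>Suc l\<^esub> Quo ?b : Box B"
    by (intro typing.Quo typing.Fst[OF w] typing.Snd[OF w])+
  have S: "wf_stack l ([[?P]] @ [[]])" using typing_wf(1)[OF w] .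
  have "[[?P]] @ [[]] \<turnstile>\<^bsub>l\<^esub> Unq (Fst (Pair (Quo ?a) (Quo ?b))) \<approx> ?a : A"
    by (rule eqth_Unq_Quo') (use Fst_beta[OF ab] S in simp_all)
  moreover have "[[?P]] @ [[]] \<turnstile>\<^bsub>l\<^esub> Unq (Snd (Pair (Quo ?a) (Quo ?b))) \<approx> ?b : B"
    by (rule eqth_Unq_Quo') (use Snd_beta[OF ab] S in simp_all)
  ultimately have "[[?P]] @ [[]] \<turnstile>\<^bsub>l\<^esub> Pair (Unq (Fst (Pair (Quo ?a) (Quo ?b)))) (Unq (Snd (Pair (Quo ?a) (Quo ?b)))) \<approx> Unq (Var 0) : Prod A B"
    using Prod_eta[OF w] CPair by (meson eqth.Sym eqth.Trans)
  from eqth.Trans[OF App_pqc[OF typing.Pair[OF ab]] eqth.Trans[OF CQuo[OF this] eqth.Sym[OF Box_eta[OF v(1)]]]]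
  have 1: "[[?P]] \<turnstile>\<^bsub>Suc l\<^esub> App (cmpc ?P (pqc A B) (tupc ?P (boxc (Prod A B) (fstc A B)) (boxc (Prod A B) (sndc A B)))) (Var 0) \<approx> Var 0 : ?P"
    by (rule App_cmpc[OF q t v(1) T])
  note f = typing.Fst[OF v(2)] and s = typing.Snd[OF v(2)]
  let ?q = "Pair (Unq (Fst (Var 0))) (Unq (Snd (Var 0)))"
  note u = typing.Pair[OF f[THEN typing_Unq_snoc] s[THEN typing_Unq_snoc]]
  have "[[?Q]] @ [[]] \<turnstile>\<^bsub>l\<^esub> Unq (Quo ?q) \<approx> ?q : Prod A B"
    by (rule eqth_Unq_Quo) (use u typing_wf(1)[OF u] in simp_all)
  note T2 = tup[OF typing.Quo[OF u] eqth_Fst[OF this] eqth_Snd[OF this]]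
  have "[[?Q]] \<turnstile>\<^bsub>Suc l\<^esub> Pair (Quo (Unq (Fst (Var 0)))) (Quo (Unq (Snd (Var 0)))) \<approx> Var 0 : ?Q"
    by (rule eqth.Trans[OF CPair[OF eqth.Sym[OF Box_eta[OF f]] eqth.Sym[OF Box_eta[OF s]]] eqth.Sym[OF Prod_eta[OF v(2)]]])
  from eqth.Trans[OF T2 this]
  have 2: "[[?Q]] \<turnstile>\<^bsub>Suc l\<^esub> App (cmpc ?Q (tupc ?P (boxc (Prod A B) (fstc A B)) (boxc (Prod A B) (sndc A B))) (pqc A B)) (Var 0) \<approx> Var 0 : ?Q"
    by (rule App_cmpc[OF t q v(2) App_pqc[OF v(2)]])
  show "is_iso (syn_cat (Suc l)) (tuple (syn_cat (Suc l)) (FM (syn_box l) (Proj1 (syn_cat l) X Y)) (FM (syn_box l) (Proj2 (syn_cat l) X Y)))"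
    using is_isoI[OF t q 1 2] p bp X by (auto simp: is_iso_def)
qed

lemma unit_map_syn_box: "unit_map (syn_cat l) (syn_cat (Suc l)) (syn_box l) = mk (Suc l) One (Box One) qsc"
proof -
  interpret ccc "syn_cat (Suc l)" by unfold_locales (rule is_ccc_syn_cat)
  show ?thesis
    unfolding unit_map_def inverse_of_def using bang_inverse[of l] inverse_arrows_unique by (auto intro!: the_equality)
qed

definition norc :: "'c tm \<Rightarrow> 'c tm" where "norc t = cmpc One (boxc One t) qsc"

lemma normal_map_syn_box:
  "[] \<turnstile>\<^bsub>l\<^esub> t : One \<rightarrow> A \<Longrightarrow> normal_map (syn_cat l) (syn_cat (Suc l)) (syn_box l) (mk l One A t) = mk (Suc l) One (Box A) (norc t)"
  using typing_boxc[of l t One A] typing_qsc[of l] by (simp add: normal_map_def unit_map_syn_box norc_def)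

lemma typing_norc: "[] \<turnstile>\<^bsub>l\<^esub> t : One \<rightarrow> A \<Longrightarrow> [] \<turnstile>\<^bsub>Suc l\<^esub> norc t : One \<rightarrow> Box A"
  unfolding norc_def by (rule typing_cmpc[OF typing_boxc typing_qsc])

lemma App_norc:
  assumes t: "[] \<turnstile>\<^bsub>l\<^esub> t : One \<rightarrow> A" and s: "S \<turnstile>\<^bsub>Suc l\<^esub> s : One" and u: "S @ [[]] \<turnstile>\<^bsub>l\<^esub> App t Star \<approx> u : A"
  shows "S \<turnstile>\<^bsub>Suc l\<^esub> App (norc t) s \<approx> Quo u : Box A"
proof -
  have S: "wf_stack l (S @ [[]])" using typing_wf(1)[OF s] by simp
  have Q: "S \<turnstile>\<^bsub>Suc l\<^esub> Quo Star : Box One" by (intro typing.Quo typing.Star S)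
  have "S @ [[]] \<turnstile>\<^bsub>l\<^esub> App t (Unq (Quo Star)) \<approx> App t Star : A"
    by (rule eqth_App_closed[OF eqth.Refl[OF t] One_eta[OF typing_Unq_snoc[OF Q]]])
  from App_boxc[OF t Q eqth.Trans[OF this u]]
  show ?thesis unfolding norc_def by (rule App_cmpc[OF typing_boxc[OF t] typing_qsc s App_qsc[OF s]])
qed

text \<open>On \<open>Star\<close>, the image of \<open>t\<close> under the normality map evaluates
  to the quotation of \<open>App t Star\<close>. Unquoting recovers \<open>App t Star\<close>, and
  eta for \<open>One\<close> recovers \<open>t\<close>; this gives injectivity.\<close>

lemma normal_syn_box: "is_normal (syn_cat l) (syn_cat (Suc l)) (syn_box l)"
  unfolding is_normal_def bij_betw_def
proof (intro ballI conjI)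
  fix X assume "X \<in> Ob (syn_cat l)"
  then obtain A where X: "X = eo A" "wf_ty l A" by auto
  let ?N = "normal_map (syn_cat l) (syn_cat (Suc l)) (syn_box l)"
  have st: "S \<turnstile>\<^bsub>l\<^esub> Star : One" if "wf_stack l S" for S :: "'c stack" and l using that by (rule typing.Star)
  have v: "[[One]] \<turnstile>\<^bsub>l\<^esub> Var 0 : One" for l by (rule typing_Var0) simp
  show "inj_on ?N (hom (syn_cat l) (Unit (syn_cat l)) X)"
  proof (rule inj_onI)
    fix f g assume fg: "f \<in> hom (syn_cat l) (Unit (syn_cat l)) X" "g \<in> hom (syn_cat l) (Unit (syn_cat l)) X" and e: "?N f = ?N g"
    then obtain t u where t: "f = mk l One A t" "[] \<turnstile>\<^bsub>l\<^esub> t : One \<rightarrow> A" "g = mk l One A u" "[] \<turnstile>\<^bsub>l\<^esub> u : One \<rightarrow> A"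
      using X by (auto elim!: homE)
    have "[] \<turnstile>\<^bsub>Suc l\<^esub> norc t \<approx> norc u : One \<rightarrow> Box A"
      using e t typing_norc[OF t(2)] typing_norc[OF t(4)] by (simp add: normal_map_syn_box mk_eq_iff)
    from eqth_App_closed[OF this eqth.Refl[OF st]]
    have n: "[] \<turnstile>\<^bsub>Suc l\<^esub> App (norc t) Star \<approx> App (norc u) Star : Box A" by simp
    have "[] \<turnstile>\<^bsub>Suc l\<^esub> App (norc s) Star \<approx> Quo (App s Star) : Box A" if "[] \<turnstile>\<^bsub>l\<^esub> s : One \<rightarrow> A" for s
      by (rule App_norc[OF that st]) (auto intro!: eqth.Refl typing_App_closed[OF that] st)
    with n t have "[] \<turnstile>\<^bsub>Suc l\<^esub> Quo (App t Star) \<approx> Quo (App u Star) : Box A" by (meson eqth.Sym eqth.Trans)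
    then have "[[One]] \<turnstile>\<^bsub>l\<^esub> Unq (Quo (App t Star)) \<approx> App u Star : A" by (intro eqth_Unq_Quo') simp_all
    moreover have "[[One]] \<turnstile>\<^bsub>l\<^esub> Unq (Quo (App t Star)) \<approx> App t Star : A"
      by (rule eqth_Unq_Quo) (auto intro!: typing_App_closed[OF t(2)] st)
    ultimately have tu: "[[One]] \<turnstile>\<^bsub>l\<^esub> App t Star \<approx> App u Star : A" by (meson eqth.Sym eqth.Trans)
    have "[[One]] \<turnstile>\<^bsub>l\<^esub> App t (Var 0) \<approx> App u Star : A"
      by (rule eqth.Trans[OF eqth_App_closed[OF eqth.Refl[OF t(2)] One_eta[OF v]] tu])
    moreover have "[[One]] \<turnstile>\<^bsub>l\<^esub> App u (Var 0) \<approx> App u Star : A"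
      by (rule eqth_App_closed[OF eqth.Refl[OF t(4)] One_eta[OF v]])
    ultimately show "f = g" unfolding t(1,3) by (rule mk_eqI[OF t(2,4)])
  qed
  show "?N ` hom (syn_cat l) (Unit (syn_cat l)) X = hom (syn_cat (Suc l)) (Unit (syn_cat (Suc l))) (FO (syn_box l) X)"
  proof (intro equalityI subsetI)
    fix g assume "g \<in> ?N ` hom (syn_cat l) (Unit (syn_cat l)) X"
    then show "g \<in> hom (syn_cat (Suc l)) (Unit (syn_cat (Suc l))) (FO (syn_box l) X)"
      using X by (auto elim!: homE simp: normal_map_syn_box typing_norc)
  next
    fix g assume "g \<in> hom (syn_cat (Suc l)) (Unit (syn_cat (Suc l))) (FO (syn_box l) X)"
    then obtain s where s: "g = mk (Suc l) One (Box A) s" "[] \<turnstile>\<^bsub>Suc l\<^esub> s : One \<rightarrow> Box A"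
      using X by (auto elim: homE)
    \<comment> \<open>The preimage of \<open>s\<close>. The unquotation discards the bound variable
      and leaves \<open>s\<close> in the empty stack; \<open>Star\<close> stands in for that
      variable, to which it is equal by \<open>One_eta\<close>.\<close>
    let ?t = "Lam One (Unq (App s Star))"
    have sS: "S \<turnstile>\<^bsub>Suc l\<^esub> App s Star : Box A" if "wf_stack (Suc l) S" for S by (rule typing_App_closed[OF s(2) st[OF that]])
    have t: "[] \<turnstile>\<^bsub>l\<^esub> ?t : One \<rightarrow> A" by (rule typing_Lam, rule typing_Unq) (auto intro: sS)
    have "[[One]] @ [[]] \<turnstile>\<^bsub>l\<^esub> App ?t Star \<approx> subst 0 0 Star (Unq (App s Star)) : A"
      by (rule eqth_beta[OF typing_Unq st]) (auto intro!: sS)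
    then have b: "[[One]] @ [[]] \<turnstile>\<^bsub>l\<^esub> App ?t Star \<approx> Unq (App s Star) : A" by simp
    have S: "wf_stack (Suc l) [[One]]" by simp
    have "[[One]] \<turnstile>\<^bsub>Suc l\<^esub> App (norc ?t) (Var 0) \<approx> App s Star : Box A"
      by (rule eqth.Trans[OF App_norc[OF t v b] eqth.Sym[OF Box_eta[OF sS[OF S]]]])
    moreover have "[[One]] \<turnstile>\<^bsub>Suc l\<^esub> App s (Var 0) \<approx> App s Star : Box A"
      by (rule eqth_App_closed[OF eqth.Refl[OF s(2)] One_eta[OF v]])
    ultimately have "mk (Suc l) One (Box A) (norc ?t) = g" unfolding s(1) by (rule mk_eqI[OF typing_norc[OF t] s(2)])
    then have "g = ?N (mk l One A ?t)" using t by (simp add: normal_map_syn_box)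
    then show "g \<in> ?N ` hom (syn_cat l) (Unit (syn_cat l)) X" using X t by simp
  qed
qed

definition syn :: "('o, 'm) enriched" where "syn = \<lparr>Cat = syn_cat, BOX = syn_box\<rparr>"

lemma syn_simps [simp]: "Cat syn l = syn_cat l" "BOX syn l = syn_box l"
  by (simp_all add: syn_def)

lemma cie_syn: "cartesian_infinitely_enriched syn"
  by (simp add: cartesian_infinitely_enriched_def is_ccc_syn_cat is_functor_syn_box products_syn_box normal_syn_box)

abbreviation syn_base :: "nat \<Rightarrow> 'c \<Rightarrow> 'o" where "syn_base \<equiv> \<lambda>_ b. eo (Base b)"

sublocale M: model syn syn_base
  by unfold_locales (simp_all add: cie_syn base_interpretation_def)

end

section \<open>Readback and completeness\<close>

primrec ctype :: "'b ctx \<Rightarrow> 'b ty" where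
  "ctype [] = One"
| "ctype (A # \<Gamma>) = Prod (ctype \<Gamma>) A"

text \<open>The identity substitution of a context, written as a tuple. The offset \<open>k\<close>
  is needed because \<open>\<Gamma>\<close> may be what remains of the current context after its
  \<open>k\<close> most recent variables.\<close>

primrec vars :: "'b ctx \<Rightarrow> nat \<Rightarrow> 'b tm" where
  "vars [] k = Star"
| "vars (A # \<Gamma>) k = Pair (vars \<Gamma> (Suc k)) (Var k)"

text \<open>The functor of a stack computed on types: in the syntactic model \<open>S(A)\<close> is
  coded by \<open>sty S A\<close>, see \<open>so_syn\<close>.\<close>

primrec sty :: "'b stack \<Rightarrow> 'b ty \<Rightarrow> 'b ty" where
  "sty [] A = A"
| "sty (\<Gamma> # S) A = Box (ctype \<Gamma> \<rightarrow> sty S A)"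

lemma sty_snoc [simp]: "sty (S @ [\<Gamma>]) A = sty S (Box (ctype \<Gamma> \<rightarrow> A))"
  by (induction S) simp_all

lemma wf_ctype [simp]: "wf_ty l (ctype \<Gamma>) \<longleftrightarrow> wf_ctx l \<Gamma>"
  by (induction \<Gamma>) auto

lemma lift_vars [simp]: "lift 0 0 (vars \<Gamma> k) = vars \<Gamma> (Suc k)"
  by (induction \<Gamma> arbitrary: k) auto

lemma drop_ConsD:
  assumes "drop k xs = y # ys"
  shows "drop (Suc k) xs = ys" "k < length xs" "xs ! k = y"
proof -
  show "drop (Suc k) xs = ys" using assms by (metis drop_Suc list.sel(3) tl_drop)
  show "k < length xs" using assms by (metis drop_all linorder_not_less list.distinct(1))
  show "xs ! k = y" using assms by (metis nth_via_drop)
qed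

lemma typing_vars: "wf_stack l S \<Longrightarrow> drop k (cur S) = \<Gamma> \<Longrightarrow> S \<turnstile>\<^bsub>l\<^esub> vars \<Gamma> k : ctype \<Gamma>"
proof (induction \<Gamma> arbitrary: k)
  case (Cons A \<Gamma>)
  then show ?case using drop_ConsD[OF Cons.prems(2)] by (auto intro!: typing.Pair typing_Var)
qed (simp add: typing.Star)

text \<open>Reads an element of \<open>S(A)\<close> back as a term in the stack \<open>S\<close>; the argument lists \<open>S\<close> in reverse.\<close>

primrec readback_rev :: "'b ctx list \<Rightarrow> 'b tm \<Rightarrow> 'b tm" where
  "readback_rev [] t = t"
| "readback_rev (\<Gamma> # R) t = App (Unq (readback_rev R t)) (vars \<Gamma> 0)"

definition readback :: "'b stack \<Rightarrow> 'b tm \<Rightarrow> 'b tm" where "readback S = readback_rev (rev S)"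

lemma readback_simps [simp]: "readback [] t = t" "readback (S @ [\<Gamma>]) t = App (Unq (readback S t)) (vars \<Gamma> 0)"
  by (simp_all add: readback_def)

lemma readback_cong:
  "[] \<turnstile>\<^bsub>l + length S\<^esub> t \<approx> u : sty S A \<Longrightarrow> wf_stack l S \<Longrightarrow> S \<turnstile>\<^bsub>l\<^esub> readback S t \<approx> readback S u : A"
proof (induction S arbitrary: l A rule: rev_induct)
  case (snoc \<Gamma> S)
  then have "S \<turnstile>\<^bsub>Suc l\<^esub> readback S t \<approx> readback S u : Box (ctype \<Gamma> \<rightarrow> A)" by simp
  then show ?case using snoc.prems(2)
    by (auto intro!: CApp[where A = "ctype \<Gamma>"] eqth_Unq eqth.Refl typing_vars)
qed simp

lemma typing_readback:
  "[] \<turnstile>\<^bsub>l + length S\<^esub> t : sty S A \<Longrightarrow> wf_stack l S \<Longrightarrow> S \<turnstile>\<^bsub>l\<^esub> readback S t : A"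
  using readback_cong[OF eqth.Refl] eqth_typing(1) by blast

section \<open>Readback of elements of the syntactic model\<close>

context term_model
begin

abbreviation star_app :: "'m \<Rightarrow> 'c tm" where "star_app m \<equiv> App (trm m) Star"

lemma ty_syn: "wf_ty l A \<Longrightarrow> M.ty l A = eo A"
  by (induction l A rule: wf_ty.induct) auto

lemma cx_syn: "wf_ctx l \<Gamma> \<Longrightarrow> M.cx l \<Gamma> = eo (ctype \<Gamma>)"
  by (induction \<Gamma>) (auto simp: ty_syn)

lemma so_syn: "wf_stack l S \<Longrightarrow> M.so l S (eo A) = eo (sty S A)"
  by (induction S) (auto simp: Let_def cx_syn)

lemma El_synE:
  assumes "a \<in> M.El S l (eo A)" "wf_stack l S"
  obtains t where "a = mk (l + length S) One (sty S A) t" "[] \<turnstile>\<^bsub>l + length S\<^esub> t : One \<rightarrow> sty S A"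
  using assms by (auto simp: M.El_def M.EW_def so_syn elim: homE)

lemma trm_mk: "[] \<turnstile>\<^bsub>l\<^esub> t : A \<rightarrow> B \<Longrightarrow> [] \<turnstile>\<^bsub>l\<^esub> trm (mk l A B t) \<approx> t : A \<rightarrow> B"
  by (auto intro: eqth.Sym rep)

definition readback_arrow :: "'c stack \<Rightarrow> 'm \<Rightarrow> 'c tm" where "readback_arrow S a = readback S (star_app a)"

lemma readback_arrow_snoc [simp]: "readback_arrow (S @ [\<Gamma>]) a = App (Unq (readback_arrow S a)) (vars \<Gamma> 0)"
  by (simp add: readback_arrow_def)

lemma star_app_mk: "[] \<turnstile>\<^bsub>l\<^esub> t : One \<rightarrow> B \<Longrightarrow> [] \<turnstile>\<^bsub>l\<^esub> star_app (mk l One B t) \<approx> App t Star : B"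
  by (rule eqth_App_closed[OF trm_mk eqth.Refl[OF typing.Star]]) simp_all

lemma typing_readback_arrow:
  assumes "a \<in> M.El S l (eo A)" "wf_stack l S"
  shows "S \<turnstile>\<^bsub>l\<^esub> readback_arrow S a : A"
proof -
  obtain t where t: "a = mk (l + length S) One (sty S A) t" "[] \<turnstile>\<^bsub>l + length S\<^esub> t : One \<rightarrow> sty S A"
    using El_synE[OF assms] .
  show ?thesis
    unfolding readback_arrow_def by (rule typing_readback[OF _ assms(2)]) (use eqth_typing(1)[OF star_app_mk[OF t(2)]] t(1) in simp)
qed

text \<open>Only the existence of a representing term and its evaluation rule are recorded, which
  keeps the nested combinators out of later goals. The lemmas for \<open>name_of\<close>,
  \<open>konst\<close>, \<open>unit_expo_iso\<close>, \<open>curry_iso\<close> and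
  \<open>ctx_proj\<close> have the same form.\<close>

lemma expo_map_syn:
  assumes t: "[] \<turnstile>\<^bsub>l\<^esub> t : A \<rightarrow> B" and X: "wf_ty l X"
  obtains e where "expo_map (syn_cat l) (eo X) (mk l A B t) = mk l (X \<rightarrow> A) (X \<rightarrow> B) e" "[] \<turnstile>\<^bsub>l\<^esub> e : (X \<rightarrow> A) \<rightarrow> X \<rightarrow> B"
    "\<And>S h x. S \<turnstile>\<^bsub>l\<^esub> h : X \<rightarrow> A \<Longrightarrow> S \<turnstile>\<^bsub>l\<^esub> x : X \<Longrightarrow> S \<turnstile>\<^bsub>l\<^esub> App (App e h) x \<approx> App t (App h x) : B"
proof -
  note wf = X wf_closed_fun[OF t]
  note ev = typing_evc[OF wf(1,2)]
  let ?f = "cmpc (Prod (X \<rightarrow> A) X) t (evc X A)"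
  note f = typing_cmpc[OF t ev]
  show thesis
  proof (rule that[of "trc (X \<rightarrow> A) X ?f"])
    show "expo_map (syn_cat l) (eo X) (mk l A B t) = mk l (X \<rightarrow> A) (X \<rightarrow> B) (trc (X \<rightarrow> A) X ?f)"
      using t ev f by (simp add: expo_map_def)
    show "[] \<turnstile>\<^bsub>l\<^esub> trc (X \<rightarrow> A) X ?f : (X \<rightarrow> A) \<rightarrow> X \<rightarrow> B" by (rule typing_trc[OF f])
    fix S h x assume h: "S \<turnstile>\<^bsub>l\<^esub> h : X \<rightarrow> A" and x: "S \<turnstile>\<^bsub>l\<^esub> x : X"
    note p = typing.Pair[OF h x] and a = typing.App[OF h x]
    show "S \<turnstile>\<^bsub>l\<^esub> App (App (trc (X \<rightarrow> A) X ?f) h) x \<approx> App t (App h x) : B"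
      by (rule App_trc[OF f h x App_cmpc[OF t ev p App_evc[OF p CApp[OF Fst_beta[OF h x] Snd_beta[OF h x]]] eqth.Refl[OF typing_App_closed[OF t a]]]])
  qed
qed

lemma App_boxc_Quo:
  assumes "[] \<turnstile>\<^bsub>l\<^esub> f : A \<rightarrow> B" "S \<turnstile>\<^bsub>Suc l\<^esub> t : Box A"
  shows "S \<turnstile>\<^bsub>Suc l\<^esub> App (boxc A f) t \<approx> Quo (App f (Unq t)) : Box B"
  by (rule App_boxc[OF assms eqth.Refl[OF typing_App_closed[OF assms(1) typing_Unq_snoc[OF assms(2)]]]])

lemma Unq_boxc:
  assumes f: "[] \<turnstile>\<^bsub>l\<^esub> f : A \<rightarrow> B" and t: "butlast S \<turnstile>\<^bsub>Suc l\<^esub> t : Box A" and u: "butlast S \<turnstile>\<^bsub>Suc l\<^esub> u \<approx> App (boxc A f) t : Box B"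
    and S: "wf_stack l S"
  shows "S \<turnstile>\<^bsub>l\<^esub> Unq u \<approx> App f (Unq t) : B"
  by (rule eqth_Unq_Quo'[OF eqth.Trans[OF u App_boxc_Quo[OF f t]] S])

text \<open>Readback is natural: acting by an arrow becomes applying its term. A context on the
  right turns the arrow into the box of its image under \<open>[\<Gamma>, -]\<close>; unquoting
  removes the box, and application to the variables of \<open>\<Gamma>\<close> removes the
  exponential.\<close>

lemma readback_arrow_act:
  assumes "[] \<turnstile>\<^bsub>l\<^esub> t : A \<rightarrow> B" "wf_stack l S" "a \<in> M.El S l (eo A)"
  shows "S \<turnstile>\<^bsub>l\<^esub> readback_arrow S (M.act S l (mk l A B t) a) \<approx> App t (readback_arrow S a) : B"
  using assms
proof (induction S arbitrary: l t A B rule: rev_induct)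
  case Nil
  note t = Nil(1)
  obtain s where s: "a = mk l One A s" "[] \<turnstile>\<^bsub>l\<^esub> s : One \<rightarrow> A" using El_synE[OF Nil(3,2)] by auto
  have st: "[] \<turnstile>\<^bsub>l\<^esub> Star : One" by (simp add: typing.Star)
  note c = typing_cmpc[OF t s(2)]
  have "[] \<turnstile>\<^bsub>l\<^esub> star_app (mk l One B (cmpc One t s)) \<approx> App (cmpc One t s) Star : B" by (rule star_app_mk[OF c])
  moreover have "[] \<turnstile>\<^bsub>l\<^esub> App (cmpc One t s) Star \<approx> App t (star_app a) : B"
    unfolding s(1)
    by (rule App_cmpc[OF t s(2) st eqth.Sym[OF star_app_mk[OF s(2)]] eqth.Refl])
      (rule typing_App_closed[OF t eqth_typing(1)[OF star_app_mk[OF s(2)]]])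
  ultimately show ?case using s t by (auto simp: M.act_Nil readback_arrow_def intro: eqth.Trans)
next
  case (snoc \<Gamma> S)
  note t = snoc.prems(1)
  have wf: "wf_stack (Suc l) S" "wf_ctx l \<Gamma>" using snoc.prems by simp_all
  have S: "wf_stack l (S @ [\<Gamma>])" using wf by simp
  obtain e where e: "expo_map (syn_cat l) (eo (ctype \<Gamma>)) (mk l A B t) = mk l (ctype \<Gamma> \<rightarrow> A) (ctype \<Gamma> \<rightarrow> B) e"
    "[] \<turnstile>\<^bsub>l\<^esub> e : (ctype \<Gamma> \<rightarrow> A) \<rightarrow> ctype \<Gamma> \<rightarrow> B"
    "\<And>S h x. S \<turnstile>\<^bsub>l\<^esub> h : ctype \<Gamma> \<rightarrow> A \<Longrightarrow> S \<turnstile>\<^bsub>l\<^esub> x : ctype \<Gamma> \<Longrightarrow> S \<turnstile>\<^bsub>l\<^esub> App (App e h) x \<approx> App t (App h x) : B"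
    using expo_map_syn[OF t, of "ctype \<Gamma>"] wf by auto
  have a: "a \<in> M.El S (Suc l) (eo (Box (ctype \<Gamma> \<rightarrow> A)))" using snoc.prems(3) wf by (simp add: M.El_snoc cx_syn)
  have act: "M.act (S @ [\<Gamma>]) l (mk l A B t) a =
      M.act S (Suc l) (mk (Suc l) (Box (ctype \<Gamma> \<rightarrow> A)) (Box (ctype \<Gamma> \<rightarrow> B)) (boxc (ctype \<Gamma> \<rightarrow> A) e)) a"
    using wf e(1,2) by (simp add: M.act_snoc cx_syn)
  note r = typing_readback_arrow[OF a wf(1)]
  have "S \<turnstile>\<^bsub>Suc l\<^esub> readback_arrow S (M.act (S @ [\<Gamma>]) l (mk l A B t) a) \<approx> App (boxc (ctype \<Gamma> \<rightarrow> A) e) (readback_arrow S a) : Box (ctype \<Gamma> \<rightarrow> B)"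
    unfolding act by (rule snoc.IH[OF typing_boxc[OF e(2)] wf(1) a])
  then have 1: "S @ [\<Gamma>] \<turnstile>\<^bsub>l\<^esub> Unq (readback_arrow S (M.act (S @ [\<Gamma>]) l (mk l A B t) a)) \<approx> App e (Unq (readback_arrow S a)) : ctype \<Gamma> \<rightarrow> B"
    by (intro Unq_boxc[OF e(2) _ _ S]) (use r in simp_all)
  have v: "S @ [\<Gamma>] \<turnstile>\<^bsub>l\<^esub> vars \<Gamma> 0 : ctype \<Gamma>" by (rule typing_vars[OF S]) simp
  have u: "S @ [\<Gamma>] \<turnstile>\<^bsub>l\<^esub> Unq (readback_arrow S a) : ctype \<Gamma> \<rightarrow> A" by (rule typing_Unq) (use r S in simp_all)
  show ?case unfolding readback_arrow_snoc by (rule eqth.Trans[OF CApp[OF 1 eqth.Refl[OF v]] e(3)[OF u v]])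
qed

text \<open>The form needed for variables, abstraction and unquotation, whose arrows end in an
  exponential over the current context: the action happens in \<open>T\<close>, the readback in
  \<open>T @ [\<Gamma>]\<close>.\<close>

lemma readback_arrow_actB:
  assumes "[] \<turnstile>\<^bsub>l\<^esub> t : A \<rightarrow> ctype \<Gamma> \<rightarrow> B" "wf_stack (Suc l) T" "wf_ctx l \<Gamma>" "a \<in> M.El T (Suc l) (eo (Box A))"
  shows "T @ [\<Gamma>] \<turnstile>\<^bsub>l\<^esub> readback_arrow (T @ [\<Gamma>]) (M.actB T l (mk l A (ctype \<Gamma> \<rightarrow> B) t) a) \<approx> App (App t (Unq (readback_arrow T a))) (vars \<Gamma> 0) : B"
proof -
  have S: "wf_stack l (T @ [\<Gamma>])" using assms by simp
  have "T \<turnstile>\<^bsub>Suc l\<^esub> readback_arrow T (M.actB T l (mk l A (ctype \<Gamma> \<rightarrow> B) t) a) \<approx> App (boxc A t) (readback_arrow T a) : Box (ctype \<Gamma> \<rightarrow> B)"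
    using readback_arrow_act[OF typing_boxc[OF assms(1)] assms(2,4)] assms(1) by simp
  then have "T @ [\<Gamma>] \<turnstile>\<^bsub>l\<^esub> Unq (readback_arrow T (M.actB T l (mk l A (ctype \<Gamma> \<rightarrow> B) t) a)) \<approx> App t (Unq (readback_arrow T a)) : ctype \<Gamma> \<rightarrow> B"
    by (intro Unq_boxc[OF assms(1) _ _ S]) (use typing_readback_arrow[OF assms(4,2)] in simp_all)
  then show ?thesis
    unfolding readback_arrow_snoc by (rule CApp[OF _ eqth.Refl[OF typing_vars[OF S]]]) simp
qed

lemma name_of_syn:
  assumes t: "[] \<turnstile>\<^bsub>l\<^esub> t : X \<rightarrow> Y"
  obtains n where "name_of (syn_cat l) (mk l X Y t) = mk l One (X \<rightarrow> Y) n" "[] \<turnstile>\<^bsub>l\<^esub> n : One \<rightarrow> X \<rightarrow> Y"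
    "\<And>S s x. S \<turnstile>\<^bsub>l\<^esub> s : One \<Longrightarrow> S \<turnstile>\<^bsub>l\<^esub> x : X \<Longrightarrow> S \<turnstile>\<^bsub>l\<^esub> App (App n s) x \<approx> App t x : Y"
proof -
  note wf = wf_closed_fun[OF t]
  have p: "[] \<turnstile>\<^bsub>l\<^esub> sndc One X : Prod One X \<rightarrow> X" by (rule typing_sndc) (simp_all add: wf)
  note f = typing_cmpc[OF t p]
  show thesis
  proof (rule that[of "trc One X (cmpc (Prod One X) t (sndc One X))"])
    show "name_of (syn_cat l) (mk l X Y t) = mk l One (X \<rightarrow> Y) (trc One X (cmpc (Prod One X) t (sndc One X)))"
      using t p f by (simp add: name_of_def)
    show "[] \<turnstile>\<^bsub>l\<^esub> trc One X (cmpc (Prod One X) t (sndc One X)) : One \<rightarrow> X \<rightarrow> Y" by (rule typing_trc[OF f])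
    fix S s x assume s: "S \<turnstile>\<^bsub>l\<^esub> s : One" and x: "S \<turnstile>\<^bsub>l\<^esub> x : X"
    note q = typing.Pair[OF s x]
    show "S \<turnstile>\<^bsub>l\<^esub> App (App (trc One X (cmpc (Prod One X) t (sndc One X))) s) x \<approx> App t x : Y"
      by (rule App_trc[OF f s x App_cmpc[OF t p q App_sndc[OF _ q Snd_beta[OF s x]] eqth.Refl[OF typing_App_closed[OF t x]]]]) simp
  qed
qed

lemma konst_syn:
  assumes X: "wf_ty l X" "wf_ty l Y"
  obtains k where "konst (syn_cat l) (eo X) (eo Y) = mk l X (Y \<rightarrow> X) k" "[] \<turnstile>\<^bsub>l\<^esub> k : X \<rightarrow> Y \<rightarrow> X"
    "\<And>S u y. S \<turnstile>\<^bsub>l\<^esub> u : X \<Longrightarrow> S \<turnstile>\<^bsub>l\<^esub> y : Y \<Longrightarrow> S \<turnstile>\<^bsub>l\<^esub> App (App k u) y \<approx> u : X"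
proof -
  note p = typing_fstc[OF X]
  show thesis
  proof (rule that[of "trc X Y (fstc X Y)"])
    show "konst (syn_cat l) (eo X) (eo Y) = mk l X (Y \<rightarrow> X) (trc X Y (fstc X Y))" using p by simp
    show "[] \<turnstile>\<^bsub>l\<^esub> trc X Y (fstc X Y) : X \<rightarrow> Y \<rightarrow> X" by (rule typing_trc[OF p])
    fix S u y assume u: "S \<turnstile>\<^bsub>l\<^esub> u : X" and y: "S \<turnstile>\<^bsub>l\<^esub> y : Y"
    show "S \<turnstile>\<^bsub>l\<^esub> App (App (trc X Y (fstc X Y)) u) y \<approx> u : X"
      by (rule App_trc[OF p u y App_fstc[OF X(2) typing.Pair[OF u y] Fst_beta[OF u y]]])
  qed
qed

lemma unit_expo_iso_syn:
  assumes X: "wf_ty l X"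
  obtains k where "unit_expo_iso (syn_cat l) (eo X) = mk l (One \<rightarrow> X) X k" "[] \<turnstile>\<^bsub>l\<^esub> k : (One \<rightarrow> X) \<rightarrow> X"
    "\<And>S h. S \<turnstile>\<^bsub>l\<^esub> h : One \<rightarrow> X \<Longrightarrow> S \<turnstile>\<^bsub>l\<^esub> App k h \<approx> App h Star : X"
proof -
  let ?E = "One \<rightarrow> X"
  have wf: "wf_ty l ?E" "wf_ty l One" using X by simp_all
  note i = typing_idc[OF wf(1)] and b = typing_bangc[OF wf(1)] and e = typing_evc[OF wf(2) X]
  note t = typing_tupc[OF i b]
  show thesis
  proof (rule that[of "cmpc ?E (evc One X) (tupc ?E (idc ?E) (bangc ?E))"])
    show "unit_expo_iso (syn_cat l) (eo X) = mk l ?E X (cmpc ?E (evc One X) (tupc ?E (idc ?E) (bangc ?E)))"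
      using i b e t syn_cat_bang[OF wf(1)] by (simp add: unit_expo_iso_def)
    show "[] \<turnstile>\<^bsub>l\<^esub> cmpc ?E (evc One X) (tupc ?E (idc ?E) (bangc ?E)) : ?E \<rightarrow> X" by (rule typing_cmpc[OF e t])
    fix S h assume h: "S \<turnstile>\<^bsub>l\<^esub> h : ?E"
    have s: "S \<turnstile>\<^bsub>l\<^esub> Star : One" by (rule typing.Star[OF typing_wf(1)[OF h]])
    show "S \<turnstile>\<^bsub>l\<^esub> App (cmpc ?E (evc One X) (tupc ?E (idc ?E) (bangc ?E))) h \<approx> App h Star : X"
      by (rule App_cmpc[OF e t h App_tupc[OF b i h App_idc[OF eqth.Refl[OF h]] App_bangc[OF h]]
            App_evc[OF typing.Pair[OF h s] CApp[OF Fst_beta[OF h s] Snd_beta[OF h s]]]])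
  qed
qed

lemma curry_iso_syn:
  assumes X: "wf_ty l X" "wf_ty l Y" "wf_ty l Z"
  obtains k where "curry_iso (syn_cat l) (eo X) (eo Y) (eo Z) = mk l (Prod X Y \<rightarrow> Z) (X \<rightarrow> Y \<rightarrow> Z) k"
    "[] \<turnstile>\<^bsub>l\<^esub> k : (Prod X Y \<rightarrow> Z) \<rightarrow> X \<rightarrow> Y \<rightarrow> Z"
    "\<And>S h x y. S \<turnstile>\<^bsub>l\<^esub> h : Prod X Y \<rightarrow> Z \<Longrightarrow> S \<turnstile>\<^bsub>l\<^esub> x : X \<Longrightarrow> S \<turnstile>\<^bsub>l\<^esub> y : Y \<Longrightarrow>
      S \<turnstile>\<^bsub>l\<^esub> App (App (App k h) x) y \<approx> App h (Pair x y) : Z"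
proof -
  let ?E = "Prod X Y \<rightarrow> Z"
  let ?P = "Prod ?E X"
  let ?Q = "Prod ?P Y"
  have wf: "wf_ty l ?E" "wf_ty l ?P" "wf_ty l (Prod X Y)" using X by simp_all
  note ev = typing_evc[OF wf(3) X(3)]
  note pq = typing_fstc[OF wf(2) X(2)] typing_sndc[OF wf(2) X(2)]
  note pp = typing_fstc[OF wf(1) X(1)] typing_sndc[OF wf(1) X(1)]
  note c1 = typing_cmpc[OF pp(1) pq(1)] and c2 = typing_cmpc[OF pp(2) pq(1)]
  note t2 = typing_tupc[OF c2 pq(2)]
  note t1 = typing_tupc[OF c1 t2]
  note f = typing_cmpc[OF ev t1]
  let ?f = "cmpc ?Q (evc (Prod X Y) Z) (tupc ?Q (cmpc ?Q (fstc ?E X) (fstc ?P Y)) (tupc ?Q (cmpc ?Q (sndc ?E X) (fstc ?P Y)) (sndc ?P Y)))"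
  note g = typing_trc[OF f]
  show thesis
  proof (rule that[of "trc ?E X (trc ?P Y ?f)"])
    show "curry_iso (syn_cat l) (eo X) (eo Y) (eo Z) = mk l ?E (X \<rightarrow> Y \<rightarrow> Z) (trc ?E X (trc ?P Y ?f))"
      using ev pq pp c1 c2 t2 t1 f g by (simp add: curry_iso_def Let_def)
    show "[] \<turnstile>\<^bsub>l\<^esub> trc ?E X (trc ?P Y ?f) : ?E \<rightarrow> X \<rightarrow> Y \<rightarrow> Z" by (rule typing_trc[OF g])
    fix S h x y assume h: "S \<turnstile>\<^bsub>l\<^esub> h : ?E" and x: "S \<turnstile>\<^bsub>l\<^esub> x : X" and y: "S \<turnstile>\<^bsub>l\<^esub> y : Y"
    note p = typing.Pair[OF h x]
    note q = typing.Pair[OF p y] and xy = typing.Pair[OF x y]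
    note F = App_fstc[OF X(2) q Fst_beta[OF p y]]
    have 1: "S \<turnstile>\<^bsub>l\<^esub> App (cmpc ?Q (fstc ?E X) (fstc ?P Y)) (Pair (Pair h x) y) \<approx> h : ?E"
      by (rule App_cmpc[OF pp(1) pq(1) q F App_fstc[OF X(1) p Fst_beta[OF h x]]])
    have 2: "S \<turnstile>\<^bsub>l\<^esub> App (cmpc ?Q (sndc ?E X) (fstc ?P Y)) (Pair (Pair h x) y) \<approx> x : X"
      by (rule App_cmpc[OF pp(2) pq(1) q F App_sndc[OF wf(1) p Snd_beta[OF h x]]])
    note 3 = App_sndc[OF wf(2) q Snd_beta[OF p y]]
    note T = App_tupc[OF t2 c1 q 1 App_tupc[OF pq(2) c2 q 2 3]]
    have "S \<turnstile>\<^bsub>l\<^esub> App ?f (Pair (Pair h x) y) \<approx> App h (Pair x y) : Z"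
      by (rule App_cmpc[OF ev t1 q T App_evc[OF typing.Pair[OF h xy] CApp[OF Fst_beta[OF h xy] Snd_beta[OF h xy]]]])
    then have "S \<turnstile>\<^bsub>l\<^esub> App (App (trc ?P Y ?f) (Pair h x)) y \<approx> App h (Pair x y) : Z" by (rule App_trc[OF f p y])
    moreover have "S \<turnstile>\<^bsub>l\<^esub> App (App (trc ?E X (trc ?P Y ?f)) h) x \<approx> App (trc ?P Y ?f) (Pair h x) : Y \<rightarrow> Z"
      by (rule App_trc[OF g h x eqth.Refl[OF typing_App_closed[OF g p]]])
    ultimately show "S \<turnstile>\<^bsub>l\<^esub> App (App (App (trc ?E X (trc ?P Y ?f)) h) x) y \<approx> App h (Pair x y) : Z"
      using CApp[OF _ eqth.Refl[OF y]] by (meson eqth.Trans)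
  qed
qed

text \<open>The induction shortens \<open>\<Gamma>\<close> while the stack stays fixed, so
  \<open>\<Gamma>\<close> is allowed to be a tail of the current context, with the indices shifted
  by \<open>k\<close>.\<close>

lemma ctx_proj_syn:
  assumes "wf_ctx l \<Gamma>" "i < length \<Gamma>"
  obtains t where "ctx_proj syn syn_base l \<Gamma> i = mk l (ctype \<Gamma>) (\<Gamma> ! i) t" "[] \<turnstile>\<^bsub>l\<^esub> t : ctype \<Gamma> \<rightarrow> \<Gamma> ! i"
    "\<And>S k. wf_stack l S \<Longrightarrow> drop k (cur S) = \<Gamma> \<Longrightarrow> S \<turnstile>\<^bsub>l\<^esub> App t (vars \<Gamma> k) \<approx> Var (k + i) : \<Gamma> ! i"
proof -
  have "\<exists>t. ctx_proj syn syn_base l \<Gamma> i = mk l (ctype \<Gamma>) (\<Gamma> ! i) t \<and> [] \<turnstile>\<^bsub>l\<^esub> t : ctype \<Gamma> \<rightarrow> \<Gamma> ! i \<and>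
    (\<forall>S k. wf_stack l S \<longrightarrow> drop k (cur S) = \<Gamma> \<longrightarrow> S \<turnstile>\<^bsub>l\<^esub> App t (vars \<Gamma> k) \<approx> Var (k + i) : \<Gamma> ! i)"
    using assms
  proof (induction \<Gamma> arbitrary: i)
    case (Cons A \<Gamma>)
    have wf: "wf_ty l (ctype \<Gamma>)" "wf_ty l A" "wf_ctx l \<Gamma>" using Cons.prems by simp_all
    note p = typing_fstc[OF wf(1,2)] typing_sndc[OF wf(1,2)]
    have v: "S \<turnstile>\<^bsub>l\<^esub> vars \<Gamma> (Suc k) : ctype \<Gamma>" "S \<turnstile>\<^bsub>l\<^esub> Var k : A" "drop (Suc k) (cur S) = \<Gamma>"
      if "wf_stack l S" "drop k (cur S) = A # \<Gamma>" for S k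
      using drop_ConsD[OF that(2)] typing_vars[OF that(1) drop_ConsD(1)[OF that(2)]] typing_Var[OF that(1)] by simp_all
    show ?case
    proof (cases i)
      case 0
      have "S \<turnstile>\<^bsub>l\<^esub> App (sndc (ctype \<Gamma>) A) (Pair (vars \<Gamma> (Suc k)) (Var k)) \<approx> Var k : A"
        if S: "wf_stack l S" "drop k (cur S) = A # \<Gamma>" for S k
        by (rule App_sndc[OF wf(1) typing.Pair[OF v(1,2)[OF S]] Snd_beta[OF v(1,2)[OF S]]])
      then show ?thesis using 0 p wf by (auto simp: cx_syn ty_syn intro!: exI[of _ "sndc (ctype \<Gamma>) A"])
    next
      case (Suc j)
      then obtain t where t: "ctx_proj syn syn_base l \<Gamma> j = mk l (ctype \<Gamma>) (\<Gamma> ! j) t" "[] \<turnstile>\<^bsub>l\<^esub> t : ctype \<Gamma> \<rightarrow> \<Gamma> ! j"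
        "\<And>S k. wf_stack l S \<Longrightarrow> drop k (cur S) = \<Gamma> \<Longrightarrow> S \<turnstile>\<^bsub>l\<^esub> App t (vars \<Gamma> k) \<approx> Var (k + j) : \<Gamma> ! j"
        using Cons.IH[OF wf(3), of j] Cons.prems by auto
      have "S \<turnstile>\<^bsub>l\<^esub> App (cmpc (Prod (ctype \<Gamma>) A) t (fstc (ctype \<Gamma>) A)) (Pair (vars \<Gamma> (Suc k)) (Var k)) \<approx> Var (Suc (k + j)) : \<Gamma> ! j"
        if S: "wf_stack l S" "drop k (cur S) = A # \<Gamma>" for S k
        using t(3)[OF S(1) v(3)[OF S]]
        by (intro App_cmpc[OF t(2) p(1) typing.Pair[OF v(1,2)[OF S]] App_fstc[OF wf(2) typing.Pair[OF v(1,2)[OF S]] Fst_beta[OF v(1,2)[OF S]]]]) simp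
      then show ?thesis using Suc p wf t(1,2) typing_cmpc[OF t(2) p(1)]
        by (auto simp: cx_syn ty_syn intro!: exI[of _ "cmpc (Prod (ctype \<Gamma>) A) t (fstc (ctype \<Gamma>) A)"])
    qed
  qed simp
  then show thesis using that by blast
qed

text \<open>Readback does not notice the padding of the empty stack: \<open>nu\<close> quotes a
  constant function, which \<open>[[]]\<close> unquotes and applies to the empty tuple
  \<open>Star\<close>.\<close>

lemma readback_arrow_nu:
  assumes "a \<in> M.El [] l (eo A)"
  shows "[[]] \<turnstile>\<^bsub>l\<^esub> readback_arrow [[]] (M.nu l a) \<approx> readback_arrow [] a : A"
proof -
  obtain s where s: "a = mk l One A s" "[] \<turnstile>\<^bsub>l\<^esub> s : One \<rightarrow> A" using El_synE[OF assms] by auto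
  obtain n where n: "name_of (syn_cat l) (mk l One A s) = mk l One (One \<rightarrow> A) n" "[] \<turnstile>\<^bsub>l\<^esub> n : One \<rightarrow> One \<rightarrow> A"
    "\<And>S s' x. S \<turnstile>\<^bsub>l\<^esub> s' : One \<Longrightarrow> S \<turnstile>\<^bsub>l\<^esub> x : One \<Longrightarrow> S \<turnstile>\<^bsub>l\<^esub> App (App n s') x \<approx> App s x : A"
    using name_of_syn[OF s(2)] by blast
  have nu: "M.nu l a = mk (Suc l) One (Box (One \<rightarrow> A)) (norc n)"
    using n s by (simp add: M.nu_def normal_map_syn_box)
  have st: "S \<turnstile>\<^bsub>l\<^esub> Star : One" if "wf_stack l S" for S :: "'c stack" and l using that by (rule typing.Star)
  have "[] \<turnstile>\<^bsub>Suc l\<^esub> star_app (M.nu l a) \<approx> Quo (App n Star) : Box (One \<rightarrow> A)"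
    unfolding nu
    by (rule eqth.Trans[OF star_app_mk[OF typing_norc[OF n(2)]] App_norc[OF n(2) st eqth.Refl[OF typing_App_closed[OF n(2) st]]]]) simp_all
  then have "[[]] \<turnstile>\<^bsub>l\<^esub> Unq (star_app (M.nu l a)) \<approx> App n Star : One \<rightarrow> A"
    by (intro eqth_Unq_Quo') simp_all
  from CApp[OF this eqth.Refl[OF st]]
  have "[[]] \<turnstile>\<^bsub>l\<^esub> App (Unq (star_app (M.nu l a))) Star \<approx> App (App n Star) Star : A" by simp
  moreover have "[[]] \<turnstile>\<^bsub>l\<^esub> App (App n Star) Star \<approx> App s Star : A" by (rule n(3)[OF st st]) simp_all
  moreover have "[[]] \<turnstile>\<^bsub>l\<^esub> App s Star \<approx> star_app a : A"
    unfolding s(1) by (rule eqth_weaken_Nil[OF eqth.Sym[OF star_app_mk[OF s(2)]]]) simp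
  ultimately have "[[]] \<turnstile>\<^bsub>l\<^esub> App (Unq (star_app (M.nu l a))) Star \<approx> star_app a : A" by (meson eqth.Trans)
  then show ?thesis using readback_arrow_snoc[of "[]" "[]" "M.nu l a"] by (simp add: readback_arrow_def)
qed

text \<open>Allows abstraction and unquotation to be treated as if the stack were nonempty; in the
  empty case \<open>sem_pad\<close> and \<open>readback_arrow_nu\<close> take the result for
  \<open>[[]]\<close> back.\<close>

lemma readback_arrow_sem_snoc:
  assumes "ity S l M A" "wf_stack l S"
    and "butlast S @ [cur S] \<turnstile>\<^bsub>l\<^esub> readback_arrow (butlast S @ [cur S]) (M.sem (butlast S @ [cur S]) l M) \<approx> M : A"
  shows "S \<turnstile>\<^bsub>l\<^esub> readback_arrow S (M.sem S l M) \<approx> M : A"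
proof (cases S rule: rev_cases)
  case Nil
  have "M.sem [] l M \<in> M.El [] l (eo A)" using M.sem_in[OF assms(1,2)] ity_wf_ty[OF assms(1,2)] Nil by (simp add: ty_syn)
  from readback_arrow_nu[OF this] have "[[]] \<turnstile>\<^bsub>l\<^esub> readback_arrow [] (M.sem [] l M) \<approx> M : A"
    using assms(3) M.sem_pad[OF assms(1,2)] Nil by (auto intro: eqth.Trans eqth.Sym)
  then show ?thesis using Nil by (simp add: eqth_Nil_iff)
next
  case (snoc T \<Gamma>)
  then show ?thesis using assms(3) by simp
qed

theorem readback_arrow_sem: "ity S l M A \<Longrightarrow> wf_stack l S \<Longrightarrow> S \<turnstile>\<^bsub>l\<^esub> readback_arrow S (M.sem S l M) \<approx> M : A"
proof (induction rule: ity.induct)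
  case (Var i S l)
  have "S \<noteq> []" using Var.hyps by auto
  then obtain T \<Gamma> where S: "S = T @ [\<Gamma>]" by (cases S rule: rev_cases) auto
  have wf: "wf_stack (Suc l) T" "wf_ctx l \<Gamma>" "i < length \<Gamma>" using Var S by simp_all
  interpret B: fpp "syn_cat l" "M.EB T l" "M.actB T l" using M.fpp_EB[OF wf(1)] by simp
  obtain t where t: "ctx_proj syn syn_base l \<Gamma> i = mk l (ctype \<Gamma>) (\<Gamma> ! i) t" "[] \<turnstile>\<^bsub>l\<^esub> t : ctype \<Gamma> \<rightarrow> \<Gamma> ! i"
    "\<And>S k. wf_stack l S \<Longrightarrow> drop k (cur S) = \<Gamma> \<Longrightarrow> S \<turnstile>\<^bsub>l\<^esub> App t (vars \<Gamma> k) \<approx> Var (k + i) : \<Gamma> ! i"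
    using ctx_proj_syn[OF wf(2,3)] by blast
  obtain n where n: "name_of (syn_cat l) (mk l (ctype \<Gamma>) (\<Gamma> ! i) t) = mk l One (ctype \<Gamma> \<rightarrow> \<Gamma> ! i) n" "[] \<turnstile>\<^bsub>l\<^esub> n : One \<rightarrow> ctype \<Gamma> \<rightarrow> \<Gamma> ! i"
    "\<And>S s x. S \<turnstile>\<^bsub>l\<^esub> s : One \<Longrightarrow> S \<turnstile>\<^bsub>l\<^esub> x : ctype \<Gamma> \<Longrightarrow> S \<turnstile>\<^bsub>l\<^esub> App (App n s) x \<approx> App t x : \<Gamma> ! i"
    using name_of_syn[OF t(2)] by blast
  \<comment> \<open>The term \<open>n\<close> below returns the same function whatever its argument
    of type \<open>One\<close>, so the readback of \<open>un\<close> disappears from the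
    result.\<close>
  have un: "B.un \<in> M.El T (Suc l) (eo (Box One))" using B.un_in by simp
  have "T @ [\<Gamma>] \<turnstile>\<^bsub>l\<^esub> readback_arrow (T @ [\<Gamma>]) (M.actB T l (mk l One (ctype \<Gamma> \<rightarrow> \<Gamma> ! i) n) B.un) \<approx>
      App (App n (Unq (readback_arrow T B.un))) (vars \<Gamma> 0) : \<Gamma> ! i"
    by (rule readback_arrow_actB[OF n(2) wf(1,2) un])
  moreover have "M.sem (T @ [\<Gamma>]) l (Var i) = M.actB T l (mk l One (ctype \<Gamma> \<rightarrow> \<Gamma> ! i) n) B.un"
    unfolding M.sem_Var_snoc using B.nm_def[of "mk l (ctype \<Gamma>) (\<Gamma> ! i) t"] n(1) t(1) by simp
  moreover have "T @ [\<Gamma>] \<turnstile>\<^bsub>l\<^esub> App (App n (Unq (readback_arrow T B.un))) (vars \<Gamma> 0) \<approx> App t (vars \<Gamma> 0) : \<Gamma> ! i"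
    by (rule n(3)[OF typing_Unq typing_vars]) (use wf typing_readback_arrow[OF un wf(1)] in simp_all)
  moreover have "T @ [\<Gamma>] \<turnstile>\<^bsub>l\<^esub> App t (vars \<Gamma> 0) \<approx> Var i : \<Gamma> ! i"
    using t(3)[of "T @ [\<Gamma>]" 0] wf by simp
  ultimately show ?case unfolding S by (auto intro: eqth.Trans simp del: M.sem.simps readback_arrow_snoc)
next
  case (Lam l A S M B)
  note wf = wf_butlast_cur[OF Lam.prems]
  have L: "ity S l (Lam A M) (A \<rightarrow> B)" using Lam.hyps by (rule ity.Lam)
  let ?T = "butlast S" and ?\<Gamma> = "cur S"
  let ?m = "M.sem (?T @ [A # ?\<Gamma>]) l M"
  have S1: "wf_stack l (?T @ [A # ?\<Gamma>])" using wf Lam.hyps(1) by simp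
  have B: "wf_ty l B" using ity_wf_ty[OF Lam.hyps(2) S1] .
  have wf': "wf_ty l (ctype ?\<Gamma>)" "wf_ty l A" "wf_ty l B" using wf Lam.hyps(1) B by simp_all
  obtain c where c: "curry_iso (syn_cat l) (eo (ctype ?\<Gamma>)) (eo A) (eo B) = mk l (Prod (ctype ?\<Gamma>) A \<rightarrow> B) (ctype ?\<Gamma> \<rightarrow> A \<rightarrow> B) c"
    "[] \<turnstile>\<^bsub>l\<^esub> c : (Prod (ctype ?\<Gamma>) A \<rightarrow> B) \<rightarrow> ctype ?\<Gamma> \<rightarrow> A \<rightarrow> B"
    "\<And>S h x y. S \<turnstile>\<^bsub>l\<^esub> h : Prod (ctype ?\<Gamma>) A \<rightarrow> B \<Longrightarrow> S \<turnstile>\<^bsub>l\<^esub> x : ctype ?\<Gamma> \<Longrightarrow> S \<turnstile>\<^bsub>l\<^esub> y : A \<Longrightarrow>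
      S \<turnstile>\<^bsub>l\<^esub> App (App (App c h) x) y \<approx> App h (Pair x y) : B"
    using curry_iso_syn[OF wf'] by blast
  have m: "?m \<in> M.El ?T (Suc l) (eo (Box (Prod (ctype ?\<Gamma>) A \<rightarrow> B)))"
    using M.sem_in[OF Lam.hyps(2) S1] wf wf' by (simp add: M.El_snoc cx_syn ty_syn)
  have sem: "M.sem (?T @ [?\<Gamma>]) l (Lam A M) = M.actB ?T l (mk l (Prod (ctype ?\<Gamma>) A \<rightarrow> B) (ctype ?\<Gamma> \<rightarrow> A \<rightarrow> B) c) ?m"
    using c(1) wf wf' tyof[OF Lam.hyps(2)] by (simp add: Let_def cx_syn ty_syn)
  have S2: "wf_stack l (?T @ [?\<Gamma>])" using wf by simp
  have r: "?T \<turnstile>\<^bsub>Suc l\<^esub> readback_arrow ?T ?m : Box (Prod (ctype ?\<Gamma>) A \<rightarrow> B)" using typing_readback_arrow[OF m] wf by simp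
  have 1: "?T @ [?\<Gamma>] \<turnstile>\<^bsub>l\<^esub> readback_arrow (?T @ [?\<Gamma>]) (M.sem (?T @ [?\<Gamma>]) l (Lam A M)) \<approx> App (App c (Unq (readback_arrow ?T ?m))) (vars ?\<Gamma> 0) : A \<rightarrow> B"
    unfolding sem by (rule readback_arrow_actB[OF c(2)]) (use wf m in simp_all)
  have u: "?T @ [A # ?\<Gamma>] \<turnstile>\<^bsub>l\<^esub> Unq (readback_arrow ?T ?m) : Prod (ctype ?\<Gamma>) A \<rightarrow> B" by (rule typing_Unq) (use r S1 in simp_all)
  have v: "?T @ [A # ?\<Gamma>] \<turnstile>\<^bsub>l\<^esub> vars ?\<Gamma> 1 : ctype ?\<Gamma>" by (rule typing_vars[OF S1]) simp
  have z: "?T @ [A # ?\<Gamma>] \<turnstile>\<^bsub>l\<^esub> Var 0 : A" by (rule typing_Var[OF S1]) simp_all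
  \<comment> \<open>The induction hypothesis, in which \<open>vars (A # cur S) 0\<close> unfolds to
    this pair.\<close>
  have "?T @ [A # ?\<Gamma>] \<turnstile>\<^bsub>l\<^esub> App (Unq (readback_arrow ?T ?m)) (Pair (vars ?\<Gamma> 1) (Var 0)) \<approx> M : B"
    using Lam.IH[OF S1] by simp
  then have 2: "?T @ [A # ?\<Gamma>] \<turnstile>\<^bsub>l\<^esub> App (App (App c (Unq (readback_arrow ?T ?m))) (vars ?\<Gamma> 1)) (Var 0) \<approx> M : B"
    by (rule eqth.Trans[OF c(3)[OF u v z]])
  \<comment> \<open>Eta expansion lifts \<open>vars (cur S) 0\<close> to
    \<open>vars (cur S) 1\<close> and leaves the unquoted part alone; the body is then the left side
    of 2.\<close>
  have "?T @ [?\<Gamma>] \<turnstile>\<^bsub>l\<^esub> App (App c (Unq (readback_arrow ?T ?m))) (vars ?\<Gamma> 0) \<approx> Lam A (App (App (App c (Unq (readback_arrow ?T ?m))) (vars ?\<Gamma> 1)) (Var 0)) : A \<rightarrow> B"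
    using Fun_eta[OF eqth_typing(2)[OF 1]] by (simp add: closed_lift[OF c(2)])
  from eqth.Trans[OF 1 eqth.Trans[OF this CAbs[OF 2]]]
  show ?case by (rule readback_arrow_sem_snoc[OF L Lam.prems])
next
  case (App S l M A B N)
  interpret F: fpp "syn_cat l" "M.El S l" "M.act S l" using M.fpp_El[OF App.prems] by simp
  have wf: "wf_ty l A" "wf_ty l B" using ity_wf_ty[OF App.hyps(1) App.prems] by auto
  have E: "M.sem S l M \<in> M.El S l (eo (A \<rightarrow> B))" "M.sem S l N \<in> M.El S l (eo A)"
    using M.sem_in[OF App.hyps(1) App.prems] M.sem_in[OF App.hyps(2) App.prems] wf by (simp_all add: ty_syn)
  let ?p = "F.pr (eo (A \<rightarrow> B)) (eo A) (M.sem S l M) (M.sem S l N)"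
  have wf': "wf_ty l (A \<rightarrow> B)" using wf by simp
  have pr: "?p \<in> M.El S l (eo (Prod (A \<rightarrow> B) A))" "M.act S l (mk l (Prod (A \<rightarrow> B) A) (A \<rightarrow> B) (fstc (A \<rightarrow> B) A)) ?p = M.sem S l M"
    "M.act S l (mk l (Prod (A \<rightarrow> B) A) A (sndc (A \<rightarrow> B) A)) ?p = M.sem S l N"
    using F.pr_props[of "eo (A \<rightarrow> B)" "eo A", OF _ _ E] wf by simp_all
  note r = typing_readback_arrow[OF pr(1) App.prems]
  \<comment> \<open>The pair \<open>?p\<close> is known only through its projections. By naturality
    the projections of its readback are the readbacks of its components, to which the induction
    hypotheses apply.\<close>
  have 1: "S \<turnstile>\<^bsub>l\<^esub> Fst (readback_arrow S ?p) \<approx> M : A \<rightarrow> B"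
    using readback_arrow_act[OF typing_fstc[OF wf' wf(1)] App.prems pr(1), unfolded pr(2)] App.IH(1)[OF App.prems]
      App_fstc[OF wf(1) r eqth.Refl[OF typing.Fst[OF r]]] by (meson eqth.Sym eqth.Trans)
  have 2: "S \<turnstile>\<^bsub>l\<^esub> Snd (readback_arrow S ?p) \<approx> N : A"
    using readback_arrow_act[OF typing_sndc[OF wf' wf(1)] App.prems pr(1), unfolded pr(3)] App.IH(2)[OF App.prems]
      App_sndc[OF wf' r eqth.Refl[OF typing.Snd[OF r]]] by (meson eqth.Sym eqth.Trans)
  have "M.sem S l (App M N) = M.act S l (mk l (Prod (A \<rightarrow> B) A) B (evc A B)) ?p"
    using tyof[OF App.hyps(1)] tyof[OF App.hyps(2)] wf by (simp add: Let_def ty_syn)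
  then show ?case
    using readback_arrow_act[OF typing_evc[OF wf] App.prems pr(1)] App_evc[OF r CApp[OF 1 2]] by (auto intro: eqth.Trans)
next
  case (Pair S l M A N B)
  interpret F: fpp "syn_cat l" "M.El S l" "M.act S l" using M.fpp_El[OF Pair.prems] by simp
  have wf: "wf_ty l A" "wf_ty l B" using ity_wf_ty[OF _ Pair.prems] Pair.hyps by blast+
  have E: "M.sem S l M \<in> M.El S l (eo A)" "M.sem S l N \<in> M.El S l (eo B)"
    using M.sem_in[OF Pair.hyps(1) Pair.prems] M.sem_in[OF Pair.hyps(2) Pair.prems] wf by (simp_all add: ty_syn)
  let ?p = "F.pr (eo A) (eo B) (M.sem S l M) (M.sem S l N)"
  have pr: "?p \<in> M.El S l (eo (Prod A B))" "M.act S l (mk l (Prod A B) A (fstc A B)) ?p = M.sem S l M"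
    "M.act S l (mk l (Prod A B) B (sndc A B)) ?p = M.sem S l N"
    using F.pr_props[of "eo A" "eo B", OF _ _ E] wf by simp_all
  note r = typing_readback_arrow[OF pr(1) Pair.prems]
  have 1: "S \<turnstile>\<^bsub>l\<^esub> Fst (readback_arrow S ?p) \<approx> M : A"
    using readback_arrow_act[OF typing_fstc[OF wf] Pair.prems pr(1), unfolded pr(2)] Pair.IH(1)[OF Pair.prems]
      App_fstc[OF wf(2) r eqth.Refl[OF typing.Fst[OF r]]] by (meson eqth.Sym eqth.Trans)
  have 2: "S \<turnstile>\<^bsub>l\<^esub> Snd (readback_arrow S ?p) \<approx> N : B"
    using readback_arrow_act[OF typing_sndc[OF wf] Pair.prems pr(1), unfolded pr(3)] Pair.IH(2)[OF Pair.prems]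
      App_sndc[OF wf(1) r eqth.Refl[OF typing.Snd[OF r]]] by (meson eqth.Sym eqth.Trans)
  have "M.sem S l (Pair M N) = ?p"
    using tyof[OF Pair.hyps(1)] tyof[OF Pair.hyps(2)] wf by (simp add: ty_syn)
  then show ?case using eqth.Trans[OF Prod_eta[OF r] CPair[OF 1 2]] by simp
next
  case (Fst S l M A B)
  have wf: "wf_ty l A" "wf_ty l B" using ity_wf_ty[OF Fst.hyps Fst.prems] by auto
  have E: "M.sem S l M \<in> M.El S l (eo (Prod A B))" using M.sem_in[OF Fst.hyps Fst.prems] wf by (simp add: ty_syn)
  note r = typing_readback_arrow[OF E Fst.prems]
  have "M.sem S l (Fst M) = M.act S l (mk l (Prod A B) A (fstc A B)) (M.sem S l M)"
    using tyof[OF Fst.hyps] wf by (simp add: ty_syn)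
  then show ?case
    using readback_arrow_act[OF typing_fstc[OF wf] Fst.prems E] App_fstc[OF wf(2) r CFst[OF Fst.IH[OF Fst.prems]]]
    by (auto intro: eqth.Trans)
next
  case (Snd S l M A B)
  have wf: "wf_ty l A" "wf_ty l B" using ity_wf_ty[OF Snd.hyps Snd.prems] by auto
  have E: "M.sem S l M \<in> M.El S l (eo (Prod A B))" using M.sem_in[OF Snd.hyps Snd.prems] wf by (simp add: ty_syn)
  note r = typing_readback_arrow[OF E Snd.prems]
  have "M.sem S l (Snd M) = M.act S l (mk l (Prod A B) B (sndc A B)) (M.sem S l M)"
    using tyof[OF Snd.hyps] wf by (simp add: ty_syn)
  then show ?case
    using readback_arrow_act[OF typing_sndc[OF wf] Snd.prems E] App_sndc[OF wf(1) r CSnd[OF Snd.IH[OF Snd.prems]]]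
    by (auto intro: eqth.Trans)
next
  case (Star S l)
  have "M.sem S l Star \<in> M.El S l (eo One)" using M.sem_in[OF ity.Star Star] by simp
  then show ?case by (rule One_eta[OF typing_readback_arrow[OF _ Star]])
next
  case (Quo S l M A)
  have S: "wf_stack l (S @ [[]])" using Quo.prems by simp
  have A: "wf_ty l A" by (rule ity_wf_ty[OF Quo.hyps S])
  obtain k where k: "unit_expo_iso (syn_cat l) (eo A) = mk l (One \<rightarrow> A) A k" "[] \<turnstile>\<^bsub>l\<^esub> k : (One \<rightarrow> A) \<rightarrow> A"
    "\<And>S h. S \<turnstile>\<^bsub>l\<^esub> h : One \<rightarrow> A \<Longrightarrow> S \<turnstile>\<^bsub>l\<^esub> App k h \<approx> App h Star : A"
    using unit_expo_iso_syn[OF A] by blast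
  let ?m = "M.sem (S @ [[]]) l M"
  have m: "?m \<in> M.El S (Suc l) (eo (Box (One \<rightarrow> A)))" using M.sem_in[OF Quo.hyps S] A by (simp add: M.El_snoc ty_syn)
  note r = typing_readback_arrow[OF m Quo.prems]
  have "S @ [[]] \<turnstile>\<^bsub>l\<^esub> App (Unq (readback_arrow S ?m)) Star \<approx> M : A" using Quo.IH[OF S] by simp
  from App_boxc[OF k(2) r eqth.Trans[OF k(3)[OF typing_Unq_snoc[OF r]] this]]
  have "S \<turnstile>\<^bsub>Suc l\<^esub> App (boxc (One \<rightarrow> A) k) (readback_arrow S ?m) \<approx> Quo M : Box A" .
  moreover have "M.sem S (Suc l) (Quo M) = M.act S (Suc l) (mk (Suc l) (Box (One \<rightarrow> A)) (Box A) (boxc (One \<rightarrow> A) k)) ?m"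
    using tyof[OF Quo.hyps] A k(1,2) by (simp add: ty_syn)
  ultimately show ?case using readback_arrow_act[OF typing_boxc[OF k(2)] Quo.prems m] by (auto intro: eqth.Trans)
next
  case (Unq S l M A)
  note wf = wf_butlast_cur[OF Unq.prems]
  have L: "ity S l (Unq M) A" using Unq.hyps by (rule ity.Unq)
  let ?T = "butlast S" and ?\<Gamma> = "cur S"
  let ?m = "M.sem ?T (Suc l) M"
  have T: "wf_stack (Suc l) ?T" "wf_stack l (?T @ [?\<Gamma>])" using wf by simp_all
  have A: "wf_ty l A" using ity_wf_ty[OF Unq.hyps T(1)] by simp
  have G: "wf_ty l (ctype ?\<Gamma>)" using wf by simp
  obtain k where k: "konst (syn_cat l) (eo A) (eo (ctype ?\<Gamma>)) = mk l A (ctype ?\<Gamma> \<rightarrow> A) k" "[] \<turnstile>\<^bsub>l\<^esub> k : A \<rightarrow> ctype ?\<Gamma> \<rightarrow> A"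
    "\<And>S u y. S \<turnstile>\<^bsub>l\<^esub> u : A \<Longrightarrow> S \<turnstile>\<^bsub>l\<^esub> y : ctype ?\<Gamma> \<Longrightarrow> S \<turnstile>\<^bsub>l\<^esub> App (App k u) y \<approx> u : A"
    using konst_syn[OF A G] by blast
  have m: "?m \<in> M.El ?T (Suc l) (eo (Box A))" using M.sem_in[OF Unq.hyps T(1)] A by (simp add: ty_syn)
  have sem: "M.sem (?T @ [?\<Gamma>]) l (Unq M) = M.actB ?T l (mk l A (ctype ?\<Gamma> \<rightarrow> A) k) ?m"
    using k(1) wf A tyof[OF Unq.hyps] by (simp add: Let_def cx_syn ty_syn)
  have 1: "?T @ [?\<Gamma>] \<turnstile>\<^bsub>l\<^esub> readback_arrow (?T @ [?\<Gamma>]) (M.sem (?T @ [?\<Gamma>]) l (Unq M)) \<approx> App (App k (Unq (readback_arrow ?T ?m))) (vars ?\<Gamma> 0) : A"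
    unfolding sem by (rule readback_arrow_actB[OF k(2)]) (use wf m in simp_all)
  have u: "?T @ [?\<Gamma>] \<turnstile>\<^bsub>l\<^esub> Unq (readback_arrow ?T ?m) \<approx> Unq M : A" by (rule CUnq[OF Unq.IH[OF T(1)]]) (use wf in simp)
  have v: "?T @ [?\<Gamma>] \<turnstile>\<^bsub>l\<^esub> vars ?\<Gamma> 0 : ctype ?\<Gamma>" by (rule typing_vars[OF T(2)]) simp
  show ?case
    by (rule readback_arrow_sem_snoc[OF L Unq.prems eqth.Trans[OF 1 eqth.Trans[OF k(3)[OF eqth_typing(1)[OF u] v] u]]])
qed

corollary completeness:
  assumes "S \<turnstile>\<^bsub>l\<^esub> M : A" "S \<turnstile>\<^bsub>l\<^esub> N : A" "M.sem S l M = M.sem S l N"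
  shows "S \<turnstile>\<^bsub>l\<^esub> M \<approx> N : A"
  using readback_arrow_sem[of S l M A] readback_arrow_sem[of S l N A] assms by (auto simp: typing_iff intro: eqth.Sym eqth.Trans)

end

section \<open>Renaming of base types, and the final argument\<close>

instance ty :: (countable) countable by countable_datatype
instance tm :: (countable) countable by countable_datatype

abbreviation map_stack :: "('b \<Rightarrow> 'c) \<Rightarrow> 'b stack \<Rightarrow> 'c stack" where
  "map_stack h \<equiv> map (map (map_ty h))"

lemma wf_ty_map [simp]: "wf_ty l (map_ty h A) \<longleftrightarrow> wf_ty l A"
  by (induction l A rule: wf_ty.induct) auto

lemma wf_ctx_map [simp]: "wf_ctx l (map (map_ty h) \<Gamma>) \<longleftrightarrow> wf_ctx l \<Gamma>"
  by (simp add: wf_ctx_def)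

lemma wf_stack_map [simp]: "wf_stack l (map_stack h S) \<longleftrightarrow> wf_stack l S"
  by (induction S) auto

lemma cur_map [simp]: "cur (map_stack h S) = map (map_ty h) (cur S)"
  by (simp add: cur_def last_map)

lemma ity_map: "ity S l M A \<Longrightarrow> ity (map_stack h S) l (map_tm h M) (map_ty h A)"
proof (induction rule: ity.induct)
  case (Var i S l)
  then show ?case using ity.Var[of i "map_stack h S" l] by simp
next
  case (Lam l A S M B)
  then show ?case by (auto intro!: ity.Lam simp: map_butlast)
next
  case (Unq S l M A)
  then show ?case by (auto intro!: ity.Unq simp: map_butlast)
qed (auto intro: ity.intros)

lemma typing_map: "S \<turnstile>\<^bsub>l\<^esub> M : A \<Longrightarrow> map_stack h S \<turnstile>\<^bsub>l\<^esub> map_tm h M : map_ty h A"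
  by (simp add: typing_iff ity_map)

lemma map_tm_lift: "map_tm h (lift n k M) = lift n k (map_tm h M)"
  by (induction M arbitrary: n k) auto

lemma map_tm_subst: "map_tm h (subst n k N M) = subst n k (map_tm h N) (map_tm h M)"
  by (induction M arbitrary: n k N) (auto simp: map_tm_lift)

lemma eqth_map: "S \<turnstile>\<^bsub>l\<^esub> M \<approx> N : A \<Longrightarrow> map_stack h S \<turnstile>\<^bsub>l\<^esub> map_tm h M \<approx> map_tm h N : map_ty h A"
proof (induction rule: eqth.induct)
  case (CApp \<Delta> l M M' A B N N')
  then show ?case by (auto intro: eqth.CApp)
next
  case (Fun_beta \<Delta> A \<Gamma> l M B N)
  show ?case
    using eqth.Fun_beta[of "map_stack h \<Delta>" "map_ty h A" "map (map_ty h) \<Gamma>" l "map_tm h M" "map_ty h B" "map_tm h N"]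
      typing_map[OF Fun_beta(1), of h] typing_map[OF Fun_beta(2), of h] by (simp add: map_tm_subst)
next
  case (Fun_eta \<Delta> l M A B)
  then show ?case using eqth.Fun_eta[of "map_stack h \<Delta>" l "map_tm h M"] typing_map[OF Fun_eta, of h]
    by (simp add: map_tm_lift)
next
  case (Fst_beta \<Delta> l M A N B)
  then show ?case by (auto dest!: typing_map[of _ _ _ _ h] intro: eqth.Fst_beta)
next
  case (Snd_beta \<Delta> l M A N B)
  then show ?case by (auto dest!: typing_map[of _ _ _ _ h] intro: eqth.Snd_beta)
next
  case (Box_beta \<Delta> l M A \<Gamma>)
  then show ?case by (auto dest!: typing_map[of _ _ _ _ h] intro: eqth.Box_beta)
qed (auto dest!: typing_map[of _ _ _ _ h] intro: eqth.intros)

text \<open>One category with two interpretations of base types, related along \<open>h\<close>. A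
  renamed term under the second has the element of the original under the first, which transfers
  semantic equality to the renamed terms.\<close>

locale model_map = model \<CC> \<beta> + N: model \<CC> \<beta>'
  for \<CC> :: "('o, 'm) enriched" and \<beta> :: "nat \<Rightarrow> 'b \<Rightarrow> 'o" and \<beta>' :: "nat \<Rightarrow> 'c \<Rightarrow> 'o" +
  fixes h :: "'b \<Rightarrow> 'c"
  assumes base_map: "\<beta> l b = \<beta>' l (h b)"
begin

lemma ty_map [simp]: "wf_ty l A \<Longrightarrow> N.ty l (map_ty h A) = ty l A"
  by (induction l A rule: wf_ty.induct) (auto simp: base_map)

lemma cx_map [simp]: "wf_ctx l \<Gamma> \<Longrightarrow> N.cx l (map (map_ty h) \<Gamma>) = cx l \<Gamma>"
  by (induction \<Gamma>) auto

lemma ctx_proj_map [simp]: "wf_ctx l \<Gamma> \<Longrightarrow> i < length \<Gamma> \<Longrightarrow> ctx_proj \<CC> \<beta>' l (map (map_ty h) \<Gamma>) i = ctx_proj \<CC> \<beta> l \<Gamma> i"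
proof (induction \<Gamma> arbitrary: i)
  case (Cons A \<Gamma>)
  then show ?case by (cases i) auto
qed simp

lemma so_map [simp]: "wf_stack l S \<Longrightarrow> N.so l (map_stack h S) X = so l S X"
  by (induction S) (auto simp: Let_def)

lemma sm_map [simp]: "wf_stack l S \<Longrightarrow> N.sm l (map_stack h S) f = sm l S f"
  by (induction S) (auto simp: Let_def)

lemma El_map: "wf_stack l S \<Longrightarrow> N.El (map_stack h S) l = El S l"
  by (simp add: El_def N.El_def EW_def N.EW_def fun_eq_iff)

lemma act_map: "wf_stack l S \<Longrightarrow> N.act (map_stack h S) l = act S l"
  by (simp add: act_def N.act_def fun_eq_iff)

lemma dn_map: "N.dn (map_stack h S) = dn S"
  by (simp add: dn_def N.dn_def fun_eq_iff)

lemma sem_map: "ity S l M A \<Longrightarrow> wf_stack l S \<Longrightarrow> N.sem (map_stack h S) l (map_tm h M) = sem S l M"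
proof (induction rule: ity.induct)
  case (Var i S l)
  then show ?case using wf_butlast_cur[OF Var.prems] by (simp add: map_butlast[symmetric] El_map act_map)
next
  case (Lam l A S M B)
  note wf = wf_butlast_cur[OF Lam.prems]
  have "wf_ty l B" using ity_wf_ty[OF Lam.hyps(2)] wf Lam.hyps(1) by simp
  then show ?case
    using Lam wf tyof[OF Lam.hyps(2)] tyof[OF ity_map[OF Lam.hyps(2), of h]]
    by (simp add: map_butlast[symmetric] El_map act_map dn_map Let_def)
next
  case (App S l M A B N)
  have "wf_ty l A" "wf_ty l B" using ity_wf_ty[OF App.hyps(1) App.prems] by auto
  then show ?case
    using App App.hyps[THEN tyof] App.hyps[THEN ity_map[of _ _ _ _ h], THEN tyof]
    by (simp add: El_map act_map Let_def)
next
  case (Pair S l M A N B)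
  have "wf_ty l A" "wf_ty l B" using Pair.hyps[THEN ity_wf_ty, OF Pair.prems] by auto
  then show ?case
    using Pair Pair.hyps[THEN tyof] Pair.hyps[THEN ity_map[of _ _ _ _ h], THEN tyof]
    by (simp add: El_map act_map)
next
  case (Fst S l M A B)
  have "wf_ty l A" "wf_ty l B" using ity_wf_ty[OF Fst.hyps Fst.prems] by auto
  then show ?case
    using Fst tyof[OF Fst.hyps] tyof[OF ity_map[OF Fst.hyps, of h]] by (simp add: act_map)
next
  case (Snd S l M A B)
  have "wf_ty l A" "wf_ty l B" using ity_wf_ty[OF Snd.hyps Snd.prems] by auto
  then show ?case
    using Snd tyof[OF Snd.hyps] tyof[OF ity_map[OF Snd.hyps, of h]] by (simp add: act_map)
next
  case (Star S l)
  then show ?case by (simp add: El_map)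
next
  case (Quo S l M A)
  have "wf_ty l A" using ity_wf_ty[OF Quo.hyps] Quo.prems by simp
  then show ?case
    using Quo tyof[OF Quo.hyps] tyof[OF ity_map[OF Quo.hyps, of h]] by (simp add: act_map)
next
  case (Unq S l M A)
  note wf = wf_butlast_cur[OF Unq.prems]
  have "wf_ty l A" using ity_wf_ty[OF Unq.hyps] wf by simp
  then show ?case
    using Unq wf tyof[OF Unq.hyps] tyof[OF ity_map[OF Unq.hyps, of h]]
    by (simp add: map_butlast[symmetric] act_map dn_map Let_def)
qed

end

theorem theorem3p16:
  fixes M N :: "'b tm" and A :: "'b ty" and \<Delta> :: "'b stack" and l :: nat
  assumes "\<Delta> \<turnstile>\<^bsub>l\<^esub> M : A"
    and "\<Delta> \<turnstile>\<^bsub>l\<^esub> N : A"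
  shows "(\<Delta> \<turnstile>\<^bsub>l\<^esub> M \<approx> N : A) \<longleftrightarrow>
    (\<forall>(\<CC> :: ('o::infinite, 'm::infinite) enriched) (\<beta> :: nat \<Rightarrow> 'b \<Rightarrow> 'o).
       cartesian_infinitely_enriched \<CC> \<longrightarrow> base_interpretation \<CC> \<beta> \<longrightarrow>
       denotation \<CC> \<beta> \<Delta> l M A = denotation \<CC> \<beta> \<Delta> l N A)"
proof (intro iffI allI impI)
  fix \<CC> :: "('o, 'm) enriched" and \<beta> :: "nat \<Rightarrow> 'b \<Rightarrow> 'o"
  assume eq: "\<Delta> \<turnstile>\<^bsub>l\<^esub> M \<approx> N : A" and "cartesian_infinitely_enriched \<CC>" "base_interpretation \<CC> \<beta>"
  then interpret model \<CC> \<beta> by unfold_locales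
  show "denotation \<CC> \<beta> \<Delta> l M A = denotation \<CC> \<beta> \<Delta> l N A"
    using soundness[OF eq] denotation_eq_iff[OF assms] by simp
next
  assume sem_eq: "\<forall>(\<CC> :: ('o, 'm) enriched) (\<beta> :: nat \<Rightarrow> 'b \<Rightarrow> 'o).
       cartesian_infinitely_enriched \<CC> \<longrightarrow> base_interpretation \<CC> \<beta> \<longrightarrow>
       denotation \<CC> \<beta> \<Delta> l M A = denotation \<CC> \<beta> \<Delta> l N A"
  \<comment> \<open>Base types of the stack and of \<open>A\<close> are included, so that the whole
    judgment can be renamed and recovered.\<close>
  define B where "B = set_tm M \<union> set_tm N \<union> set_ty A \<union> (\<Union>\<Gamma>\<in>set \<Delta>. \<Union>T\<in>set \<Gamma>. set_ty T)"
  have "finite B" by (simp add: B_def)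
  from finite_imp_inj_to_nat_seg[OF this] obtain h :: "'b \<Rightarrow> nat" where h: "inj_on h B"
    by auto
  \<comment> \<open>\<open>h\<close> is injective only on \<open>B\<close>, so \<open>g\<close>
    undoes it only there. Renaming back along \<open>g\<close> is nevertheless sound, since
    \<open>eqth_map\<close> holds for every function on base types.\<close>
  define g where "g = inv_into B h"
  have gh: "g (h b) = b" if "b \<in> B" for b using h that by (simp add: g_def)
  obtain fo :: "nat \<Rightarrow> 'o" and fm :: "nat \<Rightarrow> 'm" where f: "inj fo" "inj fm"
    using infinite_countable_subset[OF infinite_UNIV[where 'a = 'o]] infinite_countable_subset[OF infinite_UNIV[where 'a = 'm]]
    by auto
  interpret T: term_model "fo \<circ> (to_nat :: nat ty \<Rightarrow> nat)" "fm \<circ> (to_nat :: nat ty \<times> nat ty \<times> nat tm \<Rightarrow> nat)"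
    by unfold_locales (use f in \<open>auto intro!: inj_compose\<close>)
  \<comment> \<open>The syntactic model has base types from \<open>nat\<close>; pulling its
    interpretation back along \<open>h\<close> yields one for the original base types, to which the
    semantic assumption applies.\<close>
  define \<beta> where "\<beta> = (\<lambda>(l :: nat) b. T.syn_base l (h b))"
  interpret m: model T.syn \<beta>
    by unfold_locales (use T.M.cie T.M.base in \<open>auto simp: base_interpretation_def \<beta>_def simp del: T.syn_cat_simps\<close>)
  interpret model_map T.syn \<beta> T.syn_base h by unfold_locales (simp add: \<beta>_def)
  have i: "ity \<Delta> l M A" "ity \<Delta> l N A" "wf_stack l \<Delta>" using assms by (simp_all add: typing_iff)
  have "m.sem \<Delta> l M = m.sem \<Delta> l N"
    using sem_eq m.denotation_eq_iff[OF assms] m.cie m.base by simp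
  then have "T.M.sem (map_stack h \<Delta>) l (map_tm h M) = T.M.sem (map_stack h \<Delta>) l (map_tm h N)"
    using sem_map[OF i(1,3)] sem_map[OF i(2,3)] by simp
  then have "map_stack h \<Delta> \<turnstile>\<^bsub>l\<^esub> map_tm h M \<approx> map_tm h N : map_ty h A"
    by (rule T.completeness[OF typing_map[OF assms(1)] typing_map[OF assms(2)]])
  from eqth_map[OF this, of g]
  have "map_stack g (map_stack h \<Delta>) \<turnstile>\<^bsub>l\<^esub> map_tm g (map_tm h M) \<approx> map_tm g (map_tm h N) : map_ty g (map_ty h A)" .
  moreover have "map_tm g (map_tm h M) = M" "map_tm g (map_tm h N) = N" "map_ty g (map_ty h A) = A"
    by (auto simp: tm.map_comp ty.map_comp B_def intro!: tm.map_ident_strong ty.map_ident_strong gh)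
  moreover have "map_stack g (map_stack h \<Delta>) = \<Delta>"
    by (auto simp: ty.map_comp B_def intro!: map_idI ty.map_ident_strong gh)
  ultimately show "\<Delta> \<turnstile>\<^bsub>l\<^esub> M \<approx> N : A" by simp
qed

end
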